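(* Let $\Omega_1\subset\mathbb{R}^{d_1}$ and $\Omega_2\subset\mathbb{R}^{d_2}$ be open sets and $\Gamma$ a closed cone in $\dot T^*\Omega_2$. Let $f:\Omega_1\to\Omega_2$ be a smooth map such that $N_f\cap\Gamma=\emptyset$, where $$N_f=\{(f(x);\eta)\in\Omega_2\times\mathbb{R}^{d_2} : x\in\Omega_1,\ \eta\circ df_x=0\},$$ and let $f^*\Gamma=\{(x;\eta\circ df_x) : x\in\Omega_1,\ (f(x);\eta)\in\Gamma\}$, where $\eta\circ df_x=\sum_{j=1}^{d_2}\sum_{i=1}^{d_1}\eta_j\frac{\partial f^j}{\partial x^i}(x)\,dx^i$. Then the pull-back operation $f^*:\mathcal{D}'_\Gamma(\Omega_2)\to\mathcal{D}'_{f^*\Gamma}(\Omega_1)$ is continuous for the normal topology.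
   Context: For an open set $\Omega\subset\mathbb{R}^n$ write $\mathcal{D}(\Omega)=C_c^\infty(\Omega)$, $T^*\Omega=\Omega\times\mathbb{R}^n$, $\dot T^*\Omega=\{(x;\xi)\in T^*\Omega : \xi\neq 0\}$. A cone in $\dot T^*\Omega$ is a subset $\Gamma$ such that $(x;\xi)\in\Gamma$ and $\lambda>0$ imply $(x;\lambda\xi)\in\Gamma$; closed means closed in $\dot T^*\Omega$. For a closed cone $\Gamma$, $\mathcal{D}'_\Gamma(\Omega)=\{u\in\mathcal{D}'(\Omega) : \mathrm{WF}(u)\subset\Gamma\}$. The normal topology on $\mathcal{D}'_\Gamma(\Omega)$ is the locally convex topology defined by the seminorms $p_B(u)=\sup_{\phi\in B}|\langle u,\phi\rangle|$, $B$ running over the bounded subsets of $\mathcal{D}(\Omega)$, and $\|u\|_{N,V,\chi}=\sup_{k\in V}(1+|k|)^N|\widehat{u\chi}(k)|$, where $N\ge 0$, $\chi\in\mathcal{D}(\Omega)$ and $V\subset\mathbb{R}^n$ is a closed cone with $(\operatorname{supp}\chi\times V)\cap\Gamma=\emptyset$; here $\widehat{w}(k)=\langle w,e^{-ik\cdot x}\rangle$. The pull-back $f^*$ on $\mathcal{D}'_\Gamma(\Omega_2)$ is Hörmander's: the unique sequentially continuous extension of $u\mapsto u\circ f$ from $C^\infty(\Omega_2)$. *)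

theory Defs
  imports "HOL-Analysis.Analysis"
begin

section \<open>Smooth functions and test functions\<close>

primrec iter_deriv :: "'a::euclidean_space list \<Rightarrow> ('a \<Rightarrow> 'b::real_normed_vector) \<Rightarrow> 'a \<Rightarrow> 'b" where
  "iter_deriv [] f = f"
| "iter_deriv (b # bs) f = (\<lambda>x. frechet_derivative (iter_deriv bs f) (at x) b)"

text \<open>For open \<open>S\<close> this is \<open>C\<^sup>\<infinity>(S)\<close>: differentiability of all iterated partial derivatives also makes
  all of them continuous. Values outside \<open>S\<close> are irrelevant.\<close>

definition smooth_on :: "'a::euclidean_space set \<Rightarrow> ('a \<Rightarrow> 'b::real_normed_vector) \<Rightarrow> bool" where
  "smooth_on S f \<longleftrightarrow> (\<forall>bs\<in>lists Basis. \<forall>x\<in>S. iter_deriv bs f differentiable (at x))"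

definition supp :: "('a::topological_space \<Rightarrow> complex) \<Rightarrow> 'a set" where
  "supp \<phi> = closure {x. \<phi> x \<noteq> 0}"

text \<open>Elements of \<open>\<D>(\<Omega>)\<close> are identified with their extensions by zero to the whole space.\<close>

definition test_functions :: "'a::euclidean_space set \<Rightarrow> ('a \<Rightarrow> complex) set" where
  "test_functions \<Omega> = {\<phi>. smooth_on UNIV \<phi> \<and> compact (supp \<phi>) \<and> supp \<phi> \<subseteq> \<Omega>}"

text \<open>The sum runs over sequences of coordinate directions instead of multi-indices, so mixed
  derivatives are counted several times; this does not affect the topology.\<close>

definition Ck_norm :: "nat \<Rightarrow> ('a::euclidean_space \<Rightarrow> complex) \<Rightarrow> real" where
  "Ck_norm m \<phi> = (\<Sum>bs | bs \<in> lists Basis \<and> length bs \<le> m. SUP x. norm (iter_deriv bs \<phi> x))"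

text \<open>The topology of \<open>\<D>(\<Omega>)\<close> is the inductive limit of the Frechet spaces of test functions supported
  in a compact \<open>K \<subseteq> \<Omega>\<close>: a seminorm on \<open>\<D>(\<Omega>)\<close> is continuous iff its restriction to each of them is.\<close>

definition continuous_on_compact_supports ::
    "'a::euclidean_space set \<Rightarrow> (('a \<Rightarrow> complex) \<Rightarrow> real) \<Rightarrow> bool" where
  "continuous_on_compact_supports \<Omega> p \<longleftrightarrow>
     (\<forall>K. compact K \<and> K \<subseteq> \<Omega> \<longrightarrow>
       (\<exists>C m. \<forall>\<phi>\<in>test_functions \<Omega>. supp \<phi> \<subseteq> K \<longrightarrow> p \<phi> \<le> C * Ck_norm m \<phi>))"

definition continuous_seminorm ::
    "'a::euclidean_space set \<Rightarrow> (('a \<Rightarrow> complex) \<Rightarrow> real) \<Rightarrow> bool" where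
  "continuous_seminorm \<Omega> p \<longleftrightarrow>
     (\<forall>\<phi>\<in>test_functions \<Omega>. 0 \<le> p \<phi>) \<and>
     (\<forall>\<phi>\<in>test_functions \<Omega>. \<forall>\<psi>\<in>test_functions \<Omega>. p (\<lambda>x. \<phi> x + \<psi> x) \<le> p \<phi> + p \<psi>) \<and>
     (\<forall>c. \<forall>\<phi>\<in>test_functions \<Omega>. p (\<lambda>x. c * \<phi> x) = norm c * p \<phi>) \<and>
     continuous_on_compact_supports \<Omega> p"

text \<open>Boundedness in the sense of topological vector spaces.\<close>

definition bounded_test_set :: "'a::euclidean_space set \<Rightarrow> ('a \<Rightarrow> complex) set \<Rightarrow> bool" where
  "bounded_test_set \<Omega> B \<longleftrightarrow>
     B \<subseteq> test_functions \<Omega> \<and> (\<forall>p. continuous_seminorm \<Omega> p \<longrightarrow> bdd_above (p ` B))"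

section \<open>Distributions and wave front sets\<close>

text \<open>A distribution is a functional on all functions that vanishes by convention outside \<open>\<D>(\<Omega>)\<close>, so
  that equality of distributions is equality in HOL.\<close>

definition distributions ::
    "'a::euclidean_space set \<Rightarrow> (('a \<Rightarrow> complex) \<Rightarrow> complex) set" where
  "distributions \<Omega> = {u.
     (\<forall>\<phi>\<in>test_functions \<Omega>. \<forall>\<psi>\<in>test_functions \<Omega>. u (\<lambda>x. \<phi> x + \<psi> x) = u \<phi> + u \<psi>) \<and>
     (\<forall>c. \<forall>\<phi>\<in>test_functions \<Omega>. u (\<lambda>x. c * \<phi> x) = c * u \<phi>) \<and>
     continuous_on_compact_supports \<Omega> (\<lambda>\<phi>. norm (u \<phi>)) \<and>
     (\<forall>\<phi>. \<phi> \<notin> test_functions \<Omega> \<longrightarrow> u \<phi> = 0)}"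

definition distribution_of ::
    "'a::euclidean_space set \<Rightarrow> ('a \<Rightarrow> complex) \<Rightarrow> ('a \<Rightarrow> complex) \<Rightarrow> complex" where
  "distribution_of \<Omega> g = (\<lambda>\<phi>. if \<phi> \<in> test_functions \<Omega> then LINT x:\<Omega>|lborel. g x * \<phi> x else 0)"

text \<open>The Fourier transform of \<open>u\<theta>\<close> at \<open>k\<close>, where \<open>\<langle>u\<theta>, e\<^sub>k\<rangle> = \<langle>u, \<theta>e\<^sub>k\<rangle>\<close> and \<open>e\<^sub>k(x) = exp(-ik\<cdot>x)\<close>.\<close>

definition local_fourier ::
    "(('a::euclidean_space \<Rightarrow> complex) \<Rightarrow> complex) \<Rightarrow> ('a \<Rightarrow> complex) \<Rightarrow> 'a \<Rightarrow> complex" where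
  "local_fourier u \<theta> k = u (\<lambda>x. \<theta> x * exp (- \<i> * complex_of_real (k \<bullet> x)))"

definition fourier_seminorm ::
    "nat \<Rightarrow> 'a::euclidean_space set \<Rightarrow> ('a \<Rightarrow> complex) \<Rightarrow> (('a \<Rightarrow> complex) \<Rightarrow> complex) \<Rightarrow> ennreal" where
  "fourier_seminorm N V \<theta> u = (SUP k\<in>V. ennreal ((1 + norm k) ^ N * norm (local_fourier u \<theta> k)))"

definition bounded_set_seminorm ::
    "('a::euclidean_space \<Rightarrow> complex) set \<Rightarrow> (('a \<Rightarrow> complex) \<Rightarrow> complex) \<Rightarrow> ennreal" where
  "bounded_set_seminorm B u = (SUP \<phi>\<in>B. ennreal (norm (u \<phi>)))"

text \<open>Covectors are identified with vectors by the inner product. The library's \<^const>\<open>cone\<close> demands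
  invariance under scalars \<open>\<ge> 0\<close>; for closed sets this is the same as under scalars \<open>> 0\<close>.\<close>

definition wave_front_set ::
    "'a::euclidean_space set \<Rightarrow> (('a \<Rightarrow> complex) \<Rightarrow> complex) \<Rightarrow> ('a \<times> 'a) set" where
  "wave_front_set \<Omega> u = {(x, \<xi>). x \<in> \<Omega> \<and> \<xi> \<noteq> 0 \<and>
     \<not> (\<exists>\<theta>\<in>test_functions \<Omega>. \<exists>V. \<theta> x \<noteq> 0 \<and> closed V \<and> cone V \<and> \<xi> \<in> interior V \<and>
          (\<forall>N. fourier_seminorm N V \<theta> u < \<infinity>))}"

definition punctured_cotangent :: "'a::euclidean_space set \<Rightarrow> ('a \<times> 'a) set" where
  "punctured_cotangent \<Omega> = \<Omega> \<times> (- {0})"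

definition closed_cone_over :: "'a::euclidean_space set \<Rightarrow> ('a \<times> 'a) set \<Rightarrow> bool" where
  "closed_cone_over \<Omega> \<Gamma> \<longleftrightarrow>
     (\<forall>x \<xi> t. (x, \<xi>) \<in> \<Gamma> \<and> t > (0::real) \<longrightarrow> (x, t *\<^sub>R \<xi>) \<in> \<Gamma>) \<and>
     closedin (top_of_set (punctured_cotangent \<Omega>)) \<Gamma>"

definition distributions_WF ::
    "'a::euclidean_space set \<Rightarrow> ('a \<times> 'a) set \<Rightarrow> (('a \<Rightarrow> complex) \<Rightarrow> complex) set" where
  "distributions_WF \<Omega> \<Gamma> = {u \<in> distributions \<Omega>. wave_front_set \<Omega> u \<subseteq> \<Gamma>}"

section \<open>The normal topology\<close>

definition normal_seminorms ::
    "'a::euclidean_space set \<Rightarrow> ('a \<times> 'a) set \<Rightarrow> ((('a \<Rightarrow> complex) \<Rightarrow> complex) \<Rightarrow> ennreal) set" where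
  "normal_seminorms \<Omega> \<Gamma> =
     {bounded_set_seminorm B | B. bounded_test_set \<Omega> B} \<union>
     {fourier_seminorm N V \<theta> | N V \<theta>.
        \<theta> \<in> test_functions \<Omega> \<and> closed V \<and> cone V \<and> (supp \<theta> \<times> V) \<inter> \<Gamma> = {}}"

definition normal_topology ::
    "'a::euclidean_space set \<Rightarrow> ('a \<times> 'a) set \<Rightarrow> (('a \<Rightarrow> complex) \<Rightarrow> complex) topology" where
  "normal_topology \<Omega> \<Gamma> = topology_generated_by
     {{v \<in> distributions_WF \<Omega> \<Gamma>. p (\<lambda>\<phi>. v \<phi> - u \<phi>) < \<epsilon>} | p u \<epsilon>.
        p \<in> normal_seminorms \<Omega> \<Gamma> \<and> u \<in> distributions_WF \<Omega> \<Gamma> \<and> 0 < \<epsilon>}"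

lemma topspace_normal_topology [simp]:
  "topspace (normal_topology \<Omega> \<Gamma>) = distributions_WF \<Omega> \<Gamma>"
proof -
  have 1: "bounded_set_seminorm {} \<in> normal_seminorms \<Omega> \<Gamma>"
    by (auto simp: normal_seminorms_def bounded_test_set_def)
  have 2: "bounded_set_seminorm {} (\<lambda>\<phi>. v \<phi> - u \<phi>) < 1" for u v :: "('a \<Rightarrow> complex) \<Rightarrow> complex"
    by (simp add: bounded_set_seminorm_def bot_ennreal)
  show ?thesis
    unfolding normal_topology_def topology_generated_by_topspace
  proof (intro equalityI subsetI)
    fix v assume v: "v \<in> distributions_WF \<Omega> \<Gamma>"
    show "v \<in> \<Union> {{v \<in> distributions_WF \<Omega> \<Gamma>. p (\<lambda>\<phi>. v \<phi> - u \<phi>) < \<epsilon>} | p u \<epsilon>.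
        p \<in> normal_seminorms \<Omega> \<Gamma> \<and> u \<in> distributions_WF \<Omega> \<Gamma> \<and> 0 < \<epsilon>}"
    proof (rule UnionI)
      show "{w \<in> distributions_WF \<Omega> \<Gamma>. bounded_set_seminorm {} (\<lambda>\<phi>. w \<phi> - v \<phi>) < 1} \<in>
        {{v \<in> distributions_WF \<Omega> \<Gamma>. p (\<lambda>\<phi>. v \<phi> - u \<phi>) < \<epsilon>} | p u \<epsilon>.
        p \<in> normal_seminorms \<Omega> \<Gamma> \<and> u \<in> distributions_WF \<Omega> \<Gamma> \<and> 0 < \<epsilon>}"
        using 1 v zero_less_one by blast
    qed (use v 2 in auto)
  qed auto
qed

section \<open>Pull-back\<close>

definition pull_covector ::
    "(real^'m \<Rightarrow> real^'n) \<Rightarrow> real^'m \<Rightarrow> real^'n \<Rightarrow> real^'m" where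
  "pull_covector f x \<eta> = \<eta> v* jacobian f (at x)"

lemma pull_covector_nth:
  assumes "f differentiable (at x)"
  shows "pull_covector f x \<eta> $ i =
    (\<Sum>j\<in>UNIV. \<eta> $ j * frechet_derivative (\<lambda>y. f y $ j) (at x) (axis i 1))"
proof -
  have "((\<lambda>y. f y $ j) has_derivative (\<lambda>h. frechet_derivative f (at x) h $ j)) (at x)" for j
    using bounded_linear.has_derivative[OF bounded_linear_vec_nth] assms frechet_derivative_works
    by blast
  then have "frechet_derivative (\<lambda>y. f y $ j) (at x) = (\<lambda>h. frechet_derivative f (at x) h $ j)" for j
    by (metis frechet_derivative_at)
  then show ?thesis
    by (simp add: pull_covector_def jacobian_def vector_matrix_mult_def matrix_def mult.commute)
qed

definition conormal_set :: "(real^'m) set \<Rightarrow> (real^'m \<Rightarrow> real^'n) \<Rightarrow> ((real^'n) \<times> (real^'n)) set" where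
  "conormal_set \<Omega> f = {(f x, \<eta>) | x \<eta>. x \<in> \<Omega> \<and> pull_covector f x \<eta> = 0}"

definition pull_cone ::
    "(real^'m) set \<Rightarrow> (real^'m \<Rightarrow> real^'n) \<Rightarrow> ((real^'n) \<times> (real^'n)) set \<Rightarrow> ((real^'m) \<times> (real^'m)) set" where
  "pull_cone \<Omega> f \<Gamma> = {(x, pull_covector f x \<eta>) | x \<eta>. x \<in> \<Omega> \<and> (f x, \<eta>) \<in> \<Gamma>}"

definition sequentially_continuous_map :: "'a topology \<Rightarrow> 'b topology \<Rightarrow> ('a \<Rightarrow> 'b) \<Rightarrow> bool" where
  "sequentially_continuous_map X Y F \<longleftrightarrow> F ` topspace X \<subseteq> topspace Y \<and>
     (\<forall>\<sigma> l. range \<sigma> \<subseteq> topspace X \<and> limitin X \<sigma> l sequentially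
        \<longrightarrow> limitin Y (F \<circ> \<sigma>) (F l) sequentially)"

text \<open>Convergence of sequences in the normal topology is Hoermander's convergence in \<open>\<D>'\<^sub>\<Gamma>\<close>, because
  weakly convergent sequences of distributions converge uniformly on bounded sets of test functions.
  Extensionality outside \<open>\<D>'\<^sub>\<Gamma>(\<Omega>\<^sub>2)\<close> makes the map unique as a HOL function.\<close>

definition pullback ::
    "(real^'m) set \<Rightarrow> (real^'n) set \<Rightarrow> ((real^'n) \<times> (real^'n)) set \<Rightarrow> (real^'m \<Rightarrow> real^'n) \<Rightarrow>
     ((real^'n \<Rightarrow> complex) \<Rightarrow> complex) \<Rightarrow> ((real^'m \<Rightarrow> complex) \<Rightarrow> complex)" where
  "pullback \<Omega>\<^sub>1 \<Omega>\<^sub>2 \<Gamma> f = (THE F.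
     F \<in> extensional (distributions_WF \<Omega>\<^sub>2 \<Gamma>) \<and>
     sequentially_continuous_map
       (normal_topology \<Omega>\<^sub>2 \<Gamma>) (normal_topology \<Omega>\<^sub>1 (pull_cone \<Omega>\<^sub>1 f \<Gamma>)) F \<and>
     (\<forall>g. smooth_on \<Omega>\<^sub>2 g \<longrightarrow> F (distribution_of \<Omega>\<^sub>2 g) = distribution_of \<Omega>\<^sub>1 (g \<circ> f)))"

end

theory Submission
 imports Defs
begin

text \<open>
  Write \<open>e\<^sub>k(x) = exp(-ik\<cdot>x)\<close>. A test function supported in a box is the sum of its Fourier series, and the
  series can be taken through a distribution; no Fourier inversion on the whole space is needed. For smooth
  \<open>g\<close> and a cutoff \<open>\<theta>\<close> this gives \<open>\<langle>g \<circ> f, \<psi> e\<^sub>k\<rangle> = c \<Sum>\<^sub>m \<langle>g, \<theta> e\<^sub>m\<rangle> I(m,k)\<close>, where \<open>I(m,k)\<close> is the integral of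
  \<open>\<psi>\<close> against \<open>exp(i(m\<cdot>f(x) - k\<cdot>x))\<close> and \<open>m\<close> runs over a lattice. Near a point \<open>x\<^sub>0\<close>, a cone \<open>V\<close> that misses
  \<open>f\<^sup>*\<Gamma>\<close> over \<open>x\<^sub>0\<close> yields a cone \<open>W\<close> that misses \<open>\<Gamma>\<close> over \<open>f(x\<^sub>0)\<close> such that the phase has gradient at least
  \<open>c(|m| + |k|)\<close> for \<open>k \<in> V\<close> and \<open>m \<notin> W\<close>. So the term decays rapidly either by integration by parts, with
  \<open>g\<close> tested on one bounded set, or by a Fourier seminorm of \<open>g\<close> on \<open>W\<close>. This bounds each normal seminorm of
  \<open>g \<circ> f\<close> by finitely many of \<open>g\<close>. Truncated Fourier series of mollifications show that smooth functions are
  sequentially dense in \<open>\<D>'\<^sub>\<Gamma>\<close>, so the estimate extends to the limit, which is the pull-back.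
\<close>

section \<open>Partial derivatives and bounded families of smooth functions\<close>

text \<open>Continuity concerns suprema over bounded sets and cones, so no estimate may be proved
  for a single function only: estimates are stated for indexed families with uniform bounds, and a
  frequency, a mollifier radius or the test function itself can serve as index. The wave front set
  grants decay for one unspecified cutoff near each point and direction; dividing by that cutoff
  turns the passage to other families into multiplication by a smooth function, which is the
  oscillatory estimate for the identity map. The pull-back is a definite description, so its
  existence and uniqueness belong to the claim, and the limit of the compositions
  \<open>g n \<circ> f\<close> has to be recognised as a distribution with the right wave front set.
  Finiteness of its normal seminorms gives both: a linear functional bounded on bounded sets is
  continuous, and a finite Fourier seminorm on a small cone excludes a covector. The constant 3 in
  the Fourier series is a radius below 2\<pi>; larger supports are reached by dilation, at the price
  of a finer lattice.\<close>

abbreviation iexp :: "real => complex" where "iexp t \<equiv> exp (\<i> * complex_of_real t)"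

abbreviation decay :: "nat => (('a::euclidean_space => complex) => complex) => ('a => complex) => 'a => real" where
 "decay N u \<theta> k \<equiv> (1 + norm k) ^ N * norm (local_fourier u \<theta> k)"

abbreviation osc :: "'a::real_inner => 'a => complex" where "osc k x \<equiv> exp (- \<i> * complex_of_real (k \<bullet> x))"

definition partial :: "'a::euclidean_space => ('a => 'b::real_normed_vector) => 'a => 'b" where
 "partial b f x = frechet_derivative f (at x) b"

lemma partial_eqI: "(f has_derivative f') (at x) ==> partial b f x = f' b"
 unfolding partial_def using frechet_derivative_at by metis

lemma has_derivative_partial:
 fixes f :: "'a::euclidean_space => 'b::real_normed_vector"
 assumes "f differentiable (at x)"
 shows "(f has_derivative (\<lambda>v. \<Sum>b\<in>Basis. (v \<bullet> b) *\<^sub>R partial b f x)) (at x)"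
proof -
 have D: "(f has_derivative frechet_derivative f (at x)) (at x)"
  using assms frechet_derivative_works by blast
 then interpret linear "frechet_derivative f (at x)"
  by (simp add: has_derivative_linear)
 have "frechet_derivative f (at x) v = (\<Sum>b\<in>Basis. (v \<bullet> b) *\<^sub>R partial b f x)" for v
 proof -
  have "frechet_derivative f (at x) v = frechet_derivative f (at x) (\<Sum>b\<in>Basis. (v \<bullet> b) *\<^sub>R b)"
   by (simp add: euclidean_representation)
  then show ?thesis by (simp add: sum scaleR partial_def)
 qed
 then have "frechet_derivative f (at x) = (\<lambda>v. \<Sum>b\<in>Basis. (v \<bullet> b) *\<^sub>R partial b f x)" by auto
 then show ?thesis using D by simp
qed

lemma
 assumes "open U" "x \<in> U" "\<And>y. y \<in> U ==> f y = g y"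
 shows partial_cong_open: "partial b f x = partial b g x"
  and differentiable_cong_open: "f differentiable (at x) \<longleftrightarrow> g differentiable (at x)"
proof -
 have *: "(f has_derivative f') (at x) \<longleftrightarrow> (g has_derivative f') (at x)" for f'
  using has_derivative_transform_within_open[OF _ assms(1,2)] assms(3) by metis
 then show "partial b f x = partial b g x"
  by (simp add: partial_def frechet_derivative_def)
 show "f differentiable (at x) \<longleftrightarrow> g differentiable (at x)"
  by (simp add: * differentiable_def)
qed

text \<open>\<open>iter_deriv\<close> keeps the derivative taken last at the head of the list.
  Splitting at the other end exposes the one taken first, so a property of functions preserved by
  \<open>partial\<close> passes to all iterated derivatives.\<close>

lemma iter_deriv_snoc: "iter_deriv (bs @ [b]) f = iter_deriv bs (partial b f)"
proof (induction bs)
 case (Cons a bs)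
 then show ?case by (simp only: append_Cons iter_deriv.simps)
qed (simp add: partial_def[abs_def])

lemma iter_deriv_Cons_partial: "iter_deriv (b # bs) f = partial b (iter_deriv bs f)"
 by (auto simp: partial_def)

section \<open>Families with uniformly bounded derivatives\<close>

text \<open>The constants may depend on the order, but neither on the index nor on the point.
  Recursion on the derivative taken first lets sum, product and quotient rules be proved by plain
  induction on the order.\<close>

primrec bdd_derivs ::
  "nat => 'a::euclidean_space set => 'i set => ('i => 'a => complex) => bool" where
 "bdd_derivs 0 U I h \<longleftrightarrow> (\<exists>C. \<forall>i\<in>I. \<forall>x\<in>U. norm (h i x) \<le> C)"
| "bdd_derivs (Suc n) U I h \<longleftrightarrow> (\<exists>C. \<forall>i\<in>I. \<forall>x\<in>U. norm (h i x) \<le> C) \<and>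
   (\<forall>i\<in>I. \<forall>x\<in>U. h i differentiable (at x)) \<and>
   (\<forall>b\<in>Basis. bdd_derivs n U I (\<lambda>i. partial b (h i)))"

text \<open>For open \<open>U\<close> these are the bounded sets in the space of smooth functions
  with all derivatives bounded on \<open>U\<close>. Indexing carries parameters along and lets
  families be multiplied index by index.\<close>

definition bdd_family :: "'a::euclidean_space set => 'i set => ('i => 'a => complex) => bool" where
 "bdd_family U I h \<longleftrightarrow> (\<forall>n. bdd_derivs n U I h)"

lemma bdd_derivs_bound: "bdd_derivs n U I h ==> \<exists>C. \<forall>i\<in>I. \<forall>x\<in>U. norm (h i x) \<le> C"
 by (cases n) auto

lemma bdd_family_bound:
 assumes "bdd_family U I h"
 obtains C where "C > 0" "\<And>i x. i \<in> I ==> x \<in> U ==> norm (h i x) \<le> C"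
proof -
 obtain C where "\<forall>i\<in>I. \<forall>x\<in>U. norm (h i x) \<le> C"
  using assms bdd_derivs_bound unfolding bdd_family_def by blast
 then have "\<And>i x. i \<in> I ==> x \<in> U ==> norm (h i x) \<le> max C 1" by fastforce
 then show thesis using that[of "max C 1"] by auto
qed

lemma bdd_family_differentiable:
 "bdd_family U I h ==> i \<in> I ==> x \<in> U ==> h i differentiable (at x)"
 unfolding bdd_family_def by (metis bdd_derivs.simps(2))

lemma bdd_family_partial: "bdd_family U I h ==> b \<in> Basis ==> bdd_family U I (\<lambda>i. partial b (h i))"
 unfolding bdd_family_def by (metis bdd_derivs.simps(2))

lemma bdd_familyI:
 assumes "\<And>i x. i \<in> I ==> x \<in> U ==> norm (h i x) \<le> C"
  "\<And>i x. i \<in> I ==> x \<in> U ==> h i differentiable (at x)"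
  "\<And>b. b \<in> Basis ==> bdd_family U I (\<lambda>i. partial b (h i))"
 shows "bdd_family U I h"
 unfolding bdd_family_def
proof
 fix n show "bdd_derivs n U I h"
  using assms unfolding bdd_family_def by (cases n) auto
qed

lemma bdd_derivs_SucD: "bdd_derivs (Suc n) U I h ==> bdd_derivs n U I h"
 by (induction n arbitrary: h) auto

text \<open>On an open set the derivatives see only the values inside, so the functions may be
  changed outside \<open>U\<close>.\<close>

lemma bdd_derivs_cong:
 assumes "open U"
 shows "(\<And>i x. i \<in> I ==> x \<in> U ==> h i x = g i x) ==> bdd_derivs n U I h \<longleftrightarrow> bdd_derivs n U I g"
proof (induction n arbitrary: h g)
 case (Suc n)
 have 1: "partial b (h i) x = partial b (g i) x" "h i differentiable (at x) \<longleftrightarrow> g i differentiable (at x)"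
  if "i \<in> I" "x \<in> U" for i x b
  using partial_cong_open[OF assms(1) that(2)] differentiable_cong_open[OF assms(1) that(2)]
   Suc.prems that by blast+
 have "bdd_derivs n U I (\<lambda>i. partial b (h i)) \<longleftrightarrow> bdd_derivs n U I (\<lambda>i. partial b (g i))" for b
  by (rule Suc.IH) (use 1 in auto)
 then show ?case using 1 Suc.prems by auto
qed auto

lemma bdd_family_cong:
 assumes "open U" "\<And>i x. i \<in> I ==> x \<in> U ==> h i x = g i x"
 shows "bdd_family U I h \<longleftrightarrow> bdd_family U I g"
 unfolding bdd_family_def
 by (intro all_cong1 bdd_derivs_cong[OF assms(1)]) (use assms(2) in auto)

lemma bdd_derivs_reindex:
 "bdd_derivs n U I h ==> f ` J \<subseteq> I ==> V \<subseteq> U ==> bdd_derivs n V J (\<lambda>j. h (f j))"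
proof (induction n arbitrary: h)
 case 0
 then obtain C where "\<forall>i\<in>I. \<forall>x\<in>U. norm (h i x) \<le> C" by auto
 with 0 have "\<forall>i\<in>J. \<forall>x\<in>V. norm (h (f i) x) \<le> C" by blast
 then show ?case by auto
next
 case (Suc n)
 then obtain C where "\<forall>i\<in>I. \<forall>x\<in>U. norm (h i x) \<le> C" by auto
 with Suc.prems have "\<forall>i\<in>J. \<forall>x\<in>V. norm (h (f i) x) \<le> C" by blast
 moreover have "\<forall>i\<in>I. \<forall>x\<in>U. h i differentiable (at x)" using Suc.prems by simp
 with Suc.prems have "\<forall>i\<in>J. \<forall>x\<in>V. h (f i) differentiable (at x)" by blast
 moreover have "\<forall>b\<in>Basis. bdd_derivs n V J (\<lambda>j. partial b (h (f j)))"
  using Suc.IH[of "\<lambda>i. partial b (h i)" for b] Suc.prems by auto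
 ultimately show ?case by auto
qed

lemma bdd_family_reindex:
 "bdd_family U I h ==> f ` J \<subseteq> I ==> V \<subseteq> U ==> bdd_family V J (\<lambda>j. h (f j))"
 unfolding bdd_family_def by (blast intro: bdd_derivs_reindex)

lemma bdd_family_mono: "bdd_family U I h ==> J \<subseteq> I ==> V \<subseteq> U ==> bdd_family V J h"
 using bdd_family_reindex[of U I h "\<lambda>j. j" J V] by auto

text \<open>A class \<open>R\<close> of bounded differentiable families that is closed under one
  derivative, up to equality on \<open>U\<close>, contains only families with all derivatives
  bounded. For closed expressions such as exponentials, parameter integrals or series remainders it
  then suffices to compute a single derivative.\<close>

lemma bdd_family_coinduct:
 assumes "open U" "R h"
  and bound: "\<And>h. R h ==> \<exists>C. \<forall>i\<in>I. \<forall>x\<in>U. norm (h i x) \<le> C"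
  and diff: "\<And>h i x. R h ==> i \<in> I ==> x \<in> U ==> h i differentiable (at x)"
  and step: "\<And>h b. R h ==> b \<in> Basis ==> \<exists>g. R g \<and> (\<forall>i\<in>I. \<forall>x\<in>U. partial b (h i) x = g i x)"
 shows "bdd_family U I h"
proof -
 have "\<forall>h. R h --> bdd_derivs n U I h" for n
 proof (induction n)
  case (Suc n)
  have "bdd_derivs n U I (\<lambda>i. partial b (h i))" if "R h" "b \<in> Basis" for h b
  proof -
   from step[OF that] obtain g where g: "R g" "\<forall>i\<in>I. \<forall>x\<in>U. partial b (h i) x = g i x" by auto
   then show ?thesis using Suc by (subst bdd_derivs_cong[OF assms(1), of _ _ g]) auto
  qed
  then show ?case using bound diff by auto
 qed (use bound in auto)
 then show ?thesis using assms(2) unfolding bdd_family_def by auto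
qed

section \<open>Algebra of bounded families\<close>

lemma has_derivative_differentiable: "f differentiable (at x) ==> (f has_derivative frechet_derivative f (at x)) (at x)"
 using frechet_derivative_works by blast

lemma partial_add:
 assumes "f differentiable (at x)" "g differentiable (at x)"
 shows "partial b (\<lambda>x. f x + g x) x = partial b f x + partial b g x"
 unfolding partial_def
 by (subst frechet_derivative_at[symmetric,
    OF has_derivative_add[OF assms[THEN has_derivative_differentiable]]]) simp

lemma partial_mult:
 fixes f g :: "'a::euclidean_space => complex"
 assumes "f differentiable (at x)" "g differentiable (at x)"
 shows "partial b (\<lambda>x. f x * g x) x = partial b f x * g x + f x * partial b g x"
 unfolding partial_def
 by (subst frechet_derivative_at[symmetric,
    OF has_derivative_mult[OF assms[THEN has_derivative_differentiable]]]) simp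

lemma partial_const [simp]: "partial b (\<lambda>x. c) = (\<lambda>x. 0)"
 by (auto simp: partial_def fun_eq_iff)

lemma partial_sum:
 assumes "\<And>j. j \<in> J ==> f j differentiable (at x)"
 shows "partial b (\<lambda>x. \<Sum>j\<in>J. f j x) x = (\<Sum>j\<in>J. partial b (f j) x)"
proof -
 have "((\<lambda>x. \<Sum>j\<in>J. f j x) has_derivative (\<lambda>v. \<Sum>j\<in>J. frechet_derivative (f j) (at x) v)) (at x)"
  by (rule has_derivative_sum) (simp add: assms has_derivative_differentiable)
 from partial_eqI[OF this] show ?thesis by (simp add: partial_def)
qed

lemma bdd_derivs_add:
 assumes "open U"
 shows "bdd_derivs n U I h ==> bdd_derivs n U I g ==> bdd_derivs n U I (\<lambda>i x. h i x + g i x)"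
proof (induction n arbitrary: h g)
 case 0
 then obtain C D where "\<forall>i\<in>I. \<forall>x\<in>U. norm (h i x) \<le> C" "\<forall>i\<in>I. \<forall>x\<in>U. norm (g i x) \<le> D" by auto
 then have "\<forall>i\<in>I. \<forall>x\<in>U. norm (h i x + g i x) \<le> C + D" by (meson norm_triangle_mono)
 then show ?case by auto
next
 case (Suc n)
 then obtain C D where "\<forall>i\<in>I. \<forall>x\<in>U. norm (h i x) \<le> C" "\<forall>i\<in>I. \<forall>x\<in>U. norm (g i x) \<le> D" by auto
 then have 1: "\<forall>i\<in>I. \<forall>x\<in>U. norm (h i x + g i x) \<le> C + D" by (meson norm_triangle_mono)
 have "bdd_derivs n U I (\<lambda>i. partial b (\<lambda>x. h i x + g i x))" if "b \<in> Basis" for b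
  using Suc that
  by (subst bdd_derivs_cong[OF assms, of _ _ "\<lambda>i x. partial b (h i) x + partial b (g i) x"])
    (auto simp: partial_add)
 then show ?case using 1 Suc by (auto intro!: differentiable_add)
qed

lemma bdd_derivs_mult:
 assumes "open U"
 shows "bdd_derivs n U I h ==> bdd_derivs n U I g ==> bdd_derivs n U I (\<lambda>i x. h i x * g i x)"
proof (induction n arbitrary: h g)
 case 0
 then obtain C D where "\<forall>i\<in>I. \<forall>x\<in>U. norm (h i x) \<le> C" "\<forall>i\<in>I. \<forall>x\<in>U. norm (g i x) \<le> D" by auto
 then have "\<forall>i\<in>I. \<forall>x\<in>U. norm (h i x * g i x) \<le> C * D" by (meson norm_mult_ineq mult_mono norm_ge_zero order_trans)
 then show ?case by auto
next
 case (Suc n)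
 then obtain C D where "\<forall>i\<in>I. \<forall>x\<in>U. norm (h i x) \<le> C" "\<forall>i\<in>I. \<forall>x\<in>U. norm (g i x) \<le> D" by auto
 then have 1: "\<forall>i\<in>I. \<forall>x\<in>U. norm (h i x * g i x) \<le> C * D" by (meson norm_mult_ineq mult_mono norm_ge_zero order_trans)
 have "bdd_derivs n U I (\<lambda>i. partial b (\<lambda>x. h i x * g i x))" if "b \<in> Basis" for b
  using Suc that bdd_derivs_SucD[OF Suc.prems(1)] bdd_derivs_SucD[OF Suc.prems(2)]
  by (subst bdd_derivs_cong[OF assms, of _ _ "\<lambda>i x. partial b (h i) x * g i x + h i x * partial b (g i) x"])
    (auto simp: partial_mult intro!: bdd_derivs_add[OF assms])
 then show ?case using 1 Suc by (auto intro!: differentiable_mult)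
qed

lemma bdd_family_add:
 "open U ==> bdd_family U I h ==> bdd_family U I g ==> bdd_family U I (\<lambda>i x. h i x + g i x)"
 unfolding bdd_family_def by (blast intro: bdd_derivs_add)

lemma bdd_family_mult:
 "open U ==> bdd_family U I h ==> bdd_family U I g ==> bdd_family U I (\<lambda>i x. h i x * g i x)"
 unfolding bdd_family_def by (blast intro: bdd_derivs_mult)

lemma bdd_family_const:
 assumes "\<And>i. i \<in> I ==> norm (c i) \<le> C"
 shows "bdd_family U I (\<lambda>i x. c i)"
proof -
 have 0: "bdd_derivs n U I (\<lambda>i x. 0)" for n by (induction n) auto
 then have "bdd_derivs n U I (\<lambda>i x. c i)" for n
  using assms by (cases n) (auto simp: 0)
 then show ?thesis by (auto simp: bdd_family_def)
qed

lemma bdd_family_cmult: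
 "open U ==> bdd_family U I h ==> bdd_family U I (\<lambda>i x. c * h i x)"
 by (intro bdd_family_mult bdd_family_const[of _ _ "norm c"]) auto

lemma bdd_family_diff:
 assumes "open U" "bdd_family U I h" "bdd_family U I g"
 shows "bdd_family U I (\<lambda>i x. h i x - g i x)"
 using bdd_family_add[OF assms(1,2) bdd_family_cmult[OF assms(1,3), of "-1"]] by simp

lemma bdd_family_sum:
 assumes "open U" "finite J" "\<And>j. j \<in> J ==> bdd_family U I (\<lambda>i. h i j)"
 shows "bdd_family U I (\<lambda>i x. \<Sum>j\<in>J. h i j x)"
 using assms(2,3)
proof (induction J rule: finite_induct)
 case empty
 then show ?case using bdd_family_const[of I "\<lambda>_. 0" 0 U] by simp
next
 case (insert j J)
 then show ?case by (simp add: bdd_family_add[OF assms(1)])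
qed

lemma bdd_family_prod:
 assumes "open U" "finite J" "\<And>j. j \<in> J ==> bdd_family U I (\<lambda>i. h i j)"
 shows "bdd_family U I (\<lambda>i x. \<Prod>j\<in>J. h i j x)"
 using assms(2,3)
proof (induction J rule: finite_induct)
 case empty
 then show ?case using bdd_family_const[of I "\<lambda>_. 1" 1 U] by simp
next
 case (insert j J)
 then show ?case by (simp add: bdd_family_mult[OF assms(1)])
qed

text \<open>The derivative of 1/h is -(1/h)(1/h)h', so a bound of order n for the reciprocal itself
  yields the bound of order n + 1. The lower bound \<open>c\<close>, uniform in the index, starts
  the induction.\<close>

lemma bdd_family_inverse:
 assumes U: "open U" and h: "bdd_family U I h" and "c > 0"
  and c: "\<And>i x. i \<in> I ==> x \<in> U ==> c \<le> norm (h i x)"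
 shows "bdd_family U I (\<lambda>i x. inverse (h i x))"
proof -
 have nz: "h i x \<noteq> 0" if "i \<in> I" "x \<in> U" for i x using c[OF that] \<open>c > 0\<close> by auto
 have diff: "h i differentiable (at x)" if "i \<in> I" "x \<in> U" for i x
  using bdd_family_differentiable[OF h that] .
 have bd: "norm (inverse (h i x)) \<le> inverse c" if "i \<in> I" "x \<in> U" for i x
  using c[OF that] \<open>c > 0\<close> by (simp add: norm_inverse le_imp_inverse_le)
 have d: "((\<lambda>x. inverse (h i x)) has_derivative
   (\<lambda>v. - (inverse (h i x) * frechet_derivative (h i) (at x) v * inverse (h i x)))) (at x)"
  if "i \<in> I" "x \<in> U" for i x
  using Deriv.has_derivative_inverse[OF nz[OF that] has_derivative_differentiable[OF diff[OF that]]] .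
 have "bdd_derivs n U I (\<lambda>i x. inverse (h i x))" for n
 proof (induction n)
  case (Suc n)
  have "bdd_derivs n U I (\<lambda>i. partial b (\<lambda>x. inverse (h i x)))" if "b \<in> Basis" for b
  proof (subst bdd_derivs_cong[OF U])
   show "partial b (\<lambda>x. inverse (h i x)) x =
     (-1) * (inverse (h i x) * inverse (h i x) * partial b (h i) x)" if "i \<in> I" "x \<in> U" for i x
    by (subst partial_eqI[OF d[OF that]]) (simp add: partial_def)
   have "bdd_derivs n U I (\<lambda>i x. -1)"
    using bdd_family_const[of I "\<lambda>_. -1" 1 U] by (auto simp: bdd_family_def)
   then show "bdd_derivs n U I (\<lambda>i x. (-1) * (inverse (h i x) * inverse (h i x) * partial b (h i) x))"
    using Suc bdd_family_partial[OF h that] unfolding bdd_family_def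
    by (intro bdd_derivs_mult[OF U]) auto
  qed
  moreover have "\<forall>i\<in>I. \<forall>x\<in>U. (\<lambda>x. inverse (h i x)) differentiable (at x)"
   using d differentiable_def by blast
  moreover have "\<exists>C. \<forall>i\<in>I. \<forall>x\<in>U. cmod (inverse (h i x)) \<le> C" using bd by blast
  ultimately show ?case by simp
 next
  case 0
  show ?case using bd by (simp only: bdd_derivs.simps) blast
 qed
 then show ?thesis by (auto simp: bdd_family_def)
qed

section \<open>Smooth functions on open sets\<close>

lemma bdd_family_iter_deriv:
 assumes "bdd_family U I h" "bs \<in> lists Basis"
 shows "bdd_family U I (\<lambda>i. iter_deriv bs (h i))"
 using assms(2,1)
proof (induction bs arbitrary: h rule: rev_induct)
 case (snoc b bs)
 then show ?case using bdd_family_partial[of U I h b] by (auto simp: iter_deriv_snoc)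
qed auto

lemma bdd_family_imp_smooth_on: "bdd_family U I h ==> i \<in> I ==> smooth_on U (h i)"
 unfolding smooth_on_def by (intro ballI bdd_family_differentiable[OF bdd_family_iter_deriv])

lemma smooth_on_partial: "smooth_on S f ==> b \<in> Basis ==> smooth_on S (partial b f)"
 unfolding smooth_on_def
proof
 fix bs :: "'a list" assume *: "\<forall>bs\<in>lists Basis. \<forall>x\<in>S. iter_deriv bs f differentiable at x"
  "b \<in> Basis" "bs \<in> lists Basis"
 then have "bs @ [b] \<in> lists Basis" by simp
 with *(1) have "\<forall>x\<in>S. iter_deriv (bs @ [b]) f differentiable at x" by blast
 then show "\<forall>x\<in>S. iter_deriv bs (partial b f) differentiable at x" by (simp only: iter_deriv_snoc)
qed

lemma smooth_on_differentiable: "smooth_on S f ==> x \<in> S ==> f differentiable (at x)"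
 unfolding smooth_on_def by (metis lists.Nil iter_deriv.simps(1))

lemma smooth_on_continuous: "smooth_on S f ==> continuous_on S f"
 by (intro continuous_at_imp_continuous_on ballI differentiable_imp_continuous_within
   smooth_on_differentiable)

text \<open>Every derivative is continuous, hence bounded on the compact set \<open>K\<close> that
  lies between \<open>U\<close> and \<open>S\<close>.\<close>

lemma smooth_on_imp_bdd_family:
 assumes "smooth_on S h" "U \<subseteq> K" "compact K" "K \<subseteq> S"
 shows "bdd_family U I (\<lambda>i. h)"
proof -
 have "bdd_derivs n U I (\<lambda>i. h)" for n
  using assms(1)
 proof (induction n arbitrary: h)
  case 0
  have "compact (h ` K)"
   using compact_continuous_image continuous_on_subset[OF smooth_on_continuous[OF 0]] assms by blast
  then obtain C where "\<forall>y\<in>h ` K. norm y \<le> C" using compact_imp_bounded bounded_iff by metis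
  then show ?case using assms by auto
 next
  case (Suc n)
  have "compact (h ` K)"
   using compact_continuous_image continuous_on_subset[OF smooth_on_continuous[OF Suc.prems]] assms by blast
  then obtain C where "\<forall>y\<in>h ` K. norm y \<le> C" using compact_imp_bounded bounded_iff by metis
  then show ?case using assms Suc smooth_on_partial[OF Suc.prems] smooth_on_differentiable[OF Suc.prems] by auto
 qed
 then show ?thesis by (auto simp: bdd_family_def)
qed

lemma smooth_on_local:
 assumes "\<And>x. x \<in> S ==> \<exists>U. x \<in> U \<and> smooth_on U h"
 shows "smooth_on S h"
 using assms unfolding smooth_on_def by blast

lemma smooth_on_subset: "smooth_on S h ==> T \<subseteq> S ==> smooth_on T h"
 unfolding smooth_on_def by blast

text \<open>Smoothness is local, and on a ball whose closure lies in \<open>S\<close> both factors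
  form bounded families, for which the product rule is already iterated.\<close>

lemma smooth_on_mult:
 fixes f g :: "'a::euclidean_space => complex"
 assumes "open S" "smooth_on S f" "smooth_on S g"
 shows "smooth_on S (\<lambda>x. f x * g x)"
proof (rule smooth_on_local)
 fix x assume "x \<in> S"
 then obtain e where e: "e > 0" "cball x e \<subseteq> S" using assms open_contains_cball by blast
 have "bdd_family (ball x e) {()} (\<lambda>_. f)" "bdd_family (ball x e) {()} (\<lambda>_. g)"
  using smooth_on_imp_bdd_family[OF _ ball_subset_cball compact_cball] assms e by blast+
 then have "bdd_family (ball x e) {()} (\<lambda>_ x. f x * g x)" by (intro bdd_family_mult) auto
 from bdd_family_imp_smooth_on[OF this singletonI]
 have "smooth_on (ball x e) (\<lambda>x. f x * g x)" .
 then show "\<exists>U. x \<in> U \<and> smooth_on U (\<lambda>x. f x * g x)"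
  using e(1) by (intro exI[of _ "ball x e"]) simp
qed

lemma smooth_on_sum:
 fixes f :: "'j => 'a::euclidean_space => complex"
 assumes "open S" "finite J" "\<And>j. j \<in> J ==> smooth_on S (f j)"
 shows "smooth_on S (\<lambda>x. \<Sum>j\<in>J. f j x)"
proof (rule smooth_on_local)
 fix x assume "x \<in> S"
 then obtain e where e: "e > 0" "cball x e \<subseteq> S" using assms open_contains_cball by blast
 have "bdd_family (ball x e) {()} (\<lambda>_. f j)" if "j \<in> J" for j
  using smooth_on_imp_bdd_family[OF _ ball_subset_cball compact_cball] assms e that by blast
 then have "bdd_family (ball x e) {()} (\<lambda>_ x. \<Sum>j\<in>J. f j x)" by (intro bdd_family_sum assms) auto
 from bdd_family_imp_smooth_on[OF this singletonI]
 have "smooth_on (ball x e) (\<lambda>x. \<Sum>j\<in>J. f j x)" .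
 then show "\<exists>U. x \<in> U \<and> smooth_on U (\<lambda>x. \<Sum>j\<in>J. f j x)"
  using e(1) by (intro exI[of _ "ball x e"]) simp
qed

lemma smooth_on_linear_comp:
 fixes f :: "'a::euclidean_space => 'b::real_normed_vector"
 assumes "bounded_linear L" "open S" "smooth_on S f"
 shows "smooth_on S (\<lambda>x. L (f x))"
proof -
 have 2: "((\<lambda>y. L (g y)) has_derivative (\<lambda>v. L (frechet_derivative g (at x) v))) (at x)"
  if "g differentiable (at x)" for g :: "'a => 'b" and x
  using bounded_linear.has_derivative[OF assms(1) has_derivative_differentiable[OF that]] .
 have *: "\<forall>x\<in>S. iter_deriv bs (\<lambda>x. L (f x)) x = L (iter_deriv bs f x)"
  if "bs \<in> lists Basis" for bs
  using that
 proof (induction bs)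
  case (Cons b bs)
  have "iter_deriv (b # bs) (\<lambda>x. L (f x)) x = L (iter_deriv (b # bs) f x)" if "x \<in> S" for x
  proof -
   have "partial b (iter_deriv bs (\<lambda>x. L (f x))) x = partial b (\<lambda>x. L (iter_deriv bs f x)) x"
    using Cons by (intro partial_cong_open[OF assms(2) that]) auto
   also have "\<dots> = L (partial b (iter_deriv bs f) x)"
    unfolding partial_def[of _ "iter_deriv bs f"]
    by (rule partial_eqI[OF 2]) (use assms Cons that in \<open>auto simp: smooth_on_def\<close>)
   finally show ?thesis by (simp only: iter_deriv_Cons_partial)
  qed
  then show ?case by blast
 qed auto
 show ?thesis unfolding smooth_on_def
 proof (intro ballI)
  fix bs :: "'a list" and x assume bs: "bs \<in> lists Basis" "x \<in> S"
  then have "(\<lambda>x. L (iter_deriv bs f x)) differentiable (at x)"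
   using 2[of "iter_deriv bs f" x] assms(3) by (auto simp: smooth_on_def differentiable_def)
  then show "iter_deriv bs (\<lambda>x. L (f x)) differentiable (at x)"
   using differentiable_cong_open[OF assms(2) bs(2), of "iter_deriv bs (\<lambda>x. L (f x))"
     "\<lambda>x. L (iter_deriv bs f x)"] *[OF bs(1)] by simp
 qed
qed

section \<open>Oscillating exponentials\<close>

lemma has_derivative_osc:
 fixes k :: "'a::euclidean_space"
 shows "((\<lambda>x. w * osc k x) has_derivative
  (\<lambda>v. (w * (- \<i> * complex_of_real (k \<bullet> v))) * osc k x)) (at x)"
proof -
 have 1: "((\<lambda>x. - \<i> * complex_of_real (k \<bullet> x)) has_derivative (\<lambda>v. - \<i> * complex_of_real (k \<bullet> v))) (at x)"
  by (rule has_derivative_mult_right[OF has_derivative_of_real[OF has_derivative_inner_right[OF has_derivative_ident]]])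
 have "((\<lambda>x. osc k x) has_derivative
   (\<lambda>v. osc k x * (- \<i> * complex_of_real (k \<bullet> v)))) (at x)"
  using has_derivative_compose[OF 1 DERIV_exp[unfolded has_field_derivative_def]] by simp
 from has_derivative_mult_right[OF this, of w] show ?thesis by (simp add: mult_ac)
qed

text \<open>A derivative multiplies the amplitude by a component of the frequency. Amplitudes that
  decay faster than every power of the frequency are stable under this, which makes them an
  invariant for the coinduction.\<close>

lemma bdd_family_osc:
 fixes k :: "'i => 'a::euclidean_space"
 assumes "open U" and w: "\<And>N. \<exists>C. \<forall>i\<in>I. norm (w i) * (1 + norm (k i)) ^ N \<le> C"
 shows "bdd_family U I (\<lambda>i x. w i * osc (k i) x)"
proof (rule bdd_family_coinduct[OF assms(1), where R = "\<lambda>h. \<exists>w. (\<forall>N. \<exists>C. \<forall>i\<in>I. norm (w i) * (1 + norm (k i)) ^ N \<le> C)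
   \<and> h = (\<lambda>i x. w i * osc (k i) x)"])
 fix h :: "'i => 'a => complex"
 assume "\<exists>w. (\<forall>N. \<exists>C. \<forall>i\<in>I. norm (w i) * (1 + norm (k i)) ^ N \<le> C)
   \<and> h = (\<lambda>i x. w i * osc (k i) x)"
 then obtain w where w: "\<And>N. \<exists>C. \<forall>i\<in>I. norm (w i) * (1 + norm (k i)) ^ N \<le> C"
  and h: "h = (\<lambda>i x. w i * osc (k i) x)" by auto
 show "\<exists>C. \<forall>i\<in>I. \<forall>x\<in>U. norm (h i x) \<le> C"
  using w[of 0] by (auto simp: h norm_mult)
 show "h i differentiable (at x)" for i x
  using has_derivative_osc[of "w i" "k i" x] unfolding h differentiable_def by blast
 fix b :: 'a assume b: "b \<in> Basis"
 \<comment> \<open>The amplitude after one derivative; its decay of order \<open>N\<close> uses the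
   decay of order \<open>Suc N\<close> of \<open>w\<close>.\<close>
 define w' where "w' i = w i * (- \<i> * complex_of_real (k i \<bullet> b))" for i
 have "\<exists>C. \<forall>i\<in>I. norm (w' i) * (1 + norm (k i)) ^ N \<le> C" for N
 proof -
  from w[of "Suc N"] obtain C where C: "\<forall>i\<in>I. norm (w i) * (1 + norm (k i)) ^ Suc N \<le> C" ..
  have "norm (w' i) * (1 + norm (k i)) ^ N \<le> C" if "i \<in> I" for i
  proof -
   have "\<bar>k i \<bullet> b\<bar> \<le> 1 + norm (k i)" using Basis_le_norm[OF b, of "k i"] by linarith
   then have "norm (w' i) * (1 + norm (k i)) ^ N \<le> norm (w i) * (1 + norm (k i)) * (1 + norm (k i)) ^ N"
    by (intro mult_right_mono) (auto simp: w'_def norm_mult intro!: mult_left_mono)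
   also have "\<dots> = norm (w i) * (1 + norm (k i)) ^ Suc N" by simp
   also have "\<dots> \<le> C" using C that by blast
   finally show ?thesis .
  qed
  then show ?thesis by blast
 qed
 moreover have "\<forall>i\<in>I. \<forall>x\<in>U. partial b (h i) x = w' i * osc (k i) x"
  unfolding h w'_def by (intro ballI partial_eqI[OF has_derivative_osc])
 ultimately show "\<exists>g. (\<exists>w. (\<forall>N. \<exists>C. \<forall>i\<in>I. norm (w i) * (1 + norm (k i)) ^ N \<le> C) \<and>
    g = (\<lambda>i x. w i * osc (k i) x)) \<and> (\<forall>i\<in>I. \<forall>x\<in>U. partial b (h i) x = g i x)"
  by blast
qed (use w in blast)

section \<open>Families with a common support\<close>

lemma
 assumes "closed K" "x \<notin> K" "\<And>x. x \<notin> K ==> f x = 0"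
 shows partial_eq_0_off: "partial b f x = 0"
  and differentiable_off: "f differentiable (at x)"
proof -
 have o: "open (-K)" "x \<in> -K" using assms by auto
 have eq: "f y = 0" if "y \<in> -K" for y using assms(3) that by simp
 show "partial b f x = 0" using partial_cong_open[OF o eq] by (simp add: partial_def)
 show "f differentiable (at x)" using differentiable_cong_open[OF o eq] by simp
qed

text \<open>Off the closed set \<open>K\<close> the functions vanish on an open set, so all
  derivatives are zero there, while the points of \<open>K\<close> are covered by the bounds on
  \<open>U\<close>.\<close>

lemma bdd_family_extend:
 assumes "closed K" "K \<subseteq> U" "bdd_family U I h" "\<And>i x. i \<in> I ==> x \<notin> K ==> h i x = 0"
 shows "bdd_family UNIV I h"
proof (rule bdd_family_coinduct[where R = "\<lambda>h. bdd_family U I h \<and> (\<forall>i\<in>I. \<forall>x. x \<notin> K --> h i x = 0)"])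
 fix h :: "'b => 'a => complex" assume h: "bdd_family U I h \<and> (\<forall>i\<in>I. \<forall>x. x \<notin> K --> h i x = 0)"
 then obtain C where C: "C > 0" "\<And>i x. i \<in> I ==> x \<in> U ==> norm (h i x) \<le> C"
  using bdd_family_bound by blast
 have "norm (h i x) \<le> C" if "i \<in> I" for i x
  using C(1) C(2)[of i x] h that assms(2) by (cases "x \<in> K") auto
 then show "\<exists>C. \<forall>i\<in>I. \<forall>x\<in>UNIV. norm (h i x) \<le> C" by blast
 show "h i differentiable (at x)" if "i \<in> I" for i x
 proof (cases "x \<in> K")
  case True
  then show ?thesis using bdd_family_differentiable[of U I h i x] h that assms(2) by auto
 next
  case False
  then show ?thesis using h that by (intro differentiable_off[OF assms(1)]) auto
 qed
 fix b :: 'a assume b: "b \<in> Basis"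
 have "partial b (h i) x = 0" if "i \<in> I" "x \<notin> K" for i x
  using h that by (intro partial_eq_0_off[OF assms(1)]) auto
 then show "\<exists>g. (bdd_family U I g \<and> (\<forall>i\<in>I. \<forall>x. x \<notin> K --> g i x = 0)) \<and>
    (\<forall>i\<in>I. \<forall>x\<in>UNIV. partial b (h i) x = g i x)"
  using bdd_family_partial[of U I h b] h b by (intro exI[of _ "\<lambda>i. partial b (h i)"]) simp
qed (use assms in auto)

text \<open>For compact \<open>K\<close> inside \<Omega> these are, in indexed form, the bounded
  subsets of the space of test functions. \<open>K\<close> is only a set outside which all members
  vanish, common to all indices.\<close>

definition test_family :: "'a::euclidean_space set => 'i set => ('i => 'a => complex) => bool" where
 "test_family K I h \<longleftrightarrow> bdd_family UNIV I h \<and> (\<forall>i\<in>I. \<forall>x. x \<notin> K --> h i x = 0)"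

abbreviation test_fun :: "'a::euclidean_space set => ('a => complex) => bool" where
 "test_fun K \<phi> \<equiv> test_family K {()} (\<lambda>_. \<phi>)"

lemma test_family_0: "test_family K I h ==> i \<in> I ==> x \<notin> K ==> h i x = 0"
 by (auto simp: test_family_def)

lemma test_family_mult:
 assumes "open U" "bdd_family U I g" "test_family K I h" "closed K" "K \<subseteq> U"
 shows "test_family K I (\<lambda>i x. g i x * h i x)"
proof -
 have "bdd_family U I (\<lambda>i x. g i x * h i x)"
  using assms by (auto intro!: bdd_family_mult elim!: bdd_family_mono simp: test_family_def)
 then show ?thesis
  using bdd_family_extend[OF assms(4,5), of I "\<lambda>i x. g i x * h i x"] assms(3)
  by (auto simp: test_family_def)
qed

lemma test_family_add:
 assumes "test_family K I h" "test_family K I g"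
 shows "test_family K I (\<lambda>i x. h i x + g i x)"
 using assms bdd_family_add[OF open_UNIV, of I h g] by (simp add: test_family_def)

lemma test_family_diff:
 assumes "test_family K I h" "test_family K I g"
 shows "test_family K I (\<lambda>i x. h i x - g i x)"
 using assms bdd_family_diff[OF open_UNIV, of I h g] by (simp add: test_family_def)

lemma test_family_sum:
 assumes "finite J" "\<And>j. j \<in> J ==> test_family K I (\<lambda>i. h i j)"
 shows "test_family K I (\<lambda>i x. \<Sum>j\<in>J. h i j x)"
 using assms bdd_family_sum[OF open_UNIV assms(1), of I h] by (simp add: test_family_def)

lemma test_family_reindex:
 assumes "test_family K I h" "f ` J \<subseteq> I"
 shows "test_family K J (\<lambda>j. h (f j))"
 using bdd_family_reindex[of UNIV I h f J UNIV] assms by (auto simp: test_family_def image_subset_iff)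

lemma test_family_mono:
 assumes "test_family K I h" "K \<subseteq> L" "J \<subseteq> I"
 shows "test_family L J h"
 using assms bdd_family_mono[of UNIV I h J UNIV] by (auto simp: test_family_def)

lemma test_family_partial:
 assumes "closed K" "test_family K I h" "b \<in> Basis"
 shows "test_family K I (\<lambda>i. partial b (h i))"
proof -
 have "partial b (h i) x = 0" if "i \<in> I" "x \<notin> K" for i x
  using assms(2) that by (intro partial_eq_0_off[OF assms(1)]) (auto simp: test_family_def)
 then show ?thesis using assms(2) bdd_family_partial[of UNIV I h b] assms(3) by (simp add: test_family_def)
qed

lemma supp_subsetI: "closed K ==> (\<And>x. x \<notin> K ==> \<phi> x = 0) ==> supp \<phi> \<subseteq> K"
 unfolding supp_def by (rule closure_minimal) auto

lemma not_in_supp: "x \<notin> supp \<phi> ==> \<phi> x = 0"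
 unfolding supp_def using closure_subset[of "{x. \<phi> x \<noteq> 0}"] by auto

lemma test_functionsI:
 assumes "compact K" "K \<subseteq> \<Omega>" "smooth_on UNIV \<phi>" "\<And>x. x \<notin> K ==> \<phi> x = 0"
 shows "\<phi> \<in> test_functions \<Omega>"
proof -
 have 1: "supp \<phi> \<subseteq> K" by (rule supp_subsetI[OF compact_imp_closed[OF assms(1)] assms(4)])
 have "closed (supp \<phi>)" by (simp add: supp_def)
 then have "compact (K \<inter> supp \<phi>)" using assms(1) by (rule compact_Int_closed[rotated])
 moreover have "K \<inter> supp \<phi> = supp \<phi>" using 1 by blast
 ultimately show ?thesis using assms 1 by (auto simp: test_functions_def)
qed

lemma test_family_test_functions:
 assumes "compact K" "K \<subseteq> \<Omega>" "test_family K I h" "i \<in> I"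
 shows "h i \<in> test_functions \<Omega>" "supp (h i) \<subseteq> K"
proof -
 have 0: "h i x = 0" if "x \<notin> K" for x using assms that by (auto simp: test_family_def)
 show "h i \<in> test_functions \<Omega>"
  by (rule test_functionsI[OF assms(1,2) _ 0])
   (use assms bdd_family_imp_smooth_on[of UNIV I h i] in \<open>auto simp: test_family_def\<close>)
 show "supp (h i) \<subseteq> K" using 0 compact_imp_closed[OF assms(1)] by (intro supp_subsetI) auto
qed

lemma test_functionsD:
 assumes "\<phi> \<in> test_functions \<Omega>"
 shows "smooth_on UNIV \<phi>" "compact (supp \<phi>)" "supp \<phi> \<subseteq> \<Omega>"
 using assms by (auto simp: test_functions_def)

lemma test_function_family:
 assumes "\<phi> \<in> test_functions \<Omega>"
 shows "test_family (supp \<phi>) I (\<lambda>i. \<phi>)"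
proof -
 obtain e where e: "supp \<phi> \<subseteq> ball 0 e"
  using test_functionsD(2)[OF assms] compact_imp_bounded bounded_subset_ballD by blast
 have "bdd_family (ball 0 e) I (\<lambda>i. \<phi>)"
  by (rule smooth_on_imp_bdd_family[OF test_functionsD(1)[OF assms] ball_subset_cball]) auto
 moreover have "\<phi> x = 0" if "x \<notin> supp \<phi>" for x using that by (rule not_in_supp)
 moreover have "closed (supp \<phi>)" by (simp add: supp_def)
 ultimately have "bdd_family UNIV I (\<lambda>i. \<phi>)" by (intro bdd_family_extend[OF _ e]) 
 then show ?thesis using not_in_supp[of _ \<phi>] by (simp add: test_family_def)
qed

section \<open>Integration by parts\<close>

lemma bdd_family_gradient_bound:
 fixes h :: "'i => 'a::euclidean_space => complex"
 assumes "bdd_family U I h"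
 obtains C where "C > 0" "\<And>i x v. i \<in> I ==> x \<in> U ==>
  norm (\<Sum>b\<in>Basis. (v \<bullet> b) *\<^sub>R partial b (h i) x) \<le> C * norm v"
proof -
 have "\<exists>C>0. \<forall>i\<in>I. \<forall>x\<in>U. norm (partial b (h i) x) \<le> C" if b: "b \<in> Basis" for b
  using bdd_family_bound[OF bdd_family_partial[OF assms b]] by metis
 then obtain C where C: "\<And>b i x. b \<in> Basis ==> i \<in> I ==> x \<in> U ==> norm (partial b (h i) x) \<le> C b"
  and Cp: "\<And>b. b \<in> Basis ==> C b > 0" by metis
 have "norm (\<Sum>b\<in>Basis. (v \<bullet> b) *\<^sub>R partial b (h i) x) \<le> (1 + sum C Basis) * norm v"
  if "i \<in> I" "x \<in> U" for i x v
 proof -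
  have "norm (\<Sum>b\<in>Basis. (v \<bullet> b) *\<^sub>R partial b (h i) x) \<le> (\<Sum>b\<in>Basis. norm v * C b)"
  proof (rule sum_norm_le)
   fix b :: 'a assume b: "b \<in> Basis"
   show "norm ((v \<bullet> b) *\<^sub>R partial b (h i) x) \<le> norm v * C b"
    using C[OF b that] Basis_le_norm[OF b, of v] by (auto intro!: mult_mono)
  qed
  also have "\<dots> = norm v * sum C Basis" by (rule sum_distrib_left[symmetric])
  also have "\<dots> \<le> (1 + sum C Basis) * norm v" by (simp add: algebra_simps)
  finally show ?thesis .
 qed
 moreover have "1 + sum C Basis > 0" using Cp by (simp add: add_pos_nonneg less_imp_le sum_nonneg)
 ultimately show thesis using that by blast
qed

lemma bdd_family_lipschitz:
 fixes h :: "'i => 'a::euclidean_space => complex"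
 assumes "bdd_family U I h" "convex U"
 obtains L where "L > 0" "\<And>i x y. i \<in> I ==> x \<in> U ==> y \<in> U ==> norm (h i x - h i y) \<le> L * norm (x - y)"
proof -
 obtain C where C: "C > 0" "\<And>i x v. i \<in> I ==> x \<in> U ==>
  norm (\<Sum>b\<in>Basis. (v \<bullet> b) *\<^sub>R partial b (h i) x) \<le> C * norm v"
  using bdd_family_gradient_bound[OF assms(1)] by metis
 have "norm (h i x - h i y) \<le> C * norm (x - y)" if "i \<in> I" "x \<in> U" "y \<in> U" for i x y
  by (rule differentiable_bound[OF assms(2), of "h i" "\<lambda>x v. \<Sum>b\<in>Basis. (v \<bullet> b) *\<^sub>R partial b (h i) x"])
   (use that C bdd_family_differentiable[OF assms(1)] in
    \<open>auto intro!: onorm_le has_derivative_at_withinI has_derivative_partial\<close>)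
 then show thesis using that C(1) by blast
qed

text \<open>The first derivatives are Lipschitz with a constant independent of the index, so
  linearising along the segment from x to y leaves a quadratic error. Uniformity in the index is
  what later allows the remainder to be integrated over a parameter.\<close>

lemma bdd_family_taylor:
 fixes h :: "'i => 'a::euclidean_space => complex"
 assumes "bdd_family U I h" "convex U"
 obtains L where "L > 0" "\<And>i x y. i \<in> I ==> x \<in> U ==> y \<in> U ==>
  norm (h i y - h i x - (\<Sum>b\<in>Basis. ((y - x) \<bullet> b) *\<^sub>R partial b (h i) x)) \<le> L * norm (y - x) ^ 2"
proof -
 have "\<exists>L>0. \<forall>i\<in>I. \<forall>x\<in>U. \<forall>y\<in>U. norm (partial b (h i) x - partial b (h i) y) \<le> L * norm (x - y)"
  if b: "b \<in> Basis" for b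
  using bdd_family_lipschitz[OF bdd_family_partial[OF assms(1) b] assms(2)] by metis
 then obtain L where L: "\<And>b i x y. b \<in> Basis ==> i \<in> I ==> x \<in> U ==> y \<in> U ==>
   norm (partial b (h i) x - partial b (h i) y) \<le> L b * norm (x - y)"
  and Lp: "\<And>b. b \<in> Basis ==> L b > 0" by metis
 define M where "M = 1 + sum L Basis"
 have M: "M > 0" using Lp unfolding M_def by (simp add: add_pos_nonneg less_imp_le sum_nonneg)
 have "norm (h i y - h i x - (\<Sum>b\<in>Basis. ((y - x) \<bullet> b) *\<^sub>R partial b (h i) x)) \<le> M * norm (y - x) ^ 2"
  if i: "i \<in> I" and x: "x \<in> U" and y: "y \<in> U" for i x y
 proof -
  define f' where "f' z v = (\<Sum>b\<in>Basis. (v \<bullet> b) *\<^sub>R partial b (h i) z)" for z v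
  have seg: "closed_segment x y \<subseteq> U" using assms(2) x y by (rule closed_segment_subset[rotated 2])
  have "norm (h i y - h i x - f' x (y - x)) \<le> norm (y - x) * (M * norm (y - x))"
  proof (rule differentiable_bound_linearization[where S = "closed_segment x y"])
   show "x + t *\<^sub>R (y - x) \<in> closed_segment x y" if "t \<in> {0..1}" for t
    using that unfolding closed_segment_def by (intro CollectI exI[of _ t]) (auto simp: algebra_simps)
   show "(h i has_derivative f' z) (at z within closed_segment x y)" if "z \<in> closed_segment x y" for z
   proof -
    have "z \<in> U" using that seg by blast
    from has_derivative_partial[OF bdd_family_differentiable[OF assms(1) i this]]
    show ?thesis unfolding f'_def by (rule has_derivative_at_withinI)
   qed
   show "onorm (f' z - f' x) \<le> M * norm (y - x)" if z: "z \<in> closed_segment x y" for z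
    unfolding fun_diff_def
   proof (rule onorm_le)
    fix v
    have zx: "norm (z - x) \<le> norm (y - x)" using z by (rule segment_bound1)
    have "norm (f' z v - f' x v) = norm (\<Sum>b\<in>Basis. (v \<bullet> b) *\<^sub>R (partial b (h i) z - partial b (h i) x))"
     by (simp add: f'_def sum_subtractf scaleR_diff_right)
    also have "\<dots> \<le> (\<Sum>b\<in>Basis. norm v * (L b * norm (y - x)))"
    proof (rule sum_norm_le)
     fix b :: 'a assume b: "b \<in> Basis"
     have "norm (partial b (h i) z - partial b (h i) x) \<le> L b * norm (z - x)"
      using L[OF b i _ x, of z] z seg by blast
     also have "\<dots> \<le> L b * norm (y - x)" using zx Lp[OF b] by simp
     finally show "norm ((v \<bullet> b) *\<^sub>R (partial b (h i) z - partial b (h i) x)) \<le> norm v * (L b * norm (y - x))"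
      using Basis_le_norm[OF b, of v] by (auto intro!: mult_mono)
    qed
    also have "\<dots> = sum L Basis * (norm (y - x) * norm v)"
     by (simp add: sum_distrib_left sum_distrib_right mult_ac)
    also have "\<dots> \<le> M * (norm (y - x) * norm v)" by (intro mult_right_mono) (auto simp: M_def)
    finally show "norm (f' z v - f' x v) \<le> M * norm (y - x) * norm v" by (simp add: mult_ac)
   qed
  qed auto
  then show ?thesis by (simp add: f'_def power2_eq_square mult_ac)
 qed
 then show thesis using that M by blast
qed

section \<open>Integrals of compactly supported functions\<close>

lemma integrable_compact_support:
 fixes h :: "'a::euclidean_space => complex"
 assumes "compact K" "continuous_on UNIV h" "\<And>x. x \<notin> K ==> h x = 0"
 shows "integrable lborel h"
proof -
 have "integrable lborel (\<lambda>x. indicator K x *\<^sub>R h x)"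
  using borel_integrable_compact[OF assms(1) continuous_on_subset[OF assms(2)]] by auto
 moreover have "(\<lambda>x. indicator K x *\<^sub>R h x) = h" using assms(3) by (auto simp: indicator_def fun_eq_iff)
 ultimately show ?thesis by simp
qed

text \<open>If \<open>h\<close> is not integrable its integral is 0 by convention, and
  \<open>C\<close> is nonnegative because it bounds a norm; the bound thus holds in that case as
  well.\<close>

lemma norm_integral_compact_support:
 fixes h :: "'a::euclidean_space => complex"
 assumes "compact K" "\<And>x. norm (h x) \<le> C" "\<And>x. x \<notin> K ==> h x = 0" 
 shows "norm (LINT x|lborel. h x) \<le> C * measure lborel K"
proof (cases "integrable lborel h")
 case True
 have K: "K \<in> sets lborel" "emeasure lborel K < \<infinity>"
  using assms(1) emeasure_compact_finite[OF assms(1)] by (auto simp: compact_imp_closed)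
 have "norm (LINT x|lborel. h x) \<le> (LINT x|lborel. norm (h x))" by (rule integral_norm_bound)
 also have "\<dots> \<le> (LINT x|lborel. C * indicator K x)"
 proof (rule integral_mono[OF integrable_norm[OF True]])
  show "integrable lborel (\<lambda>x. C * indicator K x)"
   using K by (intro integrable_mult_right integrable_real_indicator)
  show "norm (h x) \<le> C * indicator K x" for x
   using assms(2)[of x] assms(3)[of x] by (cases "x \<in> K") auto
 qed
 also have "\<dots> = C * measure lborel K" using K by simp
 finally show ?thesis .
next
 case False
 have "0 \<le> C" using assms(2)[of 0] norm_ge_zero order_trans by blast
 then show ?thesis using False by (simp add: not_integrable_integral_eq)
qed

text \<open>Translation invariance of Lebesgue measure settles measurable functions. Translating
  preserves non-measurability, and then both integrals are 0 by convention.\<close>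

lemma integral_translate:
 fixes h :: "'a::euclidean_space => complex"
 shows "(LINT x|lborel. h (a + x)) = (LINT x|lborel. h x)"
proof (cases "h \<in> borel_measurable borel")
 case True
 have "(LINT x|lborel. h x) = (LINT x|distr lborel borel ((+) a). h x)"
  by (simp add: lborel_distr_plus)
 also have "\<dots> = (LINT x|lborel. h (a + x))" using True by (intro integral_distr) auto
 finally show ?thesis ..
next
 case False
 have "(\<lambda>x. h (a + x)) \<notin> borel_measurable borel"
 proof
  assume "(\<lambda>x. h (a + x)) \<in> borel_measurable borel"
  then have "(\<lambda>x. h (a + (x - a))) \<in> borel_measurable borel"
   by (rule measurable_compose[rotated]) simp
  then show False using False by simp
 qed
 then have "\<not> integrable lborel h" "\<not> integrable lborel (\<lambda>x. h (a + x))"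
  using False borel_measurable_integrable by force+
 then show ?thesis by (simp add: not_integrable_integral_eq)
qed

lemma difference_quotient_tendsto_partial:
 fixes h :: "'a::euclidean_space => complex"
 assumes "h differentiable (at x)" "b \<in> Basis"
 shows "(\<lambda>n. (h (x + inverse (real (Suc n)) *\<^sub>R b) - h x) * of_nat (Suc n)) \<longlonglongrightarrow> partial b h x"
proof -
 let ?D = "frechet_derivative h (at x)"
 have D: "(h has_derivative ?D) (at x)" using assms(1) by (rule has_derivative_differentiable)
 have lin: "linear ?D" by (rule has_derivative_linear[OF D])
 have "(\<lambda>y. norm (h (x + y) - h x - ?D y) / norm y) \<midarrow>0\<rightarrow> 0"
  using D unfolding has_derivative_at by blast
 moreover have "(\<lambda>n. inverse (real (Suc n)) *\<^sub>R b) \<longlonglongrightarrow> 0"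
  using tendsto_scaleR[OF LIMSEQ_inverse_real_of_nat tendsto_const[of b]] by simp
 moreover have "\<forall>\<^sub>F n in sequentially. inverse (real (Suc n)) *\<^sub>R b \<noteq> 0"
  using assms(2) by (auto intro!: always_eventually)
 ultimately have "(\<lambda>n. norm (h (x + inverse (real (Suc n)) *\<^sub>R b) - h x - ?D (inverse (real (Suc n)) *\<^sub>R b)) /
   norm (inverse (real (Suc n)) *\<^sub>R b)) \<longlonglongrightarrow> 0"
  by (rule tendsto_compose_eventually)
 moreover have "norm (h (x + inverse (real (Suc n)) *\<^sub>R b) - h x - ?D (inverse (real (Suc n)) *\<^sub>R b)) /
   norm (inverse (real (Suc n)) *\<^sub>R b) =
   norm ((h (x + inverse (real (Suc n)) *\<^sub>R b) - h x) * of_nat (Suc n) - partial b h x)" for n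
 proof -
  have "?D (inverse (real (Suc n)) *\<^sub>R b) = inverse (real (Suc n)) *\<^sub>R partial b h x"
   using lin by (simp add: linear_scale partial_def)
  moreover have "norm (inverse (real (Suc n)) *\<^sub>R b) = inverse (real (Suc n))" using assms(2) by simp
  moreover have "norm (z - inverse (real (Suc n)) *\<^sub>R p) / inverse (real (Suc n)) = norm (z * of_nat (Suc n) - p)"
   for z p :: complex
  proof -
   have "z * of_nat (Suc n) - p = (z - inverse (real (Suc n)) *\<^sub>R p) * of_nat (Suc n)"
    by (simp add: scaleR_conv_of_real left_diff_distrib field_simps del: of_nat_Suc)
   then have "norm (z * of_nat (Suc n) - p) = norm (z - inverse (real (Suc n)) *\<^sub>R p) * real (Suc n)"
    by (simp only: norm_mult norm_of_nat)
   then show ?thesis by (simp add: divide_inverse)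
  qed
  ultimately show ?thesis by metis
 qed
 ultimately have "(\<lambda>n. norm ((h (x + inverse (real (Suc n)) *\<^sub>R b) - h x) * of_nat (Suc n) - partial b h x)) \<longlonglongrightarrow> 0"
  by (simp only:)
 then show ?thesis by (rule LIM_zero_cancel[OF tendsto_norm_zero_cancel])
qed

text \<open>The difference quotients in direction \<open>b\<close> have integral zero by translation
  invariance and converge to the derivative; the bound \<open>C\<close> on the derivative and the
  compact support make the convergence dominated.\<close>

lemma integral_partial_eq_0:
 fixes h :: "'a::euclidean_space => complex"
 assumes K: "compact K" "\<And>x. x \<notin> K ==> h x = 0" and diff: "\<And>x. h differentiable (at x)"
  and C: "\<And>x. norm (partial b h x) \<le> C" and b: "b \<in> Basis"
 shows "(LINT x|lborel. partial b h x) = 0"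
proof -
 \<comment> \<open>Steps of length at most 1, so that all difference quotients vanish outside the
   ball of radius \<open>R + 1\<close>.\<close>
 define t where "t n = inverse (real (Suc n))" for n
 define g where "g n x = (h (x + t n *\<^sub>R b) - h x) * of_nat (Suc n)" for n x
 have t: "0 < t n" "t n \<le> 1" "t n * real (Suc n) = 1" for n
  by (simp_all add: t_def inverse_le_1_iff del: of_nat_Suc)
 have cont: "continuous_on UNIV h" by (simp add: continuous_at_imp_continuous_on differentiable_imp_continuous_within diff)
 then have hm: "h \<in> borel_measurable borel" by (rule borel_measurable_continuous_onI)
 have hi: "integrable lborel h" using integrable_compact_support[OF K(1) cont K(2)] .
 obtain R where R: "K \<subseteq> cball 0 R" using compact_imp_bounded[OF K(1)] by (auto simp: bounded_iff subset_eq)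
 have lim: "(\<lambda>n. g n x) \<longlonglongrightarrow> partial b h x" for x
  unfolding g_def t_def by (rule difference_quotient_tendsto_partial[OF diff b])
 have shift_c: "continuous_on UNIV (\<lambda>x. h (x + t n *\<^sub>R b))" for n
  by (rule continuous_on_compose2[OF cont]) (intro continuous_intros, simp)
 have gm: "g n \<in> borel_measurable borel" for n
  unfolding g_def[abs_def]
  by (intro borel_measurable_times borel_measurable_diff borel_measurable_const hm
    borel_measurable_continuous_onI[OF shift_c])
 have shift_i: "integrable lborel (\<lambda>x. h (x + t n *\<^sub>R b))" for n
 proof (rule integrable_compact_support)
  show "compact ((\<lambda>x. x - t n *\<^sub>R b) ` K)" by (rule compact_continuous_image[OF _ K(1)]) (intro continuous_intros)
  show "continuous_on UNIV (\<lambda>x. h (x + t n *\<^sub>R b))" by (rule shift_c)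
  show "h (x + t n *\<^sub>R b) = 0" if "x \<notin> (\<lambda>x. x - t n *\<^sub>R b) ` K" for x
   using that K(2)[of "x + t n *\<^sub>R b"] by force
 qed
 have gint: "(LINT x|lborel. g n x) = 0" for n
 proof -
  have "(LINT x|lborel. g n x) = ((LINT x|lborel. h (x + t n *\<^sub>R b)) - (LINT x|lborel. h x)) * of_nat (Suc n)"
   unfolding g_def using hi shift_i by simp
  then show ?thesis using integral_translate[of h "t n *\<^sub>R b"] by (simp add: add.commute)
 qed
 \<comment> \<open>On the ball the mean value inequality bounds the increment by
   \<open>C * t n\<close>, and the factor \<open>Suc n\<close> is the reciprocal of
   \<open>t n\<close>; outside, both points miss \<open>K\<close>.\<close>
 have gb: "norm (g n x) \<le> C * indicator (cball 0 (R + 1)) x" for n x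
 proof (cases "x \<in> cball 0 (R + 1)")
  case True
  have "((\<lambda>s. h (x + s *\<^sub>R b)) has_derivative (\<lambda>r. r *\<^sub>R partial b h (x + s *\<^sub>R b))) (at s)" for s
  proof -
   have "((\<lambda>s. x + s *\<^sub>R b) has_derivative (\<lambda>r. r *\<^sub>R b)) (at s)" by (auto intro!: derivative_eq_intros)
   from has_derivative_compose[OF this has_derivative_partial[OF diff]]
   have "((\<lambda>s. h (x + s *\<^sub>R b)) has_derivative
     (\<lambda>r. \<Sum>c\<in>Basis. (r *\<^sub>R b \<bullet> c) *\<^sub>R partial c h (x + s *\<^sub>R b))) (at s)" .
   moreover have "(\<Sum>c\<in>Basis. (r *\<^sub>R b \<bullet> c) *\<^sub>R partial c h (x + s *\<^sub>R b)) = r *\<^sub>R partial b h (x + s *\<^sub>R b)" for r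
   proof -
    have "(\<Sum>c\<in>Basis. (r *\<^sub>R b \<bullet> c) *\<^sub>R partial c h (x + s *\<^sub>R b)) =
     (\<Sum>c\<in>Basis. if c = b then r *\<^sub>R partial b h (x + s *\<^sub>R b) else 0)"
     by (rule sum.cong) (use b in \<open>auto simp: inner_Basis\<close>)
    then show ?thesis using b by simp
   qed
   ultimately show ?thesis by simp
  qed
  then have "norm (h (x + t n *\<^sub>R b) - h (x + 0 *\<^sub>R b)) \<le> C * norm (t n - 0)"
   by (intro differentiable_bound[of UNIV "\<lambda>s. h (x + s *\<^sub>R b)" "\<lambda>s r. r *\<^sub>R partial b h (x + s *\<^sub>R b)" C])
    (use C in \<open>auto intro!: onorm_le mult_left_mono simp: mult.commute[of C] intro: has_derivative_at_withinI\<close>)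
  then have "norm (h (x + t n *\<^sub>R b) - h x) * real (Suc n) \<le> C * t n * real (Suc n)"
   using t(1)[of n] by (intro mult_right_mono) auto
  also have "\<dots> = C" using t(3)[of n] by (metis mult.assoc mult.right_neutral)
  finally show ?thesis using True by (simp add: g_def norm_mult del: of_nat_Suc)
 next
  case False
  have "norm (x + t n *\<^sub>R b) \<ge> norm x - norm (t n *\<^sub>R b)"
   using norm_triangle_ineq2[of x "- (t n *\<^sub>R b)"] by simp
  moreover have "norm (t n *\<^sub>R b) \<le> 1" using t(1,2)[of n] b by simp
  ultimately have "norm (x + t n *\<^sub>R b) > R" using False by simp
  then have "x + t n *\<^sub>R b \<notin> K" "x \<notin> K" using R False by auto
  then show ?thesis using K(2) False by (simp add: g_def)
 qed
 have "(\<lambda>n. LINT x|lborel. g n x) \<longlonglongrightarrow> (LINT x|lborel. partial b h x)"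
 proof (rule integral_dominated_convergence)
  \<comment> \<open>Measurability of the derivative comes from its being a pointwise limit of
    measurable quotients.\<close>
  show "partial b h \<in> borel_measurable lborel"
   using borel_measurable_LIMSEQ_metric[OF gm lim] by simp
  show "integrable lborel (\<lambda>x. C * indicator (cball (0::'a) (R + 1)) x :: real)"
   using emeasure_compact_finite[OF compact_cball[of "0::'a" "R + 1"]]
   by (intro integrable_mult_right integrable_real_indicator) auto
 qed (use gm gb lim in auto)
 then show ?thesis using gint LIMSEQ_unique[OF _ tendsto_const] by (auto simp: fun_eq_iff)
qed

section \<open>Non-stationary phase\<close>

lemma norm_exp_i_real [simp]: "norm (iexp t) = 1"
 by (simp add: norm_exp_eq_Re)

lemma norm_exp_minus_i_real [simp]: "norm (exp (- (\<i> * complex_of_real t))) = 1"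
 by (simp add: norm_exp_eq_Re)

text \<open>Let \<open>s i\<close> be the size of the frequency and \<open>d\<close> the phase
  gradient divided by it. Since the sum of \<open>d\<^sup>2\<close> is at least \<open>c\<close>,
  the amplitude can be written as a combination of the \<open>d i b\<close>, each of which arises by
  differentiating the exponential and dividing by \<open>s i\<close>. One integration by parts gains
  a factor 1/\<open>s i\<close> and produces an amplitude of the same kind, so the gain can be
  repeated \<open>N\<close> times.\<close>

lemma nonstationary_phase:
 fixes \<psi> :: "'i => 'a::euclidean_space => complex" and \<Phi> :: "'i => 'a => real"
 assumes U: "open U" and K: "compact K" "K \<subseteq> U" and \<psi>: "test_family K I \<psi>"
  and s: "\<And>i. i \<in> I ==> s i > 0"
  and \<Phi>: "\<And>i x. i \<in> I ==> x \<in> U ==>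
   (\<Phi> i has_derivative (\<lambda>v. s i * (\<Sum>b\<in>Basis. (v \<bullet> b) * d i b x))) (at x)"
  and d: "\<And>b. b \<in> Basis ==> bdd_family U I (\<lambda>i x. complex_of_real (d i b x))"
  and c: "c > 0" "\<And>i x. i \<in> I ==> x \<in> U ==> c \<le> (\<Sum>b\<in>Basis. (d i b x)\<^sup>2)"
 shows "\<exists>C. \<forall>i\<in>I. s i ^ N * norm (LINT x|lborel. \<psi> i x * iexp (\<Phi> i x)) \<le> C"
 using \<psi>
proof (induction N arbitrary: \<psi>)
 case 0
 then obtain C where C: "C > 0" "\<And>i x. i \<in> I ==> x \<in> UNIV ==> norm (\<psi> i x) \<le> C"
  using bdd_family_bound unfolding test_family_def by metis
 have "norm (LINT x|lborel. \<psi> i x * iexp (\<Phi> i x)) \<le> C * measure lborel K"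
  if "i \<in> I" for i
  by (rule norm_integral_compact_support[OF K(1)])
   (use C that test_family_0[OF 0 that] in \<open>auto simp: norm_mult\<close>)
 then show ?case by auto
next
 case (Suc N)
 have Kc: "closed K" using K compact_imp_closed by blast
 define q where "q i x = (\<Sum>b\<in>Basis. complex_of_real (d i b x) * complex_of_real (d i b x))" for i x
 have q: "q i x = complex_of_real (\<Sum>b\<in>Basis. (d i b x)\<^sup>2)" for i x
  by (simp add: q_def power2_eq_square)
 have qn: "c \<le> norm (q i x)" if "i \<in> I" "x \<in> U" for i x
  using c(1) c(2)[OF that] unfolding q norm_of_real by linarith
 have q_inv: "bdd_family U I (\<lambda>i x. inverse (q i x))"
  by (rule bdd_family_inverse[OF U _ c(1) qn]) (auto simp: q_def intro!: bdd_family_sum bdd_family_mult U d)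
 \<comment> \<open>The dual coefficients: the sum of \<open>d i b x * a i b x\<close> over
   \<open>b\<close> is 1 on \<open>U\<close>, because \<open>q\<close> is the squared length of
   \<open>d\<close>.\<close>
 define a where "a i b x = inverse (q i x) * complex_of_real (d i b x)" for i b x
 have a: "bdd_family U I (\<lambda>i x. a i b x)" if "b \<in> Basis" for b
  unfolding a_def by (intro bdd_family_mult U q_inv d that)
 have a\<psi>: "test_family K I (\<lambda>i x. a i b x * \<psi> i x)" if "b \<in> Basis" for b
  by (rule test_family_mult[OF U a[OF that] Suc.prems Kc K(2)])
 have da\<psi>: "test_family K I (\<lambda>i x. complex_of_real (d i b x) * (a i b x * \<psi> i x))" if "b \<in> Basis" for b
  by (rule test_family_mult[OF U d[OF that] a\<psi>[OF that] Kc K(2)])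
 \<comment> \<open>The new amplitude after moving the derivatives from the exponential to the other
   factors; up to sign it is the transpose of the vector field given by \<open>a\<close>.\<close>
 define \<psi>' where "\<psi>' i x = (\<Sum>b\<in>Basis. partial b (\<lambda>x. a i b x * \<psi> i x) x)" for i x
 have \<psi>': "test_family K I \<psi>'"
  unfolding \<psi>'_def using test_family_partial[OF Kc a\<psi>] by (intro test_family_sum) auto
 then obtain C where C: "\<forall>i\<in>I. s i ^ N * norm (LINT x|lborel. \<psi>' i x * iexp (\<Phi> i x)) \<le> C"
  using Suc.IH by blast
 have "s i * norm (LINT x|lborel. \<psi> i x * iexp (\<Phi> i x)) =
   norm (LINT x|lborel. \<psi>' i x * iexp (\<Phi> i x))" if i: "i \<in> I" for i
 proof -
  define e where "e x = iexp (\<Phi> i x)" for x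
  have e: "(e has_derivative (\<lambda>v. e x * (\<i> * complex_of_real (s i * (\<Sum>b\<in>Basis. (v \<bullet> b) * d i b x))))) (at x)"
   if "x \<in> U" for x
   unfolding e_def
   using has_derivative_compose[OF has_derivative_mult_right[OF has_derivative_of_real[OF \<Phi>[OF i that]], of \<i>]
     DERIV_exp[unfolded has_field_derivative_def]] by simp
  \<comment> \<open>The phase is differentiable only on \<open>U\<close>. At other points the
    product is locally zero, since \<open>g\<close> vanishes off the closed set
    \<open>K\<close>.\<close>
  have D: "(\<lambda>x. g x * e x) differentiable (at x) \<and> (\<forall>b\<in>Basis. partial b (\<lambda>x. g x * e x) x =
    partial b g x * e x + \<i> * complex_of_real (s i) * ((complex_of_real (d i b x) * g x) * e x))"
   if g: "\<And>x. g differentiable (at x)" "\<And>x. x \<notin> K ==> g x = 0" for g x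
  proof (cases "x \<in> U")
   case True
   have ed: "e differentiable (at x)" using e[OF True] differentiable_def by blast
   have "partial b e x = e x * (\<i> * complex_of_real (s i * d i b x))" if b: "b \<in> Basis" for b
   proof -
    have "(\<Sum>c\<in>Basis. (b \<bullet> c) * d i c x) = (\<Sum>c\<in>Basis. if c = b then d i b x else 0)"
     by (rule sum.cong) (use b in \<open>auto simp: inner_Basis\<close>)
    then show ?thesis using partial_eqI[OF e[OF True], of b] b by simp
   qed
   then show ?thesis using ed g(1) by (auto simp: partial_mult mult_ac intro!: differentiable_mult)
  next
   case False
   then have x: "x \<notin> K" using K by auto
   have g0: "g y * e y = 0" if "y \<notin> K" for y using g(2)[OF that] by simp
   have "(\<lambda>x. g x * e x) differentiable (at x)" by (rule differentiable_off[OF Kc x]) (erule g0)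
   moreover have "partial b (\<lambda>x. g x * e x) x = 0" for b
    by (rule partial_eq_0_off[OF Kc x]) (erule g0)
   moreover have "partial b g x = 0" for b by (rule partial_eq_0_off[OF Kc x]) (erule g(2))
   ultimately show ?thesis using g(2)[OF x] by simp
  qed
  have int: "integrable lborel (\<lambda>x. g i x * e x)" if g: "test_family K I g" for g
  proof (rule integrable_compact_support[OF K(1)])
   have "g i differentiable (at x)" for x
    using bdd_family_differentiable[of UNIV I g i x] g i by (simp add: test_family_def)
   then have "(\<lambda>x. g i x * e x) differentiable (at x)" for x
    by (rule conjunct1[OF D[of "g i"]]) (erule test_family_0[OF g i])
   then show "continuous_on UNIV (\<lambda>x. g i x * e x)"
    by (simp add: continuous_at_imp_continuous_on differentiable_imp_continuous_within)
  qed (use test_family_0[OF g i] in auto)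
  have b0: "(LINT x|lborel. partial b (\<lambda>x. a i b x * \<psi> i x) x * e x) =
    - \<i> * complex_of_real (s i) * (LINT x|lborel. complex_of_real (d i b x) * (a i b x * \<psi> i x) * e x)"
   if b: "b \<in> Basis" for b
  proof -
   have gd: "(\<lambda>x. a i b x * \<psi> i x) differentiable (at x)" for x
    using bdd_family_differentiable[of UNIV I "\<lambda>i x. a i b x * \<psi> i x" i x] a\<psi>[OF b] i
    by (simp add: test_family_def)
   have g0: "a i b x * \<psi> i x = 0" if "x \<notin> K" for x using test_family_0[OF a\<psi>[OF b] i that] .
   have D': "(\<lambda>x. a i b x * \<psi> i x * e x) differentiable (at x) \<and>
     (\<forall>c\<in>Basis. partial c (\<lambda>x. a i b x * \<psi> i x * e x) x = partial c (\<lambda>x. a i b x * \<psi> i x) x * e x +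
       \<i> * complex_of_real (s i) * ((complex_of_real (d i c x) * (a i b x * \<psi> i x)) * e x))" for x
    by (rule D[of "\<lambda>x. a i b x * \<psi> i x"], rule gd, erule g0)
   obtain C1 where C1: "norm (partial b (\<lambda>x. a i b x * \<psi> i x) x) \<le> C1" for x
    using bdd_family_bound[of UNIV I "\<lambda>i. partial b (\<lambda>x. a i b x * \<psi> i x)"]
     test_family_partial[OF Kc a\<psi>[OF b] b] i unfolding test_family_def by (metis UNIV_I)
   obtain C2 where C2: "norm (complex_of_real (d i b x) * (a i b x * \<psi> i x)) \<le> C2" for x
    using bdd_family_bound[of UNIV I "\<lambda>i x. complex_of_real (d i b x) * (a i b x * \<psi> i x)"]
     da\<psi>[OF b] i unfolding test_family_def by (metis UNIV_I)
   have "(LINT x|lborel. partial b (\<lambda>x. a i b x * \<psi> i x * e x) x) = 0"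
   proof (rule integral_partial_eq_0[OF K(1) _ _ _ b])
    show "a i b x * \<psi> i x * e x = 0" if "x \<notin> K" for x using g0[OF that] by simp
    show "(\<lambda>x. a i b x * \<psi> i x * e x) differentiable (at x)" for x using D' by blast
    show "norm (partial b (\<lambda>x. a i b x * \<psi> i x * e x) x) \<le> C1 + \<bar>s i\<bar> * C2" for x
    proof -
     have "norm (partial b (\<lambda>x. a i b x * \<psi> i x * e x) x) \<le> norm (partial b (\<lambda>x. a i b x * \<psi> i x) x * e x) +
      norm (\<i> * complex_of_real (s i) * (complex_of_real (d i b x) * (a i b x * \<psi> i x) * e x))"
      using D'[of x] b norm_triangle_ineq by simp
     also have "\<dots> = norm (partial b (\<lambda>x. a i b x * \<psi> i x) x) +
       \<bar>s i\<bar> * norm (complex_of_real (d i b x) * (a i b x * \<psi> i x))"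
      by (simp add: norm_mult e_def)
     also have "\<dots> \<le> C1 + \<bar>s i\<bar> * C2" using C1 C2 by (intro add_mono mult_left_mono) auto
     finally show ?thesis .
    qed
   qed
   moreover have "partial b (\<lambda>x. a i b x * \<psi> i x * e x) x = partial b (\<lambda>x. a i b x * \<psi> i x) x * e x +
     \<i> * complex_of_real (s i) * (complex_of_real (d i b x) * (a i b x * \<psi> i x) * e x)" for x
    using D'[of x] b by blast
   ultimately show ?thesis
    using int[OF test_family_partial[OF Kc a\<psi>[OF b] b]] int[OF da\<psi>[OF b]]
    by (simp add: eq_neg_iff_add_eq_0)
  qed
  have "(LINT x|lborel. \<psi>' i x * e x) = (\<Sum>b\<in>Basis. LINT x|lborel. partial b (\<lambda>x. a i b x * \<psi> i x) x * e x)"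
   unfolding \<psi>'_def sum_distrib_right
   by (intro Bochner_Integration.integral_sum int test_family_partial[OF Kc a\<psi>])
  also have "\<dots> = - \<i> * complex_of_real (s i) *
    (\<Sum>b\<in>Basis. LINT x|lborel. complex_of_real (d i b x) * (a i b x * \<psi> i x) * e x)"
   using b0 by (simp add: sum_distrib_left)
  also have "(\<Sum>b\<in>Basis. LINT x|lborel. complex_of_real (d i b x) * (a i b x * \<psi> i x) * e x) =
    (LINT x|lborel. (\<Sum>b\<in>Basis. complex_of_real (d i b x) * (a i b x * \<psi> i x) * e x))"
   by (intro Bochner_Integration.integral_sum[symmetric] int[OF da\<psi>])
  \<comment> \<open>Duality of \<open>a\<close> and \<open>d\<close> restores the original
    amplitude; off \<open>K\<close> both sides vanish.\<close>
  also have "(\<lambda>x. \<Sum>b\<in>Basis. complex_of_real (d i b x) * (a i b x * \<psi> i x) * e x) = (\<lambda>x. \<psi> i x * e x)"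
  proof
   fix x
   show "(\<Sum>b\<in>Basis. complex_of_real (d i b x) * (a i b x * \<psi> i x) * e x) = \<psi> i x * e x"
   proof (cases "x \<in> K")
    case True
    then have "q i x \<noteq> 0" using qn[OF i, of x] K c(1) by auto
    moreover have "(\<Sum>b\<in>Basis. complex_of_real (d i b x) * (a i b x * \<psi> i x) * e x) =
      (inverse (q i x) * q i x) * (\<psi> i x * e x)"
     unfolding q_def[of i x] a_def by (simp add: sum_distrib_left sum_distrib_right mult_ac)
    ultimately show ?thesis by simp
   qed (use test_family_0[OF Suc.prems i] in simp)
  qed
  finally have "norm (LINT x|lborel. \<psi>' i x * e x) = s i * norm (LINT x|lborel. \<psi> i x * e x)"
   using s[OF i] by (simp add: norm_mult)
  then show ?thesis by (simp add: e_def)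
 qed
 then have "\<forall>i\<in>I. s i ^ Suc N * norm (LINT x|lborel. \<psi> i x * iexp (\<Phi> i x)) \<le> C"
  using C by (simp add: mult.assoc mult.left_commute[of _ "s _ ^ N"]) 
 then show ?case by blast
qed

section \<open>Integrals depending on a parameter\<close>

text \<open>The Taylor remainder is quadratic uniformly in the parameter, so integrating it against
  weights of bounded total mass gives the derivative under the integral sign. The differentiated
  integrand satisfies the same hypotheses, and coinduction gives all orders.\<close>

lemma bdd_family_integral:
 fixes h :: "'i => 'z::euclidean_space => 'a::euclidean_space => complex" and w :: "'i => 'z => complex"
 assumes U: "open U" and h: "bdd_family U (I \<times> Z) (\<lambda>(i, z). h i z)"
  and meas: "\<And>i x. i \<in> I ==> x \<in> U ==> (\<lambda>z. w i z * h i z x) \<in> borel_measurable borel"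
  and w: "\<And>i. i \<in> I ==> integrable lborel (w i)" "\<And>i z. i \<in> I ==> z \<notin> Z ==> w i z = 0"
   "\<And>i. i \<in> I ==> (LINT z|lborel. norm (w i z)) \<le> B"
 shows "bdd_family U I (\<lambda>i x. LINT z|lborel. w i z * h i z x)" (is ?thesis1)
  and "\<And>i x b. i \<in> I ==> x \<in> U ==> b \<in> Basis ==>
   partial b (\<lambda>x. LINT z|lborel. w i z * h i z x) x = (LINT z|lborel. w i z * partial b (h i z) x)"
proof -
 \<comment> \<open>The invariant of the coinduction. Measurability is required of the product with
   the weight, since \<open>h\<close> is controlled only for parameters in \<open>Z\<close>, outside
   which the weight vanishes.\<close>
 define A :: "('i => 'z => 'a => complex) => bool" where
  "A h \<longleftrightarrow> bdd_family U (I \<times> Z) (\<lambda>(i, z). h i z) \<and>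
   (\<forall>i\<in>I. \<forall>x\<in>U. (\<lambda>z. w i z * h i z x) \<in> borel_measurable borel)" for h
 define H :: "('i => 'z => 'a => complex) => 'i => 'a => complex" where
  "H h i x = (LINT z|lborel. w i z * h i z x)" for h i x
 have step: "A (\<lambda>i z. partial b (h i z))" if h: "A h" and b: "b \<in> Basis" for h b
 proof -
  have bd: "bdd_family U (I \<times> Z) (\<lambda>(i, z). h i z)" using h by (simp add: A_def)
  have "bdd_family U (I \<times> Z) (\<lambda>(i, z). partial b (h i z))"
   using bdd_family_partial[OF bd b] by (simp add: case_prod_beta')
  moreover have "(\<lambda>z. w i z * partial b (h i z) x) \<in> borel_measurable borel" if i: "i \<in> I" and x: "x \<in> U" for i x
  proof -
   obtain e where e: "e > 0" "ball x e \<subseteq> U" using U x open_contains_ball by blast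
   \<comment> \<open>Dropping the first \<open>n0\<close> difference quotients keeps the shifted
     points inside \<open>U\<close>.\<close>
   obtain n0 where n0: "inverse (real (Suc n0)) < e" using reals_Archimedean[OF e(1)] by blast
   define t where "t n = inverse (real (Suc (n + n0)))" for n
   have t: "0 < t n" "t n < e" for n
   proof -
    have "t n \<le> inverse (real (Suc n0))" unfolding t_def by (intro le_imp_inverse_le) auto
    then show "t n < e" using n0 by simp
    show "0 < t n" by (simp add: t_def del: of_nat_Suc)
   qed
   have tx: "x + t n *\<^sub>R b \<in> U" for n using e(2) t[of n] b by (auto simp: dist_norm)
   have "(\<lambda>n. w i z * ((h i z (x + t n *\<^sub>R b) - h i z x) * of_nat (Suc (n + n0)))) \<longlonglongrightarrow> w i z * partial b (h i z) x" for z
   proof (cases "z \<in> Z")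
    case True
    then have "h i z differentiable (at x)" using bdd_family_differentiable[OF bd, of "(i, z)" x] i x by simp
    from LIMSEQ_ignore_initial_segment[OF difference_quotient_tendsto_partial[OF this b], of n0]
    show ?thesis unfolding t_def by (intro tendsto_mult_left)
   qed (use w(2)[OF i] in simp)
   moreover have "(\<lambda>z. w i z * ((h i z (x + t n *\<^sub>R b) - h i z x) * of_nat (Suc (n + n0)))) \<in> borel_measurable borel" for n
   proof -
    have "(\<lambda>z. w i z * h i z (x + t n *\<^sub>R b)) \<in> borel_measurable borel"
     "(\<lambda>z. w i z * h i z x) \<in> borel_measurable borel" using h i x tx[of n] by (auto simp: A_def)
    then have "(\<lambda>z. (w i z * h i z (x + t n *\<^sub>R b) - w i z * h i z x) * of_nat (Suc (n + n0))) \<in> borel_measurable borel"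
     by (rule borel_measurable_times[OF borel_measurable_diff borel_measurable_const])
    then show ?thesis by (simp add: algebra_simps)
   qed
   ultimately show ?thesis by (rule borel_measurable_LIMSEQ_metric[rotated])
  qed
  ultimately show ?thesis by (simp add: A_def)
 qed
 have int: "integrable lborel (\<lambda>z. w i z * h i z x)" if h: "A h" and "i \<in> I" "x \<in> U" for h i x
 proof -
  obtain C where C: "C > 0" "\<And>j x. j \<in> I \<times> Z ==> x \<in> U ==> norm ((\<lambda>(i, z). h i z) j x) \<le> C"
   using h bdd_family_bound[of U "I \<times> Z" "\<lambda>(i, z). h i z"] unfolding A_def by metis
  show ?thesis
  proof (rule Bochner_Integration.integrable_bound)
   show "integrable lborel (\<lambda>z. complex_of_real C * w i z)" using w(1)[OF that(2)] by simp
   show "AE z in lborel. norm (w i z * h i z x) \<le> norm (complex_of_real C * w i z)"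
   proof (rule AE_I2)
    fix z show "norm (w i z * h i z x) \<le> norm (complex_of_real C * w i z)"
     using C(2)[of "(i, z)" x] that w(2)[of i z] C(1)
     by (cases "z \<in> Z") (auto simp: norm_mult mult.commute[of C] intro!: mult_left_mono)
   qed
  qed (use h that in \<open>auto simp: A_def\<close>)
 qed
 have int_le: "norm (LINT z|lborel. w i z * g z) \<le> C * B"
  if "i \<in> I" "integrable lborel (\<lambda>z. w i z * g z)" "\<And>z. z \<in> Z ==> norm (g z) \<le> C" "0 \<le> C" for i g C
 proof -
  have "norm (LINT z|lborel. w i z * g z) \<le> (LINT z|lborel. norm (w i z * g z))" by (rule integral_norm_bound)
  also have "\<dots> \<le> (LINT z|lborel. C * norm (w i z))"
  proof (rule integral_mono)
   fix z show "norm (w i z * g z) \<le> C * norm (w i z)"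
    using that(3)[of z] w(2)[OF that(1), of z]
    by (cases "z \<in> Z") (auto simp: norm_mult mult.commute[of C] intro!: mult_left_mono)
  qed (use that w(1) in auto)
  also have "\<dots> \<le> C * B" using w(3)[OF that(1)] that(4) by (simp add: mult_left_mono)
  finally show ?thesis .
 qed
 have deriv: "(H h i has_derivative (\<lambda>v. \<Sum>b\<in>Basis. (v \<bullet> b) *\<^sub>R H (\<lambda>i z. partial b (h i z)) i x)) (at x)"
  if h: "A h" and i: "i \<in> I" and x: "x \<in> U" for h i x
 proof -
  obtain e where e: "e > 0" "ball x e \<subseteq> U" using U x open_contains_ball by blast
  have bd: "bdd_family (ball x e) (I \<times> Z) (\<lambda>(i, z). h i z)" using h e(2) by (auto simp: A_def intro: bdd_family_mono)
  obtain L where L: "L > 0" "\<And>j x' y. j \<in> I \<times> Z ==> x' \<in> ball x e ==> y \<in> ball x e ==>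
    norm ((\<lambda>(i, z). h i z) j y - (\<lambda>(i, z). h i z) j x' -
     (\<Sum>b\<in>Basis. ((y - x') \<bullet> b) *\<^sub>R partial b ((\<lambda>(i, z). h i z) j) x')) \<le> L * norm (y - x') ^ 2"
   by (rule bdd_family_taylor[OF bd convex_ball]) (erule that, assumption)
  \<comment> \<open>The integrated Taylor estimate: the error of the candidate derivative is
    quadratic in the displacement.\<close>
  have est: "norm (H h i y - H h i x - (\<Sum>b\<in>Basis. ((y - x) \<bullet> b) *\<^sub>R H (\<lambda>i z. partial b (h i z)) i x))
    \<le> L * norm (y - x) ^ 2 * B" if y: "y \<in> ball x e" for y
  proof -
   have yU: "y \<in> U" using e(2) y by auto
   let ?r = "\<lambda>z. h i z y - h i z x - (\<Sum>b\<in>Basis. ((y - x) \<bullet> b) *\<^sub>R partial b (h i z) x)"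
   have i1: "integrable lborel (\<lambda>z. (\<Sum>b\<in>Basis. ((y - x) \<bullet> b) *\<^sub>R (w i z * partial b (h i z) x)))"
    by (intro Bochner_Integration.integrable_sum integrable_scaleR_right int[OF step[OF h]] i x)
   have eq: "w i z * ?r z = w i z * h i z y - w i z * h i z x - (\<Sum>b\<in>Basis. ((y - x) \<bullet> b) *\<^sub>R (w i z * partial b (h i z) x))" for z
    by (simp add: right_diff_distrib sum_distrib_left mult_scaleR_right)
   have i2: "integrable lborel (\<lambda>z. w i z * ?r z)" unfolding eq
    by (intro Bochner_Integration.integrable_diff i1 int[OF h i] x yU)
   have "(LINT z|lborel. w i z * ?r z) =
     H h i y - H h i x - (\<Sum>b\<in>Basis. ((y - x) \<bullet> b) *\<^sub>R H (\<lambda>i z. partial b (h i z)) i x)"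
    unfolding eq H_def
    by (simp add: i1 int[OF h i] int[OF step[OF h] i] x yU Bochner_Integration.integral_sum)
   moreover have "norm (LINT z|lborel. w i z * ?r z) \<le> L * norm (y - x) ^ 2 * B"
    using L(2)[of "(i, _)" x y] i y e(1) L(1) by (intro int_le[OF i i2]) auto
   ultimately show ?thesis by simp
  qed
  show ?thesis
  proof (rule has_derivativeI_sandwich[OF e(1)])
   show "bounded_linear (\<lambda>v. \<Sum>b\<in>Basis. (v \<bullet> b) *\<^sub>R H (\<lambda>i z. partial b (h i z)) i x)"
    by (intro bounded_linear_sum bounded_linear_scaleR_left[THEN bounded_linear_compose] bounded_linear_inner_left)
   show "norm (H h i y - H h i x - (\<Sum>b\<in>Basis. ((y - x) \<bullet> b) *\<^sub>R H (\<lambda>i z. partial b (h i z)) i x)) / norm (y - x)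
    \<le> L * norm (y - x) * B" if "y \<in> UNIV" "y \<noteq> x" "dist y x < e" for y
    using est[of y] that by (simp add: divide_simps dist_commute power2_eq_square mult_ac)
   have "((\<lambda>y. L * norm (y - x) * B) \<longlongrightarrow> L * norm (x - x) * B) (at x)" by (intro tendsto_intros)
   then show "((\<lambda>y. L * norm (y - x) * B) \<longlongrightarrow> 0) (at x)" by simp
  qed
 qed
 have part: "partial b (H h i) x = H (\<lambda>i z. partial b (h i z)) i x"
  if "A h" "i \<in> I" "x \<in> U" "b \<in> Basis" for h i x b
 proof -
  have "(\<Sum>c\<in>Basis. (b \<bullet> c) *\<^sub>R H (\<lambda>i z. partial c (h i z)) i x) =
    (\<Sum>c\<in>Basis. if c = b then H (\<lambda>i z. partial b (h i z)) i x else 0)"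
   by (rule sum.cong) (use that in \<open>auto simp: inner_Basis\<close>)
  then show ?thesis using partial_eqI[OF deriv[OF that(1-3)], of b] that(4) by simp
 qed
 have A: "A h" using h meas by (simp add: A_def)
 show ?thesis1 unfolding H_def[symmetric]
 proof (rule bdd_family_coinduct[OF U, where R = "\<lambda>g. \<exists>h. A h \<and> g = H h"])
  fix g assume "\<exists>h. A h \<and> g = H h"
  then obtain h where h: "A h" "g = H h" by blast
  obtain C where C: "C > 0" "\<And>j x. j \<in> I \<times> Z ==> x \<in> U ==> norm ((\<lambda>(i, z). h i z) j x) \<le> C"
   using h bdd_family_bound[of U "I \<times> Z" "\<lambda>(i, z). h i z"] unfolding A_def by metis
  have "norm (H h i x) \<le> C * B" if "i \<in> I" "x \<in> U" for i x
   unfolding H_def using C(2)[of "(i, _)" x] that C(1) by (intro int_le int[OF h(1)]) auto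
  then show "\<exists>C. \<forall>i\<in>I. \<forall>x\<in>U. norm (g i x) \<le> C" using h(2) by blast
  show "g i differentiable (at x)" if "i \<in> I" "x \<in> U" for i x
   using deriv[OF h(1) that] h(2) differentiable_def by blast
  fix b :: 'a assume b: "b \<in> Basis"
  show "\<exists>g'. (\<exists>h. A h \<and> g' = H h) \<and> (\<forall>i\<in>I. \<forall>x\<in>U. partial b (g i) x = g' i x)"
   using step[OF h(1) b] part[OF h(1) _ _ b] h(2)
   by (intro exI[of _ "H (\<lambda>i z. partial b (h i z))"] conjI exI[of _ "\<lambda>i z. partial b (h i z)"]) auto
 qed (use A in blast)
 show "partial b (\<lambda>x. LINT z|lborel. w i z * h i z x) x = (LINT z|lborel. w i z * partial b (h i z) x)"
  if "i \<in> I" "x \<in> U" "b \<in> Basis" for i x b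
  using part[OF A that] unfolding H_def[abs_def] .
qed

section \<open>Bump functions and mollifiers\<close>

text \<open>\<open>flat 0\<close> is the classical function exp(-1/t) for t > 0, extended by 0. The
  powers of 1/t make the collection of all \<open>flat k\<close> closed under differentiation up to
  linear combinations.\<close>

definition flat :: "nat => real => real" where
 "flat k t = (if t > 0 then inverse t ^ k * exp (- inverse t) else 0)"

text \<open>One term of the exponential series is at most the whole sum when all terms are
  nonnegative.\<close>

lemma power_times_exp_le: 
 fixes y :: real assumes "0 \<le> y" shows "y ^ k * exp (- y) \<le> fact k"
proof -
 have "y ^ k / fact k \<le> (\<Sum>n\<in>{k}. inverse (fact n) *\<^sub>R y ^ n)" by (simp add: divide_inverse mult.commute)
 also have "\<dots> \<le> exp y" unfolding exp_def using assms
  by (intro sum_le_suminf summable_exp_generic) auto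
 finally have "y ^ k \<le> fact k * exp y" by (simp add: divide_simps mult.commute)
 then show ?thesis by (simp add: exp_minus divide_simps)
qed

lemma flat_bound: "\<bar>flat k t\<bar> \<le> fact k"
 using power_times_exp_le[of "inverse t" k] by (auto simp: flat_def)

lemma DERIV_flat: "(flat k has_real_derivative (flat (k + 2) t - real k * flat (k + 1) t)) (at t)"
proof (cases t "0::real" rule: linorder_cases)
 case less
 have "((\<lambda>_. 0) has_real_derivative 0) (at t)" by simp
 then have "(flat k has_real_derivative 0) (at t)"
  by (rule has_field_derivative_transform_within_open[where S = "{..<0}"]) (use less in \<open>auto simp: flat_def\<close>)
 then show ?thesis using less by (simp add: flat_def)
next
 case greater
 have "((\<lambda>t. inverse t ^ k * exp (- inverse t)) has_real_derivative
   (real k * (inverse t ^ (k - 1) * - (inverse t * inverse t))) * exp (- inverse t)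
   + inverse t ^ k * (exp (- inverse t) * (inverse t * inverse t))) (at t)"
  using greater by (auto intro!: derivative_eq_intros simp: power2_eq_square divide_inverse)
 moreover have "(real k * (inverse t ^ (k - 1) * - (inverse t * inverse t))) = - (real k * inverse t ^ (k + 1))"
  by (cases k) auto
 ultimately have "((\<lambda>t. inverse t ^ k * exp (- inverse t)) has_real_derivative
   - (real k * inverse t ^ (k + 1)) * exp (- inverse t)
   + inverse t ^ k * (exp (- inverse t) * (inverse t * inverse t))) (at t)" by (simp only:)
 then have "((\<lambda>t. inverse t ^ k * exp (- inverse t)) has_real_derivative
   (flat (k + 2) t - real k * flat (k + 1) t)) (at t)"
  using greater by (simp add: flat_def algebra_simps)
 then show ?thesis
  by (rule has_field_derivative_transform_within_open[where S = "{0<..}"]) (use greater in \<open>auto simp: flat_def\<close>)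
next
 case equal
 \<comment> \<open>Using two more powers of 1/y in \<open>power_times_exp_le\<close> than
   \<open>flat k\<close> contains yields a quadratic bound, hence derivative 0 at the
   origin.\<close>
 have *: "\<bar>flat k y\<bar> \<le> fact (k + 2) * \<bar>y\<bar>\<^sup>2" for y
 proof (cases "y > 0")
  case True
  have "inverse y ^ (k + 2) * exp (- inverse y) \<le> fact (k + 2)"
   using True by (intro power_times_exp_le) auto
  then have "inverse y ^ (k + 2) * exp (- inverse y) * y\<^sup>2 \<le> fact (k + 2) * y\<^sup>2" by (rule mult_right_mono) simp
  moreover have "inverse y ^ (k + 2) * exp (- inverse y) * y\<^sup>2 = inverse y ^ k * exp (- inverse y)"
   using True by (simp add: power_add field_simps power2_eq_square)
  ultimately have "inverse y ^ k * exp (- inverse y) \<le> fact (k + 2) * y\<^sup>2" by (simp only:)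
  then show ?thesis using True by (simp add: flat_def del: fact_Suc)
 qed (simp add: flat_def)
 have "(flat k has_derivative (\<lambda>v. v * 0)) (at 0)"
 proof (rule has_derivativeI_sandwich[of 1])
  show "norm (flat k y - flat k 0 - (y - 0) * 0) / norm (y - 0) \<le> fact (k + 2) * \<bar>y\<bar>"
   if "y \<in> UNIV" "y \<noteq> 0" "dist y 0 < 1" for y
  proof -
   have "flat k 0 = 0" by (simp add: flat_def)
   then show ?thesis using *[of y] that
    by (simp add: pos_divide_le_eq power2_eq_square mult.assoc del: fact_Suc)
  qed
  have "((\<lambda>y. fact (k + 2) * \<bar>y\<bar>) \<longlongrightarrow> fact (k + 2) * \<bar>0::real\<bar>) (at 0)" by (intro tendsto_intros)
  then show "((\<lambda>y. fact (k + 2) * \<bar>y\<bar>) \<longlongrightarrow> (0::real)) (at 0)" by simp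
 qed auto
 then show ?thesis using equal by (simp add: has_field_derivative_def flat_def lambda_zero)
qed

text \<open>Induction on the order with \<open>k\<close> left free, since each derivative replaces
  \<open>flat k\<close> by \<open>flat (k + 1)\<close> and \<open>flat (k + 2)\<close>; all of them
  are bounded, by \<open>fact k\<close> for \<open>flat k\<close>.\<close>

lemma bdd_derivs_flat_comp:
 fixes q :: "'a::euclidean_space => real"
 assumes U: "open U" and q: "\<And>x. x \<in> U ==> (q has_derivative (\<lambda>v. \<Sum>b\<in>Basis. (v \<bullet> b) * q' b x)) (at x)"
  and q': "\<And>b. b \<in> Basis ==> bdd_family U I (\<lambda>_ x. complex_of_real (q' b x))"
 shows "bdd_derivs n U I (\<lambda>_ x. complex_of_real (flat k (q x)))"
proof (induction n arbitrary: k)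
 case 0
 show ?case using flat_bound by (auto intro!: exI[of _ "fact k"])
next
 case (Suc n)
 have D: "((\<lambda>x. complex_of_real (flat k (q x))) has_derivative
   (\<lambda>v. complex_of_real ((flat (k + 2) (q x) - real k * flat (k + 1) (q x)) * (\<Sum>b\<in>Basis. (v \<bullet> b) * q' b x)))) (at x)"
  if "x \<in> U" for x
  using has_derivative_of_real[OF has_derivative_compose[OF q[OF that] DERIV_flat[unfolded has_field_derivative_def]]] .
 have P: "partial b (\<lambda>x. complex_of_real (flat k (q x))) x =
   (complex_of_real (flat (k + 2) (q x)) + (- of_nat k) * complex_of_real (flat (k + 1) (q x))) * complex_of_real (q' b x)"
  if "x \<in> U" "b \<in> Basis" for x b
 proof -
  have "(\<Sum>c\<in>Basis. (b \<bullet> c) * q' c x) = (\<Sum>c\<in>Basis. if c = b then q' b x else 0)"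
   by (rule sum.cong) (use that in \<open>auto simp: inner_Basis\<close>)
  then show ?thesis using partial_eqI[OF D[OF that(1)], of b] that by simp
 qed
 have "bdd_derivs n U I (\<lambda>_. partial b (\<lambda>x. complex_of_real (flat k (q x))))" if b: "b \<in> Basis" for b
 proof (subst bdd_derivs_cong[OF U])
  have "bdd_derivs n U I (\<lambda>_ x. - of_nat k :: complex)"
   using bdd_family_const[of I "\<lambda>_. - of_nat k" "real k" U] by (auto simp: bdd_family_def)
  then show "bdd_derivs n U I (\<lambda>_ x. (complex_of_real (flat (k + 2) (q x)) +
    (- of_nat k) * complex_of_real (flat (k + 1) (q x))) * complex_of_real (q' b x))"
   using q'[OF b] by (intro bdd_derivs_mult bdd_derivs_add U Suc.IH) (auto simp: bdd_family_def)
 qed (use P b in auto)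
 moreover have "(\<lambda>x. complex_of_real (flat k (q x))) differentiable (at x)" if "x \<in> U" for x
  using D[OF that] differentiable_def by blast
 moreover have "\<exists>C. \<forall>i\<in>I. \<forall>x\<in>U. norm (complex_of_real (flat k (q x))) \<le> C"
  using flat_bound by (auto intro!: exI[of _ "fact k"])
 ultimately show ?case by simp
qed

lemma bdd_family_inner:
 fixes a :: "'i => 'a::euclidean_space"
 assumes "bounded U" "\<And>i. i \<in> I ==> norm (a i) \<le> A"
 shows "bdd_family U I (\<lambda>i x. complex_of_real (a i \<bullet> x))"
proof -
 obtain R where R: "\<And>x. x \<in> U ==> norm x \<le> R" using assms(1) bounded_iff by metis
 have D: "((\<lambda>x. complex_of_real (a i \<bullet> x)) has_derivative (\<lambda>v. complex_of_real (a i \<bullet> v))) (at x)" for i x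
  by (rule has_derivative_of_real[OF has_derivative_inner_right[OF has_derivative_ident]])
 show ?thesis
 proof (rule bdd_familyI)
  show "norm (complex_of_real (a i \<bullet> x)) \<le> A * R" if "i \<in> I" "x \<in> U" for i x
  proof -
   have "\<bar>a i \<bullet> x\<bar> \<le> norm (a i) * norm x" by (rule Cauchy_Schwarz_ineq2)
   also have "\<dots> \<le> A * R" using assms(2)[OF that(1)] R[OF that(2)] norm_ge_zero order_trans by (intro mult_mono) blast+
   finally show ?thesis by simp
  qed
  show "(\<lambda>x. complex_of_real (a i \<bullet> x)) differentiable (at x)" for i x using D differentiable_def by blast
  fix b :: 'a assume b: "b \<in> Basis"
  have eq: "partial b (\<lambda>x. complex_of_real (a i \<bullet> x)) = (\<lambda>x. complex_of_real (a i \<bullet> b))" for i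
   using partial_eqI[OF D, of b] by (simp add: fun_eq_iff)
  have "norm (complex_of_real (a i \<bullet> b)) \<le> A" if "i \<in> I" for i
   using Basis_le_norm[OF b, of "a i"] assms(2)[OF that] by simp
  then show "bdd_family U I (\<lambda>i. partial b (\<lambda>x. complex_of_real (a i \<bullet> x)))"
   unfolding eq by (rule bdd_family_const)
 qed
qed

lemma bump_function_exists:
 fixes c :: "'a::euclidean_space"
 assumes "0 < r" "r < R"
 obtains \<beta> :: "'a => real" where "test_family (cball c R) (UNIV :: 'i set) (\<lambda>_ x. complex_of_real (\<beta> x))"
  "\<And>x. x \<in> cball c r ==> \<beta> x = 1" "\<And>x. 0 \<le> \<beta> x" "\<And>x. \<beta> x \<le> 1"
proof -
 define U where "U = ball c (R + 1)"
 have U: "open U" "bounded U" by (simp_all add: U_def)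
 define q where "q x = (x - c) \<bullet> (x - c)" for x
 have q: "q x = (dist c x)\<^sup>2" for x
  unfolding q_def dist_norm norm_minus_commute[of c] by (simp add: dot_square_norm)
 have dq: "(q has_derivative (\<lambda>v. \<Sum>b\<in>Basis. (v \<bullet> b) * (2 * ((x - c) \<bullet> b)))) (at x)" for x
 proof -
  have "(q has_derivative (\<lambda>v. (x - c) \<bullet> v + v \<bullet> (x - c))) (at x)"
   unfolding q_def[abs_def] by (auto intro!: derivative_eq_intros)
  moreover have "(\<lambda>v. (x - c) \<bullet> v + v \<bullet> (x - c)) = (\<lambda>v. \<Sum>b\<in>Basis. (v \<bullet> b) * (2 * ((x - c) \<bullet> b)))"
  proof
   fix v show "(x - c) \<bullet> v + v \<bullet> (x - c) = (\<Sum>b\<in>Basis. (v \<bullet> b) * (2 * ((x - c) \<bullet> b)))"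
    by (subst (1 2) euclidean_inner) (simp add: sum.distrib[symmetric] algebra_simps)
  qed
  ultimately show ?thesis by simp
 qed
 have fam: "bdd_family U (UNIV :: 'i set) (\<lambda>_ x. complex_of_real (s * (2 * ((x - c) \<bullet> b))))" for b :: 'a and s
 proof -
  have "bdd_family U (UNIV :: 'i set) (\<lambda>_ x. complex_of_real (s * 2) * (complex_of_real (b \<bullet> x) - complex_of_real (b \<bullet> c)))"
   by (intro bdd_family_cmult bdd_family_diff bdd_family_inner[of U _ "\<lambda>_. b" "norm b"] U
     bdd_family_const[of _ _ "norm (complex_of_real (b \<bullet> c))"]) auto
  then show ?thesis by (simp add: inner_diff_left inner_diff_right inner_commute algebra_simps)
 qed
 have F1: "bdd_family U (UNIV :: 'i set) (\<lambda>_ x. complex_of_real (flat 0 (R\<^sup>2 - q x)))"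
  unfolding bdd_family_def
 proof (intro allI bdd_derivs_flat_comp[OF U(1)])
  show "((\<lambda>x. R\<^sup>2 - q x) has_derivative (\<lambda>v. \<Sum>b\<in>Basis. (v \<bullet> b) * ((-1) * (2 * ((x - c) \<bullet> b))))) (at x)" for x
   using has_derivative_diff[OF has_derivative_const[of "R\<^sup>2"] dq[of x]] by (simp add: sum_negf)
 qed (rule fam)
 have F2: "bdd_family U (UNIV :: 'i set) (\<lambda>_ x. complex_of_real (flat 0 (q x - r\<^sup>2)))"
  unfolding bdd_family_def
 proof (intro allI bdd_derivs_flat_comp[OF U(1)])
  show "((\<lambda>x. q x - r\<^sup>2) has_derivative (\<lambda>v. \<Sum>b\<in>Basis. (v \<bullet> b) * (1 * (2 * ((x - c) \<bullet> b))))) (at x)" for x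
   using has_derivative_diff[OF dq[of x] has_derivative_const[of "r\<^sup>2"]] by simp
 qed (rule fam)
 define D where "D x = flat 0 (R\<^sup>2 - q x) + flat 0 (q x - r\<^sup>2)" for x
 have r2: "r\<^sup>2 < R\<^sup>2" using assms by (intro power_strict_mono) auto
 have flat_pos: "flat 0 t \<ge> 0" "t > 0 ==> flat 0 t > 0" for t by (auto simp: flat_def)
 have Dpos: "D x > 0" for x
 proof (cases "q x < R\<^sup>2")
  case True
  then show ?thesis unfolding D_def using flat_pos(2)[of "R\<^sup>2 - q x"] flat_pos(1)[of "q x - r\<^sup>2"] by simp
 next
  case False
  then show ?thesis unfolding D_def using flat_pos(2)[of "q x - r\<^sup>2"] flat_pos(1)[of "R\<^sup>2 - q x"] r2 by simp
 qed
 have flat_cont: "continuous_on UNIV (flat 0)"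
  by (intro continuous_at_imp_continuous_on ballI DERIV_isCont[OF DERIV_flat])
 have "continuous_on UNIV D" unfolding D_def q_def
  by (intro continuous_intros continuous_on_compose2[OF flat_cont]) auto
 then have "continuous_on (cball c (R + 1)) D" by (rule continuous_on_subset) simp
 \<comment> \<open>The minimum over a compact ball containing \<open>U\<close> is a uniform positive
   lower bound for the denominator, as \<open>bdd_family_inverse\<close> requires.\<close>
 then obtain x0 where x0: "\<forall>x\<in>cball c (R + 1). D x0 \<le> D x"
  using continuous_attains_inf[OF compact_cball, of c "R + 1" D] assms by (auto simp del: mem_cball)
 define \<beta> where "\<beta> x = flat 0 (R\<^sup>2 - q x) / D x" for x
 have "bdd_family U (UNIV :: 'i set) (\<lambda>_ x. inverse (complex_of_real (flat 0 (R\<^sup>2 - q x)) + complex_of_real (flat 0 (q x - r\<^sup>2))))"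
 proof (rule bdd_family_inverse[OF U(1) bdd_family_add[OF U(1) F1 F2] Dpos[of x0]])
  fix x assume "x \<in> U"
  then have "D x0 \<le> D x" using x0 by (auto simp: U_def)
  then show "D x0 \<le> norm (complex_of_real (flat 0 (R\<^sup>2 - q x)) + complex_of_real (flat 0 (q x - r\<^sup>2)))"
   unfolding of_real_add[symmetric] norm_of_real D_def by linarith
 qed
 from bdd_family_mult[OF U(1) F1 this]
 have bU: "bdd_family U (UNIV :: 'i set) (\<lambda>_ x. complex_of_real (\<beta> x))"
  by (simp add: \<beta>_def D_def divide_inverse)
 have b0: "\<beta> x = 0" if "x \<notin> cball c R" for x
 proof -
  have "R\<^sup>2 \<le> q x" unfolding q using that assms by (intro power_mono) auto
  then show ?thesis by (simp add: \<beta>_def flat_def)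
 qed
 have "bdd_family UNIV (UNIV :: 'i set) (\<lambda>_ x. complex_of_real (\<beta> x))"
  by (rule bdd_family_extend[of "cball c R" U]) (use bU b0 in \<open>auto simp: U_def\<close>)
 then have 1: "test_family (cball c R) (UNIV :: 'i set) (\<lambda>_ x. complex_of_real (\<beta> x))"
  using b0 by (auto simp: test_family_def)
 have 2: "\<beta> x = 1" if "x \<in> cball c r" for x
 proof -
  have "q x \<le> r\<^sup>2" unfolding q using that assms by (intro power_mono) auto
  then have "D x = flat 0 (R\<^sup>2 - q x)" by (simp add: D_def flat_def)
  then show ?thesis using Dpos[of x] by (simp add: \<beta>_def)
 qed
 have 3: "0 \<le> \<beta> x" "\<beta> x \<le> 1" for x
  using Dpos[of x] flat_pos(1)[of "R\<^sup>2 - q x"] flat_pos(1)[of "q x - r\<^sup>2"] by (auto simp: \<beta>_def D_def divide_simps)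
 show thesis by (rule that[OF 1 2 3])
qed

lemma bump_exists:
 fixes x :: "'a::euclidean_space"
 assumes "0 < r"
 obtains \<theta> :: "'a => complex" where "test_fun (cball x r) \<theta>" "\<And>y. y \<in> cball x (r / 2) ==> \<theta> y = 1"
proof -
 have "0 < r / 2" "r / 2 < r" using assms by auto
 then obtain \<beta> :: "'a => real" where \<beta>: "test_family (cball x r) (UNIV :: unit set) (\<lambda>_ y. complex_of_real (\<beta> y))"
  "\<And>y. y \<in> cball x (r / 2) ==> \<beta> y = 1" by (rule bump_function_exists[of "r / 2" r x]) (erule that, assumption)
 show thesis by (rule that[OF test_family_mono[OF \<beta>(1)]]) (use \<beta>(2) in auto)
qed

section \<open>Convolution and mollification\<close>

lemma partial_affine:
 fixes \<phi> :: "'a::euclidean_space => complex"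
 assumes "\<phi> differentiable (at (t *\<^sub>R x + z))" "b \<in> Basis"
 shows "(\<lambda>x. \<phi> (t *\<^sub>R x + z)) differentiable (at x)"
  and "partial b (\<lambda>x. \<phi> (t *\<^sub>R x + z)) x = complex_of_real t * partial b \<phi> (t *\<^sub>R x + z)"
proof -
 have "((\<lambda>x. t *\<^sub>R x + z) has_derivative (\<lambda>v. t *\<^sub>R v)) (at x)"
  by (auto intro!: derivative_eq_intros)
 from has_derivative_compose[OF this has_derivative_partial[OF assms(1)]]
 have D: "((\<lambda>x. \<phi> (t *\<^sub>R x + z)) has_derivative
   (\<lambda>v. \<Sum>c\<in>Basis. (t *\<^sub>R v \<bullet> c) *\<^sub>R partial c \<phi> (t *\<^sub>R x + z))) (at x)" .
 then show "(\<lambda>x. \<phi> (t *\<^sub>R x + z)) differentiable (at x)" using differentiable_def by blast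
 have "(\<Sum>c\<in>Basis. (t *\<^sub>R b \<bullet> c) *\<^sub>R partial c \<phi> (t *\<^sub>R x + z)) =
   (\<Sum>c\<in>Basis. if c = b then t *\<^sub>R partial b \<phi> (t *\<^sub>R x + z) else 0)"
  by (rule sum.cong) (use assms(2) in \<open>auto simp: inner_Basis\<close>)
 then show "partial b (\<lambda>x. \<phi> (t *\<^sub>R x + z)) x = complex_of_real t * partial b \<phi> (t *\<^sub>R x + z)"
  using partial_eqI[OF D, of b] assms(2) by (simp add: scaleR_conv_of_real)
qed

text \<open>Each derivative contributes a factor \<open>t j\<close> of modulus at most 1. The
  translations \<open>z j\<close> are unrestricted because the bounds hold on the whole
  space.\<close>

lemma bdd_family_affine:
 fixes \<phi> :: "'j => 'a::euclidean_space => complex"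
 assumes "bdd_family UNIV J \<phi>" and t: "\<And>j. j \<in> J ==> \<bar>t j\<bar> \<le> 1"
 shows "bdd_family UNIV J (\<lambda>j x. \<phi> j (t j *\<^sub>R x + z j))"
proof (rule bdd_family_coinduct[where R = "\<lambda>h. \<exists>\<phi>. bdd_family UNIV J \<phi> \<and> h = (\<lambda>j x. \<phi> j (t j *\<^sub>R x + z j))"])
 fix h :: "'j => 'a => complex" assume "\<exists>\<phi>. bdd_family UNIV J \<phi> \<and> h = (\<lambda>j x. \<phi> j (t j *\<^sub>R x + z j))"
 then obtain \<phi> where \<phi>: "bdd_family UNIV J \<phi>" and h: "h = (\<lambda>j x. \<phi> j (t j *\<^sub>R x + z j))" by blast
 obtain C where "C > 0" "\<And>i x. i \<in> J ==> x \<in> UNIV ==> norm (\<phi> i x) \<le> C"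
  by (rule bdd_family_bound[OF \<phi>]) (erule that, assumption)
 then show "\<exists>C. \<forall>i\<in>J. \<forall>x\<in>UNIV. norm (h i x) \<le> C" unfolding h by blast
 obtain b0 :: 'a where "b0 \<in> Basis" using nonempty_Basis by blast
 then show "h i differentiable (at x)" if "i \<in> J" for i x
  using partial_affine(1)[OF bdd_family_differentiable[OF \<phi> that UNIV_I]] unfolding h by blast
 fix b :: 'a assume b: "b \<in> Basis"
 have "bdd_family UNIV J (\<lambda>j x. complex_of_real (t j) * partial b (\<phi> j) x)"
  by (intro bdd_family_mult bdd_family_const[of _ _ 1] bdd_family_partial[OF \<phi> b]) (use t in auto)
 moreover have "\<forall>i\<in>J. \<forall>x\<in>UNIV. partial b (h i) x = complex_of_real (t i) * partial b (\<phi> i) (t i *\<^sub>R x + z i)"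
  unfolding h using partial_affine(2)[OF bdd_family_differentiable[OF \<phi> _ UNIV_I] b] by simp
 ultimately show "\<exists>g. (\<exists>\<phi>. bdd_family UNIV J \<phi> \<and> g = (\<lambda>j x. \<phi> j (t j *\<^sub>R x + z j))) \<and>
    (\<forall>i\<in>J. \<forall>x\<in>UNIV. partial b (h i) x = g i x)"
  by (intro exI[of _ "\<lambda>i x. complex_of_real (t i) * partial b (\<phi> i) (t i *\<^sub>R x + z i)"] conjI
    exI[of _ "\<lambda>j x. complex_of_real (t j) * partial b (\<phi> j) x"] refl)
qed (use assms(1) in auto)

lemma test_family_continuous:
 "test_family K I h ==> i \<in> I ==> continuous_on UNIV (h i)"
 unfolding test_family_def using bdd_family_differentiable[of UNIV I h i]
 by (simp add: continuous_at_imp_continuous_on differentiable_imp_continuous_within)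

lemma test_family_integrable:
 assumes "compact K" "test_family K I h" "i \<in> I" "continuous_on UNIV g"
 shows "integrable lborel (\<lambda>x. h i x * g x)"
 by (rule integrable_compact_support[OF assms(1)])
  (use test_family_continuous[OF assms(2,3)] assms(4) test_family_0[OF assms(2,3)] in
   \<open>auto intro!: continuous_intros\<close>)

lemma continuous_on_osc: "continuous_on A (\<lambda>x. osc k x)"
 "continuous_on A (\<lambda>x. iexp (k \<bullet> x))"
 by (intro continuous_intros)+

section \<open>Thickened sets and correlation\<close>

definition thicken :: "real => 'a::euclidean_space set => 'a set" where
 "thicken r K = {x + z | x z. x \<in> K \<and> z \<in> cball 0 r}"

lemma compact_thicken: "compact K ==> compact (thicken r K)"
 unfolding thicken_def using compact_sums[OF _ compact_cball] by blast

lemma not_in_thicken: "x \<notin> thicken r K ==> norm z \<le> r ==> x + z \<notin> K"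
proof
 assume a: "x \<notin> thicken r K" "norm z \<le> r" "x + z \<in> K"
 have "x = (x + z) + (- z)" by simp
 moreover have "- z \<in> cball 0 r" using a(2) by simp
 ultimately show False using a(1,3) unfolding thicken_def by blast
qed

lemma thicken_mono: "r \<le> s ==> K \<subseteq> L ==> thicken r K \<subseteq> thicken s L"
 unfolding thicken_def by fastforce

lemma subset_thicken: "0 \<le> r ==> K \<subseteq> thicken r K"
 unfolding thicken_def by force

text \<open>The transpose of convolution with \<open>w\<close>: evaluating a distribution at
  \<open>correlate w \<phi>\<close> amounts to testing its convolution with \<open>w\<close> against
  \<phi>.\<close>

definition correlate :: "('a::euclidean_space => complex) => ('a => complex) => 'a => complex" where
 "correlate w \<phi> x = (LINT z|lborel. w z * \<phi> (x + z))"

text \<open>Correlation averages translates of \<phi> with weights of bounded mass, so it is a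
  parameter integral whose parameter is the translation; derivatives fall on \<phi> alone. Supports
  grow by the radius of the weight.\<close>

lemma
 fixes \<phi> w :: "'i => 'a::euclidean_space => complex"
 assumes \<phi>: "test_family K I \<phi>"
  and w: "\<And>i. i \<in> I ==> continuous_on UNIV (w i)" "\<And>i z. i \<in> I ==> z \<notin> cball 0 r ==> w i z = 0"
   "\<And>i. i \<in> I ==> (LINT z|lborel. norm (w i z)) \<le> B"
 shows test_family_correlate: "test_family (thicken r K) I (\<lambda>i. correlate (w i) (\<phi> i))"
  and partial_correlate: "\<And>i b. i \<in> I ==> b \<in> Basis ==>
   partial b (correlate (w i) (\<phi> i)) = correlate (w i) (partial b (\<phi> i))"
proof -
 have wi: "integrable lborel (w i)" if "i \<in> I" for i
  by (rule integrable_compact_support[OF compact_cball w(1)[OF that] w(2)[OF that]])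
 have bd: "bdd_family UNIV (I \<times> UNIV) (\<lambda>(i, z) x. \<phi> i (x + z))"
 proof -
  have "fst ` (I \<times> (UNIV :: 'a set)) \<subseteq> I" by auto
  then have "bdd_family UNIV (I \<times> (UNIV :: 'a set)) (\<lambda>p. \<phi> (fst p))"
   using \<phi> bdd_family_reindex[of UNIV I \<phi> fst "I \<times> (UNIV :: 'a set)" UNIV] by (simp add: test_family_def)
  then have "bdd_family UNIV (I \<times> (UNIV :: 'a set)) (\<lambda>p x. \<phi> (fst p) (1 *\<^sub>R x + snd p))"
   by (rule bdd_family_affine) simp
  then show ?thesis by (simp add: case_prod_unfold)
 qed
 have \<phi>c: "continuous_on UNIV (\<phi> i)" if "i \<in> I" for i using test_family_continuous[OF \<phi> that] .
 have meas: "(\<lambda>z. w i z * \<phi> i (x + z)) \<in> borel_measurable borel" if "i \<in> I" for i x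
 proof -
  have "continuous_on UNIV (\<lambda>z. \<phi> i (x + z))"
   by (rule continuous_on_compose2[OF \<phi>c[OF that]]) (auto intro!: continuous_intros)
  then show ?thesis by (intro borel_measurable_continuous_onI continuous_on_mult w(1) that)
 qed
 note F = bdd_family_integral[of UNIV I UNIV "\<lambda>i z x. \<phi> i (x + z)" w B, OF open_UNIV bd meas wi _ w(3)]
 have 1: "bdd_family UNIV I (\<lambda>i. correlate (w i) (\<phi> i))"
  unfolding correlate_def by (rule F(1)) auto
 have "correlate (w i) (\<phi> i) x = 0" if "i \<in> I" "x \<notin> thicken r K" for i x
 proof -
  have "w i z * \<phi> i (x + z) = 0" for z
   using w(2)[OF that(1), of z] test_family_0[OF \<phi> that(1)] not_in_thicken[OF that(2), of z]
   by (cases "z \<in> cball 0 r") auto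
  then have "(\<lambda>z. w i z * \<phi> i (x + z)) = (\<lambda>z. 0)" by (rule ext)
  then show ?thesis by (simp only: correlate_def) simp
 qed
 then show "test_family (thicken r K) I (\<lambda>i. correlate (w i) (\<phi> i))" using 1 by (simp add: test_family_def)
 show "partial b (correlate (w i) (\<phi> i)) = correlate (w i) (partial b (\<phi> i))" if i: "i \<in> I" and b: "b \<in> Basis" for i b
 proof
  fix x
  have "partial b (\<lambda>x. LINT z|lborel. w i z * \<phi> i (x + z)) x = (LINT z|lborel. w i z * partial b (\<lambda>x. \<phi> i (x + z)) x)"
   by (rule F(2)) (use i b in auto)
  moreover have "partial b (\<lambda>x. \<phi> i (x + z)) x = partial b (\<phi> i) (x + z)" for z
   using partial_affine(2)[of "\<phi> i" 1 x z b] b bdd_family_differentiable[of UNIV I \<phi> i] \<phi> i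
   by (simp add: test_family_def)
  ultimately show "partial b (correlate (w i) (\<phi> i)) x = correlate (w i) (partial b (\<phi> i)) x"
   unfolding correlate_def[abs_def] by simp
 qed
qed

text \<open>A weight of integral 1 supported within distance \<open>r i\<close> changes a uniformly
  Lipschitz function by O(\<open>r i\<close>), so division by \<open>r i\<close> keeps the
  difference bounded. Correlation commutes with derivatives, hence the same holds for each of them.
  The weights may be complex and may depend on the index.\<close>

lemma test_family_correlate_diff:
 fixes \<phi> w :: "'i => 'a::euclidean_space => complex"
 assumes K: "closed K" and \<phi>: "test_family K I \<phi>" and r: "\<And>i. i \<in> I ==> 0 < r i \<and> r i \<le> 1"
  and w: "\<And>i. i \<in> I ==> continuous_on UNIV (w i)" "\<And>i z. i \<in> I ==> z \<notin> cball 0 (r i) ==> w i z = 0"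
   "\<And>i. i \<in> I ==> (LINT z|lborel. norm (w i z)) \<le> B" "\<And>i. i \<in> I ==> (LINT z|lborel. w i z) = 1"
 shows "test_family (thicken 1 K) I (\<lambda>i x. complex_of_real (inverse (r i)) * (correlate (w i) (\<phi> i) x - \<phi> i x))"
proof -
 have w1: "w i z = 0" if "i \<in> I" "z \<notin> cball 0 1" for i z
  using w(2)[OF that(1), of z] r[OF that(1)] that(2) by auto
 have wi: "integrable lborel (w i)" if "i \<in> I" for i
  by (rule integrable_compact_support[OF compact_cball w(1)[OF that] w1[OF that]])
 define D where "D \<phi> i x = complex_of_real (inverse (r i)) * (correlate (w i) (\<phi> i) x - \<phi> i x)" for \<phi> i x
 have C: "test_family (thicken 1 K) I (\<lambda>i. correlate (w i) (\<phi> i))" if "test_family K I \<phi>" for \<phi>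
  by (rule test_family_correlate[OF that w(1) w1 w(3)])
 have "bdd_family UNIV I (D \<phi>)"
 proof (rule bdd_family_coinduct[where R = "\<lambda>h. \<exists>\<phi>. test_family K I \<phi> \<and> h = D \<phi>"])
  fix h :: "'i => 'a => complex" assume "\<exists>\<phi>. test_family K I \<phi> \<and> h = D \<phi>"
  then obtain \<phi> where \<phi>: "test_family K I \<phi>" and h: "h = D \<phi>" by blast
  have \<phi>b: "bdd_family UNIV I \<phi>" using \<phi> by (simp add: test_family_def)
  obtain L where L: "L > 0" "\<And>i x y. i \<in> I ==> x \<in> UNIV ==> y \<in> UNIV ==> norm (\<phi> i x - \<phi> i y) \<le> L * norm (x - y)"
   by (rule bdd_family_lipschitz[OF \<phi>b convex_UNIV]) (erule that, assumption)
  have "norm (h i x) \<le> L * B" if i: "i \<in> I" for i x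
  proof -
   have c: "continuous_on UNIV (\<lambda>z. \<phi> i (x + z))"
    by (rule continuous_on_compose2[OF test_family_continuous[OF \<phi> i]]) (auto intro!: continuous_intros)
   have i1: "integrable lborel (\<lambda>z. w i z * \<phi> i (x + z))"
    by (rule integrable_compact_support[OF compact_cball[of 0 1]])
     (use w(1)[OF i] c w1[OF i] in \<open>auto intro!: continuous_intros\<close>)
   have "correlate (w i) (\<phi> i) x - \<phi> i x = (LINT z|lborel. w i z * \<phi> i (x + z)) - (LINT z|lborel. w i z * \<phi> i x)"
    using w(4)[OF i] by (simp add: correlate_def)
   also have "\<dots> = (LINT z|lborel. w i z * \<phi> i (x + z) - w i z * \<phi> i x)" using i1 wi[OF i] by simp
   finally have "norm (correlate (w i) (\<phi> i) x - \<phi> i x) \<le> (LINT z|lborel. norm (w i z * \<phi> i (x + z) - w i z * \<phi> i x))"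
    by (simp only: integral_norm_bound)
   also have "\<dots> \<le> (LINT z|lborel. L * r i * norm (w i z))"
   proof (rule integral_mono)
    fix z
    show "norm (w i z * \<phi> i (x + z) - w i z * \<phi> i x) \<le> L * r i * norm (w i z)"
    proof (cases "z \<in> cball 0 (r i)")
     case True
     have "norm (\<phi> i (x + z) - \<phi> i x) \<le> L * norm z" using L(2)[OF i, of "x + z" x] by simp
     also have "\<dots> \<le> L * r i" using True L(1) by simp
     finally have "norm (w i z) * norm (\<phi> i (x + z) - \<phi> i x) \<le> norm (w i z) * (L * r i)"
      by (rule mult_left_mono) simp
     moreover have "w i z * \<phi> i (x + z) - w i z * \<phi> i x = w i z * (\<phi> i (x + z) - \<phi> i x)"
      by (rule right_diff_distrib[symmetric])
     ultimately show ?thesis by (simp only: norm_mult mult.commute)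
    qed (use w(2)[OF i, of z] in simp)
   qed (use i1 wi[OF i] in auto)
   also have "\<dots> \<le> L * r i * B" using w(3)[OF i] L(1) r[OF i] by (simp add: mult_left_mono)
   finally have "inverse (r i) * norm (correlate (w i) (\<phi> i) x - \<phi> i x) \<le> inverse (r i) * (L * r i * B)"
    using r[OF i] by (intro mult_left_mono) auto
   also have "inverse (r i) * (L * r i * B) = L * B" using r[OF i] by (simp add: field_simps)
   finally show ?thesis using r[OF i] by (simp add: h D_def norm_mult norm_inverse abs_of_pos)
  qed
  then show "\<exists>C. \<forall>i\<in>I. \<forall>x\<in>UNIV. norm (h i x) \<le> C" by blast
  have Cd: "correlate (w i) (\<phi> i) differentiable (at x)" if "i \<in> I" for i x
   using C[OF \<phi>] bdd_family_differentiable[of UNIV I "\<lambda>i. correlate (w i) (\<phi> i)" i x] that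
   by (simp add: test_family_def)
  have \<phi>d: "\<phi> i differentiable (at x)" if "i \<in> I" for i x
   using bdd_family_differentiable[OF \<phi>b that UNIV_I] .
  show "h i differentiable (at x)" if "i \<in> I" for i x
   unfolding h D_def[abs_def] using Cd[OF that] \<phi>d[OF that]
   by (intro differentiable_mult differentiable_diff differentiable_const) auto
  fix b :: 'a assume b: "b \<in> Basis"
  have "partial b (h i) x = D (\<lambda>i. partial b (\<phi> i)) i x" if i: "i \<in> I" for i x
  proof -
   have "partial b (\<lambda>x. correlate (w i) (\<phi> i) x + (-1) * \<phi> i x) x =
     partial b (correlate (w i) (\<phi> i)) x + (0 * \<phi> i x + (-1) * partial b (\<phi> i) x)"
    by (subst partial_add[OF Cd[OF i]], intro differentiable_mult differentiable_const \<phi>d i,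
      subst partial_mult, simp, rule \<phi>d[OF i], simp)
   moreover have "partial b (correlate (w i) (\<phi> i)) = correlate (w i) (partial b (\<phi> i))"
    by (rule partial_correlate[of K I \<phi> w 1 B i b])
     (rule \<phi>, erule w(1), erule (1) w1, erule w(3), rule i, rule b)
   ultimately have "partial b (\<lambda>x. correlate (w i) (\<phi> i) x - \<phi> i x) x =
     correlate (w i) (partial b (\<phi> i)) x - partial b (\<phi> i) x"
    by simp
   moreover have "partial b (\<lambda>x. complex_of_real (inverse (r i)) * (correlate (w i) (\<phi> i) x - \<phi> i x)) x =
     0 * (correlate (w i) (\<phi> i) x - \<phi> i x) +
     complex_of_real (inverse (r i)) * partial b (\<lambda>x. correlate (w i) (\<phi> i) x - \<phi> i x) x"
    by (subst partial_mult) (auto intro!: differentiable_diff Cd \<phi>d i)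
   ultimately show ?thesis by (simp add: h D_def[abs_def])
  qed
  then show "\<exists>g. (\<exists>\<phi>. test_family K I \<phi> \<and> g = D \<phi>) \<and> (\<forall>i\<in>I. \<forall>x\<in>UNIV. partial b (h i) x = g i x)"
   using test_family_partial[OF K \<phi> b]
   by (intro exI[of _ "D (\<lambda>i. partial b (\<phi> i))"] conjI exI[of _ "\<lambda>i. partial b (\<phi> i)"]) auto
 qed (use \<phi> in auto)
 moreover have "D \<phi> i x = 0" if "i \<in> I" "x \<notin> thicken 1 K" for i x
  using test_family_0[OF C[OF \<phi>] that] test_family_0[OF \<phi> that(1), of x] subset_thicken[of 1 K] that(2)
  by (auto simp: D_def)
 ultimately show ?thesis by (simp add: test_family_def D_def[abs_def])
qed

section \<open>Fourier series of test functions\<close>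

text \<open>The exponent has the sign opposite to \<open>local_fourier\<close>. With this choice the
  coefficients \<open>fhat \<phi> m\<close> belong to the functions \<open>osc m\<close> in the
  expansion of \<phi>.\<close>

definition fhat :: "('a::euclidean_space => complex) => 'a => complex" where
 "fhat \<phi> m = (LINT x|lborel. \<phi> x * iexp (m \<bullet> x))"

lemma one_plus_power_le: "(1 + x) ^ N \<le> 2 ^ N * (1 + x ^ N)" if "0 \<le> x" for x :: real
proof -
 have "(1 + x) ^ N \<le> (2 * max 1 x) ^ N" using that by (intro power_mono) auto
 also have "\<dots> = 2 ^ N * max 1 x ^ N" by (simp add: power_mult_distrib)
 also have "max 1 x ^ N \<le> 1 + x ^ N" using that by (cases "x \<le> 1") (auto simp: max_def)
 finally show ?thesis by simp
qed

text \<open>Fubini and a translation; the argument of the first factor is -m because correlation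
  reflects the weight in comparison with convolution.\<close>

lemma fhat_correlate:
 fixes \<phi> w :: "'a::euclidean_space => complex"
 assumes \<phi>: "compact K" "continuous_on UNIV \<phi>" "\<And>x. x \<notin> K ==> \<phi> x = 0"
  and w: "continuous_on UNIV w" "\<And>z. z \<notin> cball 0 r ==> w z = 0"
 shows "fhat (correlate w \<phi>) m = fhat w (- m) * fhat \<phi> m"
proof -
 let ?f = "\<lambda>x z. w z * \<phi> (x + z) * iexp (m \<bullet> x)"
 have inner: "(LINT x|lborel. ?f x z) = w z * iexp (- m \<bullet> z) * fhat \<phi> m" for z
 proof -
  have "(LINT x|lborel. ?f x z) = (LINT x|lborel. w z * iexp (- m \<bullet> z) *
    (\<phi> (z + x) * iexp (m \<bullet> (z + x))))"
   by (rule Bochner_Integration.integral_cong)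
    (auto simp: inner_add_right algebra_simps exp_add[symmetric] add.commute)
  also have "\<dots> = w z * iexp (- m \<bullet> z) *
    (LINT x|lborel. \<phi> (z + x) * iexp (m \<bullet> (z + x)))" by simp
  also have "(LINT x|lborel. \<phi> (z + x) * iexp (m \<bullet> (z + x))) = fhat \<phi> m"
   unfolding fhat_def by (rule integral_translate)
  finally show ?thesis .
 qed
 have "integrable lborel (case_prod ?f)"
 proof (rule integrable_compact_support[OF compact_Times[OF compact_thicken[OF \<phi>(1)] compact_cball]])
  show "continuous_on UNIV (case_prod ?f)"
   unfolding case_prod_beta'
   by (intro continuous_intros continuous_on_compose2[OF w(1)] continuous_on_compose2[OF \<phi>(2)]) auto
  show "case_prod ?f p = 0" if "p \<notin> thicken r K \<times> cball 0 r" for p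
  proof (cases "snd p \<in> cball 0 r")
   case True
   then have "fst p \<notin> thicken r K" using that by (cases p) auto
   then have "fst p + snd p \<notin> K" using True by (intro not_in_thicken) auto
   then show ?thesis using \<phi>(3) by (simp add: case_prod_beta)
  qed (use w(2)[of "snd p"] in \<open>auto simp: case_prod_beta\<close>)
 qed
 then have "integrable (lborel \<Otimes>\<^sub>M lborel) (case_prod ?f)" by (simp add: lborel_prod)
 from lborel_pair.Fubini_integral[OF this]
 have "(LINT x|lborel. LINT z|lborel. ?f x z) = (LINT z|lborel. LINT x|lborel. ?f x z)" by (rule sym)
 also have "(LINT x|lborel. LINT z|lborel. ?f x z) = fhat (correlate w \<phi>) m"
  unfolding fhat_def correlate_def by simp
 also have "(LINT z|lborel. LINT x|lborel. ?f x z) =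
   (LINT z|lborel. w z * iexp (- m \<bullet> z) * fhat \<phi> m)" by (simp only: inner)
 finally show ?thesis by (simp add: fhat_def)
qed

text \<open>The phase is linear, with gradient \<open>m\<close>; normalised by its length it is a
  unit vector, so \<open>nonstationary_phase\<close> applies with lower bound 1. The trivial bound
  covers m = 0 and converts powers of |m| into powers of 1 + |m|.\<close>

lemma fhat_decay:
 fixes \<phi> :: "'i => 'a::euclidean_space => complex"
 assumes K: "compact K" and \<phi>: "test_family K I \<phi>"
 obtains C where "C > 0" "\<And>i m. i \<in> I ==> (1 + norm m) ^ N * norm (fhat (\<phi> i) m) \<le> C"
proof -
 \<comment> \<open>The frequency joins the index, which makes the constant independent of
   it.\<close>
 let ?J = "{(i, m). i \<in> I \<and> m \<noteq> (0::'a)}"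
 have fam: "test_family K ?J (\<lambda>(i, m). \<phi> i)"
  using test_family_reindex[OF \<phi>, of fst ?J] by (simp add: case_prod_beta') force
 have "\<exists>C. \<forall>p\<in>?J. norm (snd p) ^ N' * norm (LINT x|lborel. (case p of (i, m) => \<phi> i) x *
   iexp (snd p \<bullet> x)) \<le> C" for N'
 proof (rule nonstationary_phase[OF open_UNIV K subset_UNIV fam, where c = 1 and d = "\<lambda>p b x. (snd p \<bullet> b) / norm (snd p)"])
  show "((\<lambda>x. snd p \<bullet> x) has_derivative
    (\<lambda>v. norm (snd p) * (\<Sum>b\<in>Basis. (v \<bullet> b) * ((snd p \<bullet> b) / norm (snd p))))) (at x)" if "p \<in> ?J" for p x
  proof -
   have "norm (snd p) * (\<Sum>b\<in>Basis. (v \<bullet> b) * ((snd p \<bullet> b) / norm (snd p))) = snd p \<bullet> v" for v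
   proof -
    have "norm (snd p) \<noteq> 0" using that by auto
    then have "norm (snd p) * (\<Sum>b\<in>Basis. (v \<bullet> b) * ((snd p \<bullet> b) / norm (snd p))) = (\<Sum>b\<in>Basis. (snd p \<bullet> b) * (v \<bullet> b))"
     unfolding sum_distrib_left by (intro sum.cong) (auto simp: field_simps)
    then show ?thesis by (simp add: euclidean_inner[of "snd p" v])
   qed
   then show ?thesis using has_derivative_inner_right[OF has_derivative_ident] by simp
  qed
  show "bdd_family UNIV ?J (\<lambda>p x. complex_of_real ((snd p \<bullet> b) / norm (snd p)))" if "b \<in> Basis" for b
  proof (rule bdd_family_const[of _ _ 1])
   fix p assume "p \<in> ?J"
   then show "norm (complex_of_real ((snd p \<bullet> b) / norm (snd p))) \<le> 1"
    using Basis_le_norm[OF that, of "snd p"] unfolding norm_of_real by (auto simp: divide_le_eq)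
  qed
  show "1 \<le> (\<Sum>b\<in>Basis. ((snd p \<bullet> b) / norm (snd p))\<^sup>2)" if "p \<in> ?J" for p
  proof -
   have "(\<Sum>b\<in>Basis. (snd p \<bullet> b)\<^sup>2) = (norm (snd p))\<^sup>2"
    by (simp add: norm_eq_sqrt_inner euclidean_inner[of "snd p" "snd p"] power2_eq_square sum_nonneg)
   moreover have "norm (snd p) \<noteq> 0" using that by auto
   ultimately show ?thesis by (simp add: power_divide sum_divide_distrib[symmetric])
  qed
 qed (auto)?
 then have NSP: "\<exists>C. \<forall>i\<in>I. \<forall>m. m \<noteq> 0 --> norm m ^ N' * norm (fhat (\<phi> i) m) \<le> C" for N'
  unfolding fhat_def by (simp add: case_prod_beta)
 obtain C1 where C1: "\<And>i x. i \<in> I ==> norm (\<phi> i x) \<le> C1"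
  using \<phi> bdd_family_bound[of UNIV I \<phi>] unfolding test_family_def by (metis UNIV_I)
 have F0: "norm (fhat (\<phi> i) m) \<le> C1 * measure lborel K" if "i \<in> I" for i m
  unfolding fhat_def by (rule norm_integral_compact_support[OF K])
   (use C1[OF that] test_family_0[OF \<phi> that] in \<open>auto simp: norm_mult\<close>)
 obtain C2 where C2: "\<And>i m. i \<in> I ==> m \<noteq> 0 ==> norm m ^ N * norm (fhat (\<phi> i) m) \<le> C2"
  using NSP[of N] by blast
 define M where "M = 2 ^ N * (\<bar>C1 * measure lborel K\<bar> + \<bar>C2\<bar>) + \<bar>C1 * measure lborel K\<bar> + 1"
 have Mpos: "M > 0" unfolding M_def by (intro add_nonneg_pos add_nonneg_nonneg mult_nonneg_nonneg) auto
 have M: "(1 + norm m) ^ N * norm (fhat (\<phi> i) m) \<le> M" if i: "i \<in> I" for i m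
 proof (cases "m = 0")
  case True
  then show ?thesis using F0[OF i, of m] unfolding M_def
   by (simp add: add_increasing add_increasing2)
 next
  case False
  have "(1 + norm m) ^ N * norm (fhat (\<phi> i) m) \<le> 2 ^ N * (1 + norm m ^ N) * norm (fhat (\<phi> i) m)"
   by (intro mult_right_mono one_plus_power_le) auto
  also have "\<dots> = 2 ^ N * (norm (fhat (\<phi> i) m) + norm m ^ N * norm (fhat (\<phi> i) m))" by (simp add: algebra_simps)
  also have "\<dots> \<le> 2 ^ N * (\<bar>C1 * measure lborel K\<bar> + \<bar>C2\<bar>)"
   using F0[OF i, of m] C2[OF i False] by (intro mult_left_mono add_mono) auto
  also have "\<dots> \<le> M" unfolding M_def by simp
  finally show ?thesis .
 qed
 show thesis by (rule that[OF Mpos M])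
qed

section \<open>Summation over the integer lattice\<close>

definition int_lattice :: "'a::euclidean_space set" where
 "int_lattice = {m. \<forall>b\<in>Basis. m \<bullet> b \<in> \<int>}"

lemma sum_inverse_square_le:
 "(\<Sum>j\<in>{- int n..int n}. inverse ((1 + \<bar>real_of_int j\<bar>)\<^sup>2)) \<le> 3 - 2 / (1 + real n)"
proof (induction n)
 case (Suc n)
 have "{- int (Suc n)..int (Suc n)} = insert (int n + 1) (insert (- int n - 1) {- int n..int n})" by auto
 then have "(\<Sum>j\<in>{- int (Suc n)..int (Suc n)}. inverse ((1 + \<bar>real_of_int j\<bar>)\<^sup>2)) =
   2 * inverse ((real n + 2)\<^sup>2) + (\<Sum>j\<in>{- int n..int n}. inverse ((1 + \<bar>real_of_int j\<bar>)\<^sup>2))"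
  by (simp add: add.commute abs_if)
 also have "\<dots> \<le> 2 * inverse ((real n + 2)\<^sup>2) + (3 - 2 / (1 + real n))" using Suc.IH by simp
 also have "\<dots> \<le> 3 - 2 / (1 + real (Suc n))"
 proof -
  have "2 * inverse ((real n + 2)\<^sup>2) \<le> 2 / ((1 + real n) * (2 + real n))"
   unfolding divide_inverse by (intro mult_left_mono le_imp_inverse_le mult_pos_pos) (auto simp: power2_eq_square algebra_simps)
  also have "\<dots> = 2 / (1 + real n) - 2 / (2 + real n)" by (simp add: field_simps)
  finally show ?thesis by simp
 qed
 finally show ?case .
qed auto

lemma lattice_summable:
 "(\<lambda>m::'a::euclidean_space. inverse ((1 + norm m) ^ (2 * DIM('a)))) summable_on int_lattice"
proof (rule nonneg_bdd_above_summable_on)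
 have "sum (\<lambda>m::'a. inverse ((1 + norm m) ^ (2 * DIM('a)))) F \<le> 3 ^ DIM('a)" if F: "F \<subseteq> int_lattice" "finite F" for F
 proof -
  define n where "n = nat \<lceil>Max (insert 0 (norm ` F))\<rceil>"
  have n: "norm m \<le> real n" if "m \<in> F" for m
  proof -
   have "norm m \<le> Max (insert 0 (norm ` F))" using F that by (intro Max_ge) auto
   then show ?thesis unfolding n_def by linarith
  qed
  \<comment> \<open>The vector of integer coordinates, which embeds the finite set into a product of
    integer intervals.\<close>
  define g where "g m = restrict (\<lambda>b. \<lfloor>m \<bullet> b\<rfloor>) Basis" for m :: 'a
  have gI: "real_of_int (g m b) = m \<bullet> b" if "m \<in> F" "b \<in> Basis" for m b
   using that F by (auto simp: g_def int_lattice_def subset_eq)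
  have inj: "inj_on g F"
  proof (rule inj_onI)
   fix m m' assume "m \<in> F" "m' \<in> F" "g m = g m'"
   then have "m \<bullet> b = m' \<bullet> b" if "b \<in> Basis" for b using gI that by metis
   then show "m = m'" by (rule euclidean_eqI)
  qed
  have sub: "g ` F \<subseteq> PiE Basis (\<lambda>_. {- int n..int n})"
  proof (rule image_subsetI, rule PiE_I)
   fix m b assume m: "m \<in> F" and b: "(b::'a) \<in> Basis"
   have "\<bar>real_of_int (g m b)\<bar> \<le> real n" using gI[OF m b] Basis_le_norm[OF b, of m] n[OF m] by linarith
   then show "g m b \<in> {- int n..int n}" by (simp add: abs_le_iff)
  qed (simp add: g_def)
  define P where "P v = (\<Prod>b\<in>(Basis::'a set). inverse ((1 + \<bar>real_of_int (v b)\<bar>)\<^sup>2))" for v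
  have "inverse ((1 + norm m) ^ (2 * DIM('a))) \<le> P (g m)" if m: "m \<in> F" for m
  proof -
   have "inverse ((1 + norm m) ^ (2 * DIM('a))) = (\<Prod>b\<in>(Basis::'a set). inverse ((1 + norm m)\<^sup>2))"
    by (simp add: power_mult power_inverse)
   also have "\<dots> \<le> P (g m)" unfolding P_def
    using gI[OF m] Basis_le_norm[of _ m] by (intro prod_mono conjI le_imp_inverse_le power_mono) auto
   finally show ?thesis .
  qed
  then have "sum (\<lambda>m. inverse ((1 + norm m) ^ (2 * DIM('a)))) F \<le> sum (\<lambda>m. P (g m)) F" by (rule sum_mono)
  also have "\<dots> = sum P (g ` F)" by (simp add: sum.reindex[OF inj])
  also have "\<dots> \<le> sum P (PiE Basis (\<lambda>_. {- int n..int n}))"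
   by (rule sum_mono2[OF _ sub]) (auto simp: P_def finite_PiE intro!: prod_nonneg)
  also have "\<dots> = (\<Prod>b\<in>(Basis::'a set). \<Sum>j\<in>{- int n..int n}. inverse ((1 + \<bar>real_of_int j\<bar>)\<^sup>2))"
   unfolding P_def by (rule prod_sum_PiE[symmetric]) auto
  also have "\<dots> \<le> (\<Prod>b\<in>(Basis::'a set). 3)"
  proof (intro prod_mono conjI sum_nonneg)
   show "(\<Sum>j\<in>{- int n..int n}. inverse ((1 + \<bar>real_of_int j\<bar>)\<^sup>2)) \<le> 3"
    using sum_inverse_square_le[of n] by (rule order_trans) simp
  qed auto
  finally show ?thesis by simp
 qed
 then show "bdd_above (sum (\<lambda>m::'a. inverse ((1 + norm m) ^ (2 * DIM('a)))) ` {F. F \<subseteq> int_lattice \<and> finite F})"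
  by (intro bdd_aboveI[of _ "3 ^ DIM('a)"]) auto
qed auto

lemma lattice_norm_summable:
 fixes f :: "'a::euclidean_space => 'b::real_normed_vector"
 assumes "\<And>m. m \<in> int_lattice ==> norm (f m) * (1 + norm m) ^ (2 * DIM('a)) \<le> C"
 shows "(\<lambda>m. norm (f m)) summable_on int_lattice"
proof (rule summable_on_comparison_test)
 show "(\<lambda>m::'a. C * inverse ((1 + norm m) ^ (2 * DIM('a)))) summable_on int_lattice"
  by (rule summable_on_cmult_right[OF lattice_summable])
 show "norm (f m) \<le> C * inverse ((1 + norm m) ^ (2 * DIM('a)))" if "m \<in> int_lattice" for m
 proof -
  have "0 < (1 + norm m) ^ (2 * DIM('a))" by (intro zero_less_power add_pos_nonneg) auto
  then show ?thesis using assms[OF that] by (simp add: divide_inverse[symmetric] pos_le_divide_eq)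
 qed
qed auto

lemma fhat_summable:
 fixes \<phi> :: "'a::euclidean_space => complex"
 assumes "compact K" "test_fun K \<phi>"
 shows "(\<lambda>m. norm (fhat \<phi> m) * (1 + norm m) ^ N) summable_on int_lattice" "fhat \<phi> summable_on int_lattice"
proof -
 have *: "(\<lambda>m. norm (fhat \<phi> m) * (1 + norm m) ^ N) summable_on int_lattice" for N
 proof -
  obtain C where C: "\<And>i m. i \<in> {()} ==> (1 + norm m) ^ (N + 2 * DIM('a)) * norm (fhat \<phi> m) \<le> C"
   by (rule fhat_decay[OF assms, of "N + 2 * DIM('a)"]) (erule that)
  have "(\<lambda>m. norm (norm (fhat \<phi> m) * (1 + norm m) ^ N)) summable_on int_lattice"
   by (rule lattice_norm_summable[of _ C]) (use C in \<open>simp add: power_add abs_mult mult_ac\<close>)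
  then show ?thesis by (simp add: abs_mult)
 qed
 then show "(\<lambda>m. norm (fhat \<phi> m) * (1 + norm m) ^ N) summable_on int_lattice" .
 show "fhat \<phi> summable_on int_lattice" using *[of 0] by (simp add: abs_summable_summable)
qed

lemma bij_betw_lattice_add: "b \<in> Basis ==> bij_betw (\<lambda>m. m + b) int_lattice int_lattice"
 by (rule bij_betwI[where g = "\<lambda>m. m - b"])
  (auto simp: int_lattice_def inner_add_left inner_diff_left inner_Basis)

lemma bij_betw_lattice_uminus: "bij_betw uminus int_lattice int_lattice"
 by (rule bij_betwI[where g = uminus]) (auto simp: int_lattice_def)

text \<open>Multiplication by \<open>iexp (b \<bullet> x)\<close> shifts the coefficients by
  \<open>b\<close>. The shift permutes the lattice, so the two absolutely convergent sums
  cancel.\<close>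

lemma fhat_shift_has_sum:
 fixes \<psi> :: "'a::euclidean_space => complex"
 assumes K: "compact K" and \<psi>: "test_fun K \<psi>" and b: "b \<in> Basis"
 shows "((\<lambda>m. fhat (\<lambda>x. (iexp (b \<bullet> x) - 1) * \<psi> x) m) has_sum 0) int_lattice"
proof -
 have int: "integrable lborel (\<lambda>x. \<psi> x * iexp (m \<bullet> x))" for m
  using test_family_integrable[OF K \<psi> _ continuous_on_osc(2)] by simp
 have eq: "fhat (\<lambda>x. (iexp (b \<bullet> x) - 1) * \<psi> x) m = fhat \<psi> (m + b) - fhat \<psi> m" for m
 proof -
  have "(iexp (b \<bullet> x) - 1) * \<psi> x * iexp (m \<bullet> x) =
   \<psi> x * iexp ((m + b) \<bullet> x) - \<psi> x * iexp (m \<bullet> x)" for x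
   by (simp add: inner_add_left ring_distribs exp_add mult_ac)
  then show ?thesis unfolding fhat_def by (simp add: int)
 qed
 have S: "(fhat \<psi> has_sum infsum (fhat \<psi>) int_lattice) int_lattice"
  using fhat_summable(2)[OF K \<psi>] by simp
 moreover have "((\<lambda>m. fhat \<psi> (m + b)) has_sum infsum (fhat \<psi>) int_lattice) int_lattice"
  using S has_sum_reindex_bij_betw[OF bij_betw_lattice_add[OF b], of "fhat \<psi>"] by simp
 ultimately have "((\<lambda>m. fhat \<psi> (m + b) + - fhat \<psi> m) has_sum
   (infsum (fhat \<psi>) int_lattice + - infsum (fhat \<psi>) int_lattice)) int_lattice"
  by (intro has_sum_add) (simp_all add: has_sum_uminus)
 then show ?thesis using eq by simp
qed

text \<open>A function vanishing at 0 is a sum of coordinates times smooth functions. Near the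
  support the coordinate x_b may be replaced by exp(i x_b) - 1, since their quotient is smooth and
  nonzero for |x_b| < 2\<pi>. Each summand then has coefficients that cancel by
  \<open>fhat_shift_has_sum\<close>.\<close>

lemma fhat_vanishing_has_sum:
 fixes \<phi> :: "'a::euclidean_space => complex"
 assumes K: "compact K" "K \<subseteq> ball 0 3" and \<phi>: "test_fun K \<phi>" and \<phi>0: "\<phi> 0 = 0"
 shows "(fhat \<phi> has_sum 0) int_lattice"
proof -
 have "compact (insert 0 K)" "insert 0 K \<noteq> {}" using K by auto
 then obtain x1 where x1: "x1 \<in> insert 0 K" "\<forall>y\<in>insert 0 K. norm y \<le> norm x1"
  using continuous_attains_sup[of "insert 0 K" norm] continuous_on_norm_id by blast
 \<comment> \<open>Two radii strictly between the outermost point of the support and 3, leaving room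
   for a cutoff that is 1 on the support and still lives where the division is possible.\<close>
 define r where "r = (norm x1 + 3) / 2"
 define R where "R = (r + 3) / 2"
 have "norm x1 < 3" using x1(1) K(2) by auto
 moreover have "2 * r = norm x1 + 3" "2 * R = r + 3" by (simp_all add: r_def R_def)
 moreover have "0 \<le> norm x1" by simp
 ultimately have r1: "0 < r" and r2: "r < R" and r3: "R < 3" and r4: "norm x1 < r" by linarith+
 note rR = r1 r2 r3 r4
 have Kr: "K \<subseteq> cball 0 r"
 proof
  fix y assume "y \<in> K"
  then have "norm y \<le> norm x1" using x1(2) by simp
  then show "y \<in> cball 0 r" using rR(4) by simp
 qed
 obtain \<zeta> :: "'a => real" where \<zeta>: "test_family (cball 0 R) (UNIV :: unit set) (\<lambda>_ x. complex_of_real (\<zeta> x))"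
  "\<And>x. x \<in> cball 0 r ==> \<zeta> x = 1"
  by (rule bump_function_exists[OF rR(1,2), of 0]) (erule that, assumption)
 have \<phi>b: "bdd_family UNIV {()} (\<lambda>_. \<phi>)" using \<phi> by (simp add: test_family_def)
 have \<phi>d: "\<phi> differentiable (at x)" for x using bdd_family_differentiable[OF \<phi>b] by simp
 have d\<phi>c: "continuous_on UNIV (partial b \<phi>)" if "b \<in> Basis" for b
  using test_family_continuous[OF test_family_partial[OF compact_imp_closed[OF K(1)] \<phi> that], of "()"] by simp
 \<comment> \<open>The indicator of the unit interval as weight: integrals over the segment from 0
   to x become instances of \<open>bdd_family_integral\<close>.\<close>
 let ?w = "\<lambda>t::real. indicator {0..1} t :: complex"
 have wS: "?w t * z = indicator {0..1} t *\<^sub>R z" for t z by (simp add: indicator_def)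
 have w: "integrable lborel ?w" "(LINT t|lborel. norm (?w t)) = 1"
 proof -
  have "integrable lborel (\<lambda>t. indicator {0..1::real} t *\<^sub>R (1::complex))" by (rule borel_integrable_compact) auto
  moreover have "(\<lambda>t. indicator {0..1} t *\<^sub>R (1::complex)) = ?w" by (auto simp: indicator_def)
  ultimately show "integrable lborel ?w" by (simp only:)
  have "(\<lambda>t. norm (?w t)) = indicator {0..1}" by (auto simp: indicator_def)
  then show "(LINT t|lborel. norm (?w t)) = 1" by simp
 qed
 define g where "g b x = (LINT t|lborel. ?w t * partial b \<phi> (t *\<^sub>R x))" for b x
 \<comment> \<open>The quotient of exp(i x_b) - 1 by x_b as an integral, which shows its smoothness
   across x_b = 0.\<close>
 define q where "q b x = (LINT t|lborel. ?w t * (\<i> * osc (- t *\<^sub>R b) x))" for b x :: 'a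
 have cont1: "continuous_on UNIV (\<lambda>t. partial b \<phi> (t *\<^sub>R x))" if "b \<in> Basis" for b x
  by (rule continuous_on_compose2[OF d\<phi>c[OF that]]) (auto intro!: continuous_intros)
 have cont2: "continuous_on UNIV (\<lambda>t. \<i> * osc (- t *\<^sub>R b) x)" for b x :: 'a
  by (intro continuous_intros)
 have m: "(\<lambda>t. ?w t * f t) \<in> borel_measurable borel" if "continuous_on UNIV f" for f
  using borel_measurable_continuous_onI[OF that] by (intro borel_measurable_times borel_measurable_indicator) auto
 have gb: "bdd_family UNIV {()} (\<lambda>_. g b)" if b: "b \<in> Basis" for b
  unfolding g_def
 proof (rule bdd_family_integral(1)[of UNIV "{()}" "{0..1}" "\<lambda>_ t x. partial b \<phi> (t *\<^sub>R x)" "\<lambda>_. ?w" 1])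
  have "(\<lambda>_. ()) ` ({()} \<times> {0..1::real}) \<subseteq> {()}" by auto
  from bdd_family_reindex[OF bdd_family_partial[OF \<phi>b b] this subset_UNIV, of UNIV]
  have "bdd_family UNIV ({()} \<times> {0..1::real}) (\<lambda>p x. partial b \<phi> (snd p *\<^sub>R x + 0))"
   by (intro bdd_family_affine) auto
  then show "bdd_family UNIV ({()} \<times> {0..1}) (\<lambda>(i, t) x. partial b \<phi> (t *\<^sub>R x))"
   by (simp add: case_prod_unfold)
 qed (use w m[OF cont1[OF b]] in auto)
 have qb: "bdd_family UNIV {()} (\<lambda>_. q b)" if b: "b \<in> Basis" for b
  unfolding q_def
 proof (rule bdd_family_integral(1)[of UNIV "{()}" "{0..1}" "\<lambda>_ t x. \<i> * osc (- t *\<^sub>R b) x" "\<lambda>_. ?w" 1])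
  have "bdd_family UNIV ({()} \<times> {0..1::real}) (\<lambda>p x. \<i> * osc (- snd p *\<^sub>R b) x)"
  proof (rule bdd_family_osc)
   show "\<exists>C. \<forall>p\<in>{()} \<times> {0..1::real}. norm \<i> * (1 + norm (- snd p *\<^sub>R b)) ^ N \<le> C" for N
    using b by (intro exI[of _ "2 ^ N"]) (auto intro!: power_mono)
  qed simp
  then show "bdd_family UNIV ({()} \<times> {0..1}) (\<lambda>(i, t) x. \<i> * osc (- t *\<^sub>R b) x)"
   by (simp only: case_prod_unfold)
 qed (use w m[OF cont2] in auto)
 have ftc1: "\<phi> x = (\<Sum>b\<in>Basis. complex_of_real (x \<bullet> b) * g b x)" for x
 proof -
  have D: "((\<lambda>t. \<phi> (t *\<^sub>R x)) has_vector_derivative (\<Sum>b\<in>Basis. (x \<bullet> b) *\<^sub>R partial b \<phi> (t *\<^sub>R x))) (at t within {0..1})" for t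
  proof -
   have "((\<lambda>t. t *\<^sub>R x) has_derivative (\<lambda>s. s *\<^sub>R x)) (at t within {0..1})" by (auto intro!: derivative_eq_intros)
   from has_derivative_compose[OF this has_derivative_partial[OF \<phi>d]]
   show ?thesis unfolding has_vector_derivative_def by (simp add: scaleR_sum_right)
  qed
  have "(LINT t|lborel. indicator {0..1} t *\<^sub>R (\<Sum>b\<in>Basis. (x \<bullet> b) *\<^sub>R partial b \<phi> (t *\<^sub>R x))) = \<phi> (1 *\<^sub>R x) - \<phi> (0 *\<^sub>R x)"
   by (rule integral_FTC_Icc[OF _ D])
    (auto intro!: continuous_intros continuous_on_subset[OF cont1])
  also have "(\<lambda>t. indicator {0..1} t *\<^sub>R (\<Sum>b\<in>Basis. (x \<bullet> b) *\<^sub>R partial b \<phi> (t *\<^sub>R x))) =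
    (\<lambda>t. \<Sum>b\<in>Basis. complex_of_real (x \<bullet> b) * (?w t * partial b \<phi> (t *\<^sub>R x)))"
   unfolding wS by (simp add: scaleR_sum_right scaleR_conv_of_real sum_distrib_left mult_ac)
  also have "(LINT t|lborel. (\<Sum>b\<in>Basis. complex_of_real (x \<bullet> b) * (?w t * partial b \<phi> (t *\<^sub>R x)))) =
    (\<Sum>b\<in>Basis. complex_of_real (x \<bullet> b) * g b x)"
  proof -
   have "integrable lborel (\<lambda>t. ?w t * partial b \<phi> (t *\<^sub>R x))" if "b \<in> Basis" for b
    unfolding wS by (rule borel_integrable_compact) (auto intro!: continuous_on_subset[OF cont1] that)
   then show ?thesis unfolding g_def by (simp add: Bochner_Integration.integral_sum)
  qed
  finally show ?thesis using \<phi>0 by simp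
 qed
 have ftc2: "complex_of_real (b \<bullet> x) * q b x = iexp (b \<bullet> x) - 1" for b x :: 'a
 proof -
  let ?s = "complex_of_real (b \<bullet> x)"
  have D: "((\<lambda>t. exp (\<i> * (complex_of_real t * ?s))) has_vector_derivative (?s * (\<i> * exp (\<i> * (complex_of_real t * ?s))))) (at t within {0..1})" for t
  proof -
   have "((\<lambda>z. exp (\<i> * (z * ?s))) has_field_derivative (?s * (\<i> * exp (\<i> * (complex_of_real t * ?s))))) (at (complex_of_real t))"
    by (auto intro!: derivative_eq_intros)
   from has_vector_derivative_real_field[OF this] show ?thesis by (simp add: has_vector_derivative_at_within)
  qed
  have "(LINT t|lborel. indicator {0..1} t *\<^sub>R (?s * (\<i> * exp (\<i> * (complex_of_real t * ?s))))) =
    exp (\<i> * (complex_of_real 1 * ?s)) - exp (\<i> * (complex_of_real 0 * ?s))"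
   by (rule integral_FTC_Icc[OF _ D]) (auto intro!: continuous_intros)
  also have "(\<lambda>t. indicator {0..1} t *\<^sub>R (?s * (\<i> * exp (\<i> * (complex_of_real t * ?s))))) =
    (\<lambda>t. ?s * (?w t * (\<i> * osc (- t *\<^sub>R b) x)))"
   unfolding wS by (simp add: scaleR_conv_of_real mult_ac)
  finally show ?thesis by (simp add: q_def)
 qed
 have q0: "q b x \<noteq> 0" if b: "b \<in> Basis" and x: "x \<in> cball 0 3" for b x
 proof (cases "b \<bullet> x = 0")
  case True
  have "q b x = (LINT t|lborel. ?w t * \<i>)" unfolding q_def using True by simp
  also have "\<dots> = \<i>" unfolding wS by simp
  finally show ?thesis by simp
 next
  case False
  \<comment> \<open>The value 1 is attained only at multiples of 2\<pi>, whereas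
    \<open>b \<bullet> x\<close> is nonzero and at most 3 in modulus.\<close>
  have "iexp (b \<bullet> x) \<noteq> 1"
  proof
   assume "iexp (b \<bullet> x) = 1"
   then obtain n :: int where n: "b \<bullet> x = of_int (2 * n) * pi" by (auto simp: exp_eq_1)
   with False have "n \<noteq> 0" by auto
   then have "1 \<le> \<bar>real_of_int n\<bar>" by linarith
   then have "1 * (2 * pi) \<le> \<bar>real_of_int n\<bar> * (2 * pi)" by (intro mult_right_mono) auto
   also have "\<dots> = \<bar>b \<bullet> x\<bar>" using n by (simp add: abs_mult)
   also have "\<dots> \<le> 3" using Basis_le_norm[OF b, of x] x by (simp add: inner_commute)
   finally show False using pi_ge_two by simp
  qed
  then show ?thesis using ftc2[of b x] by auto
 qed
 \<comment> \<open>The coefficient of exp(i x_b) - 1; the cutoff \<zeta> makes it a test function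
   without changing it on the support of \<phi>.\<close>
 define \<psi> where "\<psi> b x = (g b x * inverse (q b x)) * complex_of_real (\<zeta> x)" for b x
 have \<psi>: "test_fun (cball 0 R) (\<psi> b)" if b: "b \<in> Basis" for b
 proof -
  have "continuous_on (cball 0 3) (\<lambda>x. norm (q b x))"
   using bdd_family_differentiable[OF qb[OF b]]
   by (intro continuous_on_norm continuous_at_imp_continuous_on ballI differentiable_imp_continuous_within) auto
  then obtain y where y: "y \<in> cball 0 3" "\<forall>x\<in>cball 0 3. norm (q b y) \<le> norm (q b x)"
   using continuous_attains_inf[OF compact_cball, of "0::'a" 3 "\<lambda>x. norm (q b x)"] by auto
  have "bdd_family (ball 0 3) {()} (\<lambda>_ x. inverse (q b x))"
   by (rule bdd_family_inverse[of _ _ _ "norm (q b y)"])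
    (use y q0[OF b y(1)] bdd_family_mono[OF qb[OF b] order_refl subset_UNIV] in \<open>auto simp: less_imp_le\<close>)
  then have "bdd_family (ball 0 3) {()} (\<lambda>_ x. g b x * inverse (q b x))"
   using bdd_family_mono[OF gb[OF b] order_refl subset_UNIV] by (intro bdd_family_mult) auto
  moreover have "test_fun (cball 0 R) (\<lambda>x. complex_of_real (\<zeta> x))"
   by (rule test_family_mono[OF \<zeta>(1)]) auto
  ultimately show ?thesis unfolding \<psi>_def using rR by (intro test_family_mult[of "ball 0 3"]) auto
 qed
 have \<phi>\<psi>: "\<phi> x = (\<Sum>b\<in>Basis. (iexp (b \<bullet> x) - 1) * \<psi> b x)" for x
 proof (cases "x \<in> cball 0 3")
  case True
  have "(iexp (b \<bullet> x) - 1) * \<psi> b x = complex_of_real (x \<bullet> b) * g b x * complex_of_real (\<zeta> x)"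
   if b: "b \<in> Basis" for b
   unfolding ftc2[symmetric] \<psi>_def using q0[OF b True] by (simp add: inner_commute)
  then have "(\<Sum>b\<in>Basis. (iexp (b \<bullet> x) - 1) * \<psi> b x) = \<phi> x * complex_of_real (\<zeta> x)"
   unfolding ftc1[of x] by (simp add: sum_distrib_right)
  then show ?thesis using \<zeta>(2)[of x] Kr test_family_0[OF \<phi>, of "()" x] by (cases "x \<in> K") auto
 next
  case False
  then have "x \<notin> K" "x \<notin> cball 0 R" using K rR by auto
  then show ?thesis using test_family_0[OF \<phi>, of "()" x] test_family_0[OF \<zeta>(1), of "()" x] by (simp add: \<psi>_def)
 qed
 let ?t = "\<lambda>b x. (iexp (b \<bullet> x) - 1) * \<psi> b x"
 have eq: "fhat \<phi> m = (\<Sum>b\<in>Basis. fhat (?t b) m)" for m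
 proof -
  have int: "integrable lborel (\<lambda>x. ?t b x * iexp (m \<bullet> x))" if "b \<in> Basis" for b
  proof -
   have "integrable lborel (\<lambda>x. \<psi> b x * ((iexp (b \<bullet> x) - 1) * iexp (m \<bullet> x)))"
    by (rule test_family_integrable[OF compact_cball \<psi>[OF that]]) (auto intro!: continuous_intros)
   then show ?thesis by (simp add: mult_ac)
  qed
  have "fhat \<phi> m = (LINT x|lborel. (\<Sum>b\<in>Basis. ?t b x * iexp (m \<bullet> x)))"
   unfolding fhat_def by (subst \<phi>\<psi>) (simp add: sum_distrib_right)
  also have "\<dots> = (\<Sum>b\<in>Basis. fhat (?t b) m)" unfolding fhat_def by (rule Bochner_Integration.integral_sum[OF int])
  finally show ?thesis .
 qed
 have "((\<lambda>m. \<Sum>b\<in>B. fhat (?t b) m) has_sum 0) int_lattice" if "B \<subseteq> Basis" for B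
  using finite_subset[OF that finite_Basis] that
 proof (induction B rule: finite_induct)
  case (insert b B)
  then show ?case
   using has_sum_add[OF fhat_shift_has_sum[OF compact_cball \<psi>, of b b] insert.IH] by simp
 qed auto
 from this[OF order_refl] show ?thesis by (simp only: eq[symmetric])
qed

section \<open>Normalised bumps and the summation constant\<close>

lemma integral_bump_pos:
 fixes \<beta> :: "'a::euclidean_space => real"
 assumes "integrable lborel \<beta>" "\<And>x. 0 \<le> \<beta> x" "\<And>x. x \<in> cball 0 s ==> \<beta> x = 1" "0 < s"
 shows "0 < (LINT x|lborel. \<beta> x)"
proof -
 have i: "integrable lborel (indicator (cball (0::'a) s) :: 'a => real)"
  using emeasure_compact_finite[OF compact_cball[of "0::'a" s]] by (intro integrable_real_indicator) auto
 have "0 < measure lborel (cball (0::'a) s)" using assms(4) by (rule content_cball_pos)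
 also have "\<dots> = (LINT x|lborel. indicator (cball (0::'a) s) x)" by simp
 also have "\<dots> \<le> (LINT x|lborel. \<beta> x)"
 proof (rule integral_mono[OF i assms(1)])
  show "indicator (cball 0 s) x \<le> \<beta> x" for x
   using assms(2)[of x] assms(3)[of x] by (cases "x \<in> cball 0 s") auto
 qed
 finally show ?thesis .
qed

lemma bump_at_0_exists:
 assumes "0 < (r::real)"
 obtains \<beta> :: "'a::euclidean_space => real" where "test_fun (cball 0 r) (\<lambda>x. complex_of_real (\<beta> x))"
  "\<beta> 0 = 1" "\<And>x. 0 \<le> \<beta> x" "integrable lborel \<beta>" "0 < (LINT x|lborel. \<beta> x)"
proof -
 have r: "0 < r / 2" "r / 2 < r" using assms by auto
 obtain \<beta> :: "'a => real" where \<beta>: "test_family (cball 0 r) (UNIV :: unit set) (\<lambda>_ x. complex_of_real (\<beta> x))"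
  and \<beta>1: "\<And>x. x \<in> cball 0 (r / 2) ==> \<beta> x = 1" and \<beta>0: "\<And>x. 0 \<le> \<beta> x"
  by (rule bump_function_exists[OF r, of 0]) (erule that, assumption, assumption)
 have \<beta>': "test_fun (cball 0 r) (\<lambda>x. complex_of_real (\<beta> x))" by (rule test_family_mono[OF \<beta>]) auto
 have "integrable lborel (\<lambda>x. complex_of_real (\<beta> x) * 1)"
  by (rule test_family_integrable[OF compact_cball \<beta>']) auto
 from integrable_Re[OF this] have i: "integrable lborel \<beta>" by simp
 have "\<beta> 0 = 1" using \<beta>1[of 0] r by simp
 from that[OF \<beta>' this \<beta>0 i integral_bump_pos[OF i \<beta>0 \<beta>1 r(1)]] show thesis by blast
qed

lemma mollifier_exists:
 assumes "0 < (r::real)"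
 obtains \<rho> :: "'a::euclidean_space => complex" where "test_fun (cball 0 r) \<rho>"
  "(LINT x|lborel. \<rho> x) = 1" "(LINT x|lborel. norm (\<rho> x)) = 1"
proof -
 obtain \<beta> :: "'a => real" where \<beta>: "test_fun (cball 0 r) (\<lambda>x. complex_of_real (\<beta> x))"
  "\<beta> 0 = 1" "\<And>x. 0 \<le> \<beta> x" "integrable lborel \<beta>" "0 < (LINT x|lborel. \<beta> x)"
  by (rule bump_at_0_exists[OF assms]) (erule that, assumption+)
 define J where "J = (LINT x|lborel. \<beta> x)"
 define \<rho> where "\<rho> x = complex_of_real (inverse J) * complex_of_real (\<beta> x)" for x
 have J: "0 < J" using \<beta>(5) by (simp add: J_def)
 have 1: "test_fun (cball 0 r) \<rho>" unfolding \<rho>_def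
  by (rule test_family_mult[OF open_UNIV bdd_family_const \<beta>(1)]) auto
 have 2: "(LINT x|lborel. \<rho> x) = 1"
 proof -
  have "(LINT x|lborel. \<rho> x) = complex_of_real (inverse J) * (LINT x|lborel. complex_of_real (\<beta> x))" by (simp add: \<rho>_def)
  also have "(LINT x|lborel. complex_of_real (\<beta> x)) = complex_of_real J" by (simp add: J_def)
  finally show ?thesis using J by (simp flip: of_real_mult)
 qed
 have "norm (\<rho> x) = inverse J * \<beta> x" for x using \<beta>(3)[of x] J by (simp add: \<rho>_def norm_mult norm_inverse)
 then have 3: "(LINT x|lborel. norm (\<rho> x)) = 1" using J \<beta>(4) by (simp add: J_def[symmetric])
 show thesis by (rule that[OF 1 2 3])
qed

lemma fhat_uminus_of_real: "fhat (\<lambda>x. complex_of_real (\<beta> x)) (- m) = cnj (fhat (\<lambda>x. complex_of_real (\<beta> x)) m)"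
proof -
 have "complex_of_real (\<beta> x) * iexp (- m \<bullet> x) =
   cnj (complex_of_real (\<beta> x) * iexp (m \<bullet> x))" for x
  by (simp add: exp_cnj)
 then show ?thesis unfolding fhat_def by (simp only: Bochner_Integration.integral_cnj)
qed

text \<open>Subtracting the value at 0 times a fixed bump leaves a function vanishing at 0, whose
  coefficients sum to 0; hence \<open>C\<close> is the sum for the bump. It is nonzero: otherwise
  the coefficients of the autocorrelation of the bump, which are squared moduli, would sum to 0, and
  the integral of the bump would vanish.\<close>

lemma poisson_constant_exists:
 "\<exists>C::complex. C \<noteq> 0 \<and> (\<forall>K \<phi>. compact K \<and> K \<subseteq> ball (0::'a::euclidean_space) 3 \<and> test_fun K \<phi> -->
   (fhat \<phi> has_sum C * \<phi> 0) int_lattice)"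
proof -
 obtain \<beta> :: "'a => real" where \<beta>: "test_fun (cball 0 1) (\<lambda>x. complex_of_real (\<beta> x))"
  "\<beta> 0 = 1" "\<And>x. 0 \<le> \<beta> x" "integrable lborel \<beta>" "0 < (LINT x|lborel. \<beta> x)"
  by (rule bump_at_0_exists[OF zero_less_one]) (erule that, assumption+)
 let ?\<rho> = "\<lambda>x. complex_of_real (\<beta> x)"
 define C where "C = infsum (fhat ?\<rho>) int_lattice"
 have S: "(fhat ?\<rho> has_sum C) int_lattice" unfolding C_def using fhat_summable(2)[OF compact_cball \<beta>(1)] by simp
 have main: "(fhat \<phi> has_sum C * \<phi> 0) int_lattice"
  if K: "compact K" "K \<subseteq> ball 0 3" and \<phi>: "test_fun K \<phi>" for K and \<phi> :: "'a => complex"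
 proof -
  define L where "L = K \<union> cball 0 1"
  have L: "compact L" "L \<subseteq> ball 0 3" using K by (auto simp: L_def)
  have \<phi>L: "test_fun L \<phi>" by (rule test_family_mono[OF \<phi>]) (auto simp: L_def)
  have \<rho>L: "test_fun L ?\<rho>" by (rule test_family_mono[OF \<beta>(1)]) (auto simp: L_def)
  have c\<rho>L: "test_fun L (\<lambda>x. \<phi> 0 * ?\<rho> x)"
   by (rule test_family_mult[OF open_UNIV bdd_family_const \<rho>L compact_imp_closed[OF L(1)]]) auto
  have "(fhat (\<lambda>x. \<phi> x - \<phi> 0 * ?\<rho> x) has_sum 0) int_lattice"
   by (rule fhat_vanishing_has_sum[OF L test_family_diff[OF \<phi>L c\<rho>L]]) (simp add: \<beta>(2))
  moreover have "fhat (\<lambda>x. \<phi> x - \<phi> 0 * ?\<rho> x) = (\<lambda>m. fhat \<phi> m - \<phi> 0 * fhat ?\<rho> m)"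
  proof
   fix m
   have "integrable lborel (\<lambda>x. \<phi> x * iexp (m \<bullet> x))"
    "integrable lborel (\<lambda>x. ?\<rho> x * iexp (m \<bullet> x))"
    using test_family_integrable[OF L(1) \<phi>L _ continuous_on_osc(2)]
     test_family_integrable[OF L(1) \<rho>L _ continuous_on_osc(2)] by simp_all
   then show "fhat (\<lambda>x. \<phi> x - \<phi> 0 * ?\<rho> x) m = fhat \<phi> m - \<phi> 0 * fhat ?\<rho> m"
    unfolding fhat_def by (simp add: left_diff_distrib mult.assoc)
  qed
  ultimately have "((\<lambda>m. fhat \<phi> m - \<phi> 0 * fhat ?\<rho> m) has_sum 0) int_lattice" by (simp only:)
  from has_sum_add[OF this has_sum_cmult_right[OF S, of "\<phi> 0"]] show ?thesis by (simp add: mult.commute)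
 qed
 have "C \<noteq> 0"
 proof
  assume C0: "C = 0"
  \<comment> \<open>The autocorrelation of a bump of radius 1 lives in radius 2, still inside the
    ball of radius 3.\<close>
  define L where "L = thicken 1 (cball (0::'a) 1)"
  have L: "compact L" "L \<subseteq> ball 0 3"
  proof -
   show "compact L" unfolding L_def by (rule compact_thicken) simp
   show "L \<subseteq> ball 0 3"
   proof
    fix x assume "x \<in> L"
    then obtain y z where "x = y + z" "norm y \<le> 1" "norm z \<le> 1" by (auto simp: L_def thicken_def)
    then show "x \<in> ball 0 3" using norm_triangle_ineq[of y z] by simp
   qed
  qed
  have \<rho>c: "continuous_on UNIV ?\<rho>" using test_family_continuous[OF \<beta>(1), of "()"] by simp
  have \<rho>0: "?\<rho> z = 0" if "z \<notin> cball 0 1" for z using test_family_0[OF \<beta>(1) _ that, of "()"] by simp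
  have "test_fun L (correlate ?\<rho> ?\<rho>)" unfolding L_def
   by (rule test_family_correlate[OF \<beta>(1), where B = "LINT z|lborel. norm (?\<rho> z)"]) (use \<rho>c \<rho>0 in auto)
  from main[OF L this] have "(fhat (correlate ?\<rho> ?\<rho>) has_sum 0) int_lattice" using C0 by simp
  moreover have "fhat (correlate ?\<rho> ?\<rho>) = (\<lambda>m. complex_of_real ((norm (fhat ?\<rho> m))\<^sup>2))"
  proof
   fix m
   have "fhat (correlate ?\<rho> ?\<rho>) m = fhat ?\<rho> (- m) * fhat ?\<rho> m"
    by (rule fhat_correlate[OF compact_cball \<rho>c \<rho>0 \<rho>c \<rho>0])
   then show "fhat (correlate ?\<rho> ?\<rho>) m = complex_of_real ((norm (fhat ?\<rho> m))\<^sup>2)"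
    unfolding fhat_uminus_of_real by (metis complex_norm_square mult.commute)
  qed
  ultimately have "((\<lambda>m. complex_of_real ((norm (fhat ?\<rho> m))\<^sup>2)) has_sum complex_of_real 0) int_lattice"
   by (simp only: of_real_0)
  then have "((\<lambda>m. (norm (fhat ?\<rho> m))\<^sup>2) has_sum 0) int_lattice" by (simp only: has_sum_of_real_iff)
  then have "(norm (fhat ?\<rho> 0))\<^sup>2 = 0"
   by (rule nonneg_has_sum_le_0D) (auto simp: int_lattice_def)
  then have "fhat ?\<rho> 0 = 0" by simp
  moreover have "fhat ?\<rho> 0 = complex_of_real (LINT x|lborel. \<beta> x)" by (simp add: fhat_def)
  ultimately show False using \<beta>(5) by simp
 qed
 then show ?thesis using main by blast
qed

text \<open>The value is \<open>(2\<pi>)\<^sup>-\<^sup>d\<close>, but only its existence matters.\<close>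

definition fourier_const :: "'a::euclidean_space itself => complex" where
 "fourier_const _ = inverse (SOME C::complex. C \<noteq> 0 \<and>
   (\<forall>K \<phi>. compact K \<and> K \<subseteq> ball (0::'a) 3 \<and> test_fun K \<phi> -->
    (fhat \<phi> has_sum C * \<phi> 0) int_lattice))"

text \<open>The summation formula at the origin is applied to the translate of \<phi> by
  \<open>y\<close>, whose coefficients differ by the factor \<open>osc m y\<close>. The support only
  has to be close to the point of evaluation.\<close>

theorem fourier_series:
 fixes \<phi> :: "'a::euclidean_space => complex"
 assumes K: "compact K" "K \<subseteq> ball y 3" and \<phi>: "test_fun K \<phi>"
 shows "((\<lambda>m. fourier_const TYPE('a) * (fhat \<phi> m * osc m y)) has_sum \<phi> y) int_lattice"
proof -
 define C where "C = (SOME C::complex. C \<noteq> 0 \<and>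
   (\<forall>K \<phi>. compact K \<and> K \<subseteq> ball (0::'a) 3 \<and> test_fun K \<phi> -->
    (fhat \<phi> has_sum C * \<phi> 0) int_lattice))"
 have C: "C \<noteq> 0 \<and> (\<forall>K \<phi>. compact K \<and> K \<subseteq> ball (0::'a) 3 \<and> test_fun K \<phi> -->
    (fhat \<phi> has_sum C * \<phi> 0) int_lattice)"
  unfolding C_def by (rule someI_ex[OF poisson_constant_exists])
 define \<phi>' where "\<phi>' x = \<phi> (1 *\<^sub>R x + y)" for x
 have "bdd_family UNIV {()} (\<lambda>_. \<phi>')" unfolding \<phi>'_def
  using \<phi> by (intro bdd_family_affine) (auto simp: test_family_def)
 moreover have "\<phi>' x = 0" if "x \<notin> (\<lambda>x. x - y) ` K" for x
 proof -
  have "x + y \<notin> K" using that by force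
  then show ?thesis using test_family_0[OF \<phi>, of "()"] by (simp add: \<phi>'_def)
 qed
 ultimately have "test_fun ((\<lambda>x. x - y) ` K) \<phi>'" by (simp add: test_family_def)
 moreover have "compact ((\<lambda>x. x - y) ` K)"
  by (rule compact_continuous_image[OF _ K(1)]) (intro continuous_intros)
 moreover have "(\<lambda>x. x - y) ` K \<subseteq> ball 0 3" using K(2) by (auto simp: dist_norm norm_minus_commute)
 ultimately have "(fhat \<phi>' has_sum C * \<phi>' 0) int_lattice" using C by blast
 from has_sum_cmult_right[OF this, of "inverse C"]
 have "((\<lambda>m. inverse C * fhat \<phi>' m) has_sum \<phi> y) int_lattice"
  using C by (simp add: \<phi>'_def mult.assoc[symmetric])
 moreover have "fhat \<phi>' m = fhat \<phi> m * osc m y" for m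
 proof -
  have "fhat \<phi> m = (LINT x|lborel. \<phi> (y + x) * iexp (m \<bullet> (y + x)))"
   unfolding fhat_def by (rule integral_translate[symmetric])
  then have "fhat \<phi> m * osc m y =
    (LINT x|lborel. \<phi> (y + x) * iexp (m \<bullet> (y + x)) * osc m y)"
   by simp
  also have "\<dots> = fhat \<phi>' m" unfolding fhat_def \<phi>'_def
   by (rule Bochner_Integration.integral_cong)
    (auto simp: inner_add_right add.commute algebra_simps exp_add[symmetric])
  finally show ?thesis ..
 qed
 moreover have "fourier_const TYPE('a) = inverse C" by (simp add: fourier_const_def C_def)
 ultimately show ?thesis by simp
qed

text \<open>Makes the derivative of a partial sum of the series of a function the partial sum of the
  series of its derivative.\<close>

lemma fhat_partial:
 fixes \<phi> :: "'a::euclidean_space => complex"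
 assumes K: "compact K" and \<phi>: "test_fun K \<phi>" and b: "b \<in> Basis"
 shows "fhat (partial b \<phi>) m = - \<i> * complex_of_real (m \<bullet> b) * fhat \<phi> m"
proof -
 let ?e = "\<lambda>x. 1 * osc (- m) x"
 have e: "bdd_family UNIV {()} (\<lambda>_. ?e)" by (rule bdd_family_osc) auto
 have h: "test_fun K (\<lambda>x. ?e x * \<phi> x)"
  by (rule test_family_mult[OF open_UNIV e \<phi> compact_imp_closed[OF K] subset_UNIV])
 have hb: "bdd_family UNIV {()} (\<lambda>_ x. ?e x * \<phi> x)" using h by (simp add: test_family_def)
 have diff: "?e differentiable (at x)" "\<phi> differentiable (at x)" for x
  using bdd_family_differentiable[OF e, of "()" x] bdd_family_differentiable[of UNIV "{()}" "\<lambda>_. \<phi>" "()" x] \<phi>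
  by (auto simp: test_family_def)
 have pe: "partial b ?e x = \<i> * complex_of_real (m \<bullet> b) * ?e x" for x
  by (subst partial_eqI[OF has_derivative_osc]) simp
 obtain B where B: "B > 0" "\<And>i x. i \<in> {()} ==> x \<in> UNIV ==> norm (partial b (\<lambda>x. ?e x * \<phi> x) x) \<le> B"
  by (rule bdd_family_bound[OF bdd_family_partial[OF hb b]]) (erule that, assumption)
 have "(LINT x|lborel. partial b (\<lambda>x. ?e x * \<phi> x) x) = 0"
 proof (rule integral_partial_eq_0[OF K _ _ _ b])
  show "?e x * \<phi> x = 0" if "x \<notin> K" for x using test_family_0[OF \<phi> _ that, of "()"] by simp
  show "(\<lambda>x. ?e x * \<phi> x) differentiable (at x)" for x by (intro differentiable_mult diff)
  show "norm (partial b (\<lambda>x. ?e x * \<phi> x) x) \<le> B" for x using B(2) by simp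
 qed
 moreover have "partial b (\<lambda>x. ?e x * \<phi> x) x = \<i> * complex_of_real (m \<bullet> b) * (\<phi> x * iexp (m \<bullet> x)) +
   partial b \<phi> x * iexp (m \<bullet> x)" for x
  by (subst partial_mult[OF diff], subst pe) (simp add: mult_ac)
 moreover have "integrable lborel (\<lambda>x. \<phi> x * iexp (m \<bullet> x))"
  "integrable lborel (\<lambda>x. partial b \<phi> x * iexp (m \<bullet> x))"
  using test_family_integrable[OF K \<phi> _ continuous_on_osc(2)]
   test_family_integrable[OF K test_family_partial[OF compact_imp_closed[OF K] \<phi> b] _ continuous_on_osc(2)] by simp_all
 ultimately have "\<i> * complex_of_real (m \<bullet> b) * fhat \<phi> m + fhat (partial b \<phi>) m = 0"
  by (simp add: fhat_def)
 then show ?thesis by (simp add: add_eq_0_iff)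
qed

section \<open>Bounded sets of test functions and distributions\<close>

lemma finite_multi_indices: "finite {bs. bs \<in> lists (Basis :: 'a::euclidean_space set) \<and> length bs \<le> m}"
 using finite_lists_length_le[OF finite_Basis[where 'a = 'a], of m] by (simp add: lists_eq_set conj_commute)

lemma SUP_norm_le:
 fixes g :: "'a => complex"
 assumes "\<And>x. norm (g x) \<le> C"
 shows "(SUP x. norm (g x)) \<le> C" "0 \<le> (SUP x. norm (g x))"
proof -
 show "(SUP x. norm (g x)) \<le> C" by (rule cSUP_least) (use assms in auto)
 have "norm (g undefined) \<le> (SUP x. norm (g x))"
  by (rule cSUP_upper) (use assms in \<open>auto intro!: bdd_aboveI\<close>)
 then show "0 \<le> (SUP x. norm (g x))" using norm_ge_zero order_trans by blast
qed

lemma Ck_norm_family_bound: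
 fixes h :: "'i => 'a::euclidean_space => complex"
 assumes "bdd_family UNIV I h"
 obtains C where "\<And>i. i \<in> I ==> \<bar>Ck_norm m (h i)\<bar> \<le> C"
proof -
 have "\<exists>C. \<forall>i\<in>I. \<forall>x. norm (iter_deriv bs (h i) x) \<le> C" if bs: "bs \<in> lists Basis" for bs
 proof -
  obtain C where "C > 0" "\<And>i x. i \<in> I ==> x \<in> UNIV ==> norm (iter_deriv bs (h i) x) \<le> C"
   by (rule bdd_family_bound[OF bdd_family_iter_deriv[OF assms bs]]) (erule that, assumption)
  then show ?thesis by auto
 qed
 then obtain C where C: "\<And>bs i x. bs \<in> lists Basis ==> i \<in> I ==> norm (iter_deriv bs (h i) x) \<le> C bs"
  by metis
 show thesis
 proof (rule that)
  fix i assume i: "i \<in> I"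
  have "\<bar>Ck_norm m (h i)\<bar> \<le> (\<Sum>bs | bs \<in> lists Basis \<and> length bs \<le> m. \<bar>SUP x. norm (iter_deriv bs (h i) x)\<bar>)"
   unfolding Ck_norm_def by (rule sum_abs)
  also have "\<dots> \<le> (\<Sum>bs | bs \<in> lists (Basis::'a set) \<and> length bs \<le> m. C bs)"
  proof (rule sum_mono)
   fix bs assume "bs \<in> {bs. bs \<in> lists (Basis::'a set) \<and> length bs \<le> m}"
   then have "norm (iter_deriv bs (h i) x) \<le> C bs" for x using C[of bs i x] i by simp
   from SUP_norm_le[of "iter_deriv bs (h i)", OF this] show "\<bar>SUP x. norm (iter_deriv bs (h i) x)\<bar> \<le> C bs" by simp
  qed
  finally show "\<bar>Ck_norm m (h i)\<bar> \<le> (\<Sum>bs | bs \<in> lists (Basis::'a set) \<and> length bs \<le> m. C bs)" .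
 qed
qed

lemma continuous_on_compact_supports_family:
 assumes p: "continuous_on_compact_supports \<Omega> p" and K: "compact K" "K \<subseteq> \<Omega>" and h: "test_family K I h"
 obtains C where "\<And>i. i \<in> I ==> p (h i) \<le> C"
proof -
 obtain C m where Cm: "\<forall>\<phi>\<in>test_functions \<Omega>. supp \<phi> \<subseteq> K --> p \<phi> \<le> C * Ck_norm m \<phi>"
  using p K unfolding continuous_on_compact_supports_def by blast
 have hb: "bdd_family UNIV I h" using h by (simp add: test_family_def)
 obtain B where B: "\<And>i. i \<in> I ==> \<bar>Ck_norm m (h i)\<bar> \<le> B"
  by (rule Ck_norm_family_bound[OF hb, of m]) (erule that)
 show thesis
 proof (rule that)
  fix i assume i: "i \<in> I"
  have "p (h i) \<le> C * Ck_norm m (h i)" using Cm test_family_test_functions[OF K h i] by blast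
  also have "\<dots> \<le> \<bar>C * Ck_norm m (h i)\<bar>" by simp
  also have "\<dots> \<le> \<bar>C\<bar> * B" unfolding abs_mult using B[OF i] by (intro mult_left_mono) auto
  finally show "p (h i) \<le> \<bar>C\<bar> * B" .
 qed
qed

lemma distribution_family_bound:
 assumes "u \<in> distributions \<Omega>" "compact K" "K \<subseteq> \<Omega>" "test_family K I h"
 obtains C where "C > 0" "\<And>i. i \<in> I ==> norm (u (h i)) \<le> C"
proof -
 have "continuous_on_compact_supports \<Omega> (\<lambda>\<phi>. norm (u \<phi>))" using assms(1) by (simp add: distributions_def)
 then obtain C where C: "\<And>i. i \<in> I ==> norm (u (h i)) \<le> C"
  by (rule continuous_on_compact_supports_family[OF _ assms(2-4)]) (erule that)
 have "norm (u (h i)) \<le> max C 1" if "i \<in> I" for i using C[OF that] by simp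
 then show thesis by (rule that[OF less_le_trans[OF zero_less_one max.cobounded2]])
qed

text \<open>On functions supported in \<open>K\<close> a continuous seminorm is dominated by a
  multiple of some \<open>Ck_norm\<close>, and these norms are bounded along the family.\<close>

lemma bounded_test_set_family:
 assumes K: "compact K" "K \<subseteq> \<Omega>" and h: "test_family K I h"
 shows "bounded_test_set \<Omega> (h ` I)"
proof -
 have "bdd_above (p ` h ` I)" if p: "continuous_seminorm \<Omega> p" for p
 proof -
  have "continuous_on_compact_supports \<Omega> p" using p by (simp add: continuous_seminorm_def)
  then obtain C where "\<And>i. i \<in> I ==> p (h i) \<le> C"
   by (rule continuous_on_compact_supports_family[OF _ assms]) (erule that)
  then show ?thesis by (auto intro!: bdd_aboveI)
 qed
 then show ?thesis using test_family_test_functions(1)[OF assms] by (auto simp: bounded_test_set_def)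
qed

lemma iter_deriv_smooth:
 "smooth_on UNIV \<phi> ==> bs \<in> lists Basis ==> iter_deriv bs \<phi> differentiable (at x)"
 by (simp add: smooth_on_def)

lemma iter_deriv_add:
 fixes \<phi> \<psi> :: "'a::euclidean_space => complex"
 assumes "smooth_on UNIV \<phi>" "smooth_on UNIV \<psi>" "bs \<in> lists Basis"
 shows "iter_deriv bs (\<lambda>x. \<phi> x + \<psi> x) = (\<lambda>x. iter_deriv bs \<phi> x + iter_deriv bs \<psi> x)"
 using assms(3)
proof (induction bs)
 case (Cons b bs)
 show ?case
 proof
  fix x
  have "iter_deriv (b # bs) (\<lambda>x. \<phi> x + \<psi> x) x = partial b (\<lambda>x. iter_deriv bs \<phi> x + iter_deriv bs \<psi> x) x"
   by (simp only: iter_deriv_Cons_partial Cons.IH)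
  also have "\<dots> = partial b (iter_deriv bs \<phi>) x + partial b (iter_deriv bs \<psi>) x"
   by (rule partial_add) (use iter_deriv_smooth assms Cons in auto)
  finally show "iter_deriv (b # bs) (\<lambda>x. \<phi> x + \<psi> x) x = iter_deriv (b # bs) \<phi> x + iter_deriv (b # bs) \<psi> x"
   by (simp only: iter_deriv_Cons_partial)
 qed
qed auto

lemma iter_deriv_cmult:
 fixes \<phi> :: "'a::euclidean_space => complex"
 assumes "smooth_on UNIV \<phi>" "bs \<in> lists Basis"
 shows "iter_deriv bs (\<lambda>x. c * \<phi> x) = (\<lambda>x. c * iter_deriv bs \<phi> x)"
 using assms(2)
proof (induction bs)
 case (Cons b bs)
 show ?case
 proof
  fix x
  have "iter_deriv (b # bs) (\<lambda>x. c * \<phi> x) x = partial b (\<lambda>x. c * iter_deriv bs \<phi> x) x"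
   by (simp only: iter_deriv_Cons_partial Cons.IH)
  also have "\<dots> = c * partial b (iter_deriv bs \<phi>) x"
   by (subst partial_mult) (use iter_deriv_smooth[of \<phi> bs x] assms Cons in auto)
  finally show "iter_deriv (b # bs) (\<lambda>x. c * \<phi> x) x = c * iter_deriv (b # bs) \<phi> x"
   by (simp only: iter_deriv_Cons_partial)
 qed
qed auto

lemma test_functions_add_cmult:
 assumes "\<phi> \<in> test_functions \<Omega>" "\<psi> \<in> test_functions \<Omega>"
 shows "(\<lambda>x. \<phi> x + \<psi> x) \<in> test_functions \<Omega>" "(\<lambda>x. c * \<phi> x) \<in> test_functions \<Omega>"
proof -
 define K where "K = supp \<phi> \<union> supp \<psi>"
 have K: "compact K" "K \<subseteq> \<Omega>" using assms by (auto simp: K_def test_functions_def)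
 have f: "test_fun K \<phi>" "test_fun K \<psi>"
  using test_function_family[OF assms(1), of "{()}"] test_function_family[OF assms(2), of "{()}"]
  by (auto simp: K_def elim: test_family_mono)
 show "(\<lambda>x. \<phi> x + \<psi> x) \<in> test_functions \<Omega>"
  using test_family_test_functions(1)[OF K test_family_add[OF f]] by simp
 have "test_fun K (\<lambda>x. c * \<phi> x)"
  by (rule test_family_mult[OF open_UNIV bdd_family_const f(1) compact_imp_closed[OF K(1)]]) auto
 from test_family_test_functions(1)[OF K this, of "()"]
 show "(\<lambda>x. c * \<phi> x) \<in> test_functions \<Omega>" by simp
qed

lemma iter_deriv_bounded:
 assumes "\<phi> \<in> test_functions \<Omega>" "bs \<in> lists Basis"
 obtains C where "\<And>x. norm (iter_deriv bs \<phi> x) \<le> C"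
proof -
 have "bdd_family UNIV {()} (\<lambda>_. \<phi>)" using test_function_family[OF assms(1), of "{()}"] by (simp add: test_family_def)
 then obtain C where "C > 0" "\<And>i x. i \<in> {()} ==> x \<in> UNIV ==> norm (iter_deriv bs \<phi> x) \<le> C"
  by (rule bdd_family_bound[OF bdd_family_iter_deriv[OF _ assms(2)]]) (erule that, assumption)
 then show thesis by (intro that[of C]) auto
qed

lemma SUP_iter_deriv_le_Ck_norm:
 fixes \<phi> :: "'a::euclidean_space => complex"
 assumes "\<phi> \<in> test_functions \<Omega>" "bs \<in> lists Basis"
 shows "(SUP x. norm (iter_deriv bs \<phi> x)) \<le> Ck_norm (length bs) \<phi>"
 unfolding Ck_norm_def
proof (rule member_le_sum[of bs _ "\<lambda>bs. SUP x. norm (iter_deriv bs \<phi> x)"])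
 fix cs :: "'a list" assume "cs \<in> {cs. cs \<in> lists Basis \<and> length cs \<le> length bs} - {bs}"
 then have cs: "cs \<in> lists Basis" by simp
 obtain C where "\<And>x. norm (iter_deriv cs \<phi> x) \<le> C" by (rule iter_deriv_bounded[OF assms(1) cs]) (erule that)
 then show "0 \<le> (SUP x. norm (iter_deriv cs \<phi> x))" by (rule SUP_norm_le(2))
qed (use assms finite_multi_indices in auto)

text \<open>These seminorms turn abstract boundedness of a set of test functions into uniform bounds
  for every derivative.\<close>

lemma continuous_seminorm_SUP_iter_deriv:
 fixes \<Omega> :: "'a::euclidean_space set"
 assumes bs: "bs \<in> lists Basis"
 shows "continuous_seminorm \<Omega> (\<lambda>\<phi>. SUP x. norm (iter_deriv bs \<phi> x))"
proof -
 let ?D = "\<lambda>\<phi>::'a => complex. SUP x. norm (iter_deriv bs \<phi> x)"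
 have up: "norm (iter_deriv bs \<phi> x) \<le> ?D \<phi>" if \<phi>: "\<phi> \<in> test_functions \<Omega>" for \<phi> x
 proof -
  obtain C where "\<And>x. norm (iter_deriv bs \<phi> x) \<le> C" by (rule iter_deriv_bounded[OF \<phi> bs]) (erule that)
  then show ?thesis by (intro cSUP_upper) (auto intro!: bdd_aboveI)
 qed
 have nn: "0 \<le> ?D \<phi>" if "\<phi> \<in> test_functions \<Omega>" for \<phi>
  using up[OF that, of undefined] norm_ge_zero order_trans by blast
 have add: "?D (\<lambda>x. \<phi> x + \<psi> x) \<le> ?D \<phi> + ?D \<psi>" if \<phi>: "\<phi> \<in> test_functions \<Omega>" and \<psi>: "\<psi> \<in> test_functions \<Omega>" for \<phi> \<psi>
 proof -
  have "norm (iter_deriv bs (\<lambda>x. \<phi> x + \<psi> x) x) \<le> ?D \<phi> + ?D \<psi>" for x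
   unfolding iter_deriv_add[OF test_functionsD(1)[OF \<phi>] test_functionsD(1)[OF \<psi>] bs]
   using up[OF \<phi>, of x] up[OF \<psi>, of x] by (meson add_mono norm_triangle_le)
  then show ?thesis by (rule SUP_norm_le(1))
 qed
 have le: "?D (\<lambda>x. c * \<phi> x) \<le> norm c * ?D \<phi>" if \<phi>: "\<phi> \<in> test_functions \<Omega>" for \<phi> c
 proof -
  have "norm (iter_deriv bs (\<lambda>x. c * \<phi> x) x) \<le> norm c * ?D \<phi>" for x
   unfolding iter_deriv_cmult[OF test_functionsD(1)[OF \<phi>] bs] norm_mult
   using up[OF \<phi>, of x] by (rule mult_left_mono) simp
  then show ?thesis by (rule SUP_norm_le(1))
 qed
 have cmult: "?D (\<lambda>x. c * \<phi> x) = norm c * ?D \<phi>" if \<phi>: "\<phi> \<in> test_functions \<Omega>" for \<phi> c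
 proof (cases "c = 0")
  case True
  have "?D (\<lambda>x. c * \<phi> x) \<le> 0" using le[OF \<phi>, of c] True by simp
  moreover have "0 \<le> ?D (\<lambda>x. c * \<phi> x)" by (rule nn[OF test_functions_add_cmult(2)[OF \<phi> \<phi>]])
  ultimately show ?thesis using True by simp
 next
  case False
  \<comment> \<open>The inequality for the scalar 1/c, applied to the multiple by c, is the missing
    half of homogeneity.\<close>
  have "?D (\<lambda>x. inverse c * (c * \<phi> x)) \<le> norm (inverse c) * ?D (\<lambda>x. c * \<phi> x)"
   by (rule le[OF test_functions_add_cmult(2)[OF \<phi> \<phi>]])
  moreover have "(\<lambda>x. inverse c * (c * \<phi> x)) = \<phi>" using False by (auto simp: fun_eq_iff)
  ultimately have "?D \<phi> \<le> norm (inverse c) * ?D (\<lambda>x. c * \<phi> x)" by simp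
  then have "norm c * ?D \<phi> \<le> norm c * (norm (inverse c) * ?D (\<lambda>x. c * \<phi> x))" by (rule mult_left_mono) simp
  also have "norm c * (norm (inverse c) * ?D (\<lambda>x. c * \<phi> x)) = ?D (\<lambda>x. c * \<phi> x)"
   using False by (simp add: norm_inverse)
  finally have "norm c * ?D \<phi> \<le> ?D (\<lambda>x. c * \<phi> x)" .
  then show ?thesis using le[OF \<phi>, of c] by simp
 qed
 have "continuous_on_compact_supports \<Omega> ?D"
  unfolding continuous_on_compact_supports_def
  using SUP_iter_deriv_le_Ck_norm[OF _ bs] by (intro allI impI exI[of _ 1] exI[of _ "length bs"]) simp
 then show ?thesis using nn add cmult by (simp add: continuous_seminorm_def)
qed

lemma bdd_family_iter_derivI:
 fixes h :: "'i => 'a::euclidean_space => complex"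
 assumes "\<And>i. i \<in> I ==> smooth_on UNIV (h i)"
  "\<And>bs. bs \<in> lists Basis ==> \<exists>C. \<forall>i\<in>I. \<forall>x. norm (iter_deriv bs (h i) x) \<le> C"
 shows "bdd_family UNIV I h"
proof (rule bdd_family_coinduct[where R = "\<lambda>h. (\<forall>i\<in>I. smooth_on UNIV (h i)) \<and>
   (\<forall>bs\<in>lists Basis. \<exists>C. \<forall>i\<in>I. \<forall>x. norm (iter_deriv bs (h i) x) \<le> C)"])
 fix h :: "'i => 'a => complex"
 assume h: "(\<forall>i\<in>I. smooth_on UNIV (h i)) \<and>
   (\<forall>bs\<in>lists Basis. \<exists>C. \<forall>i\<in>I. \<forall>x. norm (iter_deriv bs (h i) x) \<le> C)"
 have "[] \<in> lists (Basis :: 'a set)" by simp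
 with h have "\<exists>C. \<forall>i\<in>I. \<forall>x. norm (iter_deriv [] (h i) x) \<le> C" by blast
 then show "\<exists>C. \<forall>i\<in>I. \<forall>x\<in>UNIV. norm (h i x) \<le> C" by simp
 show "h i differentiable (at x)" if "i \<in> I" for i x using h that smooth_on_differentiable by blast
 fix b :: 'a assume b: "b \<in> Basis"
 have "\<exists>C. \<forall>i\<in>I. \<forall>x. norm (iter_deriv bs (partial b (h i)) x) \<le> C" if "bs \<in> lists Basis" for bs
 proof -
  have "bs @ [b] \<in> lists Basis" using that b by simp
  with h have "\<exists>C. \<forall>i\<in>I. \<forall>x. norm (iter_deriv (bs @ [b]) (h i) x) \<le> C" by blast
  then show ?thesis by (simp only: iter_deriv_snoc)
 qed
 moreover have "smooth_on UNIV (partial b (h i))" if "i \<in> I" for i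
  by (rule smooth_on_partial[OF _ b]) (use h that in auto)
 ultimately show "\<exists>g. ((\<forall>i\<in>I. smooth_on UNIV (g i)) \<and>
   (\<forall>bs\<in>lists Basis. \<exists>C. \<forall>i\<in>I. \<forall>x. norm (iter_deriv bs (g i) x) \<le> C)) \<and>
   (\<forall>i\<in>I. \<forall>x\<in>UNIV. partial b (h i) x = g i x)"
  by (intro exI[of _ "\<lambda>i. partial b (h i)"]) auto
qed (use assms in auto)

section \<open>Compact exhaustion and the structure of bounded sets\<close>

lemma compact_exhaustion:
 fixes \<Omega> :: "'a::euclidean_space set"
 assumes "open \<Omega>"
 obtains K :: "nat => 'a set" where "\<And>n. compact (K n)" "\<And>n. K n \<subseteq> \<Omega>" "\<And>n m. n \<le> m ==> K n \<subseteq> K m"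
  "\<And>L. compact L ==> L \<subseteq> \<Omega> ==> \<exists>n. L \<subseteq> K n"
proof -
 define K where "K n = cball 0 (real n) \<inter> (\<Inter>y\<in>-\<Omega>. {x. inverse (real (Suc n)) \<le> dist x y})" for n
 have 1: "compact (K n)" for n unfolding K_def
  by (intro compact_Int_closed compact_cball closed_INT ballI closed_Collect_le continuous_intros)
 have 2: "K n \<subseteq> \<Omega>" for n
 proof
  fix x assume x: "x \<in> K n"
  show "x \<in> \<Omega>"
  proof (rule ccontr)
   assume "x \<notin> \<Omega>"
   moreover have "\<forall>y\<in>-\<Omega>. inverse (real (Suc n)) \<le> dist x y" using x unfolding K_def by blast
   ultimately have "inverse (real (Suc n)) \<le> dist x x" by blast
   then show False by (simp del: of_nat_Suc)
  qed
 qed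
 have 3: "K n \<subseteq> K m" if "n \<le> m" for n m
 proof -
  have le: "inverse (real (Suc m)) \<le> inverse (real (Suc n))" using that by (intro le_imp_inverse_le) auto
  then show ?thesis using that unfolding K_def by (auto simp del: of_nat_Suc intro: order_trans[OF le])
 qed
 have 4: "\<exists>n. L \<subseteq> K n" if L: "compact L" "L \<subseteq> \<Omega>" for L
 proof -
  obtain d where d: "d > 0" "\<forall>x\<in>L. \<forall>y\<in>-\<Omega>. d \<le> dist x y"
   using separate_compact_closed[OF L(1), of "-\<Omega>"] L(2) assms by auto
  obtain R where R: "\<forall>x\<in>L. norm x \<le> R" using compact_imp_bounded[OF L(1)] by (auto simp: bounded_iff)
  obtain n1 where n1: "inverse (real (Suc n1)) < d" using reals_Archimedean[OF d(1)] by blast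
  obtain n2 where n2: "R \<le> real n2" using real_arch_simple by blast
  have "inverse (real (Suc (max n1 n2))) \<le> inverse (real (Suc n1))" by (intro le_imp_inverse_le) auto
  then have "inverse (real (Suc (max n1 n2))) \<le> d" using n1 by linarith
  moreover have "R \<le> real (max n1 n2)" using n2 by simp
  ultimately have "L \<subseteq> K (max n1 n2)" using d(2) R unfolding K_def
   by (auto simp del: of_nat_Suc of_nat_max intro: order_trans)
  then show ?thesis by blast
 qed
 show thesis by (rule that[OF 1 2 3 4])
qed

text \<open>Derivative bounds come from the seminorms above. For a common support: otherwise some
  members are nonzero at points that leave every compact set, and a weighted sum of the absolute
  values at these points is a continuous seminorm, as it is a finite sum on each compact support,
  yet unbounded on \<open>B\<close>.\<close>

lemma bounded_test_set_imp_family: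
 fixes \<Omega> :: "'a::euclidean_space set"
 assumes \<Omega>: "open \<Omega>" and B: "bounded_test_set \<Omega> B"
 obtains K where "compact K" "K \<subseteq> \<Omega>" "test_family K B (\<lambda>\<phi>. \<phi>)"
proof -
 have Bt: "B \<subseteq> test_functions \<Omega>" and Bp: "\<And>p. continuous_seminorm \<Omega> p ==> bdd_above (p ` B)"
  using B by (auto simp: bounded_test_set_def)
 have "bdd_family UNIV B (\<lambda>\<phi>. \<phi>)"
 proof (rule bdd_family_iter_derivI)
  show "smooth_on UNIV \<phi>" if "\<phi> \<in> B" for \<phi> using Bt that test_functionsD(1) by blast
  fix bs :: "'a list" assume bs: "bs \<in> lists Basis"
  from Bp[OF continuous_seminorm_SUP_iter_deriv[OF bs]]
  obtain C where C: "\<forall>\<phi>\<in>B. (SUP x. norm (iter_deriv bs \<phi> x)) \<le> C" by (auto simp: bdd_above_def)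
  have "norm (iter_deriv bs \<phi> x) \<le> C" if \<phi>: "\<phi> \<in> B" for \<phi> x
  proof -
   have "\<phi> \<in> test_functions \<Omega>" using Bt \<phi> by blast
   then obtain D where "\<And>x. norm (iter_deriv bs \<phi> x) \<le> D" by (rule iter_deriv_bounded[OF _ bs]) (erule that)
   then have "norm (iter_deriv bs \<phi> x) \<le> (SUP x. norm (iter_deriv bs \<phi> x))"
    by (intro cSUP_upper) (auto intro!: bdd_aboveI)
   then show ?thesis using C \<phi> by force
  qed
  then show "\<exists>C. \<forall>i\<in>B. \<forall>x. norm (iter_deriv bs i x) \<le> C" by blast
 qed
 moreover
 obtain K :: "nat => 'a set" where K: "\<And>n. compact (K n)" "\<And>n. K n \<subseteq> \<Omega>" "\<And>n m. n \<le> m ==> K n \<subseteq> K m"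
  "\<And>L. compact L ==> L \<subseteq> \<Omega> ==> \<exists>n. L \<subseteq> K n" by (rule compact_exhaustion[OF \<Omega>]) (erule that, assumption+)
 have "\<exists>n. \<forall>\<phi>\<in>B. \<forall>x. x \<notin> K n --> \<phi> x = 0"
 proof (rule ccontr)
  assume "\<not> (\<exists>n. \<forall>\<phi>\<in>B. \<forall>x. x \<notin> K n --> \<phi> x = 0)"
  then have "\<forall>n. \<exists>\<phi> x. \<phi> \<in> B \<and> x \<notin> K n \<and> \<phi> x \<noteq> 0" by blast
  then obtain \<Phi> X where \<Phi>: "\<And>n. \<Phi> n \<in> B" and X: "\<And>n. X n \<notin> K n" and nz: "\<And>n. \<Phi> n (X n) \<noteq> 0" by metis
  \<comment> \<open>The weight makes the n-th term of the seminorm equal to n on the n-th chosen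
    function.\<close>
  define a where "a n = real n / norm (\<Phi> n (X n))" for n
  have a0: "0 \<le> a n" for n by (simp add: a_def)
  define p where "p \<phi> = (\<Sum>n. a n * norm (\<phi> (X n)))" for \<phi> :: "'a => complex"
  \<comment> \<open>Functions supported in the N-th compact set do not see the points with index at
    least N; this local finiteness gives continuity.\<close>
  have fin: "\<phi> (X n) = 0" if "supp \<phi> \<subseteq> K N" "N \<le> n" for \<phi> N n
   using K(3)[OF that(2)] X[of n] that(1) not_in_supp[of "X n" \<phi>] by blast
  have psum: "(\<lambda>n. a n * norm (\<phi> (X n))) sums (\<Sum>n<N. a n * norm (\<phi> (X n)))" if "supp \<phi> \<subseteq> K N" for \<phi> N
   by (rule sums_finite) (use fin[OF that] in \<open>auto simp: not_less\<close>)
  have sm: "summable (\<lambda>n. a n * norm (\<phi> (X n)))" if \<phi>: "\<phi> \<in> test_functions \<Omega>" for \<phi>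
   using K(4)[OF test_functionsD(2,3)[OF \<phi>]] psum sums_summable by blast
  have "continuous_seminorm \<Omega> p" unfolding continuous_seminorm_def
  proof (intro conjI ballI allI)
   fix \<phi> assume \<phi>: "\<phi> \<in> test_functions \<Omega>"
   show "0 \<le> p \<phi>" unfolding p_def by (rule suminf_nonneg[OF sm[OF \<phi>]]) (simp add: a0)
   show "p (\<lambda>x. c * \<phi> x) = norm c * p \<phi>" for c
    unfolding p_def using suminf_mult[OF sm[OF \<phi>], of "norm c"] by (simp add: norm_mult mult_ac)
   fix \<psi> assume \<psi>: "\<psi> \<in> test_functions \<Omega>"
   have "p (\<lambda>x. \<phi> x + \<psi> x) \<le> (\<Sum>n. a n * norm (\<phi> (X n)) + a n * norm (\<psi> (X n)))"
    unfolding p_def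
   proof (rule suminf_le)
    show "a n * norm (\<phi> (X n) + \<psi> (X n)) \<le> a n * norm (\<phi> (X n)) + a n * norm (\<psi> (X n))" for n
     using mult_left_mono[OF norm_triangle_ineq a0] by (simp add: distrib_left)
   qed (use sm[OF test_functions_add_cmult(1)[OF \<phi> \<psi>]] summable_add[OF sm[OF \<phi>] sm[OF \<psi>]] in auto)
   also have "\<dots> = p \<phi> + p \<psi>" unfolding p_def by (rule suminf_add[OF sm[OF \<phi>] sm[OF \<psi>], symmetric])
   finally show "p (\<lambda>x. \<phi> x + \<psi> x) \<le> p \<phi> + p \<psi>" .
  next
   show "continuous_on_compact_supports \<Omega> p"
    unfolding continuous_on_compact_supports_def
   proof (intro allI impI)
    fix L assume L: "compact L \<and> L \<subseteq> \<Omega>"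
    then obtain N where N: "L \<subseteq> K N" using K(4) by blast
    have "p \<phi> \<le> (\<Sum>n<N. a n) * Ck_norm 0 \<phi>" if \<phi>: "\<phi> \<in> test_functions \<Omega>" "supp \<phi> \<subseteq> L" for \<phi>
    proof -
     have "p \<phi> = (\<Sum>n<N. a n * norm (\<phi> (X n)))"
      unfolding p_def using psum[of \<phi> N] N \<phi>(2) sums_unique by (metis subset_trans)
     also have "\<dots> \<le> (\<Sum>n<N. a n * Ck_norm 0 \<phi>)"
     proof (intro sum_mono mult_left_mono a0)
      fix n
      obtain D where "\<And>x. norm (iter_deriv [] \<phi> x) \<le> D"
       by (rule iter_deriv_bounded[OF \<phi>(1), of "[]"]) (auto intro: that)
      then have "norm (\<phi> (X n)) \<le> (SUP x. norm (\<phi> x))"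
       by (intro cSUP_upper) (auto intro!: bdd_aboveI)
      also have "\<dots> \<le> Ck_norm 0 \<phi>" using SUP_iter_deriv_le_Ck_norm[OF \<phi>(1), of "[]"] by simp
      finally show "norm (\<phi> (X n)) \<le> Ck_norm 0 \<phi>" .
     qed
     finally show ?thesis by (simp add: sum_distrib_right)
    qed
    then show "\<exists>C m. \<forall>\<phi>\<in>test_functions \<Omega>. supp \<phi> \<subseteq> L --> p \<phi> \<le> C * Ck_norm m \<phi>" by blast
   qed
  qed
  from Bp[OF this] obtain C where C: "\<forall>\<phi>\<in>B. p \<phi> \<le> C" by (auto simp: bdd_above_def)
  obtain n where n: "C < real n" using reals_Archimedean2 by blast
  have "real n = a n * norm (\<Phi> n (X n))" using nz[of n] by (simp add: a_def)
  also have "\<dots> = (\<Sum>k\<in>{n}. a k * norm (\<Phi> n (X k)))" by simp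
  also have "\<dots> \<le> p (\<Phi> n)" unfolding p_def
   by (rule sum_le_suminf[OF sm]) (use Bt \<Phi> a0 in auto)
  also have "\<dots> \<le> C" using C \<Phi> by blast
  finally show False using n by simp
 qed
 then obtain n where "\<forall>\<phi>\<in>B. \<forall>x. x \<notin> K n --> \<phi> x = 0" by blast
 ultimately have "test_family (K n) B (\<lambda>\<phi>. \<phi>)" by (simp add: test_family_def)
 then show thesis by (rule that[OF K(1,2)])
qed

section \<open>Linear operations on distributions\<close>

lemma distribution_add:
 "u \<in> distributions \<Omega> ==> \<phi> \<in> test_functions \<Omega> ==> \<psi> \<in> test_functions \<Omega> ==> u (\<lambda>x. \<phi> x + \<psi> x) = u \<phi> + u \<psi>"
 by (simp add: distributions_def)

lemma distribution_cmult:
 "u \<in> distributions \<Omega> ==> \<phi> \<in> test_functions \<Omega> ==> u (\<lambda>x. c * \<phi> x) = c * u \<phi>"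
 by (simp add: distributions_def)

lemma distribution_diff:
 assumes "u \<in> distributions \<Omega>" "\<phi> \<in> test_functions \<Omega>" "\<psi> \<in> test_functions \<Omega>"
 shows "u (\<lambda>x. \<phi> x - \<psi> x) = u \<phi> - u \<psi>"
proof -
 have "u (\<lambda>x. \<phi> x + (-1) * \<psi> x) = u \<phi> + u (\<lambda>x. (-1) * \<psi> x)"
  by (rule distribution_add[OF assms(1,2) test_functions_add_cmult(2)[OF assms(3,3)]])
 also have "u (\<lambda>x. (-1) * \<psi> x) = (-1) * u \<psi>" by (rule distribution_cmult[OF assms(1,3)])
 finally show ?thesis by simp
qed

lemma zero_test_function: "(\<lambda>x. 0) \<in> test_functions \<Omega>"
proof -
 have "bdd_family UNIV {()} (\<lambda>_ x. 0 :: complex)" by (rule bdd_family_const[of _ _ 0]) simp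
 then show ?thesis
  by (intro test_functionsI[of "{}"] bdd_family_imp_smooth_on[of UNIV "{()}" "\<lambda>_ x. 0" "()"]) auto
qed

lemma distribution_zero:
 assumes "u \<in> distributions \<Omega>"
 shows "u (\<lambda>x. 0) = 0"
 using distribution_cmult[OF assms zero_test_function, of 0] by simp

lemma distribution_sum:
 assumes u: "u \<in> distributions \<Omega>" and "finite F" "\<And>m. m \<in> F ==> \<psi> m \<in> test_functions \<Omega>"
 shows "u (\<lambda>x. \<Sum>m\<in>F. c m * \<psi> m x) = (\<Sum>m\<in>F. c m * u (\<psi> m)) \<and> (\<lambda>x. \<Sum>m\<in>F. c m * \<psi> m x) \<in> test_functions \<Omega>"
 using assms(2,3)
proof (induction F rule: finite_induct)
 case empty
 show ?case using distribution_zero[OF u] zero_test_function by simp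
next
 case (insert k F)
 then have t: "(\<lambda>x. c k * \<psi> k x) \<in> test_functions \<Omega>" by (intro test_functions_add_cmult(2)) auto
 have IH: "u (\<lambda>x. \<Sum>m\<in>F. c m * \<psi> m x) = (\<Sum>m\<in>F. c m * u (\<psi> m))" "(\<lambda>x. \<Sum>m\<in>F. c m * \<psi> m x) \<in> test_functions \<Omega>"
  using insert by auto
 show ?case using distribution_add[OF u t IH(2)] test_functions_add_cmult(1)[OF t IH(2)] insert
   distribution_cmult[OF u, of "\<psi> k" "c k"] IH(1) by simp
qed

section \<open>Fourier series seen through a distribution\<close>

lemma has_sum_tail_bound:
 fixes f :: "'a => complex" and G :: "'a => real"
 assumes "(f has_sum S) A" "(G has_sum T) A" "\<And>m. m \<in> A ==> norm (f m) \<le> M * G m" "finite F" "F \<subseteq> A"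
 shows "norm (S - sum f F) \<le> M * (T - sum G F)"
proof (rule norm_infsum_le)
 show "(f has_sum S - sum f F) (A - F)" by (rule has_sum_Diff[OF assms(1) _ assms(5)]) (use assms(4) in simp)
 have "(G has_sum T - sum G F) (A - F)" by (rule has_sum_Diff[OF assms(2) _ assms(5)]) (use assms(4) in simp)
 then show "((\<lambda>m. M * G m) has_sum M * (T - sum G F)) (A - F)" by (rule has_sum_cmult_right)
qed (use assms(3) in auto)

definition lattice_weight :: "'a::euclidean_space => real" where
 "lattice_weight m = inverse ((1 + norm m) ^ (2 * DIM('a)))"

lemma lattice_weight_pos: "0 < lattice_weight m"
 by (simp add: lattice_weight_def add_pos_nonneg)

lemma lattice_weight_has_sum:
 "((lattice_weight :: 'a::euclidean_space => real) has_sum infsum (lattice_weight :: 'a => real) int_lattice) int_lattice"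
 by (rule has_sum_infsum) (simp add: lattice_weight_def[abs_def] lattice_summable)

lemma le_lattice_weight:
 fixes m :: "'a::euclidean_space"
 assumes "(1 + norm m) ^ (2 * DIM('a)) * a \<le> C" shows "a \<le> C * lattice_weight m"
proof -
 have "0 < (1 + norm m) ^ (2 * DIM('a))" by (intro zero_less_power add_pos_nonneg) auto
 then show ?thesis using assms unfolding lattice_weight_def by (simp add: divide_inverse[symmetric] pos_le_divide_eq mult.commute)
qed

text \<open>The constant for the lattice of spacing 1/R; the extra factor is the Jacobian of the
  dilation by \<open>R\<close>.\<close>

definition series_const :: "real => 'a::euclidean_space itself => complex" where
 "series_const R _ = complex_of_real (inverse (R ^ DIM('a))) * fourier_const TYPE('a)"

lemma integral_scale:
 fixes F :: "'a::euclidean_space => complex"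
 assumes "R > 0" "F \<in> borel_measurable borel"
 shows "(LINT x|lborel. F x) = complex_of_real (R ^ DIM('a)) * (LINT x|lborel. F (R *\<^sub>R x))"
proof -
 have "(LINT x|lborel. F x) = (LINT x|density (distr lborel borel (\<lambda>x. 0 + R *\<^sub>R x)) (\<lambda>_. ennreal (\<bar>R\<bar> ^ DIM('a))). F x)"
  using lborel_affine[of R "0::'a"] assms(1) by simp
 also have "\<dots> = (LINT x|distr lborel borel (\<lambda>x. 0 + R *\<^sub>R x). R ^ DIM('a) *\<^sub>R F x)"
  using assms by (subst integral_density) auto
 also have "\<dots> = (LINT x|lborel. R ^ DIM('a) *\<^sub>R F (0 + R *\<^sub>R x))"
  using assms by (intro integral_distr) auto
 finally show ?thesis by (simp add: scaleR_conv_of_real)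
qed

text \<open>Shrinking by the factor \<open>R\<close> brings a support within distance 3R of the
  point of evaluation into the range of \<open>fourier_series\<close>; frequencies shrink
  accordingly.\<close>

lemma fourier_series_scaled:
 fixes \<phi> :: "'a::euclidean_space => complex"
 assumes R: "1 \<le> R" and K: "compact K" "K \<subseteq> ball y (3 * R)" and \<phi>: "test_fun K \<phi>"
 shows "((\<lambda>m. series_const R TYPE('a) * (fhat \<phi> (m /\<^sub>R R) * osc (m /\<^sub>R R) y)) has_sum \<phi> y) int_lattice"
proof -
 define \<Phi> where "\<Phi> x = \<phi> (R *\<^sub>R x)" for x
 have Kc: "compact ((\<lambda>x. x /\<^sub>R R) ` K)"
  by (rule compact_continuous_image[OF _ K(1)]) (intro continuous_intros)
 have sub: "(\<lambda>x. x /\<^sub>R R) ` K \<subseteq> ball (y /\<^sub>R R) 3"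
 proof
  fix z assume "z \<in> (\<lambda>x. x /\<^sub>R R) ` K"
  then obtain x where x: "x \<in> K" "z = x /\<^sub>R R" by blast
  have "dist (y /\<^sub>R R) z = dist y x / R" using R x(2)
   by (simp add: dist_norm scaleR_diff_right[symmetric] divide_inverse mult.commute)
  also have "\<dots> < 3" using x(1) K(2) R by (auto simp: pos_divide_less_eq)
  finally show "z \<in> ball (y /\<^sub>R R) 3" by simp
 qed
 \<comment> \<open>\<open>bdd_family_affine\<close> covers factors of modulus at most 1. Here the
   factor is \<open>R\<close>, and its powers are absorbed because a single function is dilated by a
   fixed amount.\<close>
 have dil: "bdd_family UNIV {()} (\<lambda>_ x. \<phi>' (R *\<^sub>R x))" if "bdd_family UNIV {()} (\<lambda>_. \<phi>')" for \<phi>' :: "'a => complex"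
 proof (rule bdd_family_coinduct[where R = "\<lambda>h. \<exists>\<phi>. bdd_family UNIV {()} (\<lambda>_. \<phi>) \<and> h = (\<lambda>_ x. \<phi> (R *\<^sub>R x))"])
  fix h :: "unit => 'a => complex" assume "\<exists>\<phi>. bdd_family UNIV {()} (\<lambda>_. \<phi>) \<and> h = (\<lambda>_ x. \<phi> (R *\<^sub>R x))"
  then obtain \<phi> where \<phi>: "bdd_family UNIV {()} (\<lambda>_. \<phi>)" and h: "h = (\<lambda>_ x. \<phi> (R *\<^sub>R x))" by blast
  have d: "\<phi> differentiable (at x)" for x using bdd_family_differentiable[OF \<phi>] by simp
  obtain C where "C > 0" "\<And>i x. i \<in> {()} ==> x \<in> UNIV ==> norm (\<phi> x) \<le> C"
   by (rule bdd_family_bound[OF \<phi>]) (erule that, assumption)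
  then show "\<exists>C. \<forall>i\<in>{()}. \<forall>x\<in>UNIV. norm (h i x) \<le> C" unfolding h by blast
  obtain b0 :: 'a where b0: "b0 \<in> Basis" using nonempty_Basis by blast
  show "h i differentiable (at x)" if "i \<in> {()}" for i x
   using partial_affine(1)[of \<phi> R x 0 b0] d b0 by (simp add: h)
  fix b :: 'a assume b: "b \<in> Basis"
  have "bdd_family UNIV {()} (\<lambda>_ x. complex_of_real R * partial b \<phi> x)"
   by (intro bdd_family_cmult bdd_family_partial[OF \<phi> b]) simp
  moreover have "partial b (h i) x = complex_of_real R * partial b \<phi> (R *\<^sub>R x)" for i x
   using partial_affine(2)[of \<phi> R x 0 b] d b by (simp add: h)
  ultimately show "\<exists>g. (\<exists>\<phi>. bdd_family UNIV {()} (\<lambda>_. \<phi>) \<and> g = (\<lambda>_ x. \<phi> (R *\<^sub>R x))) \<and>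
    (\<forall>i\<in>{()}. \<forall>x\<in>UNIV. partial b (h i) x = g i x)"
   by (intro exI[of _ "\<lambda>_ x. complex_of_real R * partial b \<phi> (R *\<^sub>R x)"] conjI
     exI[of _ "\<lambda>x. complex_of_real R * partial b \<phi> x"] refl) auto
 qed (use that in auto)
 have "\<Phi> x = 0" if "x \<notin> (\<lambda>x. x /\<^sub>R R) ` K" for x
 proof -
  have "R *\<^sub>R x \<notin> K"
  proof
   assume "R *\<^sub>R x \<in> K"
   then have "(R *\<^sub>R x) /\<^sub>R R \<in> (\<lambda>x. x /\<^sub>R R) ` K" by (rule imageI)
   then show False using that R by simp
  qed
  then show ?thesis using test_family_0[OF \<phi>, of "()"] by (simp add: \<Phi>_def)
 qed
 then have \<Phi>: "test_fun ((\<lambda>x. x /\<^sub>R R) ` K) \<Phi>"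
  using dil[of \<phi>] \<phi> by (simp add: test_family_def \<Phi>_def[abs_def])
 have fh: "fhat \<Phi> m = complex_of_real (inverse (R ^ DIM('a))) * fhat \<phi> (m /\<^sub>R R)" for m
 proof -
  let ?F = "\<lambda>x. \<phi> x * iexp ((m /\<^sub>R R) \<bullet> x)"
  have "?F \<in> borel_measurable borel"
   using test_family_continuous[OF \<phi>, of "()"] by (intro borel_measurable_continuous_onI continuous_intros) simp
  from integral_scale[OF _ this, of R]
  have "fhat \<phi> (m /\<^sub>R R) = complex_of_real (R ^ DIM('a)) * (LINT x|lborel. ?F (R *\<^sub>R x))"
   using R by (simp add: fhat_def)
  also have "(LINT x|lborel. ?F (R *\<^sub>R x)) = fhat \<Phi> m"
  proof -
   have "(m /\<^sub>R R) \<bullet> (R *\<^sub>R x) = m \<bullet> x" for x using R by (simp add: mult.assoc[symmetric])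
   then show ?thesis unfolding fhat_def \<Phi>_def by (simp only:)
  qed
  finally show ?thesis using R by simp
 qed
 from fourier_series[OF Kc sub \<Phi>] show ?thesis
  using R by (simp add: fh series_const_def \<Phi>_def mult_ac)
qed

text \<open>The remainder after the frequencies in \<open>F\<close>, divided by any bound
  \<open>w\<close> for the tail of \<open>lattice_weight\<close>, is bounded uniformly in
  \<open>F\<close> and \<open>w\<close>. Its derivative is the same remainder for the derivative of
  \<open>h\<close>, so coinduction gives all orders. A distribution therefore sends the remainder,
  after cutoff, to O(w).\<close>

lemma fourier_series_remainder_family:
 fixes h :: "'a::euclidean_space => complex"
 assumes R: "1 \<le> R" and K: "compact K" "K \<subseteq> ball y0 (2 * R)" and h: "test_fun K h"
 defines "T \<equiv> infsum (lattice_weight :: 'a => real) int_lattice"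
 shows "bdd_family (ball y0 R) {(F, w). finite F \<and> F \<subseteq> int_lattice \<and> 0 < w \<and> T - sum lattice_weight F \<le> w}
  (\<lambda>(F, w) y. complex_of_real (inverse w) *
   (h y + (\<Sum>m\<in>F. - (series_const R TYPE('a) * fhat h (m /\<^sub>R R)) * osc (m /\<^sub>R R) y)))"
proof -
 define c where "c = series_const R TYPE('a)"
 define J where "J = {(F, w). finite F \<and> F \<subseteq> (int_lattice :: 'a set) \<and> 0 < w \<and> T - sum lattice_weight F \<le> w}"
 define r where "r h = (\<lambda>(F, w) y. complex_of_real (inverse w) *
   (h y + (\<Sum>m\<in>F. - (c * fhat h (m /\<^sub>R R)) * osc (m /\<^sub>R R) y)))" for h :: "'a => complex"
 have "bdd_family (ball y0 R) J (r h)"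
 proof (rule bdd_family_coinduct[where R = "\<lambda>g. \<exists>h. test_fun K h \<and> g = r h"])
  fix g assume "\<exists>h. test_fun K h \<and> g = r h"
  then obtain h where h: "test_fun K h" and g: "g = r h" by blast
  obtain C' where C': "C' > 0" "\<And>i m. i \<in> {()} ==> (1 + norm m) ^ (2 * DIM('a)) * norm (fhat h m) \<le> C'"
   by (rule fhat_decay[OF K(1) h, of "2 * DIM('a)"]) (erule that, assumption)
  \<comment> \<open>The power of \<open>R\<close> pays for comparing 1 + |m| with 1 + |m/R|.\<close>
  define C where "C = R ^ (2 * DIM('a)) * C'"
  have C: "C > 0" "(1 + norm m) ^ (2 * DIM('a)) * norm (fhat h (m /\<^sub>R R)) \<le> C" for m
  proof -
   show "C > 0" unfolding C_def using R C'(1) by (intro mult_pos_pos zero_less_power) auto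
   have "1 + norm m \<le> R * (1 + norm (m /\<^sub>R R))" using R by (simp add: distrib_left mult.assoc[symmetric])
   then have "(1 + norm m) ^ (2 * DIM('a)) \<le> R ^ (2 * DIM('a)) * (1 + norm (m /\<^sub>R R)) ^ (2 * DIM('a))"
    unfolding power_mult_distrib[symmetric] by (intro power_mono) auto
   then have "(1 + norm m) ^ (2 * DIM('a)) * norm (fhat h (m /\<^sub>R R)) \<le>
     R ^ (2 * DIM('a)) * (1 + norm (m /\<^sub>R R)) ^ (2 * DIM('a)) * norm (fhat h (m /\<^sub>R R))"
    by (rule mult_right_mono) simp
   also have "\<dots> \<le> C" unfolding C_def mult.assoc using C'(2)[of "()" "m /\<^sub>R R"] R by (intro mult_left_mono) auto
   finally show "(1 + norm m) ^ (2 * DIM('a)) * norm (fhat h (m /\<^sub>R R)) \<le> C" .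
  qed
  have "norm (r h p y) \<le> norm c * C" if p: "p \<in> J" and y: "y \<in> ball y0 R" for p y
  proof -
   obtain F w where Fw: "p = (F, w)" "finite F" "F \<subseteq> int_lattice" "0 < w" "T - sum lattice_weight F \<le> w"
    using p by (auto simp: J_def)
   \<comment> \<open>The radii R and 2R around \<open>y0\<close> add up to the range of
     \<open>fourier_series_scaled\<close>.\<close>
   have "K \<subseteq> ball y (3 * R)"
   proof
    fix x assume "x \<in> K"
    then have "dist y0 x < 2 * R" "dist y0 y < R" using K y by auto
    then show "x \<in> ball y (3 * R)" using dist_triangle[of y x y0] by (simp add: dist_commute)
   qed
   note S = fourier_series_scaled[OF R K(1) this h]
   have "norm (h y - sum (\<lambda>m. series_const R TYPE('a) * (fhat h (m /\<^sub>R R) * osc (m /\<^sub>R R) y)) F) \<le>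
     norm c * C * (T - sum lattice_weight F)"
   proof (rule has_sum_tail_bound[OF S])
    show "(lattice_weight has_sum T) (int_lattice :: 'a set)" unfolding T_def by (rule lattice_weight_has_sum)
    fix m :: 'a
    have "norm (fhat h (m /\<^sub>R R)) \<le> C * lattice_weight m" by (rule le_lattice_weight) (use C in auto)
    then show "norm (series_const R TYPE('a) * (fhat h (m /\<^sub>R R) * osc (m /\<^sub>R R) y)) \<le> norm c * C * lattice_weight m"
     by (simp add: norm_mult c_def mult.assoc mult_left_mono)
   qed (use Fw in auto)
   also have "\<dots> \<le> norm c * C * w" using Fw(5) C(1) by (intro mult_left_mono) auto
   finally have "inverse w * norm (h y - sum (\<lambda>m. c * (fhat h (m /\<^sub>R R) * osc (m /\<^sub>R R) y)) F) \<le> inverse w * (norm c * C * w)"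
    using Fw(4) unfolding c_def by (intro mult_left_mono) auto
   also have "inverse w * (norm c * C * w) = norm c * C" using Fw(4) by simp
   finally show ?thesis using Fw(1,4) by (simp add: r_def norm_mult norm_inverse sum_negf mult.assoc)
  qed
  then show "\<exists>C. \<forall>p\<in>J. \<forall>y\<in>ball y0 R. norm (g p y) \<le> C" unfolding g by blast
  have hd: "h differentiable (at y)" for y
   using h bdd_family_differentiable[of UNIV "{()}" "\<lambda>_. h" "()" y] by (simp add: test_family_def)
  have od: "(\<lambda>y. a * osc (m /\<^sub>R R) y) differentiable (at y)" for a and m y :: 'a
   using has_derivative_osc differentiable_def by blast
  have sd: "(\<lambda>y. \<Sum>m\<in>F. a m * osc (m /\<^sub>R R) y) differentiable (at y)" if "finite F" for a F and y :: 'a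
   using that od by (intro differentiable_sum) auto
  show "g p differentiable (at y)" if p: "p \<in> J" "y \<in> ball y0 R" for p y
  proof -
   obtain F w where Fw: "p = (F, w)" "finite F" using p(1) by (auto simp: J_def)
   show ?thesis unfolding g r_def Fw(1) prod.case
    by (intro differentiable_mult differentiable_const differentiable_add hd sd Fw(2))
  qed
  fix b :: 'a assume b: "b \<in> Basis"
  have "partial b (r h p) y = r (partial b h) p y" if p: "p \<in> J" for p y
  proof -
   obtain F w where Fw: "p = (F, w)" "finite F" using p by (auto simp: J_def)
   have 1: "partial b (\<lambda>y. \<Sum>m\<in>F. - (c * fhat h (m /\<^sub>R R)) * osc (m /\<^sub>R R) y) y =
     (\<Sum>m\<in>F. - (c * fhat (partial b h) (m /\<^sub>R R)) * osc (m /\<^sub>R R) y)"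
    by (subst partial_sum[OF od], rule sum.cong[OF refl], subst partial_eqI[OF has_derivative_osc])
     (simp only: fhat_partial[OF K(1) h b] mult_ac mult_minus_left mult_minus_right)
   have "partial b (\<lambda>y. complex_of_real (inverse w) * (h y + (\<Sum>m\<in>F. - (c * fhat h (m /\<^sub>R R)) * osc (m /\<^sub>R R) y))) y =
     complex_of_real (inverse w) * partial b (\<lambda>y. h y + (\<Sum>m\<in>F. - (c * fhat h (m /\<^sub>R R)) * osc (m /\<^sub>R R) y)) y"
    by (subst partial_mult[OF differentiable_const differentiable_add[OF hd sd[OF Fw(2)]]]) simp
   also have "partial b (\<lambda>y. h y + (\<Sum>m\<in>F. - (c * fhat h (m /\<^sub>R R)) * osc (m /\<^sub>R R) y)) y =
     partial b h y + (\<Sum>m\<in>F. - (c * fhat (partial b h) (m /\<^sub>R R)) * osc (m /\<^sub>R R) y)"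
    by (subst partial_add[OF hd sd[OF Fw(2)]]) (simp only: 1)
   finally show ?thesis unfolding r_def Fw(1) prod.case .
  qed
  then show "\<exists>g'. (\<exists>h. test_fun K h \<and> g' = r h) \<and> (\<forall>p\<in>J. \<forall>y\<in>ball y0 R. partial b (g p) y = g' p y)"
   using test_family_partial[OF compact_imp_closed[OF K(1)] h b] unfolding g
   by (intro exI[of _ "r (partial b h)"] conjI exI[of _ "partial b h"]) auto
 qed (use h in auto)
 then show ?thesis by (simp add: r_def J_def c_def)
qed

lemma test_family_single:
 assumes "test_fun K \<theta>"
 shows "test_family K I (\<lambda>_. \<theta>)"
proof -
 have "(\<lambda>_. ()) ` I \<subseteq> {()}" by auto
 from test_family_reindex[OF assms this] show ?thesis .
qed

lemma test_family_osc:
 fixes \<theta> :: "'a::euclidean_space => complex"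
 assumes L: "compact L" and \<theta>: "test_fun L \<theta>"
  and w: "\<And>N. \<exists>C. \<forall>i\<in>I. norm (w i) * (1 + norm (k i)) ^ N \<le> C"
 shows "test_family L I (\<lambda>i y. w i * (\<theta> y * osc (k i) y))"
proof -
 have "test_family L I (\<lambda>i. \<theta>)" by (rule test_family_single[OF \<theta>])
 from test_family_mult[OF open_UNIV bdd_family_osc[OF open_UNIV w] this compact_imp_closed[OF L] subset_UNIV]
 show ?thesis by (simp add: mult_ac)
qed

text \<open>The cut off remainders, divided by their tail weights, form a test family. Continuity of
  \<open>u\<close> bounds their images by one constant \<open>C\<close>, so the partial sums differ
  from the value by at most \<open>C * w\<close>, and \<open>w\<close> can be made arbitrarily
  small.\<close>

theorem distribution_fourier_series:
 fixes h \<theta> :: "'a::euclidean_space => complex"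
 assumes R: "1 \<le> R" and u: "u \<in> distributions \<Omega>" and L: "compact L" "L \<subseteq> \<Omega>" "L \<subseteq> ball y0 R" and \<theta>: "test_fun L \<theta>"
  and K: "compact K" "K \<subseteq> ball y0 (2 * R)" and h: "test_fun K h"
 shows "((\<lambda>m. series_const R TYPE('a) * (fhat h (m /\<^sub>R R) * local_fourier u \<theta> (m /\<^sub>R R))) has_sum u (\<lambda>y. \<theta> y * h y)) int_lattice"
proof -
 define c where "c = series_const R TYPE('a)"
 define T where "T = infsum (lattice_weight :: 'a => real) int_lattice"
 define J where "J = {(F, w). finite F \<and> F \<subseteq> (int_lattice :: 'a set) \<and> 0 < w \<and> T - sum lattice_weight F \<le> w}"
 define r where "r = (\<lambda>(F, w) y. complex_of_real (inverse w) *
   (h y + (\<Sum>m\<in>F. - (c * fhat h (m /\<^sub>R R)) * osc (m /\<^sub>R R) y)))"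
 have "bdd_family (ball y0 R) J r"
  using fourier_series_remainder_family[OF R K h] by (simp add: J_def r_def c_def T_def)
 moreover have "test_family L J (\<lambda>_. \<theta>)" by (rule test_family_single[OF \<theta>])
 ultimately have fam: "test_family L J (\<lambda>p y. r p y * \<theta> y)"
  by (rule test_family_mult[OF open_ball _ _ compact_imp_closed[OF L(1)] L(3)])
 obtain C where C: "C > 0" "\<And>p. p \<in> J ==> norm (u (\<lambda>y. r p y * \<theta> y)) \<le> C"
  by (rule distribution_family_bound[OF u L(1,2) fam]) (erule that, assumption)
 have \<theta>h: "(\<lambda>y. \<theta> y * h y) \<in> test_functions \<Omega>"
 proof -
  have "test_fun L (\<lambda>y. h y * \<theta> y)"
   by (rule test_family_mult[OF open_UNIV _ \<theta> compact_imp_closed[OF L(1)] subset_UNIV]) (use h in \<open>simp add: test_family_def\<close>)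
  from test_family_test_functions(1)[OF L(1,2) this, of "()"] show ?thesis by (simp add: mult.commute)
 qed
 have \<theta>e: "(\<lambda>y. \<theta> y * osc m y) \<in> test_functions \<Omega>" for m
  using test_family_test_functions(1)[OF L(1,2) test_family_osc[OF L(1) \<theta>, of "{()}" "\<lambda>_. 1" "\<lambda>_. m"], of "()"] by auto
 have est: "norm (u (\<lambda>y. \<theta> y * h y) - (\<Sum>m\<in>F. c * (fhat h (m /\<^sub>R R) * local_fourier u \<theta> (m /\<^sub>R R)))) \<le> C * w" if p: "(F, w) \<in> J" for F w
 proof -
  have F: "finite F" "0 < w" using p by (auto simp: J_def)
  have "(\<lambda>y. r (F, w) y * \<theta> y) = (\<lambda>y. complex_of_real (inverse w) * (\<theta> y * h y -
    (\<Sum>m\<in>F. (c * fhat h (m /\<^sub>R R)) * (\<theta> y * osc (m /\<^sub>R R) y))))"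
   by (rule ext) (simp add: r_def sum_negf sum_distrib_left sum_distrib_right algebra_simps)
  moreover have S: "u (\<lambda>y. \<Sum>m\<in>F. (c * fhat h (m /\<^sub>R R)) * (\<theta> y * osc (m /\<^sub>R R) y)) =
    (\<Sum>m\<in>F. c * (fhat h (m /\<^sub>R R) * local_fourier u \<theta> (m /\<^sub>R R)))"
   "(\<lambda>y. \<Sum>m\<in>F. (c * fhat h (m /\<^sub>R R)) * (\<theta> y * osc (m /\<^sub>R R) y)) \<in> test_functions \<Omega>"
   using distribution_sum[where \<psi> = "\<lambda>m y. \<theta> y * osc (m /\<^sub>R R) y" and
     c = "\<lambda>m. c * fhat h (m /\<^sub>R R)", OF u F(1) \<theta>e] by (simp_all add: local_fourier_def mult.assoc)
  moreover have d: "(\<lambda>y. \<theta> y * h y - (\<Sum>m\<in>F. (c * fhat h (m /\<^sub>R R)) * (\<theta> y * osc (m /\<^sub>R R) y))) \<in> test_functions \<Omega>"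
   using test_functions_add_cmult(1)[OF \<theta>h test_functions_add_cmult(2)[OF S(2) S(2), of "-1"]] by simp
  ultimately have "u (\<lambda>y. r (F, w) y * \<theta> y) = complex_of_real (inverse w) *
    (u (\<lambda>y. \<theta> y * h y) - (\<Sum>m\<in>F. c * (fhat h (m /\<^sub>R R) * local_fourier u \<theta> (m /\<^sub>R R))))"
   using distribution_cmult[OF u d, of "complex_of_real (inverse w)"] distribution_diff[OF u \<theta>h S(2)] by simp
  then have "inverse w * norm (u (\<lambda>y. \<theta> y * h y) - (\<Sum>m\<in>F. c * (fhat h (m /\<^sub>R R) * local_fourier u \<theta> (m /\<^sub>R R)))) \<le> C"
   using C(2)[OF p] F(2) by (simp add: norm_mult norm_inverse)
  then show ?thesis using F(2) by (simp add: field_simps)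
 qed
 have "((\<lambda>m. c * (fhat h (m /\<^sub>R R) * local_fourier u \<theta> (m /\<^sub>R R))) has_sum u (\<lambda>y. \<theta> y * h y)) int_lattice"
  unfolding has_sum_def
 proof (rule tendstoI)
  fix \<epsilon> :: real assume \<epsilon>: "0 < \<epsilon>"
  \<comment> \<open>Half of what is allowed, so that the final inequality is strict.\<close>
  define w where "w = \<epsilon> / (2 * C)"
  have w: "0 < w" "C * w < \<epsilon>" using \<epsilon> C(1) by (auto simp: w_def)
  have "(sum lattice_weight \<longlongrightarrow> T) (finite_subsets_at_top (int_lattice :: 'a set))"
   using lattice_weight_has_sum unfolding has_sum_def T_def .
  from tendstoD[OF this w(1)]
  have "\<forall>\<^sub>F F in finite_subsets_at_top (int_lattice :: 'a set). dist (sum lattice_weight F) T < w" .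
  moreover have "\<forall>\<^sub>F F in finite_subsets_at_top (int_lattice :: 'a set). finite F \<and> F \<subseteq> int_lattice"
   by (rule eventually_finite_subsets_at_top_weakI) auto
  ultimately show "\<forall>\<^sub>F F in finite_subsets_at_top int_lattice.
    dist (\<Sum>m\<in>F. c * (fhat h (m /\<^sub>R R) * local_fourier u \<theta> (m /\<^sub>R R))) (u (\<lambda>y. \<theta> y * h y)) < \<epsilon>"
  proof eventually_elim
   case (elim F)
   then have "(F, w) \<in> J" using w by (auto simp: J_def dist_real_def)
   from est[OF this] show ?case using w(2) by (simp add: dist_norm norm_minus_commute)
  qed
 qed
 then show ?thesis by (simp add: c_def)
qed

section \<open>Oscillatory integrals\<close>

lemma bdd_family_single:
 assumes "bdd_family U {()} (\<lambda>_. g)"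
 shows "bdd_family U I (\<lambda>_. g)"
proof -
 have "(\<lambda>_. ()) ` I \<subseteq> {()}" by auto
 from bdd_family_reindex[OF assms this order_refl] show ?thesis .
qed

lemma inner_pull_covector: "f differentiable (at x) ==> pull_covector f x \<eta> \<bullet> v = \<eta> \<bullet> frechet_derivative f (at x) v"
proof -
 assume "f differentiable (at x)"
 then have "(f has_derivative (\<lambda>h. jacobian f (at x) *v h)) (at x)" by (simp add: jacobian_works)
 from frechet_derivative_at[OF this] have "frechet_derivative f (at x) v = jacobian f (at x) *v v" by metis
 then show ?thesis by (simp add: pull_covector_def dot_lmul_matrix)
qed

text \<open>The kernel of the localised pull-back in frequency variables: \<eta> is a frequency on
  the target of \<open>f\<close>, and \<open>k\<close> one on its source.\<close>

definition osc_integral :: "(real^'m => real^'n) => (real^'m => complex) => real^'n => real^'m => complex" where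
 "osc_integral f \<psi> \<eta> k = (LINT x|lborel. \<psi> x * iexp (\<eta> \<bullet> f x - k \<bullet> x))"

text \<open>Boundedness of all derivatives of \<open>f\<close>, expressed through its components
  because bounded families are complex valued.\<close>

definition bdd_map :: "(real^'m) set => (real^'m => real^'n) => bool" where
 "bdd_map U f \<longleftrightarrow> (\<forall>x\<in>U. f differentiable (at x)) \<and>
   (\<forall>j. bdd_family U {()} (\<lambda>_ x. complex_of_real (f x $ j)))"

lemma partial_component:
 assumes "f differentiable (at x)"
 shows "partial b (\<lambda>x. complex_of_real (f x $ j)) x = complex_of_real (frechet_derivative f (at x) b $ j)"
proof -
 have "((\<lambda>y. f y $ j) has_derivative (\<lambda>h. frechet_derivative f (at x) h $ j)) (at x)"
  using bounded_linear.has_derivative[OF bounded_linear_vec_nth has_derivative_differentiable[OF assms]] .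
 from partial_eqI[OF has_derivative_of_real[OF this]] show ?thesis .
qed

lemma pull_covector_bound:
 fixes f :: "real^'m => real^'n"
 assumes "bdd_map U f"
 obtains A where "A \<ge> 1" "\<And>x \<eta>. x \<in> U ==> norm (pull_covector f x \<eta>) \<le> A * norm \<eta>"
proof -
 have "\<exists>C. \<forall>x\<in>U. \<bar>frechet_derivative f (at x) b $ j\<bar> \<le> C" if b: "b \<in> Basis" for b j
 proof -
  have "bdd_family U {()} (\<lambda>_ x. complex_of_real (f x $ j))" using assms by (simp add: bdd_map_def)
  then obtain C where "C > 0" "\<And>i x. i \<in> {()} ==> x \<in> U ==> norm (partial b (\<lambda>x. complex_of_real (f x $ j)) x) \<le> C"
   by (rule bdd_family_bound[OF bdd_family_partial[OF _ b]]) (erule that, assumption)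
  then have "\<forall>x\<in>U. \<bar>frechet_derivative f (at x) b $ j\<bar> \<le> C" using assms by (simp add: bdd_map_def partial_component)
  then show ?thesis ..
 qed
 then obtain C where C: "\<And>b j x. b \<in> Basis ==> x \<in> U ==> \<bar>frechet_derivative f (at x) b $ j\<bar> \<le> C b j" by metis
 define A where "A = 1 + (\<Sum>b\<in>(Basis :: (real^'m) set). \<Sum>j\<in>(UNIV :: 'n set). \<bar>C b j\<bar>)"
 have "norm (pull_covector f x \<eta>) \<le> A * norm \<eta>" if x: "x \<in> U" for x \<eta>
 proof -
  have "norm (pull_covector f x \<eta>) \<le> (\<Sum>b\<in>Basis. \<bar>pull_covector f x \<eta> \<bullet> b\<bar>)" by (rule norm_le_l1)
  also have "\<dots> \<le> (\<Sum>b\<in>Basis. norm \<eta> * (\<Sum>j\<in>UNIV. \<bar>C b j\<bar>))"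
  proof (rule sum_mono)
   fix b :: "real^'m" assume b: "b \<in> Basis"
   have "\<bar>pull_covector f x \<eta> \<bullet> b\<bar> = \<bar>\<eta> \<bullet> frechet_derivative f (at x) b\<bar>"
    using assms x by (simp add: inner_pull_covector bdd_map_def)
   also have "\<dots> \<le> norm \<eta> * norm (frechet_derivative f (at x) b)" by (rule Cauchy_Schwarz_ineq2)
   also have "norm (frechet_derivative f (at x) b) \<le> (\<Sum>j\<in>UNIV. \<bar>frechet_derivative f (at x) b $ j\<bar>)" by (rule norm_le_l1_cart)
   also have "\<dots> \<le> (\<Sum>j\<in>UNIV. \<bar>C b j\<bar>)" by (rule sum_mono) (rule order_trans[OF C[OF b x] abs_ge_self])
   finally show "\<bar>pull_covector f x \<eta> \<bullet> b\<bar> \<le> norm \<eta> * (\<Sum>j\<in>UNIV. \<bar>C b j\<bar>)" by (simp add: mult_left_mono)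
  qed
  also have "\<dots> \<le> A * norm \<eta>" by (simp add: A_def sum_distrib_left[symmetric] algebra_simps)
  finally show ?thesis .
 qed
 moreover have "A \<ge> 1" by (simp add: A_def sum_nonneg)
 ultimately show thesis using that by blast
qed

lemma osc_integral_bound:
 assumes K: "compact K" and \<psi>: "test_family K I \<psi>"
 obtains C where "C > 0" "\<And>i \<eta> k. i \<in> I ==> norm (osc_integral f (\<psi> i) \<eta> k) \<le> C"
proof -
 have b: "bdd_family UNIV I \<psi>" using \<psi> by (simp add: test_family_def)
 obtain C where C: "C > 0" "\<And>i x. i \<in> I ==> x \<in> UNIV ==> norm (\<psi> i x) \<le> C"
  by (rule bdd_family_bound[OF b]) (erule that, assumption)
 have "norm (osc_integral f (\<psi> i) \<eta> k) \<le> C * measure lborel K" if "i \<in> I" for i \<eta> k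
  unfolding osc_integral_def by (rule norm_integral_compact_support[OF K])
   (use C(2)[OF that] test_family_0[OF \<psi> that] in \<open>auto simp: norm_mult\<close>)
 then have "norm (osc_integral f (\<psi> i) \<eta> k) \<le> C * measure lborel K + 1" if "i \<in> I" for i \<eta> k
  using that by (meson le_add_same_cancel1 order_trans zero_le_one)
 moreover have "0 < C * measure lborel K + 1" using C(1) by (simp add: add_nonneg_pos)
 ultimately show thesis using that by blast
qed

text \<open>The gradient of the phase is the pulled back covector minus \<open>k\<close>. Normalised
  by the total frequency |\<eta>| + |k| it has bounded derivatives, since the components of \<eta>
  and \<open>k\<close> divided by it are at most 1, and on \<open>P\<close> it is bounded below by
  \<open>c\<close>. The case of total frequency 0 is covered by the trivial bound.\<close>

lemma osc_integral_decay:
 fixes f :: "real^'m => real^'n"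
 assumes U: "open U" and K: "compact K" "K \<subseteq> U" and f: "bdd_map U f" and \<psi>: "test_family K I \<psi>" and c: "c > 0"
  and P: "\<And>\<eta> k x. (\<eta>, k) \<in> P ==> x \<in> U ==> c * (norm \<eta> + norm k) \<le> norm (pull_covector f x \<eta> - k)"
 obtains C where "C > 0" "\<And>i \<eta> k. i \<in> I ==> (\<eta>, k) \<in> P ==>
  (1 + (norm \<eta> + norm k)) ^ N * norm (osc_integral f (\<psi> i) \<eta> k) \<le> C"
proof -
 define s :: "'a \<times> (real^'n) \<times> (real^'m) => real" where "s = (\<lambda>(i, \<eta>, k). norm \<eta> + norm k)"
 define J where "J = {p. case p of (i, \<eta>, k) => i \<in> I \<and> (\<eta>, k) \<in> P \<and> 0 < norm \<eta> + norm k}"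
 have sJ: "0 < s p" if "p \<in> J" for p using that by (auto simp: J_def s_def)
 have fam: "test_family K J (\<lambda>p. \<psi> (fst p))"
  by (rule test_family_reindex[OF \<psi>]) (auto simp: J_def)
 define d where "d p b x = (pull_covector f x (fst (snd p)) \<bullet> b - snd (snd p) \<bullet> b) / s p" for p b x
 have fd: "f differentiable (at x)" if "x \<in> U" for x using f that by (simp add: bdd_map_def)
 have "\<exists>C. \<forall>p\<in>J. s p ^ N * norm (LINT x|lborel. \<psi> (fst p) x *
   iexp (fst (snd p) \<bullet> f x - snd (snd p) \<bullet> x)) \<le> C"
 proof (rule nonstationary_phase[OF U K fam sJ, where c = "c\<^sup>2" and d = d])
  fix p x assume p: "p \<in> J" and x: "x \<in> U"
  obtain i \<eta> k where pe: "p = (i, \<eta>, k)" by (cases p)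
  have D: "((\<lambda>x. \<eta> \<bullet> f x - k \<bullet> x) has_derivative (\<lambda>v. \<eta> \<bullet> frechet_derivative f (at x) v - k \<bullet> v)) (at x)"
   by (intro has_derivative_diff has_derivative_inner_right has_derivative_differentiable fd x has_derivative_ident)
  have "s p * (\<Sum>b\<in>Basis. (v \<bullet> b) * d p b x) = \<eta> \<bullet> frechet_derivative f (at x) v - k \<bullet> v" for v
  proof -
   have "s p * (\<Sum>b\<in>Basis. (v \<bullet> b) * d p b x) = (\<Sum>b\<in>Basis. (v \<bullet> b) * ((pull_covector f x \<eta> - k) \<bullet> b))"
    unfolding sum_distrib_left d_def pe using sJ[OF p] by (intro sum.cong) (auto simp: inner_diff_left pe)
   also have "\<dots> = (pull_covector f x \<eta> - k) \<bullet> v" by (simp add: euclidean_inner[of _ v] mult.commute)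
   also have "\<dots> = \<eta> \<bullet> frechet_derivative f (at x) v - k \<bullet> v" by (simp add: inner_diff_left inner_pull_covector[OF fd[OF x]])
   finally show ?thesis .
  qed
  then show "((\<lambda>x. fst (snd p) \<bullet> f x - snd (snd p) \<bullet> x) has_derivative (\<lambda>v. s p * (\<Sum>b\<in>Basis. (v \<bullet> b) * d p b x))) (at x)"
   using D by (simp add: pe)
  have "(\<Sum>b\<in>Basis. (d p b x)\<^sup>2) = (norm (pull_covector f x \<eta> - k) / s p)\<^sup>2"
  proof -
   have "(\<Sum>b\<in>Basis. ((pull_covector f x \<eta> - k) \<bullet> b)\<^sup>2) = (norm (pull_covector f x \<eta> - k))\<^sup>2"
    unfolding power2_norm_eq_inner euclidean_inner[of "pull_covector f x \<eta> - k" "pull_covector f x \<eta> - k"] by (simp add: power2_eq_square)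
   then show ?thesis unfolding d_def by (simp add: power_divide sum_divide_distrib[symmetric] pe inner_diff_left)
  qed
  moreover have "c \<le> norm (pull_covector f x \<eta> - k) / s p"
   using P[of \<eta> k x] p x sJ[OF p] by (simp add: pos_le_divide_eq pe J_def s_def)
  ultimately show "c\<^sup>2 \<le> (\<Sum>b\<in>Basis. (d p b x)\<^sup>2)" using c by (simp add: power_mono)
 next
  fix b :: "real^'m" assume b: "b \<in> Basis"
  define g where "g p x = (\<Sum>j\<in>UNIV. complex_of_real (fst (snd p) $ j / s p) * partial b (\<lambda>x. complex_of_real (f x $ j)) x) -
    complex_of_real ((snd (snd p) \<bullet> b) / s p)" for p x
  have "bdd_family U J g" unfolding g_def
  proof (intro bdd_family_diff bdd_family_sum bdd_family_mult U finite_class.finite_UNIV)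
   show "bdd_family U J (\<lambda>p x. complex_of_real (fst (snd p) $ j / s p))" for j
   proof (rule bdd_family_const[of _ _ 1])
    fix p assume p: "p \<in> J"
    obtain i a k where pe: "p = (i, a, k)" by (cases p)
    have "\<bar>a $ j\<bar> \<le> norm a + norm k" using component_le_norm_cart[of a j] norm_ge_zero[of k] by linarith
    then show "norm (complex_of_real (fst (snd p) $ j / s p)) \<le> 1"
     using sJ[OF p] unfolding norm_of_real by (simp add: pe s_def abs_divide)
   qed
   show "bdd_family U J (\<lambda>p x. complex_of_real ((snd (snd p) \<bullet> b) / s p))"
   proof (rule bdd_family_const[of _ _ 1])
    fix p assume p: "p \<in> J"
    obtain i a k where pe: "p = (i, a, k)" by (cases p)
    have "\<bar>k \<bullet> b\<bar> \<le> norm a + norm k" using Basis_le_norm[OF b, of k] norm_ge_zero[of a] by linarith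
    then show "norm (complex_of_real ((snd (snd p) \<bullet> b) / s p)) \<le> 1"
     using sJ[OF p] unfolding norm_of_real by (simp add: pe s_def abs_divide)
   qed
   have "bdd_family U {()} (\<lambda>_ x. complex_of_real (f x $ j))" for j using f by (simp add: bdd_map_def)
   from bdd_family_single[OF bdd_family_partial[OF this b]]
   show "bdd_family U J (\<lambda>p x. partial b (\<lambda>x. complex_of_real (f x $ j)) x)" for j .
  qed
  moreover have "g p x = complex_of_real (d p b x)" if "p \<in> J" "x \<in> U" for p x
   unfolding g_def d_def inner_pull_covector[OF fd[OF that(2)]] partial_component[OF fd[OF that(2)]] inner_vec_def[of "fst (snd p)"]
   by (simp add: sum_divide_distrib diff_divide_distrib)
  ultimately show "bdd_family U J (\<lambda>p x. complex_of_real (d p b x))"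
   using bdd_family_cong[OF U, of J g "\<lambda>p x. complex_of_real (d p b x)"] by simp
 qed (use c in auto)
 then obtain C1 where C1: "\<And>i \<eta> k. i \<in> I ==> (\<eta>, k) \<in> P ==> 0 < norm \<eta> + norm k ==>
   (norm \<eta> + norm k) ^ N * norm (osc_integral f (\<psi> i) \<eta> k) \<le> C1"
  unfolding J_def s_def osc_integral_def by (auto simp: case_prod_beta)
 obtain C0 where C0: "C0 > 0" "\<And>i \<eta> k. i \<in> I ==> norm (osc_integral f (\<psi> i) \<eta> k) \<le> C0"
  by (rule osc_integral_bound[OF K(1) \<psi>]) (erule that, assumption)
 have "(1 + (norm \<eta> + norm k)) ^ N * norm (osc_integral f (\<psi> i) \<eta> k) \<le> 2 ^ N * (C0 + \<bar>C1\<bar>) + C0"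
  if i: "i \<in> I" and Pk: "(\<eta>, k) \<in> P" for i \<eta> k
 proof (cases "norm \<eta> + norm k = 0")
  case True
  then have "(1 + (norm \<eta> + norm k)) ^ N * norm (osc_integral f (\<psi> i) \<eta> k) \<le> C0" using C0(2)[OF i] by simp
  also have "\<dots> \<le> 2 ^ N * (C0 + \<bar>C1\<bar>) + C0" using C0(1) by simp
  finally show ?thesis .
 next
  case False
  then have pos: "0 < norm \<eta> + norm k" by (metis add_nonneg_nonneg norm_ge_zero order_le_less)
  have "(1 + (norm \<eta> + norm k)) ^ N * norm (osc_integral f (\<psi> i) \<eta> k) \<le>
    2 ^ N * (1 + (norm \<eta> + norm k) ^ N) * norm (osc_integral f (\<psi> i) \<eta> k)"
   by (intro mult_right_mono one_plus_power_le) auto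
  also have "\<dots> = 2 ^ N * (norm (osc_integral f (\<psi> i) \<eta> k) + (norm \<eta> + norm k) ^ N * norm (osc_integral f (\<psi> i) \<eta> k))"
   by (simp add: distrib_right mult.assoc)
  also have "\<dots> \<le> 2 ^ N * (C0 + \<bar>C1\<bar>)"
   using C0(2)[OF i, of \<eta> k] C1[OF i Pk pos] by (intro mult_left_mono add_mono) auto
  also have "\<dots> \<le> 2 ^ N * (C0 + \<bar>C1\<bar>) + C0" using C0(1) by simp
  finally show ?thesis .
 qed
 moreover have "0 < 2 ^ N * (C0 + \<bar>C1\<bar>) + C0" using C0(1) by (simp add: add_nonneg_pos)
 ultimately show thesis using that by blast
qed

text \<open>Where |k| is large compared with |\<eta>|, the term \<open>k\<close> dominates the
  gradient and the integral decays; elsewhere powers of |k| are at most powers of |\<eta>|, and the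
  trivial bound suffices.\<close>

lemma osc_integral_growth:
 fixes f :: "real^'m => real^'n"
 assumes U: "open U" and K: "compact K" "K \<subseteq> U" and f: "bdd_map U f" and \<psi>: "test_family K I \<psi>"
 obtains C where "C > 0" "\<And>i \<eta> k. i \<in> I ==> (1 + norm k) ^ N * norm (osc_integral f (\<psi> i) \<eta> k) \<le> C * (1 + norm \<eta>) ^ N"
proof -
 obtain A where A: "A \<ge> 1" "\<And>x \<eta>. x \<in> U ==> norm (pull_covector f x \<eta>) \<le> A * norm \<eta>"
  by (rule pull_covector_bound[OF f]) (erule that, assumption)
 \<comment> \<open>Here A|\<eta>| is at most |k|/2, so the gradient is at least |k|/2; with A at
   least 1 this exceeds a quarter of the total frequency.\<close>
 define P where "P = {(\<eta>::real^'n, k::real^'m). 2 * A * norm \<eta> \<le> norm k}"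
 have low: "1 / 4 * (norm \<eta> + norm k) \<le> norm (pull_covector f x \<eta> - k)" if "(\<eta>, k) \<in> P" "x \<in> U" for \<eta> k x
 proof -
  have 1: "2 * (A * norm \<eta>) \<le> norm k" using that(1) by (simp add: P_def)
  have "1 * norm \<eta> \<le> A * norm \<eta>" using A(1) by (intro mult_right_mono) auto
  moreover have "norm k - norm (pull_covector f x \<eta>) \<le> norm (pull_covector f x \<eta> - k)"
   by (metis norm_minus_commute norm_triangle_ineq2)
  ultimately show ?thesis using 1 A(2)[OF that(2), of \<eta>] norm_ge_zero[of k] by argo
 qed
 obtain C1 where C1: "C1 > 0" "\<And>i \<eta> k. i \<in> I ==> (\<eta>, k) \<in> P ==>
   (1 + (norm \<eta> + norm k)) ^ N * norm (osc_integral f (\<psi> i) \<eta> k) \<le> C1"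
  by (rule osc_integral_decay[where N = N and P = P, OF U K f \<psi> _ low]) (simp, assumption, assumption, erule that, assumption)
 obtain C0 where C0: "C0 > 0" "\<And>i \<eta> k. i \<in> I ==> norm (osc_integral f (\<psi> i) \<eta> k) \<le> C0"
  by (rule osc_integral_bound[OF K(1) \<psi>]) (erule that, assumption)
 have "(1 + norm k) ^ N * norm (osc_integral f (\<psi> i) \<eta> k) \<le> (C1 + (2 * A) ^ N * C0) * (1 + norm \<eta>) ^ N"
  if i: "i \<in> I" for i \<eta> k
 proof (cases "(\<eta>, k) \<in> P")
  case True
  have "(1 + norm k) ^ N * norm (osc_integral f (\<psi> i) \<eta> k) \<le> (1 + (norm \<eta> + norm k)) ^ N * norm (osc_integral f (\<psi> i) \<eta> k)"
   by (intro mult_right_mono power_mono) auto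
  also have "\<dots> \<le> C1 * 1" using C1(2)[OF i True] by simp
  also have "\<dots> \<le> (C1 + (2 * A) ^ N * C0) * (1 + norm \<eta>) ^ N"
   using C1(1) C0(1) A(1) by (intro mult_mono one_le_power) auto
  finally show ?thesis .
 next
  case False
  then have "1 + norm k \<le> 2 * A * (1 + norm \<eta>)" using A(1) by (auto simp: P_def distrib_left)
  then have "(1 + norm k) ^ N \<le> (2 * A * (1 + norm \<eta>)) ^ N" by (intro power_mono) auto
  then have "(1 + norm k) ^ N * norm (osc_integral f (\<psi> i) \<eta> k) \<le> (2 * A * (1 + norm \<eta>)) ^ N * C0"
   using C0(2)[OF i, of \<eta> k] A(1) by (intro mult_mono) auto
  also have "\<dots> = ((2 * A) ^ N * C0) * (1 + norm \<eta>) ^ N" by (simp only: power_mult_distrib mult_ac)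
  also have "\<dots> \<le> (C1 + (2 * A) ^ N * C0) * (1 + norm \<eta>) ^ N"
   using C1(1) by (intro mult_right_mono) auto
  finally show ?thesis .
 qed
 moreover have "0 < C1 + (2 * A) ^ N * C0" using C1(1) C0(1) A(1) by (simp add: add_pos_nonneg)
 ultimately show thesis using that by blast
qed

text \<open>All that an estimate uses of the functional \<open>u\<close>: homogeneity, a bound
  \<open>P\<close> on one bounded set and a bound \<open>Q\<close> for the decay on
  \<open>W\<close>. Isolating it allows the bounded set and the constants to be chosen before
  \<open>u\<close>, as continuity demands.\<close>

definition controlled_by ::
  "(real^'n) set => (real^'n => complex) set => (real^'n) set => nat => (real^'n => complex) =>
   ((real^'n => complex) => complex) => real => real => bool" where
 "controlled_by \<Omega> B W M \<theta> u P Q \<longleftrightarrow> 0 \<le> P \<and> 0 \<le> Q \<and>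
   (\<forall>\<phi>\<in>test_functions \<Omega>. \<forall>c. u (\<lambda>x. c * \<phi> x) = c * u \<phi>) \<and> (\<forall>\<phi>\<in>B. norm (u \<phi>) \<le> P) \<and>
   (\<forall>m\<in>W. decay M u \<theta> m \<le> Q)"

text \<open>For frequencies \<open>m\<close> in \<open>W\<close> the decay comes from the functional \<open>u\<close>; for the others it comes from the
 oscillatory integral, and there the functional is only tested on one bounded set.\<close>

lemma oscillatory_product_bound:
 fixes f :: "real^'m => real^'n" and I :: "'i set"
 assumes U: "open U" and K: "compact K" "K \<subseteq> U" and f: "bdd_map U f" and \<psi>: "test_family K I \<psi>" and c: "c > 0"
  and low: "\<And>\<eta> k x. \<eta> \<notin> W ==> k \<in> V ==> x \<in> U ==> c * (norm \<eta> + norm k) \<le> norm (pull_covector f x \<eta> - k)"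
  and L: "compact L" "L \<subseteq> \<Omega>" and \<theta>: "test_fun L \<theta>"
 shows "\<exists>B C. bounded_test_set \<Omega> B \<and> C > 0 \<and> (\<forall>u P Q. controlled_by \<Omega> B W (N + 2 * DIM(real^'n)) \<theta> u P Q -->
   (\<forall>i\<in>I. \<forall>k\<in>V. \<forall>m. (1 + norm k) ^ N * (norm (osc_integral f (\<psi> i) m k) * norm (local_fourier u \<theta> m))
    \<le> C * (P + Q) * lattice_weight m))"
proof -
 define d where "d = 2 * DIM(real^'n)"
 define J where "J = {p. case p of (i, m, k) => i \<in> I \<and> m \<notin> W \<and> k \<in> V}"
 \<comment> \<open>The oscillatory integral with all weights built in. Off \<open>W\<close> it
   decays faster than every power of \<open>m\<close>, so the functions
   \<open>w p * \<theta> * osc m\<close> form a bounded set.\<close>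
 define w where "w = (\<lambda>(i, m, k). complex_of_real ((1 + norm k) ^ N * (1 + norm m) ^ d) * osc_integral f (\<psi> i) m k)"
 define B where "B = (\<lambda>p y. w p * (\<theta> y * osc (fst (snd p)) y)) ` J"
 have rapid: "\<exists>C. \<forall>p\<in>J. norm (w p) * (1 + norm (fst (snd p))) ^ M \<le> C" for M
 proof -
  have low': "c * (norm \<eta> + norm k) \<le> norm (pull_covector f x \<eta> - k)" if "(\<eta>, k) \<in> (- W) \<times> V" "x \<in> U" for \<eta> k x
   using low that by blast
  obtain C1 where C1: "C1 > 0" "\<And>i \<eta> k. i \<in> I ==> (\<eta>, k) \<in> (- W) \<times> V ==>
   (1 + (norm \<eta> + norm k)) ^ (N + d + M) * norm (osc_integral f (\<psi> i) \<eta> k) \<le> C1"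
   by (rule osc_integral_decay[where N = "N + d + M" and P = "(- W) \<times> V", OF U K f \<psi> c low']) (assumption, assumption, erule that, assumption)
  have "norm (w (i, m, k)) * (1 + norm m) ^ M \<le> C1" if "i \<in> I" "m \<notin> W" "k \<in> V" for i m k
  proof -
   have "norm (w (i, m, k)) * (1 + norm m) ^ M =
     ((1 + norm k) ^ N * (1 + norm m) ^ d * (1 + norm m) ^ M) * norm (osc_integral f (\<psi> i) m k)"
    by (simp add: w_def norm_mult norm_power mult_ac del: of_real_mult of_real_power)
   also have "\<dots> \<le> ((1 + (norm m + norm k)) ^ N * (1 + (norm m + norm k)) ^ d * (1 + (norm m + norm k)) ^ M) * norm (osc_integral f (\<psi> i) m k)"
    by (intro mult_right_mono mult_mono power_mono) auto
   also have "\<dots> \<le> C1" using C1(2)[of i m k] that by (simp add: power_add)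
   finally show ?thesis .
  qed
  then show ?thesis by (auto simp: J_def)
 qed
 have B: "bounded_test_set \<Omega> B"
  unfolding B_def by (rule bounded_test_set_family[OF L test_family_osc[OF L(1) \<theta> rapid]])
 obtain C2 where C2: "C2 > 0" "\<And>i \<eta> k. i \<in> I ==> (1 + norm k) ^ N * norm (osc_integral f (\<psi> i) \<eta> k) \<le> C2 * (1 + norm \<eta>) ^ N"
  by (rule osc_integral_growth[OF U K f \<psi>, of N]) (erule that, assumption)
 have main: "(1 + norm k) ^ N * (norm (osc_integral f (\<psi> i) m k) * norm (local_fourier u \<theta> m)) \<le> (1 + C2) * (P + Q) * lattice_weight m"
  if hom: "\<And>\<phi> c. \<phi> \<in> test_functions \<Omega> ==> u (\<lambda>x. c * \<phi> x) = c * u \<phi>"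
   and uB: "\<And>\<phi>. \<phi> \<in> B ==> norm (u \<phi>) \<le> P"
   and uW: "\<And>m. m \<in> W ==> (1 + norm m) ^ (N + 2 * DIM(real^'n)) * norm (local_fourier u \<theta> m) \<le> Q"
   and P: "0 \<le> P" and Q: "0 \<le> Q" and i: "i \<in> I" and k: "k \<in> V" for u P Q i k m
 proof (rule le_lattice_weight)
  show "(1 + norm m) ^ (2 * DIM(real^'n)) * ((1 + norm k) ^ N * (norm (osc_integral f (\<psi> i) m k) * norm (local_fourier u \<theta> m)))
    \<le> (1 + C2) * (P + Q)"
  proof (cases "m \<in> W")
   case True
   have "(1 + norm m) ^ (2 * DIM(real^'n)) * ((1 + norm k) ^ N * (norm (osc_integral f (\<psi> i) m k) * norm (local_fourier u \<theta> m))) =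
    ((1 + norm k) ^ N * norm (osc_integral f (\<psi> i) m k)) * ((1 + norm m) ^ (2 * DIM(real^'n)) * norm (local_fourier u \<theta> m))"
    by (simp only: mult_ac)
   also have "\<dots> \<le> (C2 * (1 + norm m) ^ N) * ((1 + norm m) ^ (2 * DIM(real^'n)) * norm (local_fourier u \<theta> m))"
    by (rule mult_right_mono[OF C2(2)[OF i]]) simp
   also have "\<dots> = C2 * ((1 + norm m) ^ (N + 2 * DIM(real^'n)) * norm (local_fourier u \<theta> m))" by (simp only: power_add mult_ac)
   also have "\<dots> \<le> C2 * Q" using uW[OF True] C2(1) by (intro mult_left_mono) auto
   also have "\<dots> \<le> (1 + C2) * (P + Q)" using C2(1) P Q by (intro mult_mono) auto
   finally show ?thesis .
  next
   case False
   then have p: "(i, m, k) \<in> J" using i k by (simp add: J_def)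
   have "(\<lambda>y. \<theta> y * osc m y) \<in> test_functions \<Omega>"
    using test_family_test_functions(1)[OF L test_family_osc[OF L(1) \<theta>, of "{()}" "\<lambda>_. 1" "\<lambda>_. m"], of "()"] by auto
   from hom[OF this, of "w (i, m, k)"]
   have "u (\<lambda>y. w (i, m, k) * (\<theta> y * osc m y)) = w (i, m, k) * local_fourier u \<theta> m"
    by (simp add: local_fourier_def)
   moreover have "(\<lambda>y. w (i, m, k) * (\<theta> y * osc m y)) \<in> B"
    unfolding B_def by (rule image_eqI[OF _ p]) simp
   ultimately have "norm (w (i, m, k) * local_fourier u \<theta> m) \<le> P" using uB by metis
   moreover have "norm (w (i, m, k) * local_fourier u \<theta> m) =
    (1 + norm m) ^ (2 * DIM(real^'n)) * ((1 + norm k) ^ N * (norm (osc_integral f (\<psi> i) m k) * norm (local_fourier u \<theta> m)))"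
    by (simp add: w_def norm_mult norm_power d_def mult_ac del: of_real_mult of_real_power)
   moreover have "1 * P \<le> (1 + C2) * (P + Q)" using C2(1) P Q by (intro mult_mono) auto
   ultimately show ?thesis by simp
  qed
 qed
 have "0 < 1 + C2" using C2(1) by simp
 with B main show ?thesis
  by (intro exI[of _ B] exI[of _ "1 + C2"]) (auto simp: controlled_by_def)
qed

section \<open>Localisation\<close>

text \<open>A finite partition of unity on \<open>K\<close>, obtained by dividing bumps by their
  sum. The same pieces serve every index, so uniformity is kept.\<close>

lemma test_family_localize:
 fixes G :: "'a::euclidean_space => 'a set" and \<psi> :: "'i => 'a => complex"
 assumes K: "compact K" and G: "\<And>x. x \<in> K ==> open (G x) \<and> x \<in> G x" and \<psi>: "test_family K I \<psi>"
 obtains X L \<Psi> where "finite X" "X \<subseteq> K" "\<And>x. x \<in> X ==> compact (L x)" "\<And>x. x \<in> X ==> L x \<subseteq> G x \<inter> K"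
  "\<And>x. x \<in> X ==> test_family (L x) I (\<Psi> x)" "\<And>i y. i \<in> I ==> \<psi> i y = (\<Sum>x\<in>X. \<Psi> x i y)"
proof -
 have "\<exists>e>0. cball x (2 * e) \<subseteq> G x" if x: "x \<in> K" for x
 proof -
  obtain e where "e > 0" "cball x e \<subseteq> G x" using G[OF x] open_contains_cball by blast
  then show ?thesis by (intro exI[of _ "e / 2"]) auto
 qed
 then obtain e where e: "\<And>x. x \<in> K ==> e x > 0" "\<And>x. x \<in> K ==> cball x (2 * e x) \<subseteq> G x" by metis
 have "K \<subseteq> (\<Union>x\<in>K. ball x (e x))" using e(1) by force
 then obtain X where X: "X \<subseteq> K" "finite X" "K \<subseteq> (\<Union>x\<in>X. ball x (e x))"
  using compactE_image[OF K, of K "\<lambda>x. ball x (e x)"] by auto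
 have "\<exists>\<beta>::'a => real. test_family (cball x (2 * e x)) (UNIV :: 'i set) (\<lambda>_ x. complex_of_real (\<beta> x)) \<and>
   (\<forall>y\<in>cball x (e x). \<beta> y = 1) \<and> (\<forall>y. 0 \<le> \<beta> y)" if x: "x \<in> X" for x
 proof -
  have r: "0 < e x" "e x < 2 * e x" using e(1) X(1) x by auto
  obtain \<beta> :: "'a => real" where "test_family (cball x (2 * e x)) (UNIV :: 'i set) (\<lambda>_ x. complex_of_real (\<beta> x))"
   "\<And>y. y \<in> cball x (e x) ==> \<beta> y = 1" "\<And>y. 0 \<le> \<beta> y"
   by (rule bump_function_exists[OF r, of x]) (erule that, assumption, assumption)
  then show ?thesis by blast
 qed
 then obtain \<beta> where \<beta>: "\<And>x. x \<in> X ==> test_family (cball x (2 * e x)) (UNIV :: 'i set) (\<lambda>_ y. complex_of_real (\<beta> x y))"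
  and \<beta>1: "\<And>x y. x \<in> X ==> y \<in> cball x (e x) ==> \<beta> x y = (1::real)" and \<beta>0: "\<And>x y. x \<in> X ==> 0 \<le> \<beta> x y" by metis
 \<comment> \<open>On this neighbourhood of \<open>K\<close> some bump equals 1, so the sum of the
   bumps is at least 1 and can be inverted.\<close>
 define U where "U = (\<Union>x\<in>X. ball x (e x))"
 have U: "open U" "K \<subseteq> U" using X by (auto simp: U_def)
 define S where "S y = (\<Sum>x\<in>X. complex_of_real (\<beta> x y))" for y
 have \<beta>b: "bdd_family V I (\<lambda>_ y. complex_of_real (\<beta> x y))" if "x \<in> X" for x V
  using \<beta>[OF that] bdd_family_mono[of UNIV "UNIV :: 'i set" "\<lambda>_ y. complex_of_real (\<beta> x y)" I V] by (simp add: test_family_def)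
 have S1: "1 \<le> norm (S y)" if "y \<in> U" for y
 proof -
  obtain x where x: "x \<in> X" "y \<in> ball x (e x)" using \<open>y \<in> U\<close> by (auto simp: U_def)
  then have "\<beta> x y = 1" using \<beta>1 by auto
  then have "1 \<le> (\<Sum>x\<in>X. \<beta> x y)" using member_le_sum[of x X "\<lambda>x. \<beta> x y"] x X(2) \<beta>0 by auto
  moreover have "S y = complex_of_real (\<Sum>x\<in>X. \<beta> x y)" by (simp add: S_def)
  ultimately show ?thesis by (simp only: norm_of_real)
 qed
 have Sb: "bdd_family U I (\<lambda>_ y. inverse (S y))"
  by (rule bdd_family_inverse[OF U(1) _ zero_less_one S1])
   (auto simp: S_def intro!: bdd_family_sum U(1) X(2) \<beta>b)
 define L where "L x = cball x (2 * e x) \<inter> K" for x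
 define \<Psi> where "\<Psi> x i y = complex_of_real (\<beta> x y) * (inverse (S y) * \<psi> i y)" for x i y
 have 1: "compact (L x)" for x unfolding L_def using K by (simp add: compact_Int)
 have 2: "L x \<subseteq> G x \<inter> K" if "x \<in> X" for x using e(2)[of x] X(1) that by (auto simp: L_def)
 have 3: "test_family (L x) I (\<Psi> x)" if x: "x \<in> X" for x
 proof -
  have Kc: "closed K" using K compact_imp_closed by blast
  have "test_family K I (\<lambda>i y. inverse (S y) * \<psi> i y)"
   by (rule test_family_mult[OF U(1) Sb \<psi> Kc U(2)])
  from test_family_mult[OF open_UNIV \<beta>b[OF x] this Kc subset_UNIV]
  have "test_family K I (\<Psi> x)" by (simp add: \<Psi>_def[abs_def])
  moreover have "\<Psi> x i y = 0" if "y \<notin> cball x (2 * e x)" for i y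
   using test_family_0[OF \<beta>[OF x] _ that, of i] by (simp add: \<Psi>_def)
  ultimately show ?thesis unfolding test_family_def L_def by blast
 qed
 have 4: "\<psi> i y = (\<Sum>x\<in>X. \<Psi> x i y)" if "i \<in> I" for i y
 proof (cases "y \<in> K")
  case True
  have "(\<Sum>x\<in>X. \<Psi> x i y) = S y * (inverse (S y) * \<psi> i y)" unfolding \<Psi>_def S_def by (simp add: sum_distrib_right)
  moreover have "S y \<noteq> 0" using S1[of y] True U(2) by auto
  ultimately show ?thesis by simp
 next
  case False
  then show ?thesis using test_family_0[OF \<psi> that False] by (simp add: \<Psi>_def)
 qed
 show thesis by (rule that[OF X(2,1) 1 2 3 4])
qed

lemma bounded_set_seminorm_le_iff:
 "0 \<le> P ==> bounded_set_seminorm B u \<le> ennreal P \<longleftrightarrow> (\<forall>\<phi>\<in>B. norm (u \<phi>) \<le> P)"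
 by (simp add: bounded_set_seminorm_def SUP_le_iff)

lemma fourier_seminorm_le_iff:
 "0 \<le> P ==> fourier_seminorm N V \<theta> u \<le> ennreal P \<longleftrightarrow> (\<forall>k\<in>V. decay N u \<theta> k \<le> P)"
 by (simp add: fourier_seminorm_def SUP_le_iff)

lemma distribution_bounded_test_set:
 assumes u: "u \<in> distributions \<Omega>" and \<Omega>: "open \<Omega>" and B: "bounded_test_set \<Omega> B"
 obtains P where "0 \<le> P" "\<And>\<phi>. \<phi> \<in> B ==> norm (u \<phi>) \<le> P"
proof -
 obtain K where K: "compact K" "K \<subseteq> \<Omega>" "test_family K B (\<lambda>\<phi>. \<phi>)"
  by (rule bounded_test_set_imp_family[OF \<Omega> B]) (erule that, assumption, assumption)
 obtain P where "P > 0" "\<And>\<phi>. \<phi> \<in> B ==> norm (u \<phi>) \<le> P"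
  by (rule distribution_family_bound[OF u K]) (erule that, assumption)
 then show thesis using that[of P] by auto
qed

section \<open>Decay of localised distributions off the wave front set\<close>

text \<open>A frequency outside \<open>V\<close> makes an angle of size at least 2\<delta> with
  \<xi>, while \<open>k\<close> stays within \<delta>. The triangle inequality and comparison of the
  lengths of \<open>m\<close> and \<open>k\<close> turn this gap into a lower bound proportional to
  both lengths.\<close>

lemma cone_separation:
 fixes \<xi> :: "'a::euclidean_space"
 assumes V: "cone V" and ball: "ball \<xi> (2 * \<delta>) \<subseteq> V" and \<delta>: "\<delta> > 0" and m: "m \<notin> V"
  and k: "norm (k - norm k *\<^sub>R \<xi>) \<le> \<delta> * norm k" and \<xi>: "norm \<xi> = 1"
 shows "\<delta> / (4 + 3 * \<delta>) * (norm m + norm k) \<le> norm (m - k)"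
proof -
 \<comment> \<open>Normalising \<open>m\<close> would otherwise put it into the ball of radius
   2\<delta> around \<xi>, hence into the cone \<open>V\<close>.\<close>
 have 1: "2 * \<delta> * norm m \<le> norm (m - norm m *\<^sub>R \<xi>)"
 proof (rule ccontr)
  assume "\<not> 2 * \<delta> * norm m \<le> norm (m - norm m *\<^sub>R \<xi>)"
  then have lt: "norm (m - norm m *\<^sub>R \<xi>) < 2 * \<delta> * norm m" by simp
  then have m0: "norm m > 0" by (cases "m = 0") auto
  have "m /\<^sub>R norm m - \<xi> = (m - norm m *\<^sub>R \<xi>) /\<^sub>R norm m" using m0 by (simp add: scaleR_diff_right)
  then have "norm (m /\<^sub>R norm m - \<xi>) = norm (m - norm m *\<^sub>R \<xi>) / norm m" by (simp add: divide_inverse mult.commute)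
  also have "\<dots> < 2 * \<delta>" using lt m0 by (simp add: pos_divide_less_eq)
  finally have "m /\<^sub>R norm m \<in> V" using ball by (auto simp: dist_norm norm_minus_commute)
  then have "norm m *\<^sub>R (m /\<^sub>R norm m) \<in> V" using V unfolding cone_def by (metis norm_ge_zero)
  then show False using m m0 by simp
 qed
 have "norm (m - norm m *\<^sub>R \<xi>) \<le> norm (m - k) + norm (k - norm k *\<^sub>R \<xi>) + norm (norm k *\<^sub>R \<xi> - norm m *\<^sub>R \<xi>)"
  using norm_triangle_ineq[of "m - k + (k - norm k *\<^sub>R \<xi>)" "norm k *\<^sub>R \<xi> - norm m *\<^sub>R \<xi>"]
   norm_triangle_ineq[of "m - k" "k - norm k *\<^sub>R \<xi>"] by simp
 also have "norm (norm k *\<^sub>R \<xi> - norm m *\<^sub>R \<xi>) = \<bar>norm k - norm m\<bar>" by (simp add: scaleR_diff_left[symmetric] \<xi>)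
 also have "\<dots> \<le> norm (m - k)" by (metis norm_minus_commute norm_triangle_ineq3)
 finally have 2: "norm (m - norm m *\<^sub>R \<xi>) \<le> 2 * norm (m - k) + \<delta> * norm k" using k by linarith
 have 3: "norm k \<le> norm m + norm (m - k)" by (metis norm_minus_commute norm_triangle_sub)
 have "\<delta> * norm k \<le> \<delta> * (norm m + norm (m - k))" using 3 \<delta> by (intro mult_left_mono) auto
 then have "\<delta> * norm m \<le> (2 + \<delta>) * norm (m - k)" using 1 2 by (simp add: algebra_simps)
 moreover have "\<delta> * (norm m + norm k) \<le> \<delta> * (2 * norm m + norm (m - k))" using 3 \<delta> by (intro mult_left_mono) auto
 ultimately have "\<delta> * (norm m + norm k) \<le> (4 + 3 * \<delta>) * norm (m - k)" by (simp add: algebra_simps)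
 then show ?thesis using \<delta> by (simp add: field_simps)
qed

lemma pull_covector_ident: "pull_covector (\<lambda>x. x) x \<eta> = (\<eta> :: real^'n)"
proof (rule vector_eq_rdot[THEN iffD1], rule allI)
 fix v :: "real^'n"
 have "frechet_derivative (\<lambda>x::real^'n. x) (at x) v = v" using frechet_derivative_at[OF has_derivative_ident] by metis
 then show "pull_covector (\<lambda>x. x) x \<eta> \<bullet> v = \<eta> \<bullet> v" by (simp add: inner_pull_covector)
qed

lemma bdd_map_ident: "bounded U ==> bdd_map U (\<lambda>x::real^'n. x)"
proof -
 assume U: "bounded U"
 have "bdd_family U {()} (\<lambda>_ x. complex_of_real (axis j 1 \<bullet> x))" for j :: 'n
  by (rule bdd_family_inner[OF U]) (auto intro: order_refl)
 then show ?thesis by (simp add: bdd_map_def inner_axis' )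
qed

text \<open>For the identity map the kernel is the Fourier transform of the amplitude shifted in
  frequency, so multiplication by a smooth function is an instance of the estimates for
  pull-backs.\<close>

lemma osc_integral_ident:
 "osc_integral (\<lambda>x. x) h m k = fhat (\<lambda>x. h x * osc k x) m"
 unfolding osc_integral_def fhat_def
 by (rule Bochner_Integration.integral_cong) (auto simp: exp_add[symmetric] algebra_simps)

text \<open>The price, in terms of the weight, of working on the lattice of spacing 1/R.\<close>

lemma lattice_weight_scale:
 fixes m :: "'a::euclidean_space"
 assumes "1 \<le> R"
 shows "lattice_weight (m /\<^sub>R R) \<le> R ^ (2 * DIM('a)) * lattice_weight m"
proof (rule le_lattice_weight)
 have "1 + norm m \<le> R * (1 + norm (m /\<^sub>R R))" using assms by (simp add: distrib_left mult.assoc[symmetric])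
 then have "(1 + norm m) ^ (2 * DIM('a)) \<le> R ^ (2 * DIM('a)) * (1 + norm (m /\<^sub>R R)) ^ (2 * DIM('a))"
  unfolding power_mult_distrib[symmetric] by (intro power_mono) auto
 moreover have "0 < (1 + norm (m /\<^sub>R R)) ^ (2 * DIM('a))" by (intro zero_less_power add_pos_nonneg) auto
 ultimately show "(1 + norm m) ^ (2 * DIM('a)) * lattice_weight (m /\<^sub>R R) \<le> R ^ (2 * DIM('a))"
  unfolding lattice_weight_def by (simp add: divide_inverse[symmetric] pos_divide_le_eq)
qed

lemma has_sum_lattice_norm_bound:
 fixes f :: "'a::euclidean_space => complex"
 assumes "(f has_sum s) int_lattice" "\<And>m. m \<in> int_lattice ==> norm (f m) \<le> M * lattice_weight m"
 shows "norm s \<le> M * infsum (lattice_weight :: 'a => real) int_lattice"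
 by (rule norm_infsum_le[OF assms(1) has_sum_cmult_right[OF lattice_weight_has_sum] assms(2)])

text \<open>Near \<open>x0\<close> the given cutoff \<theta> is invertible, so \<psi> = \<theta> h
  with h again a test family. Expanding h times an exponential in a Fourier series expresses the
  transform of u\<psi> by that of u\<theta>: frequencies in \<open>V\<close> decay by hypothesis,
  and those outside are far from \<open>k\<close> by \<open>cone_separation\<close>.\<close>

lemma wf_decay_direction:
 fixes u :: "(real^'n => complex) => complex"
 assumes u: "u \<in> distributions \<Omega>" and \<Omega>: "open \<Omega>" and \<theta>: "\<theta> \<in> test_functions \<Omega>" "\<theta> x0 \<noteq> 0"
  and V: "cone V" "\<xi> \<in> interior V" and \<xi>: "norm \<xi> = 1" and fin: "\<And>N. fourier_seminorm N V \<theta> u < \<infinity>"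
 shows "\<exists>r>0. \<exists>\<delta>>0. \<forall>K (I :: 'i set) \<psi> N. compact K \<and> K \<subseteq> ball x0 r \<and> test_family K I \<psi> -->
  (\<exists>C. \<forall>i\<in>I. \<forall>k. norm (k - norm k *\<^sub>R \<xi>) \<le> \<delta> * norm k --> decay N u (\<psi> i) k \<le> C)"
proof -
 obtain \<epsilon> where \<epsilon>: "\<epsilon> > 0" "ball \<xi> \<epsilon> \<subseteq> V" using V(2) mem_interior by blast
 define \<delta> where "\<delta> = \<epsilon> / 2"
 have \<delta>: "\<delta> > 0" "ball \<xi> (2 * \<delta>) \<subseteq> V" using \<epsilon> by (auto simp: \<delta>_def)
 obtain \<rho> where \<rho>: "\<forall>x\<in>supp \<theta>. norm x \<le> \<rho>" using compact_imp_bounded[OF test_functionsD(2)[OF \<theta>(1)]] by (auto simp: bounded_iff)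
 \<comment> \<open>Large enough for the support of \<theta> to lie within distance \<open>R\<close>
   of \<open>x0\<close>, and at least 1 as the scaled series requires.\<close>
 define R where "R = max 1 (\<rho> + norm x0 + 1)"
 have R: "1 \<le> R" by (simp add: R_def)
 have LR: "supp \<theta> \<subseteq> ball x0 R"
 proof
  fix x assume "x \<in> supp \<theta>"
  then have "norm x \<le> \<rho>" using \<rho> by blast
  then show "x \<in> ball x0 R" using norm_triangle_ineq4[of x0 x] by (simp add: R_def dist_norm)
 qed
 have \<theta>f: "test_fun (supp \<theta>) \<theta>" by (rule test_function_family[OF \<theta>(1)])
 have "continuous_on UNIV \<theta>" using test_family_continuous[OF \<theta>f] by simp
 then have "isCont \<theta> x0" by (simp add: continuous_on_eq_continuous_at)
 then obtain r0 where r0: "r0 > 0" "\<And>y. dist y x0 < r0 ==> dist (\<theta> y) (\<theta> x0) < norm (\<theta> x0) / 2"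
  using \<theta>(2) unfolding continuous_at_eps_delta by (metis half_gt_zero_iff zero_less_norm_iff)
 \<comment> \<open>At most 1, so that supports near \<open>x0\<close> lie in the ball of radius
   2R.\<close>
 define r where "r = min r0 1"
 have r: "r > 0" "r \<le> 1" using r0(1) by (auto simp: r_def)
 have \<theta>low: "norm (\<theta> x0) / 2 \<le> norm (\<theta> y)" if "y \<in> ball x0 r" for y
 proof -
  have "dist (\<theta> y) (\<theta> x0) < norm (\<theta> x0) / 2" using r0(2)[of y] that by (simp add: r_def dist_commute)
  then show ?thesis using norm_triangle_ineq3[of "\<theta> y" "\<theta> x0"] by (simp add: dist_norm abs_le_iff)
 qed
 have "\<exists>C. \<forall>i\<in>I. \<forall>k. norm (k - norm k *\<^sub>R \<xi>) \<le> \<delta> * norm k --> decay N u (\<psi> i) k \<le> C"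
  if K: "compact K" "K \<subseteq> ball x0 r" and \<psi>: "test_family K I \<psi>" for K and I :: "'i set" and \<psi> N
 proof -
  have Kc: "closed K" using K compact_imp_closed by blast
  have "bdd_family (ball x0 r) I (\<lambda>_ y. inverse (\<theta> y))"
  proof (rule bdd_family_inverse[where c = "norm (\<theta> x0) / 2"])
   show "bdd_family (ball x0 r) I (\<lambda>_. \<theta>)"
    using test_family_single[OF \<theta>f, of I] by (auto simp: test_family_def elim: bdd_family_mono)
  qed (use \<theta>(2) \<theta>low in auto)
  \<comment> \<open>Division by the cutoff, legitimate on the ball where |\<theta>| stays above half
    of its value at \<open>x0\<close>.\<close>
  define h where "h i y = inverse (\<theta> y) * \<psi> i y" for i y
  have h: "test_family K I h"
   unfolding h_def by (rule test_family_mult[OF open_ball \<open>bdd_family (ball x0 r) I (\<lambda>_ y. inverse (\<theta> y))\<close> \<psi> Kc K(2)])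
  define Vk where "Vk = {k. norm (k - norm k *\<^sub>R \<xi>) \<le> \<delta> * norm k}"
  have c0: "0 < \<delta> / (4 + 3 * \<delta>)" using \<delta>(1) by simp
  have low: "\<delta> / (4 + 3 * \<delta>) * (norm \<eta> + norm k) \<le> norm (pull_covector (\<lambda>x. x) x \<eta> - k)"
   if "\<eta> \<notin> V" "k \<in> Vk" for \<eta> k and x :: "real^'n"
   unfolding pull_covector_ident using cone_separation[OF V(1) \<delta>(2,1) that(1) _ \<xi>] that(2) by (simp add: Vk_def)
  have "\<exists>B C. bounded_test_set \<Omega> B \<and> C > 0 \<and> (\<forall>u P Q. controlled_by \<Omega> B V (N + 2 * DIM(real^'n)) \<theta> u P Q -->
   (\<forall>i\<in>I. \<forall>k\<in>Vk. \<forall>m. (1 + norm k) ^ N * (norm (osc_integral (\<lambda>x. x) (h i) m k) * norm (local_fourier u \<theta> m))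
    \<le> C * (P + Q) * lattice_weight m))"
   by (rule oscillatory_product_bound[OF open_ball K bdd_map_ident[OF bounded_ball] h c0 _ test_functionsD(2,3)[OF \<theta>(1)] \<theta>f])
    (rule low)
  then obtain B C where B: "bounded_test_set \<Omega> B" and C: "C > 0" and
   BC: "\<forall>u P Q. controlled_by \<Omega> B V (N + 2 * DIM(real^'n)) \<theta> u P Q -->
   (\<forall>i\<in>I. \<forall>k\<in>Vk. \<forall>m. (1 + norm k) ^ N * (norm (osc_integral (\<lambda>x. x) (h i) m k) * norm (local_fourier u \<theta> m))
    \<le> C * (P + Q) * lattice_weight m)" by blast
  obtain P where P: "0 \<le> P" "\<And>\<phi>. \<phi> \<in> B ==> norm (u \<phi>) \<le> P"
   by (rule distribution_bounded_test_set[OF u \<Omega> B]) (erule that, assumption)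
  obtain Q where Q: "0 \<le> Q" "fourier_seminorm (N + 2 * DIM(real^'n)) V \<theta> u = ennreal Q"
   using fin[of "N + 2 * DIM(real^'n)"] by (cases "fourier_seminorm (N + 2 * DIM(real^'n)) V \<theta> u") auto
  then have QV: "(1 + norm m) ^ (N + 2 * DIM(real^'n)) * norm (local_fourier u \<theta> m) \<le> Q" if "m \<in> V" for m
   using fourier_seminorm_le_iff[OF Q(1), of "N + 2 * DIM(real^'n)" V \<theta> u] that by auto
  have "controlled_by \<Omega> B V (N + 2 * DIM(real^'n)) \<theta> u P Q"
   using P Q(1) QV distribution_cmult[OF u] by (simp add: controlled_by_def)
  with BC have BC': "\<And>i k m. i \<in> I ==> k \<in> Vk ==> (1 + norm k) ^ N * (norm (osc_integral (\<lambda>x. x) (h i) m k) *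
    norm (local_fourier u \<theta> m)) \<le> C * (P + Q) * lattice_weight m" by blast
  define c where "c = series_const R TYPE(real^'n)"
  define T where "T = infsum (lattice_weight :: real^'n => real) int_lattice"
  \<comment> \<open>The factor from \<open>lattice_weight_scale\<close>.\<close>
  define D where "D = R ^ (2 * DIM(real^'n))"
  have "decay N u (\<psi> i) k \<le> norm c * (C * (P + Q) * D) * T" if i: "i \<in> I" and k: "k \<in> Vk" for i k
  proof -
   define H where "H y = h i y * osc k y" for y
   have H: "test_fun K H"
   proof -
    have "test_fun K (h i)" using test_family_reindex[OF h, of "\<lambda>_. i" "{()}"] i by auto
    from test_family_osc[OF K(1) this, of "{()}" "\<lambda>_. 1" "\<lambda>_. k"] show ?thesis unfolding H_def by auto
   qed
   have KR: "K \<subseteq> ball x0 (2 * R)" using K(2) r(2) R by (auto intro: less_le_trans)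
   note S = distribution_fourier_series[OF R u test_functionsD(2,3)[OF \<theta>(1)] LR \<theta>f K(1) KR H]
   have "\<theta> y * H y = \<psi> i y * osc k y" for y
   proof (cases "y \<in> K")
    case True
    have "0 < norm (\<theta> x0)" using \<theta>(2) by simp
    then have "\<theta> y \<noteq> 0" using \<theta>low[of y] K(2) True by auto
    then show ?thesis by (simp add: H_def h_def)
   qed (use test_family_0[OF \<psi> i] in \<open>simp add: H_def h_def\<close>)
   then have Su: "u (\<lambda>y. \<theta> y * H y) = local_fourier u (\<psi> i) k" by (simp add: local_fourier_def)
   have "norm (local_fourier u (\<psi> i) k) \<le> norm c * (C * (P + Q) * D) / (1 + norm k) ^ N * T"
    unfolding T_def
   proof (rule has_sum_lattice_norm_bound[OF S[unfolded Su]])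
    fix m :: "real^'n"
    have k1: "0 < (1 + norm k) ^ N" by (intro zero_less_power add_pos_nonneg) auto
    have "(1 + norm k) ^ N * (norm (fhat H (m /\<^sub>R R)) * norm (local_fourier u \<theta> (m /\<^sub>R R)))
      \<le> C * (P + Q) * lattice_weight (m /\<^sub>R R)"
     using BC'[OF i k, of "m /\<^sub>R R"]
     unfolding osc_integral_ident H_def[abs_def] by simp
    also have "\<dots> \<le> C * (P + Q) * (D * lattice_weight m)"
     unfolding D_def using lattice_weight_scale[OF R, of m] C P(1) Q(1) by (intro mult_left_mono) auto
    finally have "norm (fhat H (m /\<^sub>R R)) * norm (local_fourier u \<theta> (m /\<^sub>R R)) \<le> C * (P + Q) * (D * lattice_weight m) / (1 + norm k) ^ N"
     using k1 by (simp add: pos_le_divide_eq mult.commute)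
    then have "norm c * (norm (fhat H (m /\<^sub>R R)) * norm (local_fourier u \<theta> (m /\<^sub>R R))) \<le>
      norm c * (C * (P + Q) * (D * lattice_weight m) / (1 + norm k) ^ N)" by (rule mult_left_mono) simp
    then show "norm (series_const R TYPE(real^'n) * (fhat H (m /\<^sub>R R) * local_fourier u \<theta> (m /\<^sub>R R)))
      \<le> norm c * (C * (P + Q) * D) / (1 + norm k) ^ N * lattice_weight m"
     by (simp add: norm_mult c_def mult_ac)
   qed
   then have "decay N u (\<psi> i) k \<le>
     (1 + norm k) ^ N * (norm c * (C * (P + Q) * D) / (1 + norm k) ^ N * T)" by (rule mult_left_mono) simp
   also have "\<dots> = norm c * (C * (P + Q) * D) * T"
   proof -
    have "(1 + norm k) ^ N \<noteq> 0" using norm_ge_zero[of k] by (metis add_pos_nonneg less_numeral_extra(3) power_not_zero zero_less_one)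
    then show ?thesis by simp
   qed
   finally show ?thesis .
  qed
  then show ?thesis unfolding Vk_def by blast
 qed
 then show ?thesis using r(1) \<delta>(1) by blast
qed

text \<open>The unit vectors of \<open>V\<close> form a compact set. Finitely many of the conical
  neighbourhoods from \<open>wf_decay_direction\<close> cover them, and the smallest of the finitely
  many radii works for all.\<close>

lemma wf_decay_local:
 fixes u :: "(real^'n => complex) => complex"
 assumes u: "u \<in> distributions_WF \<Omega> \<Gamma>" and \<Omega>: "open \<Omega>" and V: "closed V" "cone V" and x0: "x0 \<in> \<Omega>" "({x0} \<times> V) \<inter> \<Gamma> = {}"
 shows "\<exists>r>0. \<forall>K (I :: 'i set) \<psi> N. compact K \<and> K \<subseteq> ball x0 r \<and> K \<subseteq> \<Omega> \<and> test_family K I \<psi> -->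
  (\<exists>C. \<forall>i\<in>I. \<forall>k\<in>V. decay N u (\<psi> i) k \<le> C)"
proof -
 have ud: "u \<in> distributions \<Omega>" and uW: "wave_front_set \<Omega> u \<subseteq> \<Gamma>" using u by (auto simp: distributions_WF_def)
 define S where "S = V \<inter> sphere 0 1"
 have S: "compact S" using V(1) by (simp add: S_def closed_Int_compact)
 have "\<exists>r>0. \<exists>\<delta>>0. \<forall>K (I :: 'i set) \<psi> N. compact K \<and> K \<subseteq> ball x0 r \<and> test_family K I \<psi> -->
  (\<exists>C. \<forall>i\<in>I. \<forall>k. norm (k - norm k *\<^sub>R \<xi>) \<le> \<delta> * norm k --> decay N u (\<psi> i) k \<le> C)"
  if \<xi>: "\<xi> \<in> S" for \<xi>
 proof -
  have "norm \<xi> = 1" "\<xi> \<in> V" using \<xi> by (auto simp: S_def)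
  then have "(x0, \<xi>) \<notin> wave_front_set \<Omega> u" using uW x0(2) by blast
  moreover have "\<xi> \<noteq> 0" using \<open>norm \<xi> = 1\<close> by auto
  ultimately obtain \<theta> V' where *: "\<theta> \<in> test_functions \<Omega>" "\<theta> x0 \<noteq> 0" "cone V'" "\<xi> \<in> interior V'"
   "\<And>N. fourier_seminorm N V' \<theta> u < \<infinity>" using x0(1) by (auto simp: wave_front_set_def)
  show ?thesis by (rule wf_decay_direction[OF ud \<Omega> *(1-4) \<open>norm \<xi> = 1\<close> *(5)])
 qed
 then obtain r \<delta> where r: "\<And>\<xi>. \<xi> \<in> S ==> r \<xi> > 0" and \<delta>: "\<And>\<xi>. \<xi> \<in> S ==> \<delta> \<xi> > (0::real)"
  and dec: "\<And>\<xi>. \<xi> \<in> S ==> \<forall>K (I :: 'i set) \<psi> N. compact K \<and> K \<subseteq> ball x0 (r \<xi>) \<and> test_family K I \<psi> -->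
  (\<exists>C. \<forall>i\<in>I. \<forall>k. norm (k - norm k *\<^sub>R \<xi>) \<le> \<delta> \<xi> * norm k --> decay N u (\<psi> i) k \<le> C)"
  by metis
 have "S \<subseteq> (\<Union>\<xi>\<in>S. ball \<xi> (\<delta> \<xi>))" using \<delta> by force
 then obtain X where X: "X \<subseteq> S" "finite X" "S \<subseteq> (\<Union>\<xi>\<in>X. ball \<xi> (\<delta> \<xi>))"
  using compactE_image[OF S, of S "\<lambda>\<xi>. ball \<xi> (\<delta> \<xi>)"] by auto
 define \<rho> where "\<rho> = Min (insert 1 (r ` X))"
 have \<rho>: "\<rho> > 0" "\<And>\<xi>. \<xi> \<in> X ==> \<rho> \<le> r \<xi>"
  using X r by (auto simp: \<rho>_def)
 have "\<exists>C. \<forall>i\<in>I. \<forall>k\<in>V. decay N u (\<psi> i) k \<le> C"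
  if K: "compact K" "K \<subseteq> ball x0 \<rho>" "K \<subseteq> \<Omega>" and \<psi>: "test_family K I \<psi>" for K and I :: "'i set" and \<psi> N
 proof -
  have "\<exists>C. \<forall>i\<in>I. \<forall>k. norm (k - norm k *\<^sub>R \<xi>) \<le> \<delta> \<xi> * norm k --> decay N u (\<psi> i) k \<le> C"
   if \<xi>: "\<xi> \<in> X" for \<xi>
  proof -
   have "K \<subseteq> ball x0 (r \<xi>)" using K(2) \<rho>(2)[OF \<xi>] by (auto intro: less_le_trans)
   then show ?thesis using dec[of \<xi>] \<xi> X(1) K(1) \<psi> by blast
  qed
  then obtain C where C: "\<And>\<xi> i k. \<xi> \<in> X ==> i \<in> I ==> norm (k - norm k *\<^sub>R \<xi>) \<le> \<delta> \<xi> * norm k ==>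
    decay N u (\<psi> i) k \<le> C \<xi>" by metis
  obtain C0 where C0: "C0 > 0" "\<And>i. i \<in> I ==> norm (u (\<psi> i)) \<le> C0"
   by (rule distribution_family_bound[OF ud K(1,3) \<psi>]) (erule that, assumption)
  have "decay N u (\<psi> i) k \<le> C0 + (\<Sum>\<xi>\<in>X. \<bar>C \<xi>\<bar>)" if i: "i \<in> I" and k: "k \<in> V" for i k
  \<comment> \<open>The zero frequency has no direction; there the value of \<open>u\<close> itself
    is bounded along the family.\<close>
  proof (cases "k = 0")
   case True
   have "0 \<le> (\<Sum>\<xi>\<in>X. \<bar>C \<xi>\<bar>)" by (simp add: sum_nonneg)
   moreover have "decay N u (\<psi> i) k = norm (u (\<psi> i))"
    using True by (simp add: local_fourier_def)
   ultimately show ?thesis using C0(2)[OF i] by linarith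
  next
   case False
   then have "k /\<^sub>R norm k \<in> S" using k V(2) unfolding S_def cone_def by auto
   then obtain \<xi> where \<xi>: "\<xi> \<in> X" "dist \<xi> (k /\<^sub>R norm k) < \<delta> \<xi>" using X(3) by auto
   have "k - norm k *\<^sub>R \<xi> = norm k *\<^sub>R (k /\<^sub>R norm k - \<xi>)" using False by (simp add: scaleR_diff_right)
   then have "norm (k - norm k *\<^sub>R \<xi>) = norm k * dist \<xi> (k /\<^sub>R norm k)" by (simp add: dist_norm norm_minus_commute)
   also have "\<dots> \<le> \<delta> \<xi> * norm k" using \<xi>(2) by (simp add: mult.commute mult_left_mono)
   finally have "decay N u (\<psi> i) k \<le> C \<xi>" by (rule C[OF \<xi>(1) i])
   also have "\<dots> \<le> \<bar>C \<xi>\<bar>" by simp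
   also have "\<dots> \<le> (\<Sum>\<xi>\<in>X. \<bar>C \<xi>\<bar>)" by (rule member_le_sum[OF \<xi>(1)]) (use X(2) in auto)
   finally show ?thesis using C0(1) by simp
  qed
  then show ?thesis by blast
 qed
 then show ?thesis using \<rho>(1) by blast
qed

lemma local_fourier_sum:
 assumes u: "u \<in> distributions \<Omega>" and X: "finite X" "\<And>x. x \<in> X ==> compact (L x)" "\<And>x. x \<in> X ==> L x \<subseteq> \<Omega>"
  "\<And>x. x \<in> X ==> test_family (L x) I (\<Psi> x)" and \<psi>: "\<And>y. \<psi> y = (\<Sum>x\<in>X. \<Psi> x i y)" and i: "i \<in> I"
 shows "local_fourier u \<psi> k = (\<Sum>x\<in>X. local_fourier u (\<Psi> x i) k)"
proof -
 have "(\<lambda>y. \<Psi> x i y * osc k y) \<in> test_functions \<Omega>" if x: "x \<in> X" for x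
 proof -
  have "test_fun (L x) (\<Psi> x i)" using test_family_reindex[OF X(4)[OF x], of "\<lambda>_. i" "{()}"] i by auto
  from test_family_test_functions(1)[OF X(2)[OF x] X(3)[OF x] test_family_osc[OF X(2)[OF x] this, of "{()}" "\<lambda>_. 1" "\<lambda>_. k"], of "()"]
  show ?thesis by auto
 qed
 from distribution_sum[where c = "\<lambda>_. 1" and \<psi> = "\<lambda>x y. \<Psi> x i y * osc k y", OF u X(1) this]
 show ?thesis unfolding local_fourier_def \<psi> by (simp add: sum_distrib_right)
qed

text \<open>Localisation to finitely many balls on which \<open>wf_decay_local\<close> applies. This
  replaces the cutoffs hidden in the wave front set by arbitrary families supported in
  \<open>K\<close>, with one constant for all indices.\<close>

theorem wf_decay:
 fixes u :: "(real^'n => complex) => complex" and \<psi> :: "'i => real^'n => complex"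
 assumes u: "u \<in> distributions_WF \<Omega> \<Gamma>" and \<Omega>: "open \<Omega>" and V: "closed V" "cone V"
  and K: "compact K" "K \<subseteq> \<Omega>" "(K \<times> V) \<inter> \<Gamma> = {}" and \<psi>: "test_family K I \<psi>"
 obtains C where "0 \<le> C" "\<And>i k. i \<in> I ==> k \<in> V ==> decay N u (\<psi> i) k \<le> C"
proof -
 have ud: "u \<in> distributions \<Omega>" using u by (simp add: distributions_WF_def)
 have "\<exists>r>0. \<forall>K (I :: 'i set) \<psi> N. compact K \<and> K \<subseteq> ball x r \<and> K \<subseteq> \<Omega> \<and> test_family K I \<psi> -->
  (\<exists>C. \<forall>i\<in>I. \<forall>k\<in>V. decay N u (\<psi> i) k \<le> C)" if x: "x \<in> K" for x
  by (rule wf_decay_local[OF u \<Omega> V]) (use x K in auto)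
 then obtain r where r: "\<And>x. x \<in> K ==> r x > 0" and
  dec: "\<And>x. x \<in> K ==> \<forall>K (I :: 'i set) \<psi> N. compact K \<and> K \<subseteq> ball x (r x) \<and> K \<subseteq> \<Omega> \<and> test_family K I \<psi> -->
  (\<exists>C. \<forall>i\<in>I. \<forall>k\<in>V. decay N u (\<psi> i) k \<le> C)" by metis
 have nb: "open (ball x (r x)) \<and> x \<in> ball x (r x)" if "x \<in> K" for x using r[OF that] by simp
 obtain X L \<Psi> where X: "finite X" "X \<subseteq> K" "\<And>x. x \<in> X ==> compact (L x)" "\<And>x. x \<in> X ==> L x \<subseteq> ball x (r x) \<inter> K"
  "\<And>x. x \<in> X ==> test_family (L x) I (\<Psi> x)" "\<And>i y. i \<in> I ==> \<psi> i y = (\<Sum>x\<in>X. \<Psi> x i y)"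
  by (rule test_family_localize[OF K(1) nb \<psi>]) (assumption, erule that, assumption+)
 have "\<exists>C. \<forall>i\<in>I. \<forall>k\<in>V. decay N u (\<Psi> x i) k \<le> C" if x: "x \<in> X" for x
  using dec[of x] x X(2) X(3)[OF x] X(4)[OF x] X(5)[OF x] K(2) by blast
 then obtain C where C: "\<And>x i k. x \<in> X ==> i \<in> I ==> k \<in> V ==> decay N u (\<Psi> x i) k \<le> C x" by metis
 have "decay N u (\<psi> i) k \<le> (\<Sum>x\<in>X. \<bar>C x\<bar>)" if i: "i \<in> I" and k: "k \<in> V" for i k
 proof -
  have L\<Omega>: "L x \<subseteq> \<Omega>" if "x \<in> X" for x using X(4)[OF that] K(2) by blast
  have "local_fourier u (\<psi> i) k = (\<Sum>x\<in>X. local_fourier u (\<Psi> x i) k)"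
   by (rule local_fourier_sum[OF ud X(1) X(3) L\<Omega> X(5) X(6)[OF i] i])
  then have "decay N u (\<psi> i) k \<le> (\<Sum>x\<in>X. decay N u (\<Psi> x i) k)"
   unfolding sum_distrib_left[symmetric] by (simp add: mult_left_mono norm_sum)
  also have "\<dots> \<le> (\<Sum>x\<in>X. \<bar>C x\<bar>)" by (rule sum_mono) (rule order_trans[OF C abs_ge_self], use i k in auto)
  finally show ?thesis .
 qed
 moreover have "0 \<le> (\<Sum>x\<in>X. \<bar>C x\<bar>)" by (simp add: sum_nonneg)
 ultimately show thesis using that by blast
qed

text \<open>Fourier seminorms take values in the extended reals; that they are finite on the space
  is precisely \<open>wf_decay\<close> for a single test function. For bounded sets it is continuity
  of \<open>u\<close>.\<close>

lemma normal_seminorm_finite: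
 fixes u :: "(real^'n => complex) => complex"
 assumes u: "u \<in> distributions_WF \<Omega> \<Gamma>" and \<Omega>: "open \<Omega>" and p: "p \<in> normal_seminorms \<Omega> \<Gamma>"
 shows "p u < \<infinity>"
proof -
 have ud: "u \<in> distributions \<Omega>" using u by (simp add: distributions_WF_def)
 consider B where "p = bounded_set_seminorm B" "bounded_test_set \<Omega> B"
  | N V \<theta> where "p = fourier_seminorm N V \<theta>" "\<theta> \<in> test_functions \<Omega>" "closed V" "cone V" "(supp \<theta> \<times> V) \<inter> \<Gamma> = {}"
  using p by (auto simp: normal_seminorms_def)
 then have "\<exists>P\<ge>0. p u \<le> ennreal P"
 proof cases
  case (1 B)
  obtain P where P: "0 \<le> P" "\<And>\<phi>. \<phi> \<in> B ==> norm (u \<phi>) \<le> P"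
   by (rule distribution_bounded_test_set[OF ud \<Omega> 1(2)]) (erule that, assumption)
  then have "p u \<le> ennreal P" unfolding 1(1) by (subst bounded_set_seminorm_le_iff) auto
  then show ?thesis using P(1) by blast
 next
  case (2 N V \<theta>)
  obtain C where C: "0 \<le> C" "\<And>i k. i \<in> {()} ==> k \<in> V ==> decay N u \<theta> k \<le> C"
   by (rule wf_decay[where N = N and I = "{()}" and \<psi> = "\<lambda>_. \<theta>", OF u \<Omega> 2(3,4) test_functionsD(2,3)[OF 2(2)] 2(5)
      test_function_family[OF 2(2)]]) (erule that, assumption)
  then have "p u \<le> ennreal C" unfolding 2(1) by (subst fourier_seminorm_le_iff) auto
  then show ?thesis using C(1) by blast
 qed
 then obtain P where "p u \<le> ennreal P" by blast
 then have "p u < top" by (rule order_le_less_trans) (rule ennreal_less_top)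
 then show ?thesis by simp
qed

section \<open>Distributions given by functions\<close>

lemma integrable_on_compact:
 fixes F :: "'a::euclidean_space => complex"
 assumes "compact K" "continuous_on K F" "\<And>x. x \<notin> K ==> F x = 0"
 shows "integrable lborel F"
proof -
 have "integrable lborel (\<lambda>x. indicator K x *\<^sub>R F x)" by (rule borel_integrable_compact[OF assms(1,2)])
 moreover have "(\<lambda>x. indicator K x *\<^sub>R F x) = F" using assms(3) by (auto simp: indicator_def fun_eq_iff)
 ultimately show ?thesis by simp
qed

lemma distribution_of_eq:
 assumes "\<phi> \<in> test_functions \<Omega>"
 shows "distribution_of \<Omega> g \<phi> = (LINT x|lborel. indicator \<Omega> x *\<^sub>R (g x * \<phi> x))"
 using assms by (simp add: distribution_of_def set_lebesgue_integral_def)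

lemma integrable_test_function:
 assumes g: "continuous_on \<Omega> g" and \<phi>: "\<phi> \<in> test_functions \<Omega>"
 shows "integrable lborel (\<lambda>x. indicator \<Omega> x *\<^sub>R (g x * \<phi> x))"
proof (rule integrable_on_compact[OF test_functionsD(2)[OF \<phi>]])
 have "continuous_on UNIV \<phi>" using test_family_continuous[OF test_function_family[OF \<phi>], of "()" "{()}"] by simp
 then have "continuous_on (supp \<phi>) (\<lambda>x. g x * \<phi> x)"
  by (intro continuous_on_mult continuous_on_subset[OF g test_functionsD(3)[OF \<phi>]]) (rule continuous_on_subset[OF _ subset_UNIV])
 then show "continuous_on (supp \<phi>) (\<lambda>x. indicator \<Omega> x *\<^sub>R (g x * \<phi> x))"
  proof (rule continuous_on_eq)
  fix x assume "x \<in> supp \<phi>"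
  then have "x \<in> \<Omega>" by (rule subsetD[OF test_functionsD(3)[OF \<phi>]])
  then show "g x * \<phi> x = indicator \<Omega> x *\<^sub>R (g x * \<phi> x)" by simp
 qed
qed (simp add: not_in_supp)

lemma distribution_of_in_distributions:
 assumes g: "continuous_on \<Omega> g"
 shows "distribution_of \<Omega> g \<in> distributions \<Omega>"
 unfolding distributions_def
proof (intro CollectI conjI ballI allI impI)
 fix \<phi> assume \<phi>: "\<phi> \<in> test_functions \<Omega>"
 show "distribution_of \<Omega> g (\<lambda>x. c * \<phi> x) = c * distribution_of \<Omega> g \<phi>" for c
 proof -
  have "indicator \<Omega> x *\<^sub>R (g x * (c * \<phi> x)) = c * (indicator \<Omega> x *\<^sub>R (g x * \<phi> x))" for x
   by (simp add: mult_ac)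
  then show ?thesis
   unfolding distribution_of_eq[OF \<phi>] distribution_of_eq[OF test_functions_add_cmult(2)[OF \<phi> \<phi>]]
   by (simp only: integral_mult_right_zero)
 qed
 fix \<psi> assume \<psi>: "\<psi> \<in> test_functions \<Omega>"
 show "distribution_of \<Omega> g (\<lambda>x. \<phi> x + \<psi> x) = distribution_of \<Omega> g \<phi> + distribution_of \<Omega> g \<psi>"
  unfolding distribution_of_eq[OF \<phi>] distribution_of_eq[OF \<psi>] distribution_of_eq[OF test_functions_add_cmult(1)[OF \<phi> \<psi>]]
  by (simp add: distrib_left scaleR_add_right integrable_test_function[OF g \<phi>] integrable_test_function[OF g \<psi>])
next
 show "continuous_on_compact_supports \<Omega> (\<lambda>\<phi>. norm (distribution_of \<Omega> g \<phi>))"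
  unfolding continuous_on_compact_supports_def
 proof (intro allI impI)
  fix K assume K: "compact K \<and> K \<subseteq> \<Omega>"
  then have "compact (g ` K)" by (intro compact_continuous_image continuous_on_subset[OF g]) auto
  then obtain M0 where M0: "\<forall>y\<in>g ` K. norm y \<le> M0" using compact_imp_bounded[of "g ` K", unfolded bounded_iff] by (elim meta_impE exE)
  define M where "M = max M0 0"
  have M: "0 \<le> M" "\<And>x. x \<in> K ==> norm (g x) \<le> M" using M0 by (auto simp: M_def le_max_iff_disj)
  have "norm (distribution_of \<Omega> g \<phi>) \<le> (M * measure lborel K) * Ck_norm 0 \<phi>" if \<phi>: "\<phi> \<in> test_functions \<Omega>" "supp \<phi> \<subseteq> K" for \<phi>
  proof -
   obtain D where D: "\<And>x. norm (iter_deriv [] \<phi> x) \<le> D"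
    by (rule iter_deriv_bounded[OF \<phi>(1), of "[]"]) (auto intro: that)
   have up: "norm (\<phi> x) \<le> Ck_norm 0 \<phi>" for x
   proof -
    have "norm (\<phi> x) \<le> (SUP x. norm (\<phi> x))" using D by (intro cSUP_upper) (auto intro!: bdd_aboveI)
    also have "\<dots> \<le> Ck_norm 0 \<phi>" using SUP_iter_deriv_le_Ck_norm[OF \<phi>(1), of "[]"] by simp
    finally show ?thesis .
   qed
   have "0 \<le> Ck_norm 0 \<phi>" using up[of undefined] norm_ge_zero order_trans by blast
   have off: "\<phi> x = 0" if "x \<notin> K" for x using that \<phi>(2) not_in_supp by blast
   have "norm (LINT x|lborel. indicator \<Omega> x *\<^sub>R (g x * \<phi> x)) \<le> (M * Ck_norm 0 \<phi>) * measure lborel K"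
   proof (rule norm_integral_compact_support)
    show "norm (indicator \<Omega> x *\<^sub>R (g x * \<phi> x)) \<le> M * Ck_norm 0 \<phi>" for x
    proof (cases "x \<in> K")
     case True
     have "norm (indicator \<Omega> x *\<^sub>R (g x * \<phi> x)) \<le> norm (g x) * norm (\<phi> x)"
      by (simp add: norm_mult indicator_def)
     also have "\<dots> \<le> M * Ck_norm 0 \<phi>" using M(1) M(2)[OF True] up[of x] by (intro mult_mono) auto
     finally show ?thesis .
    qed (use off M(1) \<open>0 \<le> Ck_norm 0 \<phi>\<close> in simp)
   qed (use K off in auto)
   then show ?thesis unfolding distribution_of_eq[OF \<phi>(1)] by (simp add: mult_ac)
  qed
  then show "\<exists>C m. \<forall>\<phi>\<in>test_functions \<Omega>. supp \<phi> \<subseteq> K --> norm (distribution_of \<Omega> g \<phi>) \<le> C * Ck_norm m \<phi>" by blast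
 qed
qed (simp add: distribution_of_def)

text \<open>Outside \<Omega> the values of \<open>g\<close> are arbitrary, but there the factor
  \<theta> vanishes. The product is smooth on \<Omega> and zero off \<open>L\<close>, and these two
  open sets cover the space.\<close>

lemma test_family_smooth_mult:
 fixes g \<theta> :: "'a::euclidean_space => complex"
 assumes \<Omega>: "open \<Omega>" and g: "smooth_on \<Omega> g" and L: "compact L" "L \<subseteq> \<Omega>" and \<theta>: "test_fun L \<theta>"
 shows "test_fun L (\<lambda>y. \<theta> y * g y)"
proof -
 have off: "\<theta> y * g y = 0" if "y \<notin> L" for y using test_family_0[OF \<theta> _ that] by simp
 have Lc: "closed L" using L(1) by (rule compact_imp_closed)
 have \<theta>s: "smooth_on UNIV \<theta>" using \<theta> bdd_family_imp_smooth_on[of UNIV "{()}" "\<lambda>_. \<theta>" "()"] by (simp add: test_family_def)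
 have "bdd_family (- L) {()} (\<lambda>_ y. \<theta> y * g y) \<longleftrightarrow> bdd_family (- L) {()} (\<lambda>_ y. 0)"
  by (rule bdd_family_cong) (use Lc off in auto)
 moreover have "bdd_family (- L) {()} (\<lambda>_ y. 0)" by (rule bdd_family_const[of _ _ 0]) simp
 ultimately have "bdd_family (- L) {()} (\<lambda>_ y. \<theta> y * g y)" by simp
 then have s1: "smooth_on (- L) (\<lambda>y. \<theta> y * g y)"
  using bdd_family_imp_smooth_on[of "- L" "{()}" "\<lambda>_ y. \<theta> y * g y" "()"] by simp
 have s2: "smooth_on \<Omega> (\<lambda>y. \<theta> y * g y)"
  by (rule smooth_on_mult[OF \<Omega> smooth_on_subset[OF \<theta>s subset_UNIV] g])
 have "smooth_on UNIV (\<lambda>y. \<theta> y * g y)"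
 proof (rule smooth_on_local)
  fix x :: 'a
  show "\<exists>U. x \<in> U \<and> smooth_on U (\<lambda>y. \<theta> y * g y)"
  proof (cases "x \<in> L")
   case True
   then show ?thesis using s2 L(2) by blast
  next
   case False
   then show ?thesis using s1 by blast
  qed
 qed
 then have t: "(\<lambda>y. \<theta> y * g y) \<in> test_functions \<Omega>" by (rule test_functionsI[OF L]) (rule off)
 show ?thesis by (rule test_family_mono[OF test_function_family[OF t]]) (use supp_subsetI[OF Lc off] in auto)
qed

lemma local_fourier_distribution_of:
 fixes g \<theta> :: "'a::euclidean_space => complex"
 assumes L: "compact L" "L \<subseteq> \<Omega>" and \<theta>: "test_fun L \<theta>"
 shows "local_fourier (distribution_of \<Omega> g) \<theta> k = fhat (\<lambda>y. \<theta> y * g y) (- k)"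
proof -
 have t: "(\<lambda>y. \<theta> y * osc k y) \<in> test_functions \<Omega>"
  using test_family_test_functions(1)[OF L test_family_osc[OF L(1) \<theta>, of "{()}" "\<lambda>_. 1" "\<lambda>_. k"], of "()"] by auto
 have "indicator \<Omega> x *\<^sub>R (g x * (\<theta> x * osc k x)) =
   \<theta> x * g x * iexp (- k \<bullet> x)" for x
  using test_family_0[OF \<theta>, of "()" x] L(2) by (cases "x \<in> \<Omega>") auto
 then show ?thesis unfolding local_fourier_def distribution_of_eq[OF t] fhat_def by simp
qed

text \<open>A smooth function times a cutoff has a rapidly decreasing transform in all directions,
  so the wave front set is empty and the membership holds for every \<Gamma>.\<close>

lemma distribution_of_smooth_WF:
 fixes g :: "'a::euclidean_space => complex"
 assumes \<Omega>: "open \<Omega>" and g: "smooth_on \<Omega> g"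
 shows "distribution_of \<Omega> g \<in> distributions_WF \<Omega> \<Gamma>"
proof -
 have "wave_front_set \<Omega> (distribution_of \<Omega> g) = {}"
 proof (rule equals0I, clarify)
  fix x \<xi> assume a: "(x, \<xi>) \<in> wave_front_set \<Omega> (distribution_of \<Omega> g)"
  then have "x \<in> \<Omega>" by (simp add: wave_front_set_def)
  then obtain e where e: "e > 0" "cball x e \<subseteq> \<Omega>" using \<Omega> open_contains_cball by blast
  obtain \<theta> :: "'a => complex" where \<theta>: "test_fun (cball x e) \<theta>"
   and one: "\<And>y. y \<in> cball x (e / 2) ==> \<theta> y = 1" by (rule bump_exists[OF e(1)]) (erule that, assumption)
  have \<theta>x: "\<theta> x \<noteq> 0" using one[of x] e(1) by simp
  have "fourier_seminorm N UNIV \<theta> (distribution_of \<Omega> g) < \<infinity>" for N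
  proof -
   obtain C where C: "C > 0" "\<And>i m. i \<in> {()} ==> (1 + norm m) ^ N * norm (fhat (\<lambda>y. \<theta> y * g y) m) \<le> C"
    by (rule fhat_decay[OF compact_cball test_family_smooth_mult[OF \<Omega> g compact_cball e(2) \<theta>], of N]) (erule that, assumption)
   have "fourier_seminorm N UNIV \<theta> (distribution_of \<Omega> g) \<le> ennreal C"
    using C(2)[of "()" "- k" for k] C(1)
    by (subst fourier_seminorm_le_iff) (auto simp: local_fourier_distribution_of[OF compact_cball e(2) \<theta>])
   then have "fourier_seminorm N UNIV \<theta> (distribution_of \<Omega> g) < top" by (rule order_le_less_trans) (rule ennreal_less_top)
   then show ?thesis by simp
  qed
  moreover have "\<theta> \<in> test_functions \<Omega>" using test_family_test_functions(1)[OF compact_cball e(2) \<theta>] by simp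
  moreover have "cone (UNIV :: 'a set)" by (simp add: cone_def)
  ultimately have "\<exists>\<theta>\<in>test_functions \<Omega>. \<exists>V. \<theta> x \<noteq> 0 \<and> closed V \<and> cone V \<and> \<xi> \<in> interior V \<and>
    (\<forall>N. fourier_seminorm N V \<theta> (distribution_of \<Omega> g) < \<infinity>)"
   using \<theta>x by (intro bexI[of _ \<theta>] exI[of _ "UNIV :: 'a set"]) (simp_all del: infinity_ennreal_def)
  with a show False unfolding wave_front_set_def mem_Collect_eq prod.case by (elim conjE) (erule notE, assumption)
 qed
 then show ?thesis using distribution_of_in_distributions[OF smooth_on_continuous[OF g]] by (simp add: distributions_WF_def)
qed

section \<open>Geometry of the pulled back cone\<close>

lemma closed_cone_overD:
 assumes "closed_cone_over \<Omega> \<Gamma>"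
 obtains C where "closed C" "\<Gamma> = (\<Omega> \<times> (- {0})) \<inter> C" "\<And>x \<xi> t. (x, \<xi>) \<in> \<Gamma> ==> t > 0 ==> (x, t *\<^sub>R \<xi>) \<in> \<Gamma>"
 using assms unfolding closed_cone_over_def punctured_cotangent_def closedin_closed by blast

text \<open>The product of \<open>K\<close> with the unit vectors of \<open>W\<close> is compact and
  disjoint from a closed set cutting out \<Gamma>, hence at positive distance from it. Homogeneity
  extends the separation from unit vectors to all of \<open>W\<close>.\<close>

lemma thicken_separate:
 fixes \<Omega> :: "'a::euclidean_space set"
 assumes \<Gamma>: "closed_cone_over \<Omega> \<Gamma>" and \<Omega>: "open \<Omega>" and K: "compact K" "K \<subseteq> \<Omega>" and W: "closed W" "cone W"
  and disj: "(K \<times> W) \<inter> \<Gamma> = {}"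
 obtains \<rho> where "\<rho> > 0" "thicken \<rho> K \<subseteq> \<Omega>" "(thicken \<rho> K \<times> W) \<inter> \<Gamma> = {}"
proof -
 obtain C where C: "closed C" "\<Gamma> = (\<Omega> \<times> (- {0})) \<inter> C" and cone: "\<And>x \<xi> t. (x, \<xi>) \<in> \<Gamma> ==> t > 0 ==> (x, t *\<^sub>R \<xi>) \<in> \<Gamma>"
  by (rule closed_cone_overD[OF \<Gamma>]) (erule that, assumption, assumption)
 \<comment> \<open>Unit vectors stay away from the zero section, where \<Gamma> need not be closed
   in the whole space.\<close>
 define A where "A = K \<times> (W \<inter> sphere 0 1)"
 have "compact A" unfolding A_def using K(1) W(1) by (intro compact_Times closed_Int_compact) auto
 moreover have "A \<inter> C = {}" using disj C(2) K(2) by (auto simp: A_def)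
 ultimately obtain d where d: "d > 0" "\<forall>p\<in>A. \<forall>q\<in>C. d \<le> dist p q" using separate_compact_closed[OF _ C(1)] by blast
 obtain d' where d': "d' > 0" "\<forall>x\<in>K. \<forall>y\<in>-\<Omega>. d' \<le> dist x y"
  using separate_compact_closed[OF K(1), of "-\<Omega>"] \<Omega> K(2) by auto
 define \<rho> where "\<rho> = min d d' / 2"
 have \<rho>: "\<rho> > 0" "\<rho> < d" "\<rho> < d'" using d(1) d'(1) by (auto simp: \<rho>_def min_def)
 have 1: "thicken \<rho> K \<subseteq> \<Omega>"
 proof
  fix y assume "y \<in> thicken \<rho> K"
  then obtain x z where y: "y = x + z" "x \<in> K" "norm z \<le> \<rho>" by (auto simp: thicken_def)
  then have "dist x y < d'" using \<rho>(3) by (simp add: dist_norm)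
  then show "y \<in> \<Omega>" using d'(2) y(2) by (metis ComplI not_le)
 qed
 have 2: "(thicken \<rho> K \<times> W) \<inter> \<Gamma> = {}"
 proof (rule equals0I, clarify)
  fix y \<xi> assume a: "y \<in> thicken \<rho> K" "\<xi> \<in> W" "(y, \<xi>) \<in> \<Gamma>"
  obtain x z where y: "y = x + z" "x \<in> K" "norm z \<le> \<rho>" using a(1) by (auto simp: thicken_def)
  have \<xi>0: "\<xi> \<noteq> 0" using a(3) C(2) by auto
  define \<xi>' where "\<xi>' = \<xi> /\<^sub>R norm \<xi>"
  have "(x, \<xi>') \<in> A" using y(2) a(2) W(2) \<xi>0 unfolding A_def \<xi>'_def cone_def by auto
  moreover have "(y, \<xi>') \<in> C" using cone[OF a(3), of "inverse (norm \<xi>)"] \<xi>0 C(2) by (auto simp: \<xi>'_def)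
  ultimately have "d \<le> dist (x, \<xi>') (y, \<xi>')" using d(2) by blast
  also have "\<dots> = norm z" by (simp add: dist_Pair_Pair y(1) dist_norm)
  finally show False using y(3) \<rho>(2) by simp
 qed
 show thesis by (rule that[OF \<rho>(1) 1 2])
qed

section \<open>The transposed derivative of a smooth map\<close>

context
 fixes \<Omega>1 :: "(real^'m) set" and f :: "real^'m => real^'n"
 assumes \<Omega>1: "open \<Omega>1" and f: "smooth_on \<Omega>1 f"
begin

lemma f_differentiable: "x \<in> \<Omega>1 ==> f differentiable (at x)"
 by (rule smooth_on_differentiable[OF f])

lemma smooth_component: "smooth_on \<Omega>1 (\<lambda>x. complex_of_real (f x $ j))"
 by (rule smooth_on_linear_comp[OF _ \<Omega>1 f])
  (rule bounded_linear_compose[OF bounded_linear_of_real bounded_linear_vec_nth])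

lemma smooth_bdd_map:
 assumes "U \<subseteq> K" "compact K" "K \<subseteq> \<Omega>1"
 shows "bdd_map U f"
 unfolding bdd_map_def using f_differentiable assms smooth_on_imp_bdd_family[OF smooth_component assms] by blast

lemma continuous_on_derivative_component:
 assumes b: "b \<in> Basis"
 shows "continuous_on \<Omega>1 (\<lambda>x. frechet_derivative f (at x) b $ j)"
proof -
 have "continuous_on \<Omega>1 (\<lambda>x. Re (partial b (\<lambda>x. complex_of_real (f x $ j)) x))"
  by (intro continuous_on_Re smooth_on_continuous smooth_on_partial[OF smooth_component b])
 then show ?thesis by (simp add: partial_component f_differentiable cong: continuous_on_cong)
qed

lemma pull_covector_expand:
 assumes "x \<in> \<Omega>1"
 shows "pull_covector f x \<eta> = (\<Sum>b\<in>Basis. (\<Sum>j\<in>UNIV. \<eta> $ j * frechet_derivative f (at x) b $ j) *\<^sub>R b)"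
proof -
 have "pull_covector f x \<eta> = (\<Sum>b\<in>Basis. (pull_covector f x \<eta> \<bullet> b) *\<^sub>R b)" by (rule euclidean_representation[symmetric])
 moreover have "pull_covector f x \<eta> \<bullet> b = (\<Sum>j\<in>UNIV. \<eta> $ j * frechet_derivative f (at x) b $ j)" for b
  unfolding inner_pull_covector[OF f_differentiable[OF assms]] by (simp add: inner_vec_def[of \<eta>])
 ultimately show ?thesis by simp
qed

lemma tendsto_pull_covector:
 assumes "X \<longlonglongrightarrow> x" "x \<in> \<Omega>1" "\<And>n. X n \<in> \<Omega>1" "H \<longlonglongrightarrow> \<eta>"
 shows "(\<lambda>n. pull_covector f (X n) (H n)) \<longlonglongrightarrow> pull_covector f x \<eta>"
 unfolding pull_covector_expand[OF assms(2)] pull_covector_expand[OF assms(3)]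
proof (rule tendsto_sum, rule tendsto_scaleR[OF _ tendsto_const], rule tendsto_sum, rule tendsto_mult[OF tendsto_vec_nth[OF assms(4)]])
 fix b :: "real^'m" and j assume b: "b \<in> Basis"
 show "(\<lambda>n. frechet_derivative f (at (X n)) b $ j) \<longlonglongrightarrow> frechet_derivative f (at x) b $ j"
  by (rule continuous_on_tendsto_compose[OF continuous_on_derivative_component[OF b] assms(1,2)]) (simp add: assms(3))
qed

lemma pull_covector_scaleR: "pull_covector f x (t *\<^sub>R \<eta>) = t *\<^sub>R pull_covector f x \<eta>"
 by (simp add: pull_covector_def vec_eq_iff vector_matrix_mult_def sum_distrib_left mult_ac)

text \<open>The first derivatives of \<open>f\<close> are continuous, so near \<open>x0\<close> the
  transposed derivative changes by a small multiple of the covector.\<close>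

lemma pull_covector_diff_bound:
 assumes x0: "x0 \<in> \<Omega>1" and \<epsilon>: "\<epsilon> > 0"
 obtains r where "r > 0" "ball x0 r \<subseteq> \<Omega>1"
  "\<And>x \<eta>. x \<in> ball x0 r ==> norm (pull_covector f x \<eta> - pull_covector f x0 \<eta>) \<le> \<epsilon> * norm \<eta>"
proof -
 define S where "S x = (\<Sum>b\<in>Basis. \<Sum>j\<in>UNIV. \<bar>frechet_derivative f (at x) b $ j - frechet_derivative f (at x0) b $ j\<bar>)" for x
 have "continuous_on \<Omega>1 S" unfolding S_def
  by (intro continuous_on_sum continuous_on_rabs continuous_on_diff continuous_on_derivative_component continuous_on_const)
 then have "isCont S x0" using \<Omega>1 x0 by (simp add: continuous_on_eq_continuous_at)
 then obtain d where d: "d > 0" "\<And>x. dist x x0 < d ==> dist (S x) (S x0) < \<epsilon>"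
  using \<epsilon> unfolding continuous_at_eps_delta by metis
 obtain e where e: "e > 0" "ball x0 e \<subseteq> \<Omega>1" using \<Omega>1 x0 open_contains_ball by blast
 have S0: "S x0 = 0" by (simp add: S_def)
 have "norm (pull_covector f x \<eta> - pull_covector f x0 \<eta>) \<le> \<epsilon> * norm \<eta>" if x: "x \<in> ball x0 (min d e)" for x \<eta>
 proof -
  have x1: "x \<in> \<Omega>1" using x e(2) by auto
  have "norm (pull_covector f x \<eta> - pull_covector f x0 \<eta>) \<le> (\<Sum>b\<in>Basis. \<bar>(pull_covector f x \<eta> - pull_covector f x0 \<eta>) \<bullet> b\<bar>)" by (rule norm_le_l1)
  also have "\<dots> \<le> (\<Sum>b\<in>Basis. norm \<eta> * (\<Sum>j\<in>UNIV. \<bar>frechet_derivative f (at x) b $ j - frechet_derivative f (at x0) b $ j\<bar>))"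
  proof (rule sum_mono)
   fix b :: "real^'m"
   let ?v = "frechet_derivative f (at x) b - frechet_derivative f (at x0) b"
   have "\<bar>(pull_covector f x \<eta> - pull_covector f x0 \<eta>) \<bullet> b\<bar> = \<bar>\<eta> \<bullet> ?v\<bar>"
    by (simp add: inner_diff_left inner_diff_right inner_pull_covector f_differentiable x1 x0)
   also have "\<dots> \<le> norm \<eta> * norm ?v" by (rule Cauchy_Schwarz_ineq2)
   also have "norm ?v \<le> (\<Sum>j\<in>UNIV. \<bar>?v $ j\<bar>)" by (rule norm_le_l1_cart)
   finally show "\<bar>(pull_covector f x \<eta> - pull_covector f x0 \<eta>) \<bullet> b\<bar> \<le>
     norm \<eta> * (\<Sum>j\<in>UNIV. \<bar>frechet_derivative f (at x) b $ j - frechet_derivative f (at x0) b $ j\<bar>)" by (simp add: mult_left_mono)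
  qed
  also have "\<dots> = S x * norm \<eta>" by (simp add: S_def sum_distrib_left sum_distrib_right mult.commute)
  also have "\<dots> \<le> \<epsilon> * norm \<eta>" using d(2)[of x] x S0 by (intro mult_right_mono) (auto simp: dist_real_def dist_commute)
  finally show ?thesis .
 qed
 moreover have "ball x0 (min d e) \<subseteq> \<Omega>1" using e(2) by auto
 moreover have "min d e > 0" using d(1) e(1) by simp
 ultimately show thesis using that by blast
qed

text \<open>Given a convergent sequence of pulled back covectors, the original covectors are
  normalised and a subsequence of directions converges within \<Gamma>. The pull-back of the limit
  direction is nonzero by the conormal condition, which forces the lengths to converge as
  well.\<close>

lemma closed_cone_over_pull_cone:
 assumes \<Gamma>: "closed_cone_over \<Omega>2 \<Gamma>" and im: "f ` \<Omega>1 \<subseteq> \<Omega>2" and conormal: "conormal_set \<Omega>1 f \<inter> \<Gamma> = {}"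
 shows "closed_cone_over \<Omega>1 (pull_cone \<Omega>1 f \<Gamma>)"
proof -
 obtain C where C: "closed C" "\<Gamma> = (\<Omega>2 \<times> (- {0})) \<inter> C" and cone: "\<And>x \<xi> t. (x, \<xi>) \<in> \<Gamma> ==> t > 0 ==> (x, t *\<^sub>R \<xi>) \<in> \<Gamma>"
  by (rule closed_cone_overD[OF \<Gamma>]) (erule that, assumption, assumption)
 have nz: "pull_covector f x \<eta> \<noteq> 0" if "x \<in> \<Omega>1" "(f x, \<eta>) \<in> \<Gamma>" for x \<eta>
  using conormal that by (auto simp: conormal_set_def)
 have sub: "pull_cone \<Omega>1 f \<Gamma> \<subseteq> punctured_cotangent \<Omega>1" using nz by (auto simp: pull_cone_def punctured_cotangent_def)
 have lim: "l \<in> pull_cone \<Omega>1 f \<Gamma>" if a: "\<forall>n. p n \<in> pull_cone \<Omega>1 f \<Gamma>" "l \<in> punctured_cotangent \<Omega>1" "p \<longlonglongrightarrow> l" for p l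
 proof -
  from a(1) have "\<forall>n. \<exists>x \<eta>. p n = (x, pull_covector f x \<eta>) \<and> x \<in> \<Omega>1 \<and> (f x, \<eta>) \<in> \<Gamma>" by (auto simp: pull_cone_def)
  then obtain X H where XH: "\<And>n. p n = (X n, pull_covector f (X n) (H n))" "\<And>n. X n \<in> \<Omega>1" "\<And>n. (f (X n), H n) \<in> \<Gamma>" by metis
  obtain x \<xi> where l: "l = (x, \<xi>)" "x \<in> \<Omega>1" "\<xi> \<noteq> 0" using a by (auto simp: punctured_cotangent_def)
  have X: "X \<longlonglongrightarrow> x" using tendsto_fst[of p l sequentially] a l(1) XH(1) by simp
  have PX: "(\<lambda>n. pull_covector f (X n) (H n)) \<longlonglongrightarrow> \<xi>" using tendsto_snd[of p l sequentially] a l(1) XH(1) by simp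
  have H0: "H n \<noteq> 0" for n using XH(3)[of n] C(2) by auto
  \<comment> \<open>Directions live on a compact sphere, whereas the lengths of \<open>H n\<close>
    are not bounded in advance.\<close>
  define \<omega> where "\<omega> n = H n /\<^sub>R norm (H n)" for n
  have "\<forall>n. \<omega> n \<in> sphere 0 1" using H0 by (simp add: \<omega>_def)
  then obtain w r where w: "w \<in> sphere 0 1" and r: "strict_mono (r :: nat => nat)" "(\<omega> \<circ> r) \<longlonglongrightarrow> w"
   using compact_sphere[of "0 :: real^'n" 1] unfolding compact_def by metis
  have Xr: "(\<lambda>n. X (r n)) \<longlonglongrightarrow> x" using LIMSEQ_subseq_LIMSEQ[OF X r(1)] by (simp add: o_def)
  have \<omega>r: "(\<lambda>n. \<omega> (r n)) \<longlonglongrightarrow> w" using r(2) by (simp add: o_def)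
  have P\<omega>: "(\<lambda>n. pull_covector f (X (r n)) (\<omega> (r n))) \<longlonglongrightarrow> pull_covector f x w"
   by (rule tendsto_pull_covector[OF Xr l(2) XH(2) \<omega>r])
  have \<omega>\<Gamma>: "(f (X n), \<omega> n) \<in> \<Gamma>" for n using cone[OF XH(3), of "inverse (norm (H n))" n] H0[of n] by (simp add: \<omega>_def)
  have "(\<lambda>n. f (X (r n))) \<longlonglongrightarrow> f x"
   by (rule continuous_on_tendsto_compose[OF smooth_on_continuous[OF f] Xr l(2)]) (simp add: XH(2))
  then have "(\<lambda>n. (f (X (r n)), \<omega> (r n))) \<longlonglongrightarrow> (f x, w)" using \<omega>r by (rule tendsto_Pair)
  moreover have "(f (X (r n)), \<omega> (r n)) \<in> C" for n using \<omega>\<Gamma> C(2) by blast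
  ultimately have "(f x, w) \<in> C" using closed_sequentially[OF C(1), of "\<lambda>n. (f (X (r n)), \<omega> (r n))"] by blast
  then have w\<Gamma>: "(f x, w) \<in> \<Gamma>" using C(2) w l(2) im by auto
  have Pw: "pull_covector f x w \<noteq> 0" by (rule nz[OF l(2) w\<Gamma>])
  have HP: "pull_covector f (X n) (H n) = norm (H n) *\<^sub>R pull_covector f (X n) (\<omega> n)" for n
   unfolding pull_covector_scaleR[symmetric] \<omega>_def using H0[of n] by simp
  have PXr: "(\<lambda>n. pull_covector f (X (r n)) (H (r n))) \<longlonglongrightarrow> \<xi>" using LIMSEQ_subseq_LIMSEQ[OF PX r(1)] by (simp add: o_def)
  \<comment> \<open>The limit of the lengths, as a quotient of norms; its denominator is nonzero by
    the conormal condition.\<close>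
  define t where "t = norm \<xi> / norm (pull_covector f x w)"
  have "(\<lambda>n. norm (pull_covector f (X (r n)) (H (r n))) / norm (pull_covector f (X (r n)) (\<omega> (r n)))) \<longlonglongrightarrow> t"
   unfolding t_def by (intro tendsto_divide tendsto_norm PXr P\<omega>) (use Pw in simp)
  moreover have "norm (pull_covector f (X n) (H n)) / norm (pull_covector f (X n) (\<omega> n)) = norm (H n)" for n
   using nz[OF XH(2) \<omega>\<Gamma>, of n] by (simp add: HP)
  ultimately have "(\<lambda>n. norm (H (r n))) \<longlonglongrightarrow> t" by simp
  from tendsto_scaleR[OF this P\<omega>] have "(\<lambda>n. pull_covector f (X (r n)) (H (r n))) \<longlonglongrightarrow> t *\<^sub>R pull_covector f x w" by (simp add: HP)
  then have "\<xi> = pull_covector f x (t *\<^sub>R w)" unfolding pull_covector_scaleR using PXr LIMSEQ_unique by blast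
  moreover have "t > 0" using Pw l(3) by (simp add: t_def)
  ultimately show ?thesis unfolding pull_cone_def l(1) using l(2) cone[OF w\<Gamma>] by blast
 qed
 have "closedin (top_of_set (punctured_cotangent \<Omega>1)) (pull_cone \<Omega>1 f \<Gamma>)"
  unfolding closedin_closed
 proof (intro exI[of _ "closure (pull_cone \<Omega>1 f \<Gamma>)"] conjI closed_closure equalityI subsetI)
  fix l assume "l \<in> pull_cone \<Omega>1 f \<Gamma>"
  then show "l \<in> punctured_cotangent \<Omega>1 \<inter> closure (pull_cone \<Omega>1 f \<Gamma>)" using sub closure_subset by blast
 next
  fix l assume l: "l \<in> punctured_cotangent \<Omega>1 \<inter> closure (pull_cone \<Omega>1 f \<Gamma>)"
  then obtain p where "\<forall>n. p n \<in> pull_cone \<Omega>1 f \<Gamma>" "p \<longlonglongrightarrow> l" unfolding Int_iff closure_sequential by (elim conjE exE)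
  with l show "l \<in> pull_cone \<Omega>1 f \<Gamma>" by (intro lim) auto
 qed
 moreover have "(x, t *\<^sub>R \<xi>) \<in> pull_cone \<Omega>1 f \<Gamma>" if "(x, \<xi>) \<in> pull_cone \<Omega>1 f \<Gamma>" "t > 0" for x \<xi> t
 proof -
  have "\<exists>\<eta>. \<xi> = pull_covector f x \<eta> \<and> x \<in> \<Omega>1 \<and> (f x, \<eta>) \<in> \<Gamma>" using that(1) by (auto simp: pull_cone_def)
  then obtain \<eta> where \<eta>: "\<xi> = pull_covector f x \<eta>" "x \<in> \<Omega>1" "(f x, \<eta>) \<in> \<Gamma>" by (elim exE conjE)
  then show ?thesis unfolding pull_cone_def \<eta>(1) pull_covector_scaleR[symmetric] using cone[OF \<eta>(3) \<open>t > 0\<close>] by blast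
 qed
 ultimately show ?thesis by (auto simp: closed_cone_over_def)
qed

text \<open>\<open>W\<close> consists of the covectors whose pull-back at \<open>x0\<close> is close
  to \<open>V\<close> relative to their length. It misses \<Gamma> by compactness of the unit
  covectors of \<Gamma> over \<open>f x0\<close>. For \<eta> outside \<open>W\<close> the gradient
  controls |\<eta>|, hence also |k|, and this survives small changes of the base point.
  \<open>V\<close> is nonempty because the distance to the empty set is 0 by convention.\<close>

lemma pull_cone_separation:
 assumes \<Gamma>: "closed_cone_over \<Omega>2 \<Gamma>" and im: "f ` \<Omega>1 \<subseteq> \<Omega>2" and x0: "x0 \<in> \<Omega>1"
  and V: "closed V" "cone V" "V \<noteq> {}" and disj: "({x0} \<times> V) \<inter> pull_cone \<Omega>1 f \<Gamma> = {}"
 obtains W c r where "closed W" "cone W" "({f x0} \<times> W) \<inter> \<Gamma> = {}" "c > 0" "r > 0" "ball x0 r \<subseteq> \<Omega>1"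
  "\<And>\<eta> k x. \<eta> \<notin> W ==> k \<in> V ==> x \<in> ball x0 r ==> c * (norm \<eta> + norm k) \<le> norm (pull_covector f x \<eta> - k)"
proof -
 obtain C where C: "closed C" "\<Gamma> = (\<Omega>2 \<times> (- {0})) \<inter> C" and cone: "\<And>x \<xi> t. (x, \<xi>) \<in> \<Gamma> ==> t > 0 ==> (x, t *\<^sub>R \<xi>) \<in> \<Gamma>"
  by (rule closed_cone_overD[OF \<Gamma>]) (erule that, assumption, assumption)
 let ?p = "pull_covector f x0"
 have pc: "continuous_on UNIV ?p"
  unfolding pull_covector_expand[OF x0] by (intro continuous_intros)
 have dc: "continuous_on UNIV (\<lambda>\<eta>. infdist (?p \<eta>) V)" by (intro continuous_on_infdist pc)
 \<comment> \<open>The unit covectors of \<Gamma> over \<open>f x0\<close>; the distance from their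
   pull-backs to \<open>V\<close> has a positive minimum.\<close>
 define G where "G = sphere 0 1 \<inter> (\<lambda>\<eta>. (f x0, \<eta>)) -` C"
 have "closed ((\<lambda>\<eta>. (f x0, \<eta>)) -` C)" by (intro continuous_closed_vimage C(1) continuous_intros)
 then have G: "compact G" unfolding G_def by (simp add: compact_Int_closed)
 have G\<Gamma>: "(f x0, \<eta>) \<in> \<Gamma>" if "\<eta> \<in> G" for \<eta> using that C(2) im x0 by (auto simp: G_def)
 have pos: "0 < infdist (?p \<eta>) V" if "(f x0, \<eta>) \<in> \<Gamma>" for \<eta>
 proof (rule infdist_pos_not_in_closed[OF V(1,3)])
  have "(x0, ?p \<eta>) \<in> pull_cone \<Omega>1 f \<Gamma>" using that x0 by (auto simp: pull_cone_def)
  then show "?p \<eta> \<notin> V" using disj by blast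
 qed
 have "\<exists>c1>0. \<forall>\<eta>\<in>G. c1 \<le> infdist (?p \<eta>) V"
 proof (cases "G = {}")
  case False
  then obtain \<eta>0 where "\<eta>0 \<in> G" "\<forall>\<eta>\<in>G. infdist (?p \<eta>0) V \<le> infdist (?p \<eta>) V"
   using continuous_attains_inf[OF G False continuous_on_subset[OF dc subset_UNIV]] by blast
  then show ?thesis using pos[OF G\<Gamma>] by blast
 qed (auto intro: zero_less_one)
 then obtain c1 where c1: "c1 > 0" "\<And>\<eta>. \<eta> \<in> G ==> c1 \<le> infdist (?p \<eta>) V" by blast
 \<comment> \<open>With a quarter of the minimum, \<open>2 * c\<close> still separates
   \<open>W\<close> from \<Gamma>, and one \<open>c\<close> remains after the variation of the base
   point is subtracted.\<close>
 define c where "c = c1 / 4"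
 have c: "c > 0" "2 * c < c1" using c1(1) by (auto simp: c_def)
 define W where "W = {\<eta>. infdist (?p \<eta>) V \<le> 2 * c * norm \<eta>}"
 have W1: "closed W" unfolding W_def by (intro closed_Collect_le dc continuous_intros)
 have scale: "infdist (t *\<^sub>R v) V \<le> t * infdist v V" if "t \<ge> 0" for t v
 proof -
  obtain k where k: "k \<in> V" "infdist v V = dist v k" using infdist_attains_inf[OF V(1,3)] by metis
  have "t *\<^sub>R k \<in> V" using V(2) k(1) that by (simp add: cone_def)
  then have "infdist (t *\<^sub>R v) V \<le> dist (t *\<^sub>R v) (t *\<^sub>R k)" by (rule infdist_le)
  also have "\<dots> = t * infdist v V" using that by (simp add: k(2) dist_norm scaleR_diff_right[symmetric])
  finally show ?thesis .
 qed
 have W2: "cone W" unfolding cone_def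
 proof (intro ballI allI impI)
  fix \<eta> t assume "\<eta> \<in> W" "0 \<le> (t::real)"
  then have "t * infdist (?p \<eta>) V \<le> t * (2 * c * norm \<eta>)" unfolding W_def by (intro mult_left_mono) auto
  then have "infdist (?p (t *\<^sub>R \<eta>)) V \<le> t * (2 * c * norm \<eta>)"
   using scale[OF \<open>0 \<le> t\<close>, of "?p \<eta>"] unfolding pull_covector_scaleR by linarith
  then show "t *\<^sub>R \<eta> \<in> W" using \<open>0 \<le> t\<close> by (simp add: W_def mult_ac)
 qed
 have W3: "({f x0} \<times> W) \<inter> \<Gamma> = {}"
 proof (rule equals0I, clarify)
  fix \<eta> assume a: "\<eta> \<in> W" "(f x0, \<eta>) \<in> \<Gamma>"
  have \<eta>0: "\<eta> \<noteq> 0" using a(2) C(2) by auto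
  define \<eta>' where "\<eta>' = inverse (norm \<eta>) *\<^sub>R \<eta>"
  have "(f x0, \<eta>') \<in> C" using cone[OF a(2), of "inverse (norm \<eta>)"] \<eta>0 C(2) by (simp add: \<eta>'_def)
  moreover have n1: "norm \<eta>' = 1" using \<eta>0 by (simp add: \<eta>'_def)
  ultimately have "c1 \<le> infdist (?p \<eta>') V" by (intro c1(2)) (simp add: G_def)
  moreover have "\<eta>' \<in> W" using a(1) W2 unfolding cone_def \<eta>'_def by simp
  then have "infdist (?p \<eta>') V \<le> 2 * c" using n1 by (simp add: W_def)
  ultimately show False using c(2) by simp
 qed
 obtain r where r: "r > 0" "ball x0 r \<subseteq> \<Omega>1"
  "\<And>x \<eta>. x \<in> ball x0 r ==> norm (pull_covector f x \<eta> - ?p \<eta>) \<le> c * norm \<eta>"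
  by (rule pull_covector_diff_bound[OF x0 c(1)]) (erule that, assumption, assumption)
 obtain A where A: "A > 0" "\<And>\<eta>. norm (?p \<eta>) \<le> A * norm \<eta>"
 proof -
  have "bdd_map {x0} f" by (rule smooth_bdd_map[of _ "{x0}"]) (use x0 in auto)
  then obtain A where "A \<ge> 1" "\<And>x \<eta>. x \<in> {x0} ==> norm (pull_covector f x \<eta>) \<le> A * norm \<eta>"
   by (rule pull_covector_bound) (erule that, assumption)
  then show thesis using that[of A] by simp
 qed
 \<comment> \<open>It collects the bounds for |\<eta>| by gradient/c and for |k| by the gradient
   plus (A + c)|\<eta>|.\<close>
 define D where "D = 1 / c + 1 + (A + c) / c"
 have D: "D > 0" using c(1) A(1) by (simp add: D_def add_pos_pos)
 have low: "inverse D * (norm \<eta> + norm k) \<le> norm (pull_covector f x \<eta> - k)"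
  if \<eta>: "\<eta> \<notin> W" and k: "k \<in> V" and x: "x \<in> ball x0 r" for \<eta> k x
 proof -
  let ?d = "norm (pull_covector f x \<eta> - k)"
  have "2 * c * norm \<eta> < infdist (?p \<eta>) V" using \<eta> by (simp add: W_def)
  also have "\<dots> \<le> dist (?p \<eta>) k" by (rule infdist_le[OF k])
  also have "\<dots> \<le> ?d + norm (pull_covector f x \<eta> - ?p \<eta>)"
   using norm_triangle_ineq[of "pull_covector f x \<eta> - k" "?p \<eta> - pull_covector f x \<eta>"]
   by (simp add: dist_norm norm_minus_commute)
  finally have 1: "c * norm \<eta> \<le> ?d" using r(3)[OF x, of \<eta>] by simp
  then have 2: "norm \<eta> \<le> ?d / c" using c(1) by (simp add: pos_le_divide_eq mult.commute)
  have "norm k \<le> ?d + norm (pull_covector f x \<eta>)" by (metis norm_minus_commute norm_triangle_sub add.commute)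
  moreover have "norm (pull_covector f x \<eta>) \<le> (A + c) * norm \<eta>"
   using norm_triangle_ineq[of "?p \<eta>" "pull_covector f x \<eta> - ?p \<eta>"] A(2)[of \<eta>] r(3)[OF x, of \<eta>] by (simp add: distrib_right)
  moreover have "(A + c) * norm \<eta> \<le> (A + c) * (?d / c)" using 2 A(1) c(1) by (intro mult_left_mono) auto
  ultimately have "norm \<eta> + norm k \<le> ?d / c + ?d + (A + c) * (?d / c)" using 2 by linarith
  also have "\<dots> = D * ?d" by (simp add: D_def distrib_right)
  finally have "inverse D * (norm \<eta> + norm k) \<le> inverse D * (D * ?d)" using D by (intro mult_left_mono) auto
  also have "\<dots> = ?d" using D by simp
  finally show ?thesis .
 qed
 have "inverse D > 0" using D by simp
 from that[OF W1 W2 W3 this r(1,2) low] show thesis by blast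
qed

end

section \<open>Estimates for the pull-back of smooth functions\<close>

text \<open>The partial sums converge uniformly at the tail rate of the absolutely summable
  coefficients, and the weight is integrable. The expansion has to hold only where the weight is
  nonzero.\<close>

lemma has_sum_integral:
 fixes h :: "'k => 'a::euclidean_space => complex" and a :: "'k => complex"
 assumes a: "(\<lambda>m. norm (a m)) summable_on A" and h: "\<And>m x. norm (h m x) \<le> 1" and w: "integrable lborel w"
  and wh: "\<And>m. m \<in> A ==> integrable lborel (\<lambda>x. w x * h m x)" and ws: "integrable lborel (\<lambda>x. w x * s x)"
  and sum: "\<And>x. w x \<noteq> 0 ==> ((\<lambda>m. a m * h m x) has_sum s x) A"
 shows "((\<lambda>m. a m * (LINT x|lborel. w x * h m x)) has_sum (LINT x|lborel. w x * s x)) A"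
proof -
 define T where "T = infsum (\<lambda>m. norm (a m)) A"
 have T: "((\<lambda>m. norm (a m)) has_sum T) A" unfolding T_def using a by (rule has_sum_infsum)
 define D where "D F = (\<Sum>m\<in>F. a m * (LINT x|lborel. w x * h m x)) - (LINT x|lborel. w x * s x)" for F
 define B where "B = (LINT x|lborel. norm (w x))"
 have bound: "norm (D F) \<le> B * (T - (\<Sum>m\<in>F. norm (a m)))" if F: "finite F" "F \<subseteq> A" for F
 proof -
  let ?g = "\<lambda>x. w x * s x - (\<Sum>m\<in>F. a m * (w x * h m x))"
  have i1: "integrable lborel (\<lambda>x. a m * (w x * h m x))" if "m \<in> F" for m
   by (intro integrable_mult_right wh) (use that F in auto)
  have i2: "integrable lborel (\<lambda>x. \<Sum>m\<in>F. a m * (w x * h m x))" by (rule Bochner_Integration.integrable_sum[OF i1])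
  have i3: "(LINT x|lborel. (\<Sum>m\<in>F. a m * (w x * h m x))) = (\<Sum>m\<in>F. a m * (LINT x|lborel. w x * h m x))"
   by (subst Bochner_Integration.integral_sum) (simp_all add: i1)
  have "D F = - (LINT x|lborel. ?g x)"
   unfolding D_def Bochner_Integration.integral_diff[OF ws i2] i3 by simp
  then have "norm (D F) = norm (LINT x|lborel. ?g x)" by simp
  also have "\<dots> \<le> (LINT x|lborel. norm (w x) * (T - (\<Sum>m\<in>F. norm (a m))))"
  proof (rule order_trans[OF integral_norm_bound integral_mono])
   show "integrable lborel (\<lambda>x. norm (?g x))" by (rule integrable_norm, rule Bochner_Integration.integrable_diff[OF ws i2])
   show "integrable lborel (\<lambda>x. norm (w x) * (T - (\<Sum>m\<in>F. norm (a m))))" by (intro integrable_mult_left integrable_norm w)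
   fix x
   have e: "?g x = w x * (s x - (\<Sum>m\<in>F. a m * h m x))" by (simp add: right_diff_distrib sum_distrib_left mult_ac)
   show "norm (?g x) \<le> norm (w x) * (T - (\<Sum>m\<in>F. norm (a m)))"
   proof (cases "w x = 0")
    case False
    have "norm (s x - (\<Sum>m\<in>F. a m * h m x)) \<le> 1 * (T - (\<Sum>m\<in>F. norm (a m)))"
    proof (rule has_sum_tail_bound[OF sum[OF False] T _ F])
     fix m
     show "norm (a m * h m x) \<le> 1 * norm (a m)" using mult_left_mono[OF h[of m x] norm_ge_zero[of "a m"]] by (simp add: norm_mult)
    qed
    then show ?thesis unfolding e norm_mult by (intro mult_left_mono) auto
   qed simp
  qed
  also have "\<dots> = B * (T - (\<Sum>m\<in>F. norm (a m)))" by (simp add: B_def)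
  finally show ?thesis .
 qed
 have "((\<lambda>F. B * (T - (\<Sum>m\<in>F. norm (a m)))) \<longlongrightarrow> B * (T - T)) (finite_subsets_at_top A)"
  by (intro tendsto_mult tendsto_diff tendsto_const T[unfolded has_sum_def])
 then have "((\<lambda>F. B * (T - (\<Sum>m\<in>F. norm (a m)))) \<longlongrightarrow> 0) (finite_subsets_at_top A)" by simp
 then have "(D \<longlongrightarrow> 0) (finite_subsets_at_top A)"
  by (rule Lim_null_comparison[rotated]) (rule eventually_finite_subsets_at_top_weakI[OF bound])
 then show ?thesis unfolding has_sum_def D_def[abs_def] by (rule LIM_zero_cancel)
qed

text \<open>\<open>S\<close> and \<open>C\<close> are chosen before \<open>g\<close>, which makes
  this a continuity estimate. One real bound \<open>P\<close> for all seminorms in \<open>S\<close>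
  avoids arithmetic with extended reals.\<close>

definition pullback_estimate ::
  "(real^'m) set => (real^'n) set => ((real^'n) \<times> (real^'n)) set => (real^'m => real^'n) =>
   (real^'m) set => nat => 'i set => ('i => real^'m => complex) => bool" where
 "pullback_estimate \<Omega>1 \<Omega>2 \<Gamma> f V N I \<psi> \<longleftrightarrow> (\<exists>S C. finite S \<and> S \<subseteq> normal_seminorms \<Omega>2 \<Gamma> \<and> 0 \<le> C \<and>
   (\<forall>g P. smooth_on \<Omega>2 g --> 0 \<le> P --> (\<forall>p\<in>S. p (distribution_of \<Omega>2 g) \<le> ennreal P) -->
    (\<forall>i\<in>I. \<forall>k\<in>V. decay N (distribution_of \<Omega>1 (g \<circ> f)) (\<psi> i) k \<le> C * P)))"

context
 fixes \<Omega>1 :: "(real^'m) set" and \<Omega>2 :: "(real^'n) set" and \<Gamma> f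
 assumes \<Omega>1: "open \<Omega>1" and \<Omega>2: "open \<Omega>2" and \<Gamma>: "closed_cone_over \<Omega>2 \<Gamma>"
  and f: "smooth_on \<Omega>1 f" and im: "f ` \<Omega>1 \<subseteq> \<Omega>2"
begin

lemma continuous_f: "continuous_on \<Omega>1 f"
 by (rule smooth_on_continuous[OF f])

lemma continuous_comp:
 assumes "smooth_on \<Omega>2 (g :: real^'n => complex)"
 shows "continuous_on \<Omega>1 (g \<circ> f)"
 by (rule continuous_on_compose[OF continuous_f continuous_on_subset[OF smooth_on_continuous[OF assms] im]])

text \<open>The series of \<theta>g is evaluated at f(x), where \<theta> is 1, and integrated
  against the localised exponential; its coefficients are local Fourier coefficients of
  \<open>g\<close>.\<close>

lemma local_fourier_pullback:
 fixes g \<theta> :: "real^'n => complex" and \<chi>0 :: "real^'m => complex"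
 assumes g: "smooth_on \<Omega>2 g" and L: "compact L" "L \<subseteq> \<Omega>2" "L \<subseteq> ball y0 1" and \<theta>: "test_fun L \<theta>"
  and K: "compact K" "K \<subseteq> \<Omega>1" and \<psi>: "test_fun K \<chi>0" and one: "\<And>x. x \<in> K ==> \<theta> (f x) = 1"
 shows "((\<lambda>m. fourier_const TYPE(real^'n) * (local_fourier (distribution_of \<Omega>2 g) \<theta> m * osc_integral f \<chi>0 m k))
   has_sum local_fourier (distribution_of \<Omega>1 (g \<circ> f)) \<chi>0 k) int_lattice"
proof -
 let ?c = "fourier_const TYPE(real^'n)"
 define \<phi> where "\<phi> y = \<theta> y * g y" for y
 have \<phi>: "test_fun L \<phi>" unfolding \<phi>_def by (rule test_family_smooth_mult[OF \<Omega>2 g L(1,2) \<theta>])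
 \<comment> \<open>The reflection m to -m reconciles the signs of \<open>fhat\<close> and
   \<open>local_fourier\<close>; the lattice is symmetric.\<close>
 define a where "a m = ?c * fhat \<phi> (- m)" for m
 define h where "h m x = iexp (m \<bullet> f x)" for m x
 define w where "w x = \<chi>0 x * osc k x" for x
 have off: "\<chi>0 x = 0" if "x \<notin> K" for x using test_family_0[OF \<psi> _ that] by simp
 have \<psi>c: "continuous_on K \<chi>0" using test_family_continuous[OF \<psi>, of "()"] by (rule continuous_on_subset) auto
 have wc: "continuous_on K w" unfolding w_def by (intro continuous_intros \<psi>c)
 have fc: "continuous_on K f" by (rule continuous_on_subset[OF continuous_f K(2)])
 have sa: "(\<lambda>m. norm (a m)) summable_on int_lattice"
 proof -
  have "(\<lambda>m. norm (fhat \<phi> m)) summable_on int_lattice" using fhat_summable(1)[OF L(1) \<phi>, of 0] by simp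
  then have "(\<lambda>m. norm (fhat \<phi> (- m))) summable_on int_lattice"
   using summable_on_reindex_bij_betw[OF bij_betw_lattice_uminus, of "\<lambda>m. norm (fhat \<phi> m)"] by simp
  then show ?thesis unfolding a_def norm_mult by (rule summable_on_cmult_right)
 qed
 have "((\<lambda>m. a m * (LINT x|lborel. w x * h m x)) has_sum (LINT x|lborel. w x * (g \<circ> f) x)) int_lattice"
 proof (rule has_sum_integral[OF sa])
  show "norm (h m x) \<le> 1" for m x by (simp add: h_def)
  show "integrable lborel w" by (rule integrable_on_compact[OF K(1) wc]) (simp add: w_def off)
  show "integrable lborel (\<lambda>x. w x * h m x)" for m
   by (rule integrable_on_compact[OF K(1)]) (auto simp: w_def off h_def intro!: continuous_intros \<psi>c fc)
  show "integrable lborel (\<lambda>x. w x * (g \<circ> f) x)"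
   by (rule integrable_on_compact[OF K(1) continuous_on_mult[OF wc continuous_on_subset[OF continuous_comp[OF g] K(2)]]])
    (simp add: w_def off)
  fix x assume "w x \<noteq> 0"
  then have xK: "x \<in> K" using off by (auto simp: w_def)
  have fL: "f x \<in> L" using one[OF xK] test_family_0[OF \<theta>, of "()" "f x"] by auto
  \<comment> \<open>Two points of a ball of radius 1 are less than 2 apart, within the range of the
    unscaled series.\<close>
  have "L \<subseteq> ball (f x) 3"
  proof
   fix y assume "y \<in> L"
   then have "dist y0 y < 1" "dist y0 (f x) < 1" using fL L(3) by auto
   then show "y \<in> ball (f x) 3" using dist_triangle[of "f x" y y0] by (simp add: dist_commute)
  qed
  from fourier_series[OF L(1) this \<phi>]
  have "((\<lambda>m. ?c * (fhat \<phi> (- m) * osc (- m) (f x))) has_sum \<phi> (f x)) int_lattice"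
   using has_sum_reindex_bij_betw[OF bij_betw_lattice_uminus, of "\<lambda>m. ?c * (fhat \<phi> m * osc m (f x))"] by simp
  then show "((\<lambda>m. a m * h m x) has_sum (g \<circ> f) x) int_lattice"
   by (simp add: a_def h_def \<phi>_def one[OF xK] mult.assoc)
 qed
 moreover have "a m * (LINT x|lborel. w x * h m x) =
   ?c * (local_fourier (distribution_of \<Omega>2 g) \<theta> m * osc_integral f \<chi>0 m k)" for m
 proof -
  have "w x * h m x = \<chi>0 x * iexp (m \<bullet> f x - k \<bullet> x)" for x
   by (simp add: w_def h_def exp_add[symmetric] algebra_simps)
  then show ?thesis
   unfolding osc_integral_def local_fourier_distribution_of[OF L(1,2) \<theta>] a_def \<phi>_def[abs_def] by (simp add: mult.assoc)
 qed
 moreover have "(LINT x|lborel. w x * (g \<circ> f) x) = local_fourier (distribution_of \<Omega>1 (g \<circ> f)) \<chi>0 k"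
 proof -
  have t: "w \<in> test_functions \<Omega>1"
   using test_family_test_functions(1)[OF K test_family_osc[OF K(1) \<psi>, of "{()}" "\<lambda>_. 1" "\<lambda>_. k"], of "()"]
   unfolding w_def[abs_def] by auto
  have "indicator \<Omega>1 x *\<^sub>R ((g \<circ> f) x * w x) = w x * (g \<circ> f) x" for x
   using off[of x] K(2) by (cases "x \<in> \<Omega>1") (auto simp: w_def)
  then show ?thesis using distribution_of_eq[OF t, of "g \<circ> f"] unfolding local_fourier_def w_def[abs_def, symmetric] by simp
 qed
 ultimately show ?thesis by simp
qed

text \<open>The cone \<open>W\<close> from \<open>pull_cone_separation\<close> misses \<Gamma> over
  \<open>f x0\<close>, and a cutoff \<theta> near that point has a support over which
  \<open>W\<close> still misses \<Gamma>. The decay of \<theta>g on \<open>W\<close> is therefore a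
  normal seminorm, and all other frequencies are handled by one bounded set.\<close>

lemma pullback_estimate_local:
 fixes V :: "(real^'m) set"
 assumes x0: "x0 \<in> \<Omega>1" and V: "closed V" "cone V" "V \<noteq> {}" and disj: "({x0} \<times> V) \<inter> pull_cone \<Omega>1 f \<Gamma> = {}"
 obtains r where "r > 0" "ball x0 r \<subseteq> \<Omega>1"
  "\<And>K (I :: 'i set) \<psi> N. compact K ==> K \<subseteq> ball x0 r ==> test_family K I \<psi> ==> pullback_estimate \<Omega>1 \<Omega>2 \<Gamma> f V N I \<psi>"
proof -
 obtain W c r where W: "closed W" "cone W" "({f x0} \<times> W) \<inter> \<Gamma> = {}" and c: "c > 0" and r: "r > 0" "ball x0 r \<subseteq> \<Omega>1"
  and low: "\<And>\<eta> k x. \<eta> \<notin> W ==> k \<in> V ==> x \<in> ball x0 r ==> c * (norm \<eta> + norm k) \<le> norm (pull_covector f x \<eta> - k)"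
  by (rule pull_cone_separation[OF \<Omega>1 f \<Gamma> im x0 V disj]) (rule that, assumption+)
 have y0: "compact {f x0}" "{f x0} \<subseteq> \<Omega>2" using im x0 by auto
 obtain \<rho> where \<rho>: "\<rho> > 0" "thicken \<rho> {f x0} \<subseteq> \<Omega>2" "(thicken \<rho> {f x0} \<times> W) \<inter> \<Gamma> = {}"
  by (rule thicken_separate[OF \<Gamma> \<Omega>2 y0 W]) (erule that, assumption, assumption)
 \<comment> \<open>Below 1, so that the unscaled Fourier series suffices on the target side.\<close>
 define r1 where "r1 = min \<rho> (1/2)"
 have r1: "0 < r1" "r1 \<le> \<rho>" "r1 < 1" using \<rho>(1) by (auto simp: r1_def)
 define L where "L = cball (f x0) r1"
 obtain \<theta> :: "real^'n => complex" where \<theta>0: "test_fun (cball (f x0) r1) \<theta>"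
  and \<theta>1: "\<And>y. y \<in> cball (f x0) (r1 / 2) ==> \<theta> y = 1" by (rule bump_exists[OF r1(1), of "f x0"]) (erule that, assumption)
 note \<theta> = \<theta>0[folded L_def]
 have Lt: "L \<subseteq> thicken \<rho> {f x0}"
 proof
  fix y assume "y \<in> L"
  then have "y = f x0 + (y - f x0)" "norm (y - f x0) \<le> \<rho>" using r1(2) by (auto simp: L_def dist_norm norm_minus_commute)
  then show "y \<in> thicken \<rho> {f x0}" unfolding thicken_def mem_Collect_eq by (intro exI[of _ "f x0"] exI[of _ "y - f x0"]) simp
 qed
 have L: "compact L" "L \<subseteq> \<Omega>2" "L \<subseteq> ball (f x0) 1" using Lt \<rho>(2) r1(3) by (auto simp: L_def)
 have \<theta>t: "\<theta> \<in> test_functions \<Omega>2" using test_family_test_functions(1)[OF L(1,2) \<theta>] by simp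
 have "\<theta> y = 0" if "y \<notin> L" for y using test_family_0[OF \<theta> _ that] by simp
 then have "supp \<theta> \<subseteq> L" by (intro supp_subsetI compact_imp_closed L(1)) auto
 then have \<theta>W: "(supp \<theta> \<times> W) \<inter> \<Gamma> = {}" using Lt \<rho>(3) by blast
 have "isCont f x0" using continuous_f \<Omega>1 x0 by (simp add: continuous_on_eq_continuous_at)
 then obtain d where d: "d > 0" "\<And>x. dist x x0 < d ==> dist (f x) (f x0) < r1 / 2"
  using half_gt_zero[OF r1(1)] unfolding continuous_at_eps_delta by metis
 \<comment> \<open>Half of the minimum keeps the closed ball inside the region of the lower bound,
   and \<open>f\<close> maps it into the set where \<theta> is 1.\<close>
 define r' where "r' = min r d / 2"
 have r': "r' > 0" "r' < r" "r' < d" using r(1) d(1) by (auto simp: r'_def min_def)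
 have U: "ball x0 r' \<subseteq> cball x0 r'" "compact (cball x0 r')" "cball x0 r' \<subseteq> \<Omega>1" "ball x0 r' \<subseteq> \<Omega>1" "ball x0 r' \<subseteq> ball x0 r"
 proof -
  show "cball x0 r' \<subseteq> \<Omega>1" using r(2) r'(2) by (intro subset_trans[OF _ r(2)]) (auto simp: subset_iff)
  then show "ball x0 r' \<subseteq> \<Omega>1" by (rule subset_trans[OF ball_subset_cball])
  show "ball x0 r' \<subseteq> ball x0 r" using r'(2) by (intro subset_ball) simp
 qed auto
 have one: "\<theta> (f x) = 1" if "x \<in> ball x0 r'" for x
 proof -
  have "dist x x0 < d" using that r'(3) by (simp add: dist_commute)
  then have "f x \<in> cball (f x0) (r1 / 2)" using d(2)[of x] by (simp add: dist_commute)
  then show ?thesis by (rule \<theta>1)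
 qed
 have "pullback_estimate \<Omega>1 \<Omega>2 \<Gamma> f V N I \<psi>" if K: "compact K" "K \<subseteq> ball x0 r'" and \<psi>: "test_family K I \<psi>"
  for K and I :: "'i set" and \<psi> N
 proof -
  have low': "c * (norm \<eta> + norm k) \<le> norm (pull_covector f x \<eta> - k)" if "\<eta> \<notin> W" "k \<in> V" "x \<in> ball x0 r'" for \<eta> k x
   using low that U(5) by blast
  define M where "M = N + 2 * DIM(real^'n)"
  obtain B C where B: "bounded_test_set \<Omega>2 B" and C: "C > 0"
   and est: "\<forall>u P Q. controlled_by \<Omega>2 B W M \<theta> u P Q -->
    (\<forall>i\<in>I. \<forall>k\<in>V. \<forall>m. (1 + norm k) ^ N * (norm (osc_integral f (\<psi> i) m k) * norm (local_fourier u \<theta> m)) \<le> C * (P + Q) * lattice_weight m)"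
  proof -
   have "\<exists>B C. bounded_test_set \<Omega>2 B \<and> C > 0 \<and> (\<forall>u P Q. controlled_by \<Omega>2 B W M \<theta> u P Q -->
    (\<forall>i\<in>I. \<forall>k\<in>V. \<forall>m. (1 + norm k) ^ N * (norm (osc_integral f (\<psi> i) m k) * norm (local_fourier u \<theta> m)) \<le> C * (P + Q) * lattice_weight m))"
    unfolding M_def by (rule oscillatory_product_bound[OF open_ball K smooth_bdd_map[OF \<Omega>1 f U(1-3)] \<psi> c _ L(1,2) \<theta>]) (rule low')
   then show thesis by (elim exE conjE) (rule that)
  qed
  \<comment> \<open>Two seminorms suffice locally: one tests \<open>g\<close> on a bounded set, the
    other measures its decay on \<open>W\<close>.\<close>
  define S where "S = {bounded_set_seminorm B, fourier_seminorm M W \<theta>}"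
  have "S \<subseteq> normal_seminorms \<Omega>2 \<Gamma>" unfolding S_def normal_seminorms_def using B \<theta>t W \<theta>W by blast
  moreover have "finite S" by (simp add: S_def)
  define E where "E = norm (fourier_const TYPE(real^'n)) * (C * 2) * infsum (lattice_weight :: real^'n => real) int_lattice"
  have "0 \<le> infsum (lattice_weight :: real^'n => real) int_lattice"
   by (intro infsum_nonneg less_imp_le lattice_weight_pos)
  then have E: "0 \<le> E" unfolding E_def using C by (intro mult_nonneg_nonneg) auto
  moreover have "decay N (distribution_of \<Omega>1 (g \<circ> f)) (\<psi> i) k \<le> E * P"
   if g: "smooth_on \<Omega>2 g" and P: "0 \<le> P" "\<forall>p\<in>S. p (distribution_of \<Omega>2 g) \<le> ennreal P" and i: "i \<in> I" and k: "k \<in> V" for g P i k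
  proof -
   let ?u = "distribution_of \<Omega>2 g"
   have u: "?u \<in> distributions \<Omega>2" by (rule distribution_of_in_distributions[OF smooth_on_continuous[OF g]])
   have "controlled_by \<Omega>2 B W M \<theta> ?u P P"
    unfolding controlled_by_def
   proof (intro conjI P(1))
    show "\<forall>\<phi>\<in>test_functions \<Omega>2. \<forall>c. ?u (\<lambda>x. c * \<phi> x) = c * ?u \<phi>" by (intro ballI allI distribution_cmult[OF u])
    show "\<forall>\<phi>\<in>B. norm (?u \<phi>) \<le> P" using P(2) unfolding S_def by (simp add: bounded_set_seminorm_le_iff[OF P(1)])
    show "\<forall>m\<in>W. decay M ?u \<theta> m \<le> P"
     using P(2) unfolding S_def by (simp add: fourier_seminorm_le_iff[OF P(1)])
   qed
   from mp[OF spec[OF spec[OF spec[OF est]]] this]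
   have e: "(1 + norm k) ^ N * (norm (osc_integral f (\<psi> i) m k) * norm (local_fourier ?u \<theta> m)) \<le> C * (P + P) * lattice_weight m" for m
    using i k by blast
   have \<psi>i: "test_fun K (\<psi> i)" using test_family_reindex[OF \<psi>, of "\<lambda>_. i" "{()}"] i by auto
   have K\<Omega>: "K \<subseteq> \<Omega>1" using K(2) U(4) by blast
   let ?t = "\<lambda>m. fourier_const TYPE(real^'n) * (local_fourier ?u \<theta> m * osc_integral f (\<psi> i) m k)"
   let ?z = "complex_of_real ((1 + norm k) ^ N)"
   have hs: "((\<lambda>m. ?z * ?t m) has_sum ?z * local_fourier (distribution_of \<Omega>1 (g \<circ> f)) (\<psi> i) k) int_lattice"
    by (intro has_sum_cmult_right local_fourier_pullback[OF g L \<theta> K(1) K\<Omega> \<psi>i] one) (use K(2) in blast)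
   have z: "norm ?z = (1 + norm k) ^ N" by (subst norm_of_real) simp
   have "norm (?z * local_fourier (distribution_of \<Omega>1 (g \<circ> f)) (\<psi> i) k) \<le>
     (norm (fourier_const TYPE(real^'n)) * (C * (P + P))) * infsum (lattice_weight :: real^'n => real) int_lattice"
   proof (rule has_sum_lattice_norm_bound[OF hs])
    fix m
    have "norm (?z * ?t m) = norm (fourier_const TYPE(real^'n)) *
      ((1 + norm k) ^ N * (norm (osc_integral f (\<psi> i) m k) * norm (local_fourier ?u \<theta> m)))"
     unfolding norm_mult z by (simp add: mult_ac)
    also have "\<dots> \<le> norm (fourier_const TYPE(real^'n)) * (C * (P + P) * lattice_weight m)"
     by (intro mult_left_mono e) simp
    finally show "norm (?z * ?t m) \<le> norm (fourier_const TYPE(real^'n)) * (C * (P + P)) * lattice_weight m" by (simp add: mult.assoc)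
   qed
   then show ?thesis unfolding norm_mult z by (simp add: E_def mult_ac)
  qed
  ultimately show ?thesis unfolding pullback_estimate_def using \<open>finite S\<close> by (intro exI[of _ S] exI[of _ E]) simp
 qed
 from that[OF r'(1) U(4) this] show thesis .
qed

text \<open>A partition of unity reduces to finitely many local estimates, whose seminorms are
  united and whose constants are added. For empty \<open>V\<close> nothing is to be estimated, and
  the local lemma needs a nonempty cone.\<close>

lemma pullback_estimate:
 fixes V :: "(real^'m) set" and I :: "'i set"
 assumes V: "closed V" "cone V" and K: "compact K" "K \<subseteq> \<Omega>1" and disj: "(K \<times> V) \<inter> pull_cone \<Omega>1 f \<Gamma> = {}"
  and \<psi>: "test_family K I \<psi>"
 shows "pullback_estimate \<Omega>1 \<Omega>2 \<Gamma> f V N I \<psi>"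
proof (cases "V = {}")
 case True
 then show ?thesis unfolding pullback_estimate_def by (intro exI[of _ "{}"] exI[of _ 0]) simp
next
 case False
 have "\<exists>r>0. ball x0 r \<subseteq> \<Omega>1 \<and> (\<forall>K (I :: 'i set) \<psi>. compact K --> K \<subseteq> ball x0 r --> test_family K I \<psi> -->
   pullback_estimate \<Omega>1 \<Omega>2 \<Gamma> f V N I \<psi>)" if x0: "x0 \<in> K" for x0
 proof -
  have x1: "x0 \<in> \<Omega>1" "({x0} \<times> V) \<inter> pull_cone \<Omega>1 f \<Gamma> = {}" using x0 K(2) disj by auto
  show ?thesis
  proof (rule pullback_estimate_local[OF x1(1) V False x1(2)])
   fix r assume r: "r > 0" "ball x0 r \<subseteq> \<Omega>1"
    "\<And>K (I :: 'i set) \<psi> N. compact K ==> K \<subseteq> ball x0 r ==> test_family K I \<psi> ==> pullback_estimate \<Omega>1 \<Omega>2 \<Gamma> f V N I \<psi>"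
   show ?thesis by (intro exI[of _ r] conjI allI impI r(1,2)) (rule r(3))
  qed
 qed
 then obtain r where r: "\<And>x0. x0 \<in> K ==> r x0 > 0"
  "\<And>x0 K' (I :: 'i set) \<psi>. x0 \<in> K ==> compact K' ==> K' \<subseteq> ball x0 (r x0) ==> test_family K' I \<psi> ==> pullback_estimate \<Omega>1 \<Omega>2 \<Gamma> f V N I \<psi>"
  by metis
 obtain X L \<Psi> where X: "finite X" "X \<subseteq> K" and L: "\<And>x. x \<in> X ==> compact (L x)" "\<And>x. x \<in> X ==> L x \<subseteq> ball x (r x) \<inter> K"
  and \<Psi>: "\<And>x. x \<in> X ==> test_family (L x) I (\<Psi> x)" and sum: "\<And>i y. i \<in> I ==> \<psi> i y = (\<Sum>x\<in>X. \<Psi> x i y)"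
 proof (rule test_family_localize[OF K(1) _ \<psi>, of "\<lambda>x. ball x (r x)"])
  show "open (ball x (r x)) \<and> x \<in> ball x (r x)" if "x \<in> K" for x using r(1)[OF that] by simp
 qed (rule that, assumption+)
 have "pullback_estimate \<Omega>1 \<Omega>2 \<Gamma> f V N I (\<Psi> x)" if "x \<in> X" for x
  by (rule r(2)[OF _ L(1)[OF that] _ \<Psi>[OF that]]) (use that X(2) L(2)[OF that] in auto)
 then have "\<forall>x. \<exists>S C. x \<in> X --> finite S \<and> S \<subseteq> normal_seminorms \<Omega>2 \<Gamma> \<and> 0 \<le> C \<and>
   (\<forall>g P. smooth_on \<Omega>2 g --> 0 \<le> P --> (\<forall>p\<in>S. p (distribution_of \<Omega>2 g) \<le> ennreal P) -->
    (\<forall>i\<in>I. \<forall>k\<in>V. decay N (distribution_of \<Omega>1 (g \<circ> f)) (\<Psi> x i) k \<le> C * P))"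
  unfolding pullback_estimate_def by simp
 then obtain S where "\<forall>x. \<exists>C. x \<in> X --> finite (S x) \<and> S x \<subseteq> normal_seminorms \<Omega>2 \<Gamma> \<and> 0 \<le> C \<and>
   (\<forall>g P. smooth_on \<Omega>2 g --> 0 \<le> P --> (\<forall>p\<in>S x. p (distribution_of \<Omega>2 g) \<le> ennreal P) -->
    (\<forall>i\<in>I. \<forall>k\<in>V. decay N (distribution_of \<Omega>1 (g \<circ> f)) (\<Psi> x i) k \<le> C * P))"
  by (drule_tac choice) (erule exE, rule that)
 then obtain C where SC: "\<And>x. x \<in> X ==> finite (S x) \<and> S x \<subseteq> normal_seminorms \<Omega>2 \<Gamma> \<and> 0 \<le> C x \<and>
   (\<forall>g P. smooth_on \<Omega>2 g --> 0 \<le> P --> (\<forall>p\<in>S x. p (distribution_of \<Omega>2 g) \<le> ennreal P) -->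
    (\<forall>i\<in>I. \<forall>k\<in>V. decay N (distribution_of \<Omega>1 (g \<circ> f)) (\<Psi> x i) k \<le> C x * P))"
  by (drule_tac choice) (erule exE, rule that, blast)
 show ?thesis unfolding pullback_estimate_def
 proof (intro exI[of _ "\<Union>x\<in>X. S x"] exI[of _ "\<Sum>x\<in>X. C x"] conjI allI impI ballI)
  show "finite (\<Union>x\<in>X. S x)" using X(1) SC by (intro finite_UN_I) simp_all
  show "(\<Union>x\<in>X. S x) \<subseteq> normal_seminorms \<Omega>2 \<Gamma>" using SC by (intro UN_least) simp
  show "0 \<le> (\<Sum>x\<in>X. C x)" using SC by (intro sum_nonneg) simp
  fix g P i k assume g: "smooth_on \<Omega>2 g" and P: "0 \<le> P" "\<forall>p\<in>\<Union>x\<in>X. S x. p (distribution_of \<Omega>2 g) \<le> ennreal P" and i: "i \<in> I" and k: "k \<in> V"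
  let ?u = "distribution_of \<Omega>1 (g \<circ> f)"
  have b: "decay N ?u (\<Psi> x i) k \<le> C x * P" if "x \<in> X" for x
   using SC[OF that] g P i k that by blast
  have u: "?u \<in> distributions \<Omega>1" by (rule distribution_of_in_distributions[OF continuous_comp[OF g]])
  have L\<Omega>: "L x \<subseteq> \<Omega>1" if "x \<in> X" for x using L(2)[OF that] K(2) by blast
  have "local_fourier ?u (\<psi> i) k = (\<Sum>x\<in>X. local_fourier ?u (\<Psi> x i) k)"
   by (rule local_fourier_sum[OF u X(1) L(1) L\<Omega> \<Psi> sum[OF i] i])
  then have "decay N ?u (\<psi> i) k \<le> (1 + norm k) ^ N * (\<Sum>x\<in>X. norm (local_fourier ?u (\<Psi> x i) k))"
   by (intro mult_left_mono) (auto intro: norm_sum)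
  also have "\<dots> \<le> (\<Sum>x\<in>X. C x * P)" unfolding sum_distrib_left by (rule sum_mono[OF b])
  finally show "decay N ?u (\<psi> i) k \<le> (\<Sum>x\<in>X. C x) * P" by (simp add: sum_distrib_right)
 qed
qed

end

section \<open>Density of smooth functions\<close>

text \<open>One minus the product of the factors 1 - \<beta>: it is 1 where some bump is 1, and 0
  where all bumps vanish.\<close>

lemma cutoff_exists:
 fixes \<Omega> :: "'a::euclidean_space set"
 assumes \<Omega>: "open \<Omega>" and K: "compact K" "K \<subseteq> \<Omega>"
 obtains \<theta> L where "compact L" "L \<subseteq> \<Omega>" "test_fun L \<theta>" "\<And>x. x \<in> K ==> \<theta> x = (1::complex)"
proof -
 have "\<forall>x. \<exists>e. x \<in> K --> 0 < e \<and> cball x e \<subseteq> \<Omega>" using \<Omega> K(2) open_contains_cball by blast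
 then obtain e where e: "\<And>x. x \<in> K ==> 0 < e x" "\<And>x. x \<in> K ==> cball x (e x) \<subseteq> \<Omega>" by metis
 have "\<exists>\<beta>. test_fun (cball x (e x)) \<beta> \<and> (\<forall>y\<in>cball x (e x / 2). \<beta> y = (1 :: complex))" if "x \<in> K" for x
  by (rule bump_exists[OF e(1)[OF that], of x]) blast
 then obtain \<beta> :: "'a => 'a => complex" where \<beta>: "\<And>x. x \<in> K ==> test_fun (cball x (e x)) (\<beta> x)"
  "\<And>x y. x \<in> K ==> y \<in> cball x (e x / 2) ==> \<beta> x y = 1" by metis
 have "K \<subseteq> (\<Union>x\<in>K. ball x (e x / 2))" using e(1) by (auto intro!: bexI)
 then obtain X where X: "X \<subseteq> K" "finite X" "K \<subseteq> (\<Union>x\<in>X. ball x (e x / 2))"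
  by (rule compactE_image[OF K(1) open_ball]) 
 define L where "L = (\<Union>x\<in>X. cball x (e x))"
 define \<theta> where "\<theta> y = 1 - (\<Prod>x\<in>X. 1 - \<beta> x y)" for y
 have L1: "compact L" unfolding L_def using X(2) by (intro compact_UN) auto
 have L2: "L \<subseteq> \<Omega>" unfolding L_def using X(1) e(2) by blast
 have b: "bdd_family UNIV {()} (\<lambda>_. \<beta> x)" if "x \<in> X" for x
  using \<beta>(1)[of x] that X(1) by (auto simp: test_family_def)
 have one: "bdd_family UNIV {()} (\<lambda>_ y. 1 :: complex)" by (rule bdd_family_const[of _ _ 1]) simp
 have "bdd_family UNIV {()} (\<lambda>_. \<theta>)" unfolding \<theta>_def
  by (intro bdd_family_diff bdd_family_prod one b X(2) open_UNIV)
 moreover have "\<theta> y = 0" if "y \<notin> L" for y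
 proof -
  have "\<beta> x y = 0" if x: "x \<in> X" for x
   by (rule test_family_0[OF \<beta>(1), of x "()" y]) (use x X(1) \<open>y \<notin> L\<close> in \<open>auto simp: L_def\<close>)
  then show ?thesis by (simp add: \<theta>_def)
 qed
 ultimately have L3: "test_fun L \<theta>" by (simp add: test_family_def)
 have "\<theta> y = 1" if y: "y \<in> K" for y
 proof -
  obtain x where x: "x \<in> X" "y \<in> ball x (e x / 2)" using X(3) y by blast
  then have "1 - \<beta> x y = 0" using \<beta>(2)[of x y] X(1) by auto
  then show ?thesis unfolding \<theta>_def using prod_zero[OF X(2), of "\<lambda>x. 1 - \<beta> x y"] x(1) by auto
 qed
 from that[OF L1 L2 L3 this] show thesis .
qed

lemma test_family_osc_single:
 fixes \<theta> :: "'i => 'a::euclidean_space => complex"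
 assumes L: "compact L" and \<theta>: "test_family L I \<theta>" and i: "i \<in> I"
 shows "test_fun L (\<lambda>y. \<theta> i y * osc k y)"
proof -
 have "test_fun L (\<theta> i)" using test_family_reindex[OF \<theta>, of "\<lambda>_. i" "{()}"] i by auto
 from test_family_osc[OF L this, of "{()}" "\<lambda>_. 1" "\<lambda>_. k"] show ?thesis by auto
qed

text \<open>Multiplying the mollifier by \<open>e\<^sub>k\<close> spoils its normalisation; adding \<open>1 - q\<close> times the mollifier, with \<open>q\<close>
 the integral of the product, restores it, and \<open>1 - q = O(r |k|)\<close> costs one power of \<open>|k|\<close>.\<close>

lemma mollify_estimate:
 fixes u :: "(real^'n => complex) => complex" and \<psi> :: "'i => real^'n => complex" and r :: "nat => real"
 assumes u: "u \<in> distributions_WF \<Omega> \<Gamma>" and \<Omega>: "open \<Omega>" and \<Gamma>: "closed_cone_over \<Omega> \<Gamma>"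
  and V: "closed V" "cone V" and K: "compact K" "K \<subseteq> \<Omega>" "(K \<times> V) \<inter> \<Gamma> = {}" and \<psi>: "test_family K I \<psi>"
  and r: "\<And>n. 0 < r n" "r \<longlonglongrightarrow> 0" and \<rho>: "\<And>n. test_fun (cball 0 (r n)) (\<rho> n)"
  and \<rho>1: "\<And>n. (LINT x|lborel. \<rho> n x) = 1" "\<And>n. (LINT x|lborel. norm (\<rho> n x)) = 1"
 obtains C n0 where "\<And>n i k. n \<ge> n0 ==> i \<in> I ==> k \<in> V ==> (1 + norm k) ^ N *
  norm (u (correlate (\<rho> n) (\<lambda>x. \<psi> i x * osc k x)) - local_fourier u (\<psi> i) k) \<le> C * r n"
proof -
 have ud: "u \<in> distributions \<Omega>" using u by (simp add: distributions_WF_def)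
 obtain d where d: "d > 0" "thicken d K \<subseteq> \<Omega>" "(thicken d K \<times> V) \<inter> \<Gamma> = {}"
  by (rule thicken_separate[OF \<Gamma> \<Omega> K(1,2) V K(3)]) (erule that, assumption, assumption)
 \<comment> \<open>The mollified families live in this thickening, which still misses \<Gamma> over
   \<open>V\<close>, so \<open>wf_decay\<close> applies to them.\<close>
 define K1 where "K1 = thicken d K"
 have K1: "compact K1" "K1 \<subseteq> \<Omega>" "(K1 \<times> V) \<inter> \<Gamma> = {}" using d K(1) by (simp_all add: K1_def compact_thicken)
 have KK1: "K \<subseteq> K1" unfolding K1_def by (rule subset_thicken) (use d(1) in simp)
 have "eventually (\<lambda>n. r n < min d 1) sequentially" by (rule order_tendstoD(2)[OF r(2)]) (use d(1) in simp)
 then obtain n0 where n0: "\<And>n. n \<ge> n0 ==> r n < min d 1" by (auto simp: eventually_sequentially)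
 define e where "e k z = osc k z" for k z :: "real^'n"
 have ne: "norm (e k z) = 1" for k z by (simp add: e_def norm_exp_eq_Re)
 have ec: "continuous_on A (e k)" for A k unfolding e_def by (rule continuous_on_osc)
 have \<rho>c: "continuous_on UNIV (\<rho> n)" for n using test_family_continuous[OF \<rho>, of "()"] by simp
 have \<rho>0: "\<rho> n z = 0" if "z \<notin> cball 0 (r n)" for n z using test_family_0[OF \<rho> _ that] by simp
 define q where "q n k = (LINT z|lborel. \<rho> n z * e k z)" for n k
 \<comment> \<open>Its integral is q + (1 - q) = 1, as \<open>test_family_correlate_diff\<close>
   requires.\<close>
 define w where "w p z = \<rho> (fst p) z * e (fst (snd p)) z + (1 - q (fst p) (fst (snd p))) * \<rho> (fst p) z"
  for p :: "nat \<times> (real^'n) \<times> 'i" and z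
 have i\<rho>: "integrable lborel (\<rho> n)" for n by (rule integrable_compact_support[OF compact_cball \<rho>c \<rho>0])
 have i\<rho>e: "integrable lborel (\<lambda>z. \<rho> n z * e k z)" for n k
  by (rule integrable_compact_support[OF compact_cball[of 0 "r n"] continuous_on_mult[OF \<rho>c ec]]) (simp add: \<rho>0)
 have q1: "norm (q n k) \<le> 1" for n k
 proof -
  have "norm (q n k) \<le> (LINT z|lborel. norm (\<rho> n z * e k z))" unfolding q_def by (rule integral_norm_bound)
  also have "\<dots> = 1" by (simp add: norm_mult ne \<rho>1(2))
  finally show ?thesis .
 qed
 \<comment> \<open>On the support of the mollifier |1 - exp(-ik.z)| is at most |k||z|, and |z| is at
   most \<open>r n\<close>.\<close>
 have q2: "norm (1 - q n k) \<le> r n * norm k" for n k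
 proof -
  have "1 - q n k = (LINT z|lborel. \<rho> n z - \<rho> n z * e k z)" unfolding q_def using i\<rho>[of n] i\<rho>e[of n k] by (simp add: \<rho>1(1))
  then have "norm (1 - q n k) \<le> (LINT z|lborel. norm (\<rho> n z - \<rho> n z * e k z))" by (simp only: integral_norm_bound)
  also have "\<dots> \<le> (LINT z|lborel. norm (\<rho> n z) * (r n * norm k))"
  proof (rule integral_mono)
   show "integrable lborel (\<lambda>z. norm (\<rho> n z - \<rho> n z * e k z))"
    by (intro integrable_norm Bochner_Integration.integrable_diff i\<rho> i\<rho>e)
   show "integrable lborel (\<lambda>z. norm (\<rho> n z) * (r n * norm k))" by (intro integrable_mult_left integrable_norm i\<rho>)
   fix z
   have z: "norm (\<rho> n z - \<rho> n z * e k z) = norm (\<rho> n z) * norm (1 - e k z)"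
    by (simp add: norm_mult[symmetric] right_diff_distrib)
   show "norm (\<rho> n z - \<rho> n z * e k z) \<le> norm (\<rho> n z) * (r n * norm k)"
   proof (cases "z \<in> cball 0 (r n)")
    case True
    have "norm (1 - e k z) = norm (iexp (- (k \<bullet> z)) - 1)" by (simp add: e_def norm_minus_commute)
    also have "\<dots> = 2 * \<bar>sin (- (k \<bullet> z) / 2)\<bar>" by (rule dist_exp_i_1)
    also have "\<dots> \<le> 2 * \<bar>- (k \<bullet> z) / 2\<bar>" by (intro mult_left_mono abs_sin_x_le_abs_x) simp
    also have "\<dots> = \<bar>- (k \<bullet> z)\<bar>" by simp
    also have "\<dots> \<le> norm k * norm z" using Cauchy_Schwarz_ineq2[of k z] by simp
    also have "\<dots> \<le> norm k * r n" using True by (intro mult_left_mono) auto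
    finally show ?thesis unfolding z by (intro mult_left_mono) (auto simp: mult.commute)
   qed (simp add: \<rho>0)
  qed
  also have "\<dots> = r n * norm k" by (simp add: \<rho>1(2))
  finally show ?thesis .
 qed
 \<comment> \<open>The frequency belongs to the index because the weight depends on it; decay is
   then read off at that same frequency, which is harmless as the bounds are uniform.\<close>
 define J where "J = {p :: nat \<times> (real^'n) \<times> 'i. n0 \<le> fst p \<and> snd (snd p) \<in> I}"
 have J: "n0 \<le> fst p" "snd (snd p) \<in> I" "0 < r (fst p) \<and> r (fst p) \<le> 1" "r (fst p) \<le> d" if "p \<in> J" for p
  using that n0[of "fst p"] r(1)[of "fst p"] by (auto simp: J_def)
 have wc: "continuous_on UNIV (w p)" for p unfolding w_def by (intro continuous_on_add continuous_on_mult continuous_on_const \<rho>c ec)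
 have w0: "w p z = 0" if "z \<notin> cball 0 (r (fst p))" for p z by (simp add: w_def \<rho>0[OF that])
 have w1: "(LINT z|lborel. norm (w p z)) \<le> 3" for p
 proof -
  have "(LINT z|lborel. norm (w p z)) \<le> (LINT z|lborel. 3 * norm (\<rho> (fst p) z))"
  proof (rule integral_mono)
   show "integrable lborel (\<lambda>z. norm (w p z))" unfolding w_def
    by (intro integrable_norm Bochner_Integration.integrable_add integrable_mult_right i\<rho> i\<rho>e)
   show "integrable lborel (\<lambda>z. 3 * norm (\<rho> (fst p) z))" by (intro integrable_mult_right integrable_norm i\<rho>)
   fix z
   have "norm (w p z) \<le> norm (\<rho> (fst p) z) + norm (1 - q (fst p) (fst (snd p))) * norm (\<rho> (fst p) z)"
    unfolding w_def by (rule order_trans[OF norm_triangle_ineq]) (simp add: norm_mult ne)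
   also have "norm (1 - q (fst p) (fst (snd p))) \<le> 2"
    using norm_triangle_ineq4[of 1 "q (fst p) (fst (snd p))"] q1[of "fst p" "fst (snd p)"] by simp
   finally show "norm (w p z) \<le> 3 * norm (\<rho> (fst p) z)" by (simp add: mult_right_mono)
  qed
  then show ?thesis by (simp add: \<rho>1(2))
 qed
 have w2: "(LINT z|lborel. w p z) = 1" for p
 proof -
  have "(LINT z|lborel. w p z) = (LINT z|lborel. \<rho> (fst p) z * e (fst (snd p)) z) + (LINT z|lborel. (1 - q (fst p) (fst (snd p))) * \<rho> (fst p) z)"
   unfolding w_def by (rule Bochner_Integration.integral_add[OF i\<rho>e integrable_mult_right[OF i\<rho>]])
  then show ?thesis by (simp add: q_def[symmetric] \<rho>1(1))
 qed
 have \<psi>J: "test_family K J (\<lambda>p. \<psi> (snd (snd p)))" by (rule test_family_reindex[OF \<psi>]) (use J(2) in auto)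
 \<comment> \<open>The mollification error divided by the radius, a bounded family.\<close>
 define \<alpha> where "\<alpha> p x = complex_of_real (inverse (r (fst p))) * (correlate (w p) (\<psi> (snd (snd p))) x - \<psi> (snd (snd p)) x)" for p x
 have \<alpha>1: "test_family (thicken 1 K) J \<alpha>" unfolding \<alpha>_def
  by (rule test_family_correlate_diff[OF compact_imp_closed[OF K(1)] \<psi>J J(3) wc w0 w1 w2])
 have supp0: "test_family K1 J (\<lambda>p. correlate (v p) (\<psi> (snd (snd p))))"
  if "\<And>p. continuous_on UNIV (v p)" "\<And>p (z :: real^'n). z \<notin> cball 0 (r (fst p)) ==> v p z = 0" "\<And>p. (LINT z|lborel. norm (v p z)) \<le> 3"
  for v :: "nat \<times> (real^'n) \<times> 'i => real^'n => complex"
  unfolding K1_def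
 proof (rule test_family_correlate[OF \<psi>J that(1) _ that(3)])
  fix p and z :: "real^'n" assume "p \<in> J" "z \<notin> cball 0 d"
  then show "v p z = 0" using J(4)[of p] by (intro that(2)) auto
 qed
 have \<alpha>: "test_family K1 J \<alpha>"
 proof -
  have "\<alpha> p x = 0" if "p \<in> J" "x \<notin> K1" for p x
   using test_family_0[OF supp0[of w, OF wc w0 w1] that] test_family_0[OF \<psi>J that(1), of x] KK1 that(2) by (auto simp: \<alpha>_def)
  then show ?thesis using \<alpha>1 by (simp add: test_family_def)
 qed
 define \<beta> where "\<beta> p = correlate (\<rho> (fst p)) (\<psi> (snd (snd p)))" for p :: "nat \<times> (real^'n) \<times> 'i"
 have \<beta>: "test_family K1 J \<beta>" unfolding \<beta>_def by (rule supp0[of "\<lambda>p. \<rho> (fst p)", OF \<rho>c \<rho>0]) (simp_all add: \<rho>1(2))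
 obtain A where A: "0 \<le> A" "\<And>p k. p \<in> J ==> k \<in> V ==> decay N u (\<alpha> p) k \<le> A"
  by (rule wf_decay[OF u \<Omega> V K1 \<alpha>]) (erule that, assumption)
 \<comment> \<open>One more power than needed, to absorb the factor |k| in the bound for 1 -
   q.\<close>
 obtain B where B: "0 \<le> B" "\<And>p k. p \<in> J ==> k \<in> V ==> (1 + norm k) ^ Suc N * norm (local_fourier u (\<beta> p) k) \<le> B"
  by (rule wf_decay[OF u \<Omega> V K1 \<beta>]) (erule that, assumption)
 have "(1 + norm k) ^ N * norm (u (correlate (\<rho> n) (\<lambda>x. \<psi> i x * osc k x)) - local_fourier u (\<psi> i) k) \<le> (A + B) * r n"
  if n: "n0 \<le> n" and i: "i \<in> I" and k: "k \<in> V" for n i k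
 proof -
  define p where "p = (n, k, i)"
  have p: "p \<in> J" "fst p = n" "fst (snd p) = k" "snd (snd p) = i" using n i by (auto simp: p_def J_def)
  have \<psi>c: "continuous_on UNIV (\<lambda>z. \<psi> i (x + z))" for x
   by (rule continuous_on_compose2[OF test_family_continuous[OF \<psi> i]]) (auto intro!: continuous_intros)
  have I1: "integrable lborel (\<lambda>z. (\<rho> n z * e k z) * \<psi> i (x + z))" for x
   by (rule integrable_compact_support[OF compact_cball[of 0 "r n"] continuous_on_mult[OF continuous_on_mult[OF \<rho>c ec] \<psi>c]]) (simp add: \<rho>0)
  have I2: "integrable lborel (\<lambda>z. \<rho> n z * \<psi> i (x + z))" for x
   by (rule integrable_compact_support[OF compact_cball[of 0 "r n"] continuous_on_mult[OF \<rho>c \<psi>c]]) (simp add: \<rho>0)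
  have ce: "correlate (\<rho> n) (\<lambda>x. \<psi> i x * e k x) x = correlate (\<lambda>z. \<rho> n z * e k z) (\<psi> i) x * e k x" for x
  proof -
   have "\<rho> n z * (\<psi> i (x + z) * e k (x + z)) = ((\<rho> n z * e k z) * \<psi> i (x + z)) * e k x" for z
    by (simp add: e_def inner_add_right exp_add[symmetric] algebra_simps)
   then show ?thesis unfolding correlate_def by (simp only: integral_mult_left_zero)
  qed
  have cw: "correlate (w p) (\<psi> i) x = correlate (\<lambda>z. \<rho> n z * e k z) (\<psi> i) x + (1 - q n k) * \<beta> p x" for x
  proof -
   have "w p z * \<psi> i (x + z) = (\<rho> n z * e k z) * \<psi> i (x + z) + (1 - q n k) * (\<rho> n z * \<psi> i (x + z))" for z
    by (simp add: w_def p algebra_simps)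
   then show ?thesis unfolding correlate_def \<beta>_def p
    using Bochner_Integration.integral_add[OF I1[of x] integrable_mult_right[OF I2[of x], of "1 - q n k"]] by (simp add: correlate_def)
  qed
  have \<alpha>x: "complex_of_real (r n) * \<alpha> p x = correlate (w p) (\<psi> i) x - \<psi> i x" for x
   using r(1)[of n] by (simp add: \<alpha>_def p mult.assoc[symmetric])
  \<comment> \<open>The mollified product is the product itself plus an error of size
    \<open>r n\<close> and a correction of size 1 - q, both of the form family times
    exponential.\<close>
  have split: "correlate (\<rho> n) (\<lambda>x. \<psi> i x * e k x) = (\<lambda>x. (\<psi> i x * e k x + complex_of_real (r n) * (\<alpha> p x * e k x)) + (- (1 - q n k)) * (\<beta> p x * e k x))"
  proof
   fix x
   have "correlate (\<lambda>z. \<rho> n z * e k z) (\<psi> i) x = \<psi> i x + complex_of_real (r n) * \<alpha> p x - (1 - q n k) * \<beta> p x"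
    unfolding \<alpha>x cw by simp
   then show "correlate (\<rho> n) (\<lambda>x. \<psi> i x * e k x) x = (\<psi> i x * e k x + complex_of_real (r n) * (\<alpha> p x * e k x)) + (- (1 - q n k)) * (\<beta> p x * e k x)"
    unfolding ce by (simp only:) (simp add: algebra_simps)
  qed
  have t1: "(\<lambda>x. \<psi> i x * e k x) \<in> test_functions \<Omega>"
   using test_family_test_functions(1)[OF K(1,2) test_family_osc_single[OF K(1) \<psi> i, of k], of "()"] by (simp add: e_def)
  have t2: "(\<lambda>x. \<alpha> p x * e k x) \<in> test_functions \<Omega>"
   using test_family_test_functions(1)[OF K1(1,2) test_family_osc_single[OF K1(1) \<alpha> p(1), of k], of "()"] by (simp add: e_def)
  have t3: "(\<lambda>x. \<beta> p x * e k x) \<in> test_functions \<Omega>"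
   using test_family_test_functions(1)[OF K1(1,2) test_family_osc_single[OF K1(1) \<beta> p(1), of k], of "()"] by (simp add: e_def)
  have "u (correlate (\<rho> n) (\<lambda>x. \<psi> i x * e k x)) =
    u (\<lambda>x. \<psi> i x * e k x) + complex_of_real (r n) * u (\<lambda>x. \<alpha> p x * e k x) + (- (1 - q n k)) * u (\<lambda>x. \<beta> p x * e k x)"
   unfolding split
    distribution_add[OF ud test_functions_add_cmult(1)[OF t1 test_functions_add_cmult(2)[OF t2 t2]] test_functions_add_cmult(2)[OF t3 t3]]
    distribution_add[OF ud t1 test_functions_add_cmult(2)[OF t2 t2]] distribution_cmult[OF ud t2] distribution_cmult[OF ud t3] by simp
  then have eq: "u (correlate (\<rho> n) (\<lambda>x. \<psi> i x * e k x)) - local_fourier u (\<psi> i) k =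
    complex_of_real (r n) * local_fourier u (\<alpha> p) k - (1 - q n k) * local_fourier u (\<beta> p) k"
   by (simp add: local_fourier_def e_def algebra_simps)
  have "norm (complex_of_real (r n) * local_fourier u (\<alpha> p) k - (1 - q n k) * local_fourier u (\<beta> p) k) \<le>
    r n * norm (local_fourier u (\<alpha> p) k) + (r n * (1 + norm k)) * norm (local_fourier u (\<beta> p) k)"
  proof (rule order_trans[OF norm_triangle_ineq4])
   have "norm (1 - q n k) \<le> r n * (1 + norm k)" using q2[of n k] r(1)[of n] by (simp add: distrib_left)
   then have "norm (1 - q n k) * norm (local_fourier u (\<beta> p) k) \<le> (r n * (1 + norm k)) * norm (local_fourier u (\<beta> p) k)"
    by (rule mult_right_mono) simp
   then show "norm (complex_of_real (r n) * local_fourier u (\<alpha> p) k) + norm ((1 - q n k) * local_fourier u (\<beta> p) k) \<le>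
     r n * norm (local_fourier u (\<alpha> p) k) + (r n * (1 + norm k)) * norm (local_fourier u (\<beta> p) k)"
    using r(1)[of n] by (simp add: norm_mult)
  qed
  then have "(1 + norm k) ^ N * norm (complex_of_real (r n) * local_fourier u (\<alpha> p) k - (1 - q n k) * local_fourier u (\<beta> p) k) \<le>
    (1 + norm k) ^ N * (r n * norm (local_fourier u (\<alpha> p) k) + (r n * (1 + norm k)) * norm (local_fourier u (\<beta> p) k))"
   by (rule mult_left_mono) simp
  also have "\<dots> = r n * (decay N u (\<alpha> p) k) + r n * ((1 + norm k) ^ Suc N * norm (local_fourier u (\<beta> p) k))"
   by (simp add: algebra_simps)
  also have "\<dots> \<le> r n * A + r n * B" using r(1)[of n] A(2)[OF p(1) k] B(2)[OF p(1) k] by (intro add_mono mult_left_mono) auto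
  also have "\<dots> = (A + B) * r n" by (simp add: algebra_simps)
  finally show ?thesis unfolding eq[unfolded e_def] .
 qed
 from that[OF this] show thesis .
qed

text \<open>The coefficients of the mollified, cut off distribution decay rapidly, because those of
  the mollifier do and those of \<theta>u grow at most polynomially. A finite part of the series is
  then close to all of it, uniformly for test functions whose transform grows with order
  \<open>N\<close>. The factor \<open>M\<close> is kept explicit because test functions carrying an
  exponential have small \<open>M\<close>.\<close>

lemma trig_approximation:
 fixes u :: "('a::euclidean_space => complex) => complex" and \<theta> \<rho> :: "'a => complex"
 assumes u: "u \<in> distributions \<Omega>" and R: "1 \<le> R" and L: "compact L" "L \<subseteq> \<Omega>" "L \<subseteq> ball 0 R" and \<theta>: "test_fun L \<theta>"
  and \<rho>: "test_fun (cball 0 r) \<rho>" and \<epsilon>: "0 < \<epsilon>"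
 obtains g :: "'a => complex" where "smooth_on UNIV g"
  "\<forall>\<phi> K M. compact K --> K \<subseteq> \<Omega> --> thicken r K \<subseteq> ball 0 (2 * R) --> test_fun K \<phi> --> 0 \<le> M -->
    (\<forall>m. norm (fhat \<phi> m) \<le> M * (1 + norm m) ^ N) -->
    norm (u (\<lambda>y. \<theta> y * correlate \<rho> \<phi> y) - distribution_of \<Omega> g \<phi>) \<le> M * \<epsilon>"
proof -
 define c where "c = series_const R TYPE('a)"
 define s :: "'a => 'a" where "s m = m /\<^sub>R R" for m
 define a where "a m = c * (fhat \<rho> (- s m) * local_fourier u \<theta> (s m))" for m
 \<comment> \<open>The coefficients weighted by the admissible growth of the transform of the test
   function; smallness of the tail of this sum decides the truncation.\<close>
 define G where "G m = norm (a m) * (1 + norm (s m)) ^ N" for m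
 have "G summable_on int_lattice"
 proof -
  define N0 where "N0 = 2 * DIM('a) + N"
  \<comment> \<open>Weighting by the coefficients of the mollifier makes the cut off exponentials a
    test family. Boundedness of \<open>u\<close> on it contains the polynomial growth of the local
    Fourier transform.\<close>
  define w where "w m = fhat \<rho> (- m) * complex_of_real ((1 + norm m) ^ N0)" for m
  have nw: "norm (w m) = norm (fhat \<rho> (- m)) * (1 + norm m) ^ N0" for m
   unfolding w_def norm_mult by (subst norm_of_real) simp
  have "\<exists>C. \<forall>m\<in>UNIV. norm (w m) * (1 + norm m) ^ N' \<le> C" for N'
  proof -
   obtain C where "C > 0" "\<And>i m. i \<in> {()} ==> (1 + norm m) ^ (N0 + N') * norm (fhat \<rho> m) \<le> C"
    by (rule fhat_decay[OF compact_cball \<rho>, of "N0 + N'"]) (erule that, assumption)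
   from this(2)[of "()" "- m" for m] show ?thesis by (intro exI[of _ C]) (simp add: nw power_add mult_ac)
  qed
  then have fam: "test_family L UNIV (\<lambda>m y. w m * (\<theta> y * osc m y))"
   by (rule test_family_osc[OF L(1) \<theta>])
  obtain C where C: "C > 0" "\<And>m. m \<in> UNIV ==> norm (u (\<lambda>y. w m * (\<theta> y * osc m y))) \<le> C"
   by (rule distribution_family_bound[OF u L(1,2) fam]) (erule that, assumption)
  have e: "u (\<lambda>y. w m * (\<theta> y * osc m y)) = w m * local_fourier u \<theta> m" for m
   unfolding local_fourier_def
   by (rule distribution_cmult[OF u test_family_test_functions(1)[OF L(1,2) test_family_osc_single[OF L(1) \<theta>]]]) simp_all
  have b: "G m \<le> norm c * C * R ^ (2 * DIM('a)) * lattice_weight m" for m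
  proof -
   have "norm (w (s m)) * norm (local_fourier u \<theta> (s m)) \<le> C" using C(2)[of "s m", unfolded e norm_mult] by simp
   then have "norm c * (norm (w (s m)) * norm (local_fourier u \<theta> (s m))) \<le> norm c * C" by (rule mult_left_mono) simp
   then have "(1 + norm (s m)) ^ (2 * DIM('a)) * G m \<le> norm c * C"
    by (simp add: G_def a_def nw N0_def norm_mult power_add mult_ac)
   then have "G m \<le> norm c * C * lattice_weight (s m)" by (rule le_lattice_weight)
   also have "\<dots> \<le> norm c * C * (R ^ (2 * DIM('a)) * lattice_weight m)"
    unfolding s_def using C(1) by (intro mult_left_mono lattice_weight_scale R) auto
   finally show ?thesis by (simp add: mult.assoc)
  qed
  have "(lattice_weight :: 'a => real) summable_on int_lattice" using lattice_weight_has_sum by (rule has_sum_imp_summable)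
  then have "(\<lambda>m. norm c * C * R ^ (2 * DIM('a)) * lattice_weight m) summable_on (int_lattice :: 'a set)"
   by (rule summable_on_cmult_right)
  then show ?thesis by (rule summable_on_comparison_test) (rule b, simp add: G_def)
 qed
 then have GT: "(G has_sum infsum G int_lattice) int_lattice" by (rule has_sum_infsum)
 have "eventually (\<lambda>F. dist (sum G F) (infsum G int_lattice) < \<epsilon>) (finite_subsets_at_top int_lattice)"
  using GT[unfolded has_sum_def] \<epsilon> by (rule tendstoD)
 then obtain F where F: "finite F" "F \<subseteq> int_lattice" "dist (sum G F) (infsum G int_lattice) < \<epsilon>"
  unfolding eventually_finite_subsets_at_top by blast
 define g where "g y = (\<Sum>m\<in>F. a m * osc (- s m) y)" for y
 have "smooth_on UNIV (\<lambda>y. a m * osc (- s m) y)" for m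
 proof (rule bdd_family_imp_smooth_on[OF bdd_family_osc[of UNIV "{()}" "\<lambda>_. a m" "\<lambda>_. - s m"]])
  show "\<exists>C. \<forall>i\<in>{()}. norm (a m) * (1 + norm (- s m)) ^ N \<le> C" for N by auto
 qed simp_all
 then have g: "smooth_on UNIV g" unfolding g_def by (intro smooth_on_sum open_UNIV F(1))
 have "norm (u (\<lambda>y. \<theta> y * correlate \<rho> \<phi> y) - distribution_of \<Omega> g \<phi>) \<le> M * \<epsilon>"
  if K: "compact K" "K \<subseteq> \<Omega>" "thicken r K \<subseteq> ball 0 (2 * R)" and \<phi>: "test_fun K \<phi>" and M: "0 \<le> M"
   and bd: "\<And>m. norm (fhat \<phi> m) \<le> M * (1 + norm m) ^ N" for \<phi> K M
 proof -
  have \<rho>c: "continuous_on UNIV \<rho>" and \<rho>0: "\<And>z. z \<notin> cball 0 r ==> \<rho> z = 0"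
   using test_family_continuous[OF \<rho>, of "()"] test_family_0[OF \<rho>, of "()"] by simp_all
  have \<phi>c: "continuous_on UNIV \<phi>" and \<phi>0: "\<And>z. z \<notin> K ==> \<phi> z = 0"
   using test_family_continuous[OF \<phi>, of "()"] test_family_0[OF \<phi>, of "()"] by simp_all
  have h: "test_fun (thicken r K) (correlate \<rho> \<phi>)"
   by (rule test_family_correlate[OF \<phi> \<rho>c \<rho>0 order_refl])
  have fc: "fhat (correlate \<rho> \<phi>) m = fhat \<rho> (- m) * fhat \<phi> m" for m
   by (rule fhat_correlate[OF K(1) \<phi>c \<phi>0 \<rho>c \<rho>0])
  have "((\<lambda>m. a m * fhat \<phi> (s m)) has_sum u (\<lambda>y. \<theta> y * correlate \<rho> \<phi> y)) int_lattice"
   using distribution_fourier_series[OF R u L \<theta> compact_thicken[OF K(1)] K(3) h]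
   by (simp add: fc a_def c_def s_def mult_ac)
  then have "norm (u (\<lambda>y. \<theta> y * correlate \<rho> \<phi> y) - (\<Sum>m\<in>F. a m * fhat \<phi> (s m))) \<le> M * (infsum G int_lattice - sum G F)"
  proof (rule has_sum_tail_bound[OF _ GT _ F(1,2)])
   fix m
   show "norm (a m * fhat \<phi> (s m)) \<le> M * G m"
    using mult_left_mono[OF bd[of "s m"] norm_ge_zero[of "a m"]] by (simp add: norm_mult G_def mult_ac)
  qed
  also have "\<dots> \<le> M * \<epsilon>" using F(3) M by (intro mult_left_mono) (auto simp: dist_real_def)
  also have "(\<Sum>m\<in>F. a m * fhat \<phi> (s m)) = distribution_of \<Omega> g \<phi>"
  proof -
   have t: "\<phi> \<in> test_functions \<Omega>" using test_family_test_functions(1)[OF K(1,2) \<phi>] by simp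
   have "indicator \<Omega> x *\<^sub>R (g x * \<phi> x) = (\<Sum>m\<in>F. a m * (\<phi> x * iexp (s m \<bullet> x)))" for x
   proof (cases "x \<in> \<Omega>")
    case True
    then show ?thesis by (simp add: g_def sum_distrib_left sum_distrib_right mult_ac)
   next
    case False
    then have "\<phi> x = 0" using \<phi>0[of x] K(2) by blast
    then show ?thesis by simp
   qed
   then have "distribution_of \<Omega> g \<phi> = (LINT x|lborel. (\<Sum>m\<in>F. a m * (\<phi> x * iexp (s m \<bullet> x))))"
    unfolding distribution_of_eq[OF t] by simp
   also have "\<dots> = (\<Sum>m\<in>F. LINT x|lborel. a m * (\<phi> x * iexp (s m \<bullet> x)))"
    by (rule Bochner_Integration.integral_sum)
     (rule integrable_mult_right[OF test_family_integrable[OF K(1) \<phi> _ continuous_on_osc(2)]], simp)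
   also have "\<dots> = (\<Sum>m\<in>F. a m * fhat \<phi> (s m))" by (simp add: fhat_def)
   finally show ?thesis by simp
  qed
  finally show ?thesis .
 qed
 then show thesis by (intro that[OF g] allI impI) simp
qed

text \<open>One sequence must serve all seminorms. The n-th function approximates the n-th
  mollification on the n-th compact set with error \<open>r n\<close> for transforms of growth order
  n; any given compact set, order and mollification estimate are covered for large n.\<close>

theorem smooth_approximation:
 fixes u :: "(real^'n => complex) => complex"
 assumes u: "u \<in> distributions_WF \<Omega> \<Gamma>" and \<Omega>: "open \<Omega>" and \<Gamma>: "closed_cone_over \<Omega> \<Gamma>"
 obtains g :: "nat => real^'n => complex" where "\<And>n. smooth_on \<Omega> (g n)"
  "\<And>K B V N \<epsilon>. compact K ==> K \<subseteq> \<Omega> ==> closed V ==> cone V ==> (K \<times> V) \<inter> \<Gamma> = {} ==> test_family K B (\<lambda>\<phi>. \<phi>) ==> 0 < \<epsilon> ==>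
   \<exists>n0. \<forall>n\<ge>n0. \<forall>\<phi>\<in>B. \<forall>k\<in>V. (1 + norm k) ^ N * norm (local_fourier (distribution_of \<Omega> (g n)) \<phi> k - local_fourier u \<phi> k) \<le> \<epsilon>"
proof -
 have ud: "u \<in> distributions \<Omega>" using u by (simp add: distributions_WF_def)
 obtain E :: "nat => (real^'n) set" where E: "\<And>n. compact (E n)" "\<And>n. E n \<subseteq> \<Omega>" "\<And>n m. n \<le> m ==> E n \<subseteq> E m"
  "\<And>L. compact L ==> L \<subseteq> \<Omega> ==> \<exists>n. L \<subseteq> E n" by (rule compact_exhaustion[OF \<Omega>]) (rule that, assumption+)
 define r where "r n = inverse (real (Suc n))" for n
 have r: "0 < r n" "r \<longlonglongrightarrow> 0" for n unfolding r_def using LIMSEQ_inverse_real_of_nat by simp_all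
 have "\<exists>\<rho> :: real^'n => complex. test_fun (cball 0 (r n)) \<rho> \<and> (LINT x|lborel. \<rho> x) = 1 \<and> (LINT x|lborel. norm (\<rho> x)) = 1" for n
  by (rule mollifier_exists[OF r(1)[of n]]) (intro exI conjI, assumption+)
 then obtain \<rho> :: "nat => real^'n => complex" where \<rho>: "\<And>n. test_fun (cball 0 (r n)) (\<rho> n)"
  "\<And>n. (LINT x|lborel. \<rho> n x) = 1" "\<And>n. (LINT x|lborel. norm (\<rho> n x)) = 1" by metis
 have "\<exists>g. smooth_on \<Omega> g \<and> (\<forall>\<phi> K M. compact K --> K \<subseteq> \<Omega> --> thicken (r n) K \<subseteq> E n --> test_fun K \<phi> --> 0 \<le> M -->
   (\<forall>m. norm (fhat \<phi> m) \<le> M * (1 + norm m) ^ n) --> norm (u (correlate (\<rho> n) \<phi>) - distribution_of \<Omega> g \<phi>) \<le> M * r n)" for n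
 proof -
  obtain \<theta> L where L: "compact L" "L \<subseteq> \<Omega>" and \<theta>: "test_fun L \<theta>" and one: "\<And>x. x \<in> E n ==> \<theta> x = (1::complex)"
   by (rule cutoff_exists[OF \<Omega> E(1,2)[of n]]) (rule that, assumption+)
  obtain b where b: "\<forall>x\<in>L. norm x \<le> b" using compact_imp_bounded[OF L(1)] unfolding bounded_iff by (elim exE)
  define R where "R = max 1 (b + 1)"
  have R: "1 \<le> R" "b < R" by (auto simp: R_def)
  have LR: "L \<subseteq> ball 0 R" using b R(2) by fastforce
  have EL: "E n \<subseteq> L" using one test_family_0[OF \<theta>, of "()"] by fastforce
  have ER: "E n \<subseteq> ball 0 (2 * R)"
   by (rule subset_trans[OF EL subset_trans[OF LR]]) (use R(1) in \<open>auto simp: subset_iff\<close>)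
  obtain g :: "real^'n => complex" where g: "smooth_on UNIV g" and est: "\<forall>\<phi> K M. compact K --> K \<subseteq> \<Omega> --> thicken (r n) K \<subseteq> ball 0 (2 * R) --> test_fun K \<phi> --> 0 \<le> M -->
    (\<forall>m. norm (fhat \<phi> m) \<le> M * (1 + norm m) ^ n) -->
    norm (u (\<lambda>y. \<theta> y * correlate (\<rho> n) \<phi> y) - distribution_of \<Omega> g \<phi>) \<le> M * r n"
   by (rule trig_approximation[OF ud R(1) L LR \<theta> \<rho>(1)[of n] r(1)[of n]]) (rule that)
  show ?thesis
  proof (intro exI[of _ g] conjI allI impI smooth_on_subset[OF g subset_UNIV])
   fix \<phi> K M assume K: "compact K" "K \<subseteq> \<Omega>" "thicken (r n) K \<subseteq> E n" and \<phi>: "test_fun K \<phi>" and M: "0 \<le> M"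
    and bd: "\<forall>m. norm (fhat \<phi> m) \<le> M * (1 + norm m) ^ n"
   have "test_fun (thicken (r n) K) (correlate (\<rho> n) \<phi>)"
    using test_family_continuous[OF \<rho>(1), of "()"] test_family_0[OF \<rho>(1), of "()"]
    by (intro test_family_correlate[OF \<phi> _ _ order_refl]) simp_all
   then have e: "\<theta> y * correlate (\<rho> n) \<phi> y = correlate (\<rho> n) \<phi> y" for y
    using one[of y] K(3) test_family_0[of "thicken (r n) K" "{()}" "\<lambda>_. correlate (\<rho> n) \<phi>" "()" y] by (cases "y \<in> E n") auto
   then show "norm (u (correlate (\<rho> n) \<phi>) - distribution_of \<Omega> g \<phi>) \<le> M * r n"
    using spec[OF spec[OF spec[OF est, of \<phi>], of K], of M] K(1,2) subset_trans[OF K(3) ER] \<phi> M bd unfolding e by (elim impE)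
  qed
 qed
 then obtain g where g: "\<And>n. smooth_on \<Omega> (g n)" and est: "\<And>n \<phi> K M. compact K ==> K \<subseteq> \<Omega> ==> thicken (r n) K \<subseteq> E n ==> test_fun K \<phi> ==> 0 \<le> M ==>
   (\<forall>m. norm (fhat \<phi> m) \<le> M * (1 + norm m) ^ n) ==> norm (u (correlate (\<rho> n) \<phi>) - distribution_of \<Omega> (g n) \<phi>) \<le> M * r n" by metis
 have "\<exists>n0. \<forall>n\<ge>n0. \<forall>\<phi>\<in>B. \<forall>k\<in>V. (1 + norm k) ^ N * norm (local_fourier (distribution_of \<Omega> (g n)) \<phi> k - local_fourier u \<phi> k) \<le> \<epsilon>"
  if K: "compact K" "K \<subseteq> \<Omega>" and V: "closed V" "cone V" and KV: "(K \<times> V) \<inter> \<Gamma> = {}" and B: "test_family K B (\<lambda>\<phi>. \<phi>)" and \<epsilon>: "0 < \<epsilon>"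
  for K B V N \<epsilon>
 proof -
  obtain C1 n1 where C1: "\<And>n \<phi> k. n \<ge> n1 ==> \<phi> \<in> B ==> k \<in> V ==> (1 + norm k) ^ N *
    norm (u (correlate (\<rho> n) (\<lambda>x. \<phi> x * osc k x)) - local_fourier u \<phi> k) \<le> C1 * r n"
   by (rule mollify_estimate[OF u \<Omega> \<Gamma> V K KV B r \<rho>]) (rule that)
  obtain b where b: "\<forall>x\<in>K. norm x \<le> b" using compact_imp_bounded[OF K(1)] unfolding bounded_iff by (elim exE)
  have Kb: "K \<subseteq> ball 0 (b + 1)" using b by fastforce
  obtain C2 where C2: "C2 > 0" "\<And>\<phi> m k. \<phi> \<in> B ==> (1 + norm k) ^ N * norm (osc_integral (\<lambda>x. x) \<phi> m k) \<le> C2 * (1 + norm m) ^ N"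
   by (rule osc_integral_growth[OF open_ball K(1) Kb bdd_map_ident[OF bounded_ball] B]) (rule that)
  obtain d where d: "d > 0" "thicken d K \<subseteq> \<Omega>" "(thicken d K \<times> V) \<inter> \<Gamma> = {}"
   by (rule thicken_separate[OF \<Gamma> \<Omega> K V KV]) (erule that, assumption, assumption)
  obtain n2 where n2: "thicken d K \<subseteq> E n2" using E(4)[OF compact_thicken[OF K(1)] d(2)] by blast
  have "(\<lambda>n. (C1 + C2) * r n) \<longlonglongrightarrow> (C1 + C2) * 0" by (intro tendsto_mult tendsto_const r(2))
  then have "eventually (\<lambda>n. (C1 + C2) * r n < \<epsilon>) sequentially" by (rule order_tendstoD(2)) (use \<epsilon> in simp)
  then obtain n3 where n3: "\<And>n. n3 \<le> n ==> (C1 + C2) * r n < \<epsilon>" by (auto simp: eventually_sequentially)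
  have "eventually (\<lambda>n. r n < d) sequentially" by (rule order_tendstoD(2)[OF r(2) d(1)])
  then obtain n4 where n4: "\<And>n. n4 \<le> n ==> r n < d" by (auto simp: eventually_sequentially)
  show ?thesis
  \<comment> \<open>Beyond this sum every single threshold is passed, and n is at least the order
    \<open>N\<close>.\<close>
  proof (intro exI[of _ "n1 + n2 + n3 + n4 + N"] allI impI ballI)
   fix n \<phi> k assume n: "n1 + n2 + n3 + n4 + N \<le> n" and \<phi>: "\<phi> \<in> B" and k: "k \<in> V"
   define \<phi>' where "\<phi>' x = \<phi> x * osc k x" for x
   have t: "test_fun K \<phi>'" unfolding \<phi>'_def by (rule test_family_osc_single[OF K(1) B \<phi>])
   have "thicken (r n) K \<subseteq> thicken d K" using n4[of n] n by (intro thicken_mono) auto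
   also note n2
   also have "E n2 \<subseteq> E n" using n by (intro E(3)) simp
   finally have TE: "thicken (r n) K \<subseteq> E n" .
   have kp: "0 < (1 + norm k) ^ N" by (intro zero_less_power add_pos_nonneg) auto
   \<comment> \<open>Taken from \<open>osc_integral_growth\<close> for the identity map: growth of
     order \<open>N\<close> in m is traded for decay of order \<open>N\<close> in \<open>k\<close>,
     and this supplies the weight in the Fourier seminorm.\<close>
   define M where "M = C2 / (1 + norm k) ^ N"
   have M: "0 \<le> M" using kp C2(1) by (simp add: M_def)
   have "norm (fhat \<phi>' m) \<le> M * (1 + norm m) ^ n" for m
   proof -
    have "fhat \<phi>' m = osc_integral (\<lambda>x. x) \<phi> m k" unfolding osc_integral_ident \<phi>'_def ..
    then have "(1 + norm k) ^ N * norm (fhat \<phi>' m) \<le> C2 * (1 + norm m) ^ N" using C2(2)[OF \<phi>] by simp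
    then have "norm (fhat \<phi>' m) \<le> M * (1 + norm m) ^ N" using kp by (simp add: M_def field_simps)
    also have "\<dots> \<le> M * (1 + norm m) ^ n" using n M by (intro mult_left_mono power_increasing) auto
    finally show ?thesis .
   qed
   then have "norm (u (correlate (\<rho> n) \<phi>') - distribution_of \<Omega> (g n) \<phi>') \<le> M * r n" by (intro est[OF K TE t M]) simp
   then have "(1 + norm k) ^ N * norm (u (correlate (\<rho> n) \<phi>') - distribution_of \<Omega> (g n) \<phi>') \<le> (1 + norm k) ^ N * (M * r n)"
    using kp by (intro mult_left_mono) auto
   also have "b * (C2 / b * r n) = C2 * r n" if "0 < b" for b using that by simp
   from this[OF kp] have "(1 + norm k) ^ N * (M * r n) = C2 * r n" by (simp only: M_def)
   finally have 1: "(1 + norm k) ^ N * norm (u (correlate (\<rho> n) \<phi>') - distribution_of \<Omega> (g n) \<phi>') \<le> C2 * r n" .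
   have 2: "(1 + norm k) ^ N * norm (u (correlate (\<rho> n) \<phi>') - local_fourier u \<phi> k) \<le> C1 * r n"
    unfolding \<phi>'_def by (rule C1) (use n \<phi> k in auto)
   have "norm (local_fourier (distribution_of \<Omega> (g n)) \<phi> k - local_fourier u \<phi> k) \<le>
     norm (u (correlate (\<rho> n) \<phi>') - distribution_of \<Omega> (g n) \<phi>') + norm (u (correlate (\<rho> n) \<phi>') - local_fourier u \<phi> k)"
    unfolding local_fourier_def[of "distribution_of \<Omega> (g n)"] \<phi>'_def[symmetric, abs_def]
    using norm_triangle_ineq4[of "u (correlate (\<rho> n) \<phi>') - local_fourier u \<phi> k" "u (correlate (\<rho> n) \<phi>') - distribution_of \<Omega> (g n) \<phi>'"] by simp
   then have "(1 + norm k) ^ N * norm (local_fourier (distribution_of \<Omega> (g n)) \<phi> k - local_fourier u \<phi> k) \<le> (1 + norm k) ^ N *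
     (norm (u (correlate (\<rho> n) \<phi>') - distribution_of \<Omega> (g n) \<phi>') + norm (u (correlate (\<rho> n) \<phi>') - local_fourier u \<phi> k))"
    using kp by (intro mult_left_mono) auto
   also have "\<dots> \<le> (C1 + C2) * r n" using 1 2 by (simp add: distrib_left distrib_right)
   also have "\<dots> \<le> \<epsilon>" using n3[of n] n by simp
   finally show "(1 + norm k) ^ N * norm (local_fourier (distribution_of \<Omega> (g n)) \<phi> k - local_fourier u \<phi> k) \<le> \<epsilon>" .
  qed
 qed
 from that[OF g this] show thesis .
qed

section \<open>Normal seminorms\<close>

lemma local_fourier_diff: "local_fourier (\<lambda>\<phi>. u \<phi> - v \<phi>) \<theta> k = local_fourier u \<theta> k - local_fourier v \<theta> k"
 by (simp add: local_fourier_def)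

lemma local_fourier_0: "local_fourier u \<theta> 0 = u \<theta>"
 by (simp add: local_fourier_def)

text \<open>Both kinds of seminorms become suprema over a cone; for bounded sets the cone is \<open>{0}\<close>.\<close>

lemma normal_seminorm_form:
 assumes \<Omega>: "open \<Omega>" and \<Gamma>: "closed_cone_over \<Omega> \<Gamma>" and p: "p \<in> normal_seminorms \<Omega> \<Gamma>"
 obtains K B V N where "compact K" "K \<subseteq> \<Omega>" "closed V" "cone V" "(K \<times> V) \<inter> \<Gamma> = {}" "test_family K B (\<lambda>\<phi>. \<phi>)"
  "\<And>u P. 0 \<le> P ==> p u \<le> ennreal P \<longleftrightarrow> (\<forall>\<phi>\<in>B. \<forall>k\<in>V. decay N u \<phi> k \<le> P)"
proof -
 consider B where "p = bounded_set_seminorm B" "bounded_test_set \<Omega> B"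
  | N V \<theta> where "p = fourier_seminorm N V \<theta>" "\<theta> \<in> test_functions \<Omega>" "closed V" "cone V" "(supp \<theta> \<times> V) \<inter> \<Gamma> = {}"
  using p by (auto simp: normal_seminorms_def)
 then show thesis
 proof cases
  case 1
  obtain K where K: "compact K" "K \<subseteq> \<Omega>" "test_family K B (\<lambda>\<phi>. \<phi>)"
   by (rule bounded_test_set_imp_family[OF \<Omega> 1(2)]) (erule that, assumption)
  have "\<Gamma> \<subseteq> punctured_cotangent \<Omega>" using \<Gamma> closedin_imp_subset unfolding closed_cone_over_def by blast
  then have "(K \<times> {0}) \<inter> \<Gamma> = {}" by (auto simp: punctured_cotangent_def)
  then show thesis
   by (intro that[of K "{0}" B 0] K) (simp_all add: 1(1) bounded_set_seminorm_le_iff local_fourier_0 cone_def)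
 next
  case 2
  have "test_fun (supp \<theta>) \<theta>" by (rule test_function_family[OF 2(2)])
  then have "test_family (supp \<theta>) {\<theta>} (\<lambda>_. \<theta>)" by (rule test_family_single)
  moreover have "bdd_family UNIV {\<theta>} (\<lambda>_. \<theta>) = bdd_family UNIV {\<theta>} (\<lambda>\<phi>. \<phi>)" by (rule bdd_family_cong) simp_all
  ultimately have "test_family (supp \<theta>) {\<theta>} (\<lambda>\<phi>. \<phi>)" by (simp add: test_family_def)
  then show thesis
   by (intro that[of "supp \<theta>" V "{\<theta>}" N] test_functionsD(2,3)[OF 2(2)] 2) (simp_all add: 2(1) fourier_seminorm_le_iff)
 qed
qed

lemma singleton_normal_seminorm:
 assumes "\<phi> \<in> test_functions \<Omega>"
 shows "bounded_set_seminorm {\<phi>} \<in> normal_seminorms \<Omega> \<Gamma>"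
proof -
 have "bounded_test_set \<Omega> ((\<lambda>_. \<phi>) ` {()})"
  by (rule bounded_test_set_family[OF test_functionsD(2,3)[OF assms] test_function_family[OF assms]])
 then show ?thesis by (auto simp: normal_seminorms_def)
qed

context
 fixes \<Omega> :: "(real^'n) set" and \<Gamma> and p :: "((real^'n => complex) => complex) => ennreal"
 assumes \<Omega>: "open \<Omega>" and \<Gamma>: "closed_cone_over \<Omega> \<Gamma>" and p: "p \<in> normal_seminorms \<Omega> \<Gamma>"
begin

lemma normal_seminorm_diff_trans:
 assumes "p (\<lambda>\<phi>. u \<phi> - v \<phi>) \<le> ennreal P" "p (\<lambda>\<phi>. v \<phi> - w \<phi>) \<le> ennreal Q" "0 \<le> P" "0 \<le> Q"
 shows "p (\<lambda>\<phi>. u \<phi> - w \<phi>) \<le> ennreal (P + Q)"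
proof (rule normal_seminorm_form[OF \<Omega> \<Gamma> p], goal_cases)
 case (1 K B V N)
 note form = 1(7)
 have "(1 + norm k) ^ N * norm (local_fourier u \<phi> k - local_fourier w \<phi> k) \<le> P + Q" if "\<phi> \<in> B" "k \<in> V" for \<phi> k
 proof -
  have "norm (local_fourier u \<phi> k - local_fourier w \<phi> k) \<le>
    norm (local_fourier u \<phi> k - local_fourier v \<phi> k) + norm (local_fourier v \<phi> k - local_fourier w \<phi> k)"
   using norm_triangle_ineq[of "local_fourier u \<phi> k - local_fourier v \<phi> k" "local_fourier v \<phi> k - local_fourier w \<phi> k"] by simp
  then have "(1 + norm k) ^ N * norm (local_fourier u \<phi> k - local_fourier w \<phi> k) \<le>
    (1 + norm k) ^ N * (norm (local_fourier u \<phi> k - local_fourier v \<phi> k) + norm (local_fourier v \<phi> k - local_fourier w \<phi> k))"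
   by (rule mult_left_mono) simp
  moreover have "(1 + norm k) ^ N * norm (local_fourier u \<phi> k - local_fourier v \<phi> k) \<le> P"
    "(1 + norm k) ^ N * norm (local_fourier v \<phi> k - local_fourier w \<phi> k) \<le> Q"
   using assms that by (auto simp: form local_fourier_diff)
  ultimately show ?thesis by (simp add: distrib_left)
 qed
 then show ?thesis unfolding form[OF add_nonneg_nonneg[OF assms(3,4)]] local_fourier_diff by blast
qed

lemma normal_seminorm_diff_commute:
 assumes "0 \<le> P"
 shows "p (\<lambda>\<phi>. u \<phi> - v \<phi>) \<le> ennreal P \<longleftrightarrow> p (\<lambda>\<phi>. v \<phi> - u \<phi>) \<le> ennreal P"
proof (rule normal_seminorm_form[OF \<Omega> \<Gamma> p], goal_cases)
 case (1 K B V N)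
 note form = 1(7)
 show ?thesis unfolding form[OF assms] local_fourier_diff norm_minus_commute[of "local_fourier u _ _"] ..
qed

lemma normal_seminorm_diff_self: "p (\<lambda>\<phi>. u \<phi> - u \<phi>) \<le> ennreal 0"
proof (rule normal_seminorm_form[OF \<Omega> \<Gamma> p], goal_cases)
 case (1 K B V N)
 note form = 1(7)
 show ?thesis unfolding form[OF order_refl] local_fourier_diff by simp
qed

text \<open>Lower semicontinuity: the seminorm is a supremum of quantities that depend on finitely
  many values of the functional each, so bounds pass to pointwise limits.\<close>

lemma normal_seminorm_limit:
 assumes lim: "\<And>\<phi>. (\<lambda>n. w n \<phi>) \<longlonglongrightarrow> v \<phi>" and ev: "eventually (\<lambda>n. p (w n) \<le> ennreal P) sequentially" and P: "0 \<le> P"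
 shows "p v \<le> ennreal P"
proof (rule normal_seminorm_form[OF \<Omega> \<Gamma> p], goal_cases)
 case (1 K B V N)
 note form = 1(7)
 have "decay N v \<phi> k \<le> P" if "\<phi> \<in> B" "k \<in> V" for \<phi> k
 proof (rule tendsto_upperbound[of "\<lambda>n. decay N (w n) \<phi> k" _ sequentially])
  show "(\<lambda>n. decay N (w n) \<phi> k) \<longlonglongrightarrow> decay N v \<phi> k"
   unfolding local_fourier_def by (intro tendsto_mult tendsto_norm tendsto_const lim)
  show "eventually (\<lambda>n. decay N (w n) \<phi> k \<le> P) sequentially"
   using ev by (rule eventually_mono) (use that P in \<open>simp add: form\<close>)
 qed simp
 then show ?thesis using P by (simp add: form)
qed

text \<open>The sets generating the topology are balls about arbitrary centres. This supplies a
  smaller ball about each of their points, by choosing a real number strictly between the distance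
  and the radius.\<close>

lemma normal_seminorm_gap:
 assumes "p (\<lambda>\<phi>. u \<phi> - w \<phi>) < \<epsilon>"
 obtains \<delta> where "0 < \<delta>" "\<And>v. p (\<lambda>\<phi>. v \<phi> - u \<phi>) \<le> ennreal \<delta> ==> p (\<lambda>\<phi>. v \<phi> - w \<phi>) < \<epsilon>"
proof -
 obtain e where e: "p (\<lambda>\<phi>. u \<phi> - w \<phi>) < e" "e < \<epsilon>" using dense[OF assms] by blast
 have "e < top" by (rule less_le_trans[OF e(2)]) simp
 then obtain E where E: "0 \<le> E" "e = ennreal E" by (cases e) auto
 have "p (\<lambda>\<phi>. u \<phi> - w \<phi>) < top" using e(1) \<open>e < top\<close> by (rule less_trans)
 then obtain D where D: "0 \<le> D" "p (\<lambda>\<phi>. u \<phi> - w \<phi>) = ennreal D" by (cases "p (\<lambda>\<phi>. u \<phi> - w \<phi>)") auto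
 have DE: "D < E" using e(1) unfolding D(2) E(2) using D(1) by (simp add: ennreal_less_iff)
 have "p (\<lambda>\<phi>. v \<phi> - w \<phi>) < \<epsilon>" if "p (\<lambda>\<phi>. v \<phi> - u \<phi>) \<le> ennreal (E - D)" for v
 proof -
  have "p (\<lambda>\<phi>. v \<phi> - w \<phi>) \<le> ennreal (E - D + D)"
   by (rule normal_seminorm_diff_trans[OF that]) (use D DE in auto)
  then show ?thesis using e(2) E(2) by simp
 qed
 then show thesis using that[of "E - D"] DE by simp
qed

lemma openin_normal_ball:
 assumes "w \<in> distributions_WF \<Omega> \<Gamma>" "0 < \<epsilon>"
 shows "openin (normal_topology \<Omega> \<Gamma>) {v \<in> distributions_WF \<Omega> \<Gamma>. p (\<lambda>\<phi>. v \<phi> - w \<phi>) < \<epsilon>}"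
 unfolding normal_topology_def using assms p by (intro topology_generated_by_Basis) blast

end

section \<open>Approximating sequences and convergence\<close>

definition approximates ::
  "(real^'n) set => ((real^'n) \<times> (real^'n)) set => (nat => real^'n => complex) => ((real^'n => complex) => complex) => bool" where
 "approximates \<Omega> \<Gamma> g u \<longleftrightarrow> (\<forall>n. smooth_on \<Omega> (g n)) \<and> (\<forall>p\<in>normal_seminorms \<Omega> \<Gamma>. \<forall>\<epsilon>>0.
   eventually (\<lambda>n. p (\<lambda>\<phi>. distribution_of \<Omega> (g n) \<phi> - u \<phi>) \<le> ennreal \<epsilon>) sequentially)"

lemma approximates_exists:
 fixes \<Omega> :: "(real^'n) set"
 assumes u: "u \<in> distributions_WF \<Omega> \<Gamma>" and \<Omega>: "open \<Omega>" and \<Gamma>: "closed_cone_over \<Omega> \<Gamma>"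
 shows "\<exists>g. approximates \<Omega> \<Gamma> g u"
proof (rule smooth_approximation[OF u \<Omega> \<Gamma>])
 fix g :: "nat => real^'n => complex"
 assume g: "\<And>n. smooth_on \<Omega> (g n)" and est: "\<And>K B V N \<epsilon>. compact K ==> K \<subseteq> \<Omega> ==> closed V ==> cone V ==> (K \<times> V) \<inter> \<Gamma> = {} ==> test_family K B (\<lambda>\<phi>. \<phi>) ==> 0 < \<epsilon> ==>
   \<exists>n0. \<forall>n\<ge>n0. \<forall>\<phi>\<in>B. \<forall>k\<in>V. (1 + norm k) ^ N * norm (local_fourier (distribution_of \<Omega> (g n)) \<phi> k - local_fourier u \<phi> k) \<le> \<epsilon>"
 have "eventually (\<lambda>n. p (\<lambda>\<phi>. distribution_of \<Omega> (g n) \<phi> - u \<phi>) \<le> ennreal \<epsilon>) sequentially"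
  if p: "p \<in> normal_seminorms \<Omega> \<Gamma>" and \<epsilon>: "\<epsilon> > 0" for p \<epsilon>
 proof (rule normal_seminorm_form[OF \<Omega> \<Gamma> p])
  fix K B V N assume a: "compact K" "K \<subseteq> \<Omega>" "closed V" "cone V" "(K \<times> V) \<inter> \<Gamma> = {}" "test_family K B (\<lambda>\<phi>. \<phi>)"
   and form: "\<And>u P. 0 \<le> P ==> p u \<le> ennreal P \<longleftrightarrow> (\<forall>\<phi>\<in>B. \<forall>k\<in>V. decay N u \<phi> k \<le> P)"
  show ?thesis unfolding form[OF less_imp_le[OF \<epsilon>]] local_fourier_diff eventually_sequentially by (rule est[OF a \<epsilon>])
 qed
 then show ?thesis unfolding approximates_def using g by blast
qed

text \<open>The topology is given by generating sets, so the claim is proved by induction on how an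
  open set is generated; generating sets are handled by \<open>normal_seminorm_gap\<close>.\<close>

lemma approximates_limitin:
 fixes \<Omega> :: "(real^'n) set"
 assumes \<Omega>: "open \<Omega>" and \<Gamma>: "closed_cone_over \<Omega> \<Gamma>" and g: "approximates \<Omega> \<Gamma> g u" and u: "u \<in> distributions_WF \<Omega> \<Gamma>"
 shows "limitin (normal_topology \<Omega> \<Gamma>) (\<lambda>n. distribution_of \<Omega> (g n)) u sequentially"
 unfolding limitin_def
proof (intro conjI allI impI)
 show "u \<in> topspace (normal_topology \<Omega> \<Gamma>)" using u by simp
 fix U assume "openin (normal_topology \<Omega> \<Gamma>) U \<and> u \<in> U"
 then have "openin (normal_topology \<Omega> \<Gamma>) U" "u \<in> U" by simp_all
 then have "generate_topology_on {{v \<in> distributions_WF \<Omega> \<Gamma>. p (\<lambda>\<phi>. v \<phi> - u \<phi>) < \<epsilon>} | p u \<epsilon>.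
    p \<in> normal_seminorms \<Omega> \<Gamma> \<and> u \<in> distributions_WF \<Omega> \<Gamma> \<and> 0 < \<epsilon>} U"
  unfolding normal_topology_def by (simp add: openin_topology_generated_by)
 then have "u \<in> U --> eventually (\<lambda>n. distribution_of \<Omega> (g n) \<in> U) sequentially"
 proof (induction rule: generate_topology_on.induct)
  case (Int a b)
  then show ?case by (auto intro: eventually_conj)
 next
  case (UN K)
  show ?case
  proof
   assume "u \<in> \<Union>K"
   then obtain k where k: "k \<in> K" "u \<in> k" by blast
   then have "eventually (\<lambda>n. distribution_of \<Omega> (g n) \<in> k) sequentially" using UN(2) by simp
   then show "eventually (\<lambda>n. distribution_of \<Omega> (g n) \<in> \<Union>K) sequentially" by (rule eventually_mono) (use k in blast)
  qed
 next
  case (Basis s)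
  then obtain p w \<epsilon> where s: "s = {v \<in> distributions_WF \<Omega> \<Gamma>. p (\<lambda>\<phi>. v \<phi> - w \<phi>) < \<epsilon>}" and p: "p \<in> normal_seminorms \<Omega> \<Gamma>" by auto
  show ?case
  proof
   assume "u \<in> s"
   then have "p (\<lambda>\<phi>. u \<phi> - w \<phi>) < \<epsilon>" by (simp add: s)
   then obtain \<delta> where \<delta>: "0 < \<delta>" "\<And>v. p (\<lambda>\<phi>. v \<phi> - u \<phi>) \<le> ennreal \<delta> ==> p (\<lambda>\<phi>. v \<phi> - w \<phi>) < \<epsilon>"
    by (rule normal_seminorm_gap[OF \<Omega> \<Gamma> p]) (rule that)
   have "eventually (\<lambda>n. p (\<lambda>\<phi>. distribution_of \<Omega> (g n) \<phi> - u \<phi>) \<le> ennreal \<delta>) sequentially"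
    using g p \<delta>(1) by (simp add: approximates_def)
   moreover have "distribution_of \<Omega> (g n) \<in> distributions_WF \<Omega> \<Gamma>" for n
    by (rule distribution_of_smooth_WF[OF \<Omega>]) (use g in \<open>simp add: approximates_def\<close>)
   ultimately show "eventually (\<lambda>n. distribution_of \<Omega> (g n) \<in> s) sequentially"
    unfolding s by (auto elim!: eventually_mono intro: \<delta>(2))
  qed
 qed simp
 then show "eventually (\<lambda>n. distribution_of \<Omega> (g n) \<in> U) sequentially" using \<open>u \<in> U\<close> by simp
qed

text \<open>A single test function is a bounded set, so the normal topology is finer than that of
  pointwise convergence.\<close>

lemma limitin_normal_pointwise:
 fixes \<Omega> :: "(real^'n) set"
 assumes \<Omega>: "open \<Omega>" and \<Gamma>: "closed_cone_over \<Omega> \<Gamma>"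
  and lim: "limitin (normal_topology \<Omega> \<Gamma>) \<tau> v sequentially" and \<phi>: "\<phi> \<in> test_functions \<Omega>"
 shows "(\<lambda>n. \<tau> n \<phi>) \<longlonglongrightarrow> v \<phi>"
proof (rule tendstoI)
 fix e :: real assume e: "0 < e"
 let ?p = "bounded_set_seminorm {\<phi>}"
 let ?U = "{w \<in> distributions_WF \<Omega> \<Gamma>. ?p (\<lambda>\<phi>. w \<phi> - v \<phi>) < ennreal e}"
 have p: "?p \<in> normal_seminorms \<Omega> \<Gamma>" by (rule singleton_normal_seminorm[OF \<phi>])
 have v: "v \<in> distributions_WF \<Omega> \<Gamma>" using lim by (simp add: limitin_def)
 have "openin (normal_topology \<Omega> \<Gamma>) ?U" by (rule openin_normal_ball[OF \<Omega> \<Gamma> p v]) (use e in simp)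
 moreover have "v \<in> ?U" using v e by (simp add: bounded_set_seminorm_def)
 ultimately have "eventually (\<lambda>n. \<tau> n \<in> ?U) sequentially" using lim unfolding limitin_def by blast
 then show "eventually (\<lambda>n. dist (\<tau> n \<phi>) (v \<phi>) < e) sequentially"
  by (rule eventually_mono) (simp add: bounded_set_seminorm_def dist_norm ennreal_less_iff)
qed

section \<open>Recognising distributions and their wave front sets\<close>

lemma norm_iter_deriv_le_Ck_norm:
 fixes \<phi> :: "'a::euclidean_space => complex"
 assumes \<phi>: "\<phi> \<in> test_functions \<Omega>" and bs: "bs \<in> lists Basis" "length bs \<le> m"
 shows "norm (iter_deriv bs \<phi> x) \<le> Ck_norm m \<phi>"
proof -
 obtain D where D: "\<And>x. norm (iter_deriv bs \<phi> x) \<le> D" by (rule iter_deriv_bounded[OF \<phi> bs(1)]) (erule that)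
 then have "norm (iter_deriv bs \<phi> x) \<le> (SUP x. norm (iter_deriv bs \<phi> x))" by (intro cSUP_upper) (auto intro!: bdd_aboveI)
 also have "\<dots> \<le> Ck_norm m \<phi>" unfolding Ck_norm_def
 proof (rule member_le_sum[of bs _ "\<lambda>bs. SUP x. norm (iter_deriv bs \<phi> x)"])
  fix cs :: "'a list" assume "cs \<in> {cs. cs \<in> lists Basis \<and> length cs \<le> m} - {bs}"
  then have cs: "cs \<in> lists Basis" by simp
  obtain C where "\<And>x. norm (iter_deriv cs \<phi> x) \<le> C" by (rule iter_deriv_bounded[OF \<phi> cs]) (erule that)
  then show "0 \<le> (SUP x. norm (iter_deriv cs \<phi> x))" by (rule SUP_norm_le(2))
 qed (use bs finite_multi_indices in auto)
 finally show ?thesis .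
qed

text \<open>The space of test functions supported in a fixed compact set is bornological.\<close>

lemma bounded_imp_continuous_on_compact_supports:
 fixes v :: "('a::euclidean_space => complex) => complex"
 assumes cm: "\<And>\<phi> c. \<phi> \<in> test_functions \<Omega> ==> v (\<lambda>x. c * \<phi> x) = c * v \<phi>"
  and bd: "\<And>B. bounded_test_set \<Omega> B ==> bounded_set_seminorm B v < \<infinity>"
 shows "continuous_on_compact_supports \<Omega> (\<lambda>\<phi>. norm (v \<phi>))"
 unfolding continuous_on_compact_supports_def
proof (intro allI impI, rule ccontr)
 fix K assume K: "compact K \<and> K \<subseteq> \<Omega>"
 assume "\<nexists>C m. \<forall>\<phi>\<in>test_functions \<Omega>. supp \<phi> \<subseteq> K --> norm (v \<phi>) \<le> C * Ck_norm m \<phi>"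
 then have "\<forall>m. \<exists>\<phi>. \<phi> \<in> test_functions \<Omega> \<and> supp \<phi> \<subseteq> K \<and> real m * Ck_norm m \<phi> < norm (v \<phi>)" by (force simp: not_le)
 then obtain \<phi> where \<phi>: "\<And>m. \<phi> m \<in> test_functions \<Omega>" "\<And>m. supp (\<phi> m) \<subseteq> K" "\<And>m. real m * Ck_norm m (\<phi> m) < norm (v (\<phi> m))" by metis
 have Ck: "0 \<le> Ck_norm m (\<phi> m)" for m
  using norm_iter_deriv_le_Ck_norm[OF \<phi>(1), of "[]" m m undefined] order_trans[OF norm_ge_zero] by simp
 have v0: "0 < norm (v (\<phi> m))" for m
 proof -
  have "0 \<le> real m * Ck_norm m (\<phi> m)" by (intro mult_nonneg_nonneg Ck) simp
  then show ?thesis using \<phi>(3)[of m] by linarith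
 qed
 \<comment> \<open>Rescaling makes |v| equal to m on the m-th function, while its
   \<open>Ck_norm\<close> of order m stays at most 1 for positive m and is 0 for m = 0.\<close>
 define t where "t m = real m / norm (v (\<phi> m))" for m
 have tn: "norm (complex_of_real (t m)) = t m" for m unfolding norm_of_real by (simp add: t_def)
 define \<psi> where "\<psi> m x = complex_of_real (t m) * \<phi> m x" for m x
 have \<psi>t: "\<psi> m \<in> test_functions \<Omega>" for m unfolding \<psi>_def by (rule test_functions_add_cmult(2)[OF \<phi>(1) \<phi>(1)])
 have "test_family K UNIV \<psi>"
  unfolding test_family_def
 proof (intro conjI ballI allI impI bdd_family_iter_derivI)
  show "smooth_on UNIV (\<psi> m)" for m by (rule test_functionsD(1)[OF \<psi>t])
  show "\<psi> m x = 0" if "x \<notin> K" for m x using that \<phi>(2)[of m] not_in_supp[of x "\<phi> m"] by (auto simp: \<psi>_def)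
  fix bs :: "'a list" assume bs: "bs \<in> lists Basis"
  \<comment> \<open>For a derivative of given order the normalised bound works once m reaches that
    order; the finitely many earlier functions are bounded one by one.\<close>
  have "\<exists>D. \<forall>m. m < length bs --> (\<forall>x. norm (iter_deriv bs (\<psi> m) x) \<le> D)"
  proof -
   have "\<forall>m. \<exists>D. \<forall>x. norm (iter_deriv bs (\<psi> m) x) \<le> D"
   proof
    fix m
    obtain D where "\<And>x. norm (iter_deriv bs (\<psi> m) x) \<le> D" by (rule iter_deriv_bounded[OF \<psi>t bs]) (erule that)
    then show "\<exists>D. \<forall>x. norm (iter_deriv bs (\<psi> m) x) \<le> D" by blast
   qed
   then obtain D where D: "\<And>m x. norm (iter_deriv bs (\<psi> m) x) \<le> D m" by metis
   have D0: "0 \<le> D m" for m using order_trans[OF norm_ge_zero D] .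
   have "norm (iter_deriv bs (\<psi> m) x) \<le> (\<Sum>m<length bs. D m)" if "m < length bs" for m x
    by (rule order_trans[OF D[of m x] member_le_sum[of m "{..<length bs}" D]]) (use that D0 in auto)
   then show ?thesis by blast
  qed
  then obtain D where D: "\<And>m x. m < length bs ==> norm (iter_deriv bs (\<psi> m) x) \<le> D" by blast
  have "norm (iter_deriv bs (\<psi> m) x) \<le> max D 1" for m x
  proof (cases "m < length bs")
   case True
   then show ?thesis using D[OF True, of x] by simp
  next
   case False
   have "norm (iter_deriv bs (\<psi> m) x) = t m * norm (iter_deriv bs (\<phi> m) x)"
    unfolding \<psi>_def[abs_def] iter_deriv_cmult[OF test_functionsD(1)[OF \<phi>(1)] bs] norm_mult tn ..
   also have "\<dots> \<le> t m * Ck_norm m (\<phi> m)"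
    by (intro mult_left_mono norm_iter_deriv_le_Ck_norm[OF \<phi>(1) bs]) (use False in \<open>auto simp: t_def\<close>)
   also have "\<dots> = real m * Ck_norm m (\<phi> m) / norm (v (\<phi> m))" by (simp add: t_def)
   also have "\<dots> \<le> 1" using \<phi>(3)[of m] v0[of m] by (simp add: pos_divide_le_eq)
   finally show ?thesis by simp
  qed
  then show "\<exists>C. \<forall>m\<in>UNIV. \<forall>x. norm (iter_deriv bs (\<psi> m) x) \<le> C" by blast
 qed
 then have "bounded_test_set \<Omega> (range \<psi>)" using K by (intro bounded_test_set_family) auto
 then have "bounded_set_seminorm (range \<psi>) v < top" using bd by simp
 then obtain P where P: "0 \<le> P" "bounded_set_seminorm (range \<psi>) v = ennreal P" by (cases "bounded_set_seminorm (range \<psi>) v") auto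
 then have "bounded_set_seminorm (range \<psi>) v \<le> ennreal P" by simp
 then have b: "norm (v (\<psi> m)) \<le> P" for m unfolding bounded_set_seminorm_le_iff[OF P(1)] by blast
 have "norm (v (\<psi> m)) = real m" for m
  unfolding \<psi>_def[abs_def] cm[OF \<phi>(1)] norm_mult tn using v0[of m] by (simp add: t_def)
 then have "real m \<le> P" for m using b[of m] by simp
 then show False using reals_Archimedean2[of P] not_less by blast
qed

text \<open>A covector off the closed cone \<Gamma> has a neighbourhood of the form closed ball
  times closed cone that misses \<Gamma>. A bump on the ball and this cone give normal seminorms,
  whose finiteness of all orders excludes the covector from the wave front set.\<close>

lemma wave_front_set_subset:
 fixes v :: "('a::euclidean_space => complex) => complex"
 assumes \<Omega>: "open \<Omega>" and \<Gamma>: "closed_cone_over \<Omega> \<Gamma>" and fin: "\<And>p. p \<in> normal_seminorms \<Omega> \<Gamma> ==> p v < \<infinity>"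
 shows "wave_front_set \<Omega> v \<subseteq> \<Gamma>"
proof (rule subrelI, rule ccontr)
 fix x \<xi> assume wf: "(x, \<xi>) \<in> wave_front_set \<Omega> v" and n\<Gamma>: "(x, \<xi>) \<notin> \<Gamma>"
 have x: "x \<in> \<Omega>" "\<xi> \<noteq> 0" using wf by (simp_all add: wave_front_set_def)
 obtain C where C: "closed C" "\<Gamma> = (\<Omega> \<times> (- {0})) \<inter> C" and cone: "\<And>x \<xi> t. (x, \<xi>) \<in> \<Gamma> ==> t > 0 ==> (x, t *\<^sub>R \<xi>) \<in> \<Gamma>"
  by (rule closed_cone_overD[OF \<Gamma>]) (erule that, assumption, assumption)
 have "(x, \<xi>) \<in> - C" using n\<Gamma> x C(2) by simp
 moreover have "open (- C)" using C(1) by (rule open_Compl)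
 ultimately obtain e where e: "e > 0" "ball (x, \<xi>) e \<subseteq> - C" using open_contains_ball by blast
 obtain e' where e': "e' > 0" "cball x e' \<subseteq> \<Omega>" using \<Omega> x(1) open_contains_cball by blast
 define d where "d = min (e / 3) e'"
 have d: "0 < d" "d \<le> e'" "2 * d < e" using e(1) e'(1) by (auto simp: d_def min_def)
 \<comment> \<open>A closed conical neighbourhood of \<xi>, written homogeneously so that no
   division by the length of the covector occurs.\<close>
 define V where "V = {\<eta>. norm (norm \<xi> *\<^sub>R \<eta> - norm \<eta> *\<^sub>R \<xi>) \<le> d * norm \<eta>}"
 have V1: "closed V" unfolding V_def by (intro closed_Collect_le continuous_intros)
 have V2: "cone V" unfolding cone_def
 proof (intro ballI allI impI)
  fix \<eta> and t :: real assume a: "\<eta> \<in> V" "0 \<le> t"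
  have "norm \<xi> *\<^sub>R (t *\<^sub>R \<eta>) - norm (t *\<^sub>R \<eta>) *\<^sub>R \<xi> = t *\<^sub>R (norm \<xi> *\<^sub>R \<eta> - norm \<eta> *\<^sub>R \<xi>)"
   using a(2) by (simp add: algebra_simps)
  then have "norm (norm \<xi> *\<^sub>R (t *\<^sub>R \<eta>) - norm (t *\<^sub>R \<eta>) *\<^sub>R \<xi>) = t * norm (norm \<xi> *\<^sub>R \<eta> - norm \<eta> *\<^sub>R \<xi>)" using a(2) by simp
  also have "\<dots> \<le> t * (d * norm \<eta>)" using a by (intro mult_left_mono) (auto simp: V_def)
  finally show "t *\<^sub>R \<eta> \<in> V" using a(2) by (simp add: V_def mult_ac)
 qed
 have V3: "\<xi> \<in> interior V"
 proof (rule interiorI)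
  show "open {\<eta>. norm (norm \<xi> *\<^sub>R \<eta> - norm \<eta> *\<^sub>R \<xi>) < d * norm \<eta>}" by (intro open_Collect_less continuous_intros)
  show "\<xi> \<in> {\<eta>. norm (norm \<xi> *\<^sub>R \<eta> - norm \<eta> *\<^sub>R \<xi>) < d * norm \<eta>}" using x(2) d(1) by simp
  show "{\<eta>. norm (norm \<xi> *\<^sub>R \<eta> - norm \<eta> *\<^sub>R \<xi>) < d * norm \<eta>} \<subseteq> V" by (auto simp: V_def)
 qed
 have disj: "(cball x d \<times> V) \<inter> \<Gamma> = {}"
 proof (rule equals0I, clarify)
  fix y \<eta> assume a: "y \<in> cball x d" "\<eta> \<in> V" "(y, \<eta>) \<in> \<Gamma>"
  have \<eta>0: "norm \<eta> > 0" using a(3) C(2) by auto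
  \<comment> \<open>Rescaling to the length of \<xi> brings the point back into the ball around (x,
    \<xi>), where the complement of \<open>C\<close> is known.\<close>
  define \<zeta> where "\<zeta> = (norm \<xi> / norm \<eta>) *\<^sub>R \<eta>"
  have "(y, \<zeta>) \<in> \<Gamma>" unfolding \<zeta>_def by (rule cone[OF a(3)]) (use \<eta>0 x(2) in simp)
  have "\<zeta> - \<xi> = inverse (norm \<eta>) *\<^sub>R (norm \<xi> *\<^sub>R \<eta> - norm \<eta> *\<^sub>R \<xi>)"
   using \<eta>0 by (simp add: \<zeta>_def scaleR_diff_right divide_inverse mult.commute)
  then have "norm (\<zeta> - \<xi>) = inverse (norm \<eta>) * norm (norm \<xi> *\<^sub>R \<eta> - norm \<eta> *\<^sub>R \<xi>)" using \<eta>0 by simp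
  also have "\<dots> \<le> inverse (norm \<eta>) * (d * norm \<eta>)" using a(2) by (intro mult_left_mono) (auto simp: V_def)
  also have "\<dots> = d" using \<eta>0 by simp
  finally have \<zeta>d: "norm (\<zeta> - \<xi>) \<le> d" .
  have "dist (x, \<xi>) (y, \<zeta>) \<le> dist x y + dist \<xi> \<zeta>"
   unfolding dist_Pair_Pair using sqrt_sum_squares_le_sum[of "dist x y" "dist \<xi> \<zeta>"] by simp
  also have "\<dots> \<le> d + d" using a(1) \<zeta>d by (intro add_mono) (auto simp: dist_norm norm_minus_commute)
  also have "\<dots> < e" using d(3) by simp
  finally have "(y, \<zeta>) \<notin> C" using e(2) by auto
  then show False using \<open>(y, \<zeta>) \<in> \<Gamma>\<close> C(2) by blast
 qed
 obtain \<theta> :: "'a => complex" where \<theta>: "test_fun (cball x d) \<theta>"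
  and one: "\<And>y. y \<in> cball x (d / 2) ==> \<theta> y = 1" by (rule bump_exists[OF d(1)]) (erule that, assumption)
 have \<theta>x: "\<theta> x \<noteq> 0" using one[of x] d(1) by simp
 have sub: "cball x d \<subseteq> \<Omega>" using e'(2) d(2) by (auto simp: subset_iff)
 have \<theta>t: "\<theta> \<in> test_functions \<Omega>" "supp \<theta> \<subseteq> cball x d"
  using test_family_test_functions[OF compact_cball sub \<theta>] by simp_all
 have "fourier_seminorm N V \<theta> \<in> normal_seminorms \<Omega> \<Gamma>" for N
  unfolding normal_seminorms_def using \<theta>t V1 V2 disj by blast
 then have "\<forall>N. fourier_seminorm N V \<theta> v < \<infinity>" using fin by blast
 then have "\<exists>\<theta>\<in>test_functions \<Omega>. \<exists>V. \<theta> x \<noteq> 0 \<and> closed V \<and> cone V \<and> \<xi> \<in> interior V \<and> (\<forall>N. fourier_seminorm N V \<theta> v < \<infinity>)"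
  using \<theta>t(1) \<theta>x V1 V2 V3 by (intro bexI[of _ \<theta>] exI[of _ V] conjI)
 with wf show False unfolding wave_front_set_def mem_Collect_eq prod.case by (elim conjE) (erule notE, assumption)
qed

section \<open>The extension by continuity\<close>

lemma smooth_on_diff:
 fixes g h :: "'a::euclidean_space => complex"
 assumes "open S" "smooth_on S g" "smooth_on S h"
 shows "smooth_on S (\<lambda>x. g x - h x)"
proof (rule smooth_on_local)
 fix x assume "x \<in> S"
 then obtain e where e: "e > 0" "cball x e \<subseteq> S" using assms(1) open_contains_cball by blast
 have "bdd_family (ball x e) {()} (\<lambda>_. g)" "bdd_family (ball x e) {()} (\<lambda>_. h)"
  by (rule smooth_on_imp_bdd_family[OF assms(2) ball_subset_cball compact_cball e(2)],
    rule smooth_on_imp_bdd_family[OF assms(3) ball_subset_cball compact_cball e(2)])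
 then have "bdd_family (ball x e) {()} (\<lambda>_ x. g x - h x)" by (rule bdd_family_diff[OF open_ball])
 then have "smooth_on (ball x e) (\<lambda>x. g x - h x)" using bdd_family_imp_smooth_on[of "ball x e" "{()}" "\<lambda>_ x. g x - h x" "()"] by simp
 then show "\<exists>U. x \<in> U \<and> smooth_on U (\<lambda>x. g x - h x)" using e(1) by (intro exI[of _ "ball x e"]) simp
qed

lemma distribution_of_diff:
 fixes g h :: "'a::euclidean_space => complex"
 assumes "continuous_on \<Omega> g" "continuous_on \<Omega> h"
 shows "distribution_of \<Omega> (\<lambda>x. g x - h x) = (\<lambda>\<phi>. distribution_of \<Omega> g \<phi> - distribution_of \<Omega> h \<phi>)"
proof
 fix \<phi>
 show "distribution_of \<Omega> (\<lambda>x. g x - h x) \<phi> = distribution_of \<Omega> g \<phi> - distribution_of \<Omega> h \<phi>"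
 proof (cases "\<phi> \<in> test_functions \<Omega>")
  case True
  then show ?thesis
   using Bochner_Integration.integral_diff[OF integrable_test_function[OF assms(1) True] integrable_test_function[OF assms(2) True]]
   by (simp add: distribution_of_eq left_diff_distrib scaleR_diff_right)
 qed (simp add: distribution_of_def)
qed

text \<open>Seminorm bounds for differences F u - F v take the place of linearity, which for a map
  built from chosen sequences would have to be proved separately.\<close>

lemma continuous_map_normalI:
 fixes \<Omega> :: "(real^'n) set" and \<Omega>' :: "(real^'m) set"
 assumes \<Omega>: "open \<Omega>" and \<Gamma>: "closed_cone_over \<Omega> \<Gamma>" and \<Omega>': "open \<Omega>'" and \<Gamma>': "closed_cone_over \<Omega>' \<Gamma>'"
  and F: "\<And>u. u \<in> distributions_WF \<Omega> \<Gamma> ==> F u \<in> distributions_WF \<Omega>' \<Gamma>'"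
  and est: "\<And>q. q \<in> normal_seminorms \<Omega>' \<Gamma>' ==> \<exists>S C. finite S \<and> S \<subseteq> normal_seminorms \<Omega> \<Gamma> \<and> 0 \<le> C \<and>
   (\<forall>u\<in>distributions_WF \<Omega> \<Gamma>. \<forall>v\<in>distributions_WF \<Omega> \<Gamma>. \<forall>P>0. (\<forall>p\<in>S. p (\<lambda>\<phi>. u \<phi> - v \<phi>) \<le> ennreal P) -->
    q (\<lambda>\<phi>. F u \<phi> - F v \<phi>) \<le> ennreal (C * P))"
 shows "continuous_map (normal_topology \<Omega> \<Gamma>) (normal_topology \<Omega>' \<Gamma>') F"
 unfolding normal_topology_def[of \<Omega>' \<Gamma>']
proof (rule continuous_on_generated_topo)
 have "\<Union> {{v \<in> distributions_WF \<Omega>' \<Gamma>'. p (\<lambda>\<phi>. v \<phi> - u \<phi>) < \<epsilon>} | p u \<epsilon>. p \<in> normal_seminorms \<Omega>' \<Gamma>' \<and> u \<in> distributions_WF \<Omega>' \<Gamma>' \<and> 0 < \<epsilon>}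
   = distributions_WF \<Omega>' \<Gamma>'"
  using topspace_normal_topology[of \<Omega>' \<Gamma>'] unfolding normal_topology_def topology_generated_by_topspace .
 then show "F ` topspace (normal_topology \<Omega> \<Gamma>) \<subseteq> \<Union> {{v \<in> distributions_WF \<Omega>' \<Gamma>'. p (\<lambda>\<phi>. v \<phi> - u \<phi>) < \<epsilon>} | p u \<epsilon>.
   p \<in> normal_seminorms \<Omega>' \<Gamma>' \<and> u \<in> distributions_WF \<Omega>' \<Gamma>' \<and> 0 < \<epsilon>}" using F by auto
 fix U assume "U \<in> {{v \<in> distributions_WF \<Omega>' \<Gamma>'. p (\<lambda>\<phi>. v \<phi> - u \<phi>) < \<epsilon>} | p u \<epsilon>.
   p \<in> normal_seminorms \<Omega>' \<Gamma>' \<and> u \<in> distributions_WF \<Omega>' \<Gamma>' \<and> 0 < \<epsilon>}"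
 then obtain q w \<epsilon> where U: "U = {v \<in> distributions_WF \<Omega>' \<Gamma>'. q (\<lambda>\<phi>. v \<phi> - w \<phi>) < \<epsilon>}" and q: "q \<in> normal_seminorms \<Omega>' \<Gamma>'" by auto
 let ?X = "normal_topology \<Omega> \<Gamma>"
 show "openin ?X (F -` U \<inter> topspace ?X)"
 proof (rule openin_subopen[THEN iffD2], intro ballI)
  fix u assume "u \<in> F -` U \<inter> topspace ?X"
  then have u: "u \<in> distributions_WF \<Omega> \<Gamma>" and Fu: "q (\<lambda>\<phi>. F u \<phi> - w \<phi>) < \<epsilon>" by (simp_all add: U)
  obtain \<delta> where \<delta>: "0 < \<delta>" "\<And>v. q (\<lambda>\<phi>. v \<phi> - F u \<phi>) \<le> ennreal \<delta> ==> q (\<lambda>\<phi>. v \<phi> - w \<phi>) < \<epsilon>"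
   by (rule normal_seminorm_gap[OF \<Omega>' \<Gamma>' q Fu]) (rule that)
  obtain S C where S: "finite S" "S \<subseteq> normal_seminorms \<Omega> \<Gamma>" and C: "0 \<le> C" and
   b: "\<forall>u\<in>distributions_WF \<Omega> \<Gamma>. \<forall>v\<in>distributions_WF \<Omega> \<Gamma>. \<forall>P>0. (\<forall>p\<in>S. p (\<lambda>\<phi>. u \<phi> - v \<phi>) \<le> ennreal P) -->
    q (\<lambda>\<phi>. F u \<phi> - F v \<phi>) \<le> ennreal (C * P)" using est[OF q] by (elim exE conjE)
  \<comment> \<open>The summand 1 guards against C = 0.\<close>
  define P where "P = \<delta> / (C + 1)"
  have P: "0 < P" using \<delta>(1) C by (simp add: P_def)
  have CP: "C * P \<le> \<delta>" using \<delta>(1) C by (simp add: P_def field_simps)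
  define T where "T = \<Inter> (insert (topspace ?X) ((\<lambda>p. {v \<in> distributions_WF \<Omega> \<Gamma>. p (\<lambda>\<phi>. v \<phi> - u \<phi>) < ennreal P}) ` S))"
  have "openin ?X T" unfolding T_def
  proof (rule openin_Inter)
   fix A assume "A \<in> insert (topspace ?X) ((\<lambda>p. {v \<in> distributions_WF \<Omega> \<Gamma>. p (\<lambda>\<phi>. v \<phi> - u \<phi>) < ennreal P}) ` S)"
   then consider "A = topspace ?X" | p where "p \<in> S" "A = {v \<in> distributions_WF \<Omega> \<Gamma>. p (\<lambda>\<phi>. v \<phi> - u \<phi>) < ennreal P}" by blast
   then show "openin ?X A"
   proof cases
    case 2
    have "p \<in> normal_seminorms \<Omega> \<Gamma>" using 2(1) S(2) by blast
    then show ?thesis unfolding 2(2) by (rule openin_normal_ball[OF \<Omega> \<Gamma> _ u]) (use P in simp)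
   qed (simp only: openin_topspace)
  qed (use S(1) in auto)
  moreover have "p (\<lambda>\<phi>. u \<phi> - u \<phi>) < ennreal P" if "p \<in> S" for p
   by (rule le_less_trans[OF normal_seminorm_diff_self[OF \<Omega> \<Gamma>]]) (use that S(2) P in auto)
  then have "u \<in> T" using u by (auto simp: T_def)
  moreover have "T \<subseteq> F -` U \<inter> topspace ?X"
  proof
   fix v assume "v \<in> T"
   then have v: "v \<in> distributions_WF \<Omega> \<Gamma>" "\<forall>p\<in>S. p (\<lambda>\<phi>. v \<phi> - u \<phi>) \<le> ennreal P" by (auto simp: T_def less_imp_le)
   then have "q (\<lambda>\<phi>. F v \<phi> - F u \<phi>) \<le> ennreal (C * P)" using b u P by simp
   also have "\<dots> \<le> ennreal \<delta>" using CP by (rule ennreal_leI)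
   finally have "q (\<lambda>\<phi>. F v \<phi> - w \<phi>) < \<epsilon>" by (rule \<delta>(2))
   then show "v \<in> F -` U \<inter> topspace ?X" using v(1) F by (simp add: U)
  qed
  ultimately show "\<exists>T. openin ?X T \<and> u \<in> T \<and> T \<subseteq> F -` U \<inter> topspace ?X" by blast
 qed
qed

text \<open>Attached to an approximating sequence rather than to the distribution; independence of
  the sequence is a consequence of the estimates.\<close>

definition pullback_limit :: "(real^'m) set => (real^'m => real^'n) => (nat => real^'n => complex) => (real^'m => complex) => complex" where
 "pullback_limit \<Omega>1 f g = (\<lambda>\<phi>. lim (\<lambda>n. distribution_of \<Omega>1 (g n \<circ> f) \<phi>))"

section \<open>Existence, estimates and identification of the limit\<close>

context
 fixes \<Omega>1 :: "(real^'m) set" and \<Omega>2 :: "(real^'n) set" and \<Gamma> f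
 assumes \<Omega>1: "open \<Omega>1" and \<Omega>2: "open \<Omega>2" and \<Gamma>: "closed_cone_over \<Omega>2 \<Gamma>"
  and f: "smooth_on \<Omega>1 f" and im: "f ` \<Omega>1 \<subseteq> \<Omega>2" and conormal: "conormal_set \<Omega>1 f \<inter> \<Gamma> = {}"
begin

lemma closed_pull_cone: "closed_cone_over \<Omega>1 (pull_cone \<Omega>1 f \<Gamma>)"
 by (rule closed_cone_over_pull_cone[OF \<Omega>1 f \<Gamma> im conormal])

lemma normal_seminorm_pullback:
 assumes q: "q \<in> normal_seminorms \<Omega>1 (pull_cone \<Omega>1 f \<Gamma>)"
 obtains S C where "finite S" "S \<subseteq> normal_seminorms \<Omega>2 \<Gamma>" "0 \<le> C"
  "\<forall>g P. smooth_on \<Omega>2 g --> 0 \<le> P --> (\<forall>p\<in>S. p (distribution_of \<Omega>2 g) \<le> ennreal P) -->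
   q (distribution_of \<Omega>1 (g \<circ> f)) \<le> ennreal (C * P)"
proof (rule normal_seminorm_form[OF \<Omega>1 closed_pull_cone q])
 fix K B V N assume a: "compact K" "K \<subseteq> \<Omega>1" "closed V" "cone V" "(K \<times> V) \<inter> pull_cone \<Omega>1 f \<Gamma> = {}" "test_family K B (\<lambda>\<phi>. \<phi>)"
  and form: "\<And>u P. 0 \<le> P ==> q u \<le> ennreal P \<longleftrightarrow> (\<forall>\<phi>\<in>B. \<forall>k\<in>V. decay N u \<phi> k \<le> P)"
 have "pullback_estimate \<Omega>1 \<Omega>2 \<Gamma> f V N B (\<lambda>\<phi>. \<phi>)" by (rule pullback_estimate[OF \<Omega>1 \<Omega>2 \<Gamma> f im a(3,4,1,2,5,6)])
 then obtain S C where SC: "finite S" "S \<subseteq> normal_seminorms \<Omega>2 \<Gamma>" "0 \<le> C" and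
  b: "\<forall>g P. smooth_on \<Omega>2 g --> 0 \<le> P --> (\<forall>p\<in>S. p (distribution_of \<Omega>2 g) \<le> ennreal P) -->
    (\<forall>i\<in>B. \<forall>k\<in>V. decay N (distribution_of \<Omega>1 (g \<circ> f)) i k \<le> C * P)"
  unfolding pullback_estimate_def by (elim exE conjE)
 show thesis
 proof (rule that[OF SC], intro allI impI)
  fix g P assume "smooth_on \<Omega>2 g" "0 \<le> P" "\<forall>p\<in>S. p (distribution_of \<Omega>2 g) \<le> ennreal P"
  then show "q (distribution_of \<Omega>1 (g \<circ> f)) \<le> ennreal (C * P)"
   using b unfolding form[OF mult_nonneg_nonneg[OF SC(3) \<open>0 \<le> P\<close>]] by blast
 qed
qed

lemma distribution_of_comp_diff:
 assumes g: "smooth_on \<Omega>2 (g :: real^'n => complex)" and h: "smooth_on \<Omega>2 h"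
 shows "distribution_of \<Omega>1 ((\<lambda>x. g x - h x) \<circ> f) = (\<lambda>\<phi>. distribution_of \<Omega>1 (g \<circ> f) \<phi> - distribution_of \<Omega>1 (h \<circ> f) \<phi>)"
 using distribution_of_diff[OF continuous_comp[OF \<Omega>1 \<Omega>2 \<Gamma> f im g] continuous_comp[OF \<Omega>1 \<Omega>2 \<Gamma> f im h]] by (simp add: o_def)

text \<open>The difference of \<open>g n\<close> and \<open>h m\<close> is split as (g n - u) + (u -
  v) + (v - h m), and the estimate for smooth functions is applied to the whole. Two sequences with
  two limits in one statement yield both the Cauchy property and the comparison of limits.\<close>

lemma pullback_approximants:
 assumes q: "q \<in> normal_seminorms \<Omega>1 (pull_cone \<Omega>1 f \<Gamma>)"
 obtains S C where "finite S" "S \<subseteq> normal_seminorms \<Omega>2 \<Gamma>" "0 \<le> C"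
  "\<And>g h u v P \<epsilon>. approximates \<Omega>2 \<Gamma> g u ==> approximates \<Omega>2 \<Gamma> h v ==> 0 \<le> P ==> 0 < \<epsilon> ==> \<forall>p\<in>S. p (\<lambda>\<phi>. u \<phi> - v \<phi>) \<le> ennreal P ==>
   \<exists>n0. \<forall>n\<ge>n0. \<forall>m\<ge>n0. q (\<lambda>\<phi>. distribution_of \<Omega>1 (g n \<circ> f) \<phi> - distribution_of \<Omega>1 (h m \<circ> f) \<phi>) \<le> ennreal (C * (\<epsilon> + P + \<epsilon>))"
proof (rule normal_seminorm_pullback[OF q], goal_cases)
 case (1 S C)
 note S = 1(2-4) and est = 1(5)
 have ev: "\<exists>n0. \<forall>n\<ge>n0. \<forall>p\<in>S. p (\<lambda>\<phi>. distribution_of \<Omega>2 (g n) \<phi> - u \<phi>) \<le> ennreal \<epsilon>"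
  if "approximates \<Omega>2 \<Gamma> g u" "0 < \<epsilon>" for g u \<epsilon>
 proof -
  have "eventually (\<lambda>n. \<forall>p\<in>S. p (\<lambda>\<phi>. distribution_of \<Omega>2 (g n) \<phi> - u \<phi>) \<le> ennreal \<epsilon>) sequentially"
   by (rule eventually_ball_finite[OF S(1)]) (use that S(2) in \<open>auto simp: approximates_def\<close>)
  then show ?thesis by (simp add: eventually_sequentially)
 qed
 have "\<exists>n0. \<forall>n\<ge>n0. \<forall>m\<ge>n0. q (\<lambda>\<phi>. distribution_of \<Omega>1 (g n \<circ> f) \<phi> - distribution_of \<Omega>1 (h m \<circ> f) \<phi>) \<le> ennreal (C * (\<epsilon> + P + \<epsilon>))"
  if g: "approximates \<Omega>2 \<Gamma> g u" and h: "approximates \<Omega>2 \<Gamma> h v" and P: "0 \<le> P" and \<epsilon>: "0 < \<epsilon>" and uv: "\<forall>p\<in>S. p (\<lambda>\<phi>. u \<phi> - v \<phi>) \<le> ennreal P"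
  for g h u v P \<epsilon>
 proof -
  obtain n1 where n1: "\<And>n p. n1 \<le> n ==> p \<in> S ==> p (\<lambda>\<phi>. distribution_of \<Omega>2 (g n) \<phi> - u \<phi>) \<le> ennreal \<epsilon>" using ev[OF g \<epsilon>] by blast
  obtain n2 where n2: "\<And>n p. n2 \<le> n ==> p \<in> S ==> p (\<lambda>\<phi>. distribution_of \<Omega>2 (h n) \<phi> - v \<phi>) \<le> ennreal \<epsilon>" using ev[OF h \<epsilon>] by blast
  show ?thesis
  proof (intro exI[of _ "max n1 n2"] allI impI)
   fix n m assume n: "max n1 n2 \<le> n" "max n1 n2 \<le> m"
   have sm: "smooth_on \<Omega>2 (g n)" "smooth_on \<Omega>2 (h m)" using g h by (simp_all add: approximates_def)
   have "p (distribution_of \<Omega>2 (\<lambda>x. g n x - h m x)) \<le> ennreal (\<epsilon> + P + \<epsilon>)" if p: "p \<in> S" for p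
   proof -
    have p': "p \<in> normal_seminorms \<Omega>2 \<Gamma>" using p S(2) by blast
    have A: "p (\<lambda>\<phi>. v \<phi> - distribution_of \<Omega>2 (h m) \<phi>) \<le> ennreal \<epsilon>"
     using n2[OF _ p, of m] n(2) normal_seminorm_diff_commute[OF \<Omega>2 \<Gamma> p' less_imp_le[OF \<epsilon>], of "distribution_of \<Omega>2 (h m)" v] by simp
    have B: "p (\<lambda>\<phi>. distribution_of \<Omega>2 (g n) \<phi> - v \<phi>) \<le> ennreal (\<epsilon> + P)"
     by (rule normal_seminorm_diff_trans[OF \<Omega>2 \<Gamma> p', where v = u]) (use n1[OF _ p, of n] n(1) uv p P \<epsilon> in auto)
    have "p (\<lambda>\<phi>. distribution_of \<Omega>2 (g n) \<phi> - distribution_of \<Omega>2 (h m) \<phi>) \<le> ennreal (\<epsilon> + P + \<epsilon>)"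
     by (rule normal_seminorm_diff_trans[OF \<Omega>2 \<Gamma> p' B A]) (use P \<epsilon> in auto)
    then show ?thesis unfolding distribution_of_diff[OF smooth_on_continuous[OF sm(1)] smooth_on_continuous[OF sm(2)]] .
   qed
   moreover have "smooth_on \<Omega>2 (\<lambda>x. g n x - h m x)" by (rule smooth_on_diff[OF \<Omega>2 sm])
   moreover have "0 \<le> \<epsilon> + P + \<epsilon>" using P \<epsilon> by simp
   ultimately have "q (distribution_of \<Omega>1 ((\<lambda>x. g n x - h m x) \<circ> f)) \<le> ennreal (C * (\<epsilon> + P + \<epsilon>))" using est by blast
   then show "q (\<lambda>\<phi>. distribution_of \<Omega>1 (g n \<circ> f) \<phi> - distribution_of \<Omega>1 (h m \<circ> f) \<phi>) \<le> ennreal (C * (\<epsilon> + P + \<epsilon>))"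
    unfolding distribution_of_comp_diff[OF sm] .
  qed
 qed
 from that[OF S this] show thesis .
qed

lemma pullback_cauchy:
 assumes q: "q \<in> normal_seminorms \<Omega>1 (pull_cone \<Omega>1 f \<Gamma>)" and g: "approximates \<Omega>2 \<Gamma> g u" and \<epsilon>: "0 < \<epsilon>"
 shows "\<exists>n0. \<forall>n\<ge>n0. \<forall>m\<ge>n0. q (\<lambda>\<phi>. distribution_of \<Omega>1 (g n \<circ> f) \<phi> - distribution_of \<Omega>1 (g m \<circ> f) \<phi>) \<le> ennreal \<epsilon>"
proof (rule pullback_approximants[OF q], goal_cases)
 case (1 S C)
 note S = 1(1-3) and est = 1(4)
 \<comment> \<open>Two approximation errors, each multiplied by \<open>C\<close>, must stay below
   \<epsilon>; the summand 1 avoids division by zero.\<close>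
 define e where "e = \<epsilon> / (2 * (C + 1))"
 have e1: "0 < e" using \<epsilon> S(3) by (simp add: e_def)
 have "2 * (C + 1) * e = \<epsilon>" using S(3) by (simp add: e_def)
 then have "C * (e + 0 + e) + 2 * e = \<epsilon>" by (simp add: algebra_simps)
 with e1 have e: "0 < e" "C * (e + 0 + e) \<le> \<epsilon>" by linarith+
 have self: "\<forall>p\<in>S. p (\<lambda>\<phi>. u \<phi> - u \<phi>) \<le> ennreal 0"
 proof
  fix p assume "p \<in> S"
  then show "p (\<lambda>\<phi>. u \<phi> - u \<phi>) \<le> ennreal 0" by (intro normal_seminorm_diff_self[OF \<Omega>2 \<Gamma> subsetD[OF S(2)]])
 qed
 obtain n0 where n0: "\<forall>n\<ge>n0. \<forall>m\<ge>n0. q (\<lambda>\<phi>. distribution_of \<Omega>1 (g n \<circ> f) \<phi> - distribution_of \<Omega>1 (g m \<circ> f) \<phi>) \<le> ennreal (C * (e + 0 + e))"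
  using est[OF g g order_refl e(1) self] by (elim exE)
 show ?thesis
 proof (intro exI[of _ n0] allI impI)
  fix n m assume "n0 \<le> n" "n0 \<le> m"
  then have "q (\<lambda>\<phi>. distribution_of \<Omega>1 (g n \<circ> f) \<phi> - distribution_of \<Omega>1 (g m \<circ> f) \<phi>) \<le> ennreal (C * (e + 0 + e))" using n0 by blast
  also have "\<dots> \<le> ennreal \<epsilon>" by (rule ennreal_leI[OF e(2)])
  finally show "q (\<lambda>\<phi>. distribution_of \<Omega>1 (g n \<circ> f) \<phi> - distribution_of \<Omega>1 (g m \<circ> f) \<phi>) \<le> ennreal \<epsilon>" .
 qed
qed

text \<open>The seminorm of a singleton makes the values a Cauchy sequence. On functions that are
  not test functions all terms are 0 by convention.\<close>

lemma pullback_limit_tendsto: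
 assumes g: "approximates \<Omega>2 \<Gamma> g u"
 shows "(\<lambda>n. distribution_of \<Omega>1 (g n \<circ> f) \<phi>) \<longlonglongrightarrow> pullback_limit \<Omega>1 f g \<phi>"
proof (cases "\<phi> \<in> test_functions \<Omega>1")
 case True
 have "Cauchy (\<lambda>n. distribution_of \<Omega>1 (g n \<circ> f) \<phi>)"
 proof (rule CauchyI)
  fix e :: real assume e: "0 < e"
  then have e2: "0 < e / 2" by simp
  obtain n0 where n0: "\<forall>n\<ge>n0. \<forall>m\<ge>n0. bounded_set_seminorm {\<phi>} (\<lambda>\<phi>. distribution_of \<Omega>1 (g n \<circ> f) \<phi> - distribution_of \<Omega>1 (g m \<circ> f) \<phi>) \<le> ennreal (e / 2)"
   using pullback_cauchy[OF singleton_normal_seminorm[OF True] g e2] by (elim exE)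
  then have "\<forall>n\<ge>n0. \<forall>m\<ge>n0. norm (distribution_of \<Omega>1 (g n \<circ> f) \<phi> - distribution_of \<Omega>1 (g m \<circ> f) \<phi>) \<le> e / 2"
   unfolding bounded_set_seminorm_le_iff[OF less_imp_le[OF e2]] by blast
  moreover have "e / 2 < e" using e by simp
  ultimately show "\<exists>M. \<forall>m\<ge>M. \<forall>n\<ge>M. norm (distribution_of \<Omega>1 (g m \<circ> f) \<phi> - distribution_of \<Omega>1 (g n \<circ> f) \<phi>) < e"
   by (meson le_less_trans)
 qed
 then show ?thesis unfolding pullback_limit_def by (simp add: Cauchy_convergent convergent_LIMSEQ_iff[symmetric])
qed (simp add: pullback_limit_def distribution_of_def)

text \<open>The Cauchy estimate with one index fixed and the other tending to infinity, using lower
  semicontinuity of the seminorm.\<close>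

lemma pullback_limit_approx:
 assumes q: "q \<in> normal_seminorms \<Omega>1 (pull_cone \<Omega>1 f \<Gamma>)" and g: "approximates \<Omega>2 \<Gamma> g u" and \<epsilon>: "0 < \<epsilon>"
 shows "\<exists>n. q (\<lambda>\<phi>. pullback_limit \<Omega>1 f g \<phi> - distribution_of \<Omega>1 (g n \<circ> f) \<phi>) \<le> ennreal \<epsilon>"
proof -
 obtain n0 where n0: "\<forall>n\<ge>n0. \<forall>m\<ge>n0. q (\<lambda>\<phi>. distribution_of \<Omega>1 (g n \<circ> f) \<phi> - distribution_of \<Omega>1 (g m \<circ> f) \<phi>) \<le> ennreal \<epsilon>"
  using pullback_cauchy[OF q g \<epsilon>] by (elim exE)
 have "q (\<lambda>\<phi>. pullback_limit \<Omega>1 f g \<phi> - distribution_of \<Omega>1 (g n0 \<circ> f) \<phi>) \<le> ennreal \<epsilon>"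
 proof (rule normal_seminorm_limit[OF \<Omega>1 closed_pull_cone q])
  show "(\<lambda>n. distribution_of \<Omega>1 (g n \<circ> f) \<phi> - distribution_of \<Omega>1 (g n0 \<circ> f) \<phi>) \<longlonglongrightarrow>
    pullback_limit \<Omega>1 f g \<phi> - distribution_of \<Omega>1 (g n0 \<circ> f) \<phi>" for \<phi>
   by (intro tendsto_diff tendsto_const pullback_limit_tendsto[OF g])
  show "eventually (\<lambda>n. q (\<lambda>\<phi>. distribution_of \<Omega>1 (g n \<circ> f) \<phi> - distribution_of \<Omega>1 (g n0 \<circ> f) \<phi>) \<le> ennreal \<epsilon>) sequentially"
   using n0 unfolding eventually_sequentially by blast
 qed (use \<epsilon> in simp)
 then show ?thesis by blast
qed

lemma pullback_limit_estimate:
 assumes q: "q \<in> normal_seminorms \<Omega>1 (pull_cone \<Omega>1 f \<Gamma>)"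
 obtains S C where "finite S" "S \<subseteq> normal_seminorms \<Omega>2 \<Gamma>" "0 \<le> C"
  "\<And>g h u v P. approximates \<Omega>2 \<Gamma> g u ==> approximates \<Omega>2 \<Gamma> h v ==> 0 < P ==> \<forall>p\<in>S. p (\<lambda>\<phi>. u \<phi> - v \<phi>) \<le> ennreal P ==>
   q (\<lambda>\<phi>. pullback_limit \<Omega>1 f g \<phi> - pullback_limit \<Omega>1 f h \<phi>) \<le> ennreal (C * P)"
proof (rule pullback_approximants[OF q], goal_cases)
 case (1 S C)
 note S = 1(2-4) and est = 1(5)
 have "q (\<lambda>\<phi>. pullback_limit \<Omega>1 f g \<phi> - pullback_limit \<Omega>1 f h \<phi>) \<le> ennreal (3 * C * P)"
  if g: "approximates \<Omega>2 \<Gamma> g u" and h: "approximates \<Omega>2 \<Gamma> h v" and P: "0 < P" and uv: "\<forall>p\<in>S. p (\<lambda>\<phi>. u \<phi> - v \<phi>) \<le> ennreal P" for g h u v P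
 proof (rule normal_seminorm_limit[OF \<Omega>1 closed_pull_cone q])
  show "(\<lambda>n. distribution_of \<Omega>1 (g n \<circ> f) \<phi> - distribution_of \<Omega>1 (h n \<circ> f) \<phi>) \<longlonglongrightarrow>
    pullback_limit \<Omega>1 f g \<phi> - pullback_limit \<Omega>1 f h \<phi>" for \<phi>
   by (intro tendsto_diff pullback_limit_tendsto[OF g] pullback_limit_tendsto[OF h])
  \<comment> \<open>The approximation error is allowed to be as large as \<open>P\<close>, which
    turns the constant into 3C.\<close>
  have C3: "C * (P + P + P) = 3 * C * P" by simp
  show "eventually (\<lambda>n. q (\<lambda>\<phi>. distribution_of \<Omega>1 (g n \<circ> f) \<phi> - distribution_of \<Omega>1 (h n \<circ> f) \<phi>) \<le> ennreal (3 * C * P)) sequentially"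
   using est[OF g h less_imp_le[OF P] P uv] unfolding C3 eventually_sequentially by blast
 qed (use S(3) P in simp)
 then show thesis by (intro that[OF S(1,2), of "3 * C"]) (use S(3) in auto)
qed

text \<open>With u = v the hypothesis of \<open>pullback_limit_estimate\<close> holds for every
  positive \<open>P\<close>, so the difference is arbitrarily small on each test function.\<close>

lemma pullback_limit_unique:
 assumes g: "approximates \<Omega>2 \<Gamma> g u" and h: "approximates \<Omega>2 \<Gamma> h u"
 shows "pullback_limit \<Omega>1 f g = pullback_limit \<Omega>1 f h"
proof
 fix \<phi>
 show "pullback_limit \<Omega>1 f g \<phi> = pullback_limit \<Omega>1 f h \<phi>"
 proof (cases "\<phi> \<in> test_functions \<Omega>1")
  case True
  show ?thesis
  proof (rule pullback_limit_estimate[OF singleton_normal_seminorm[OF True]], goal_cases)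
   case (1 S C)
   note S = 1(1-3) and est = 1(4)
   have "norm (pullback_limit \<Omega>1 f g \<phi> - pullback_limit \<Omega>1 f h \<phi>) \<le> 0 + e" if e: "0 < e" for e
   proof -
    define P where "P = e / (C + 1)"
    have P: "0 < P" "C * P \<le> e" using e S(3) by (simp_all add: P_def field_simps)
    have "p (\<lambda>\<phi>. u \<phi> - u \<phi>) \<le> ennreal P" if "p \<in> S" for p
     by (rule order_trans[OF normal_seminorm_diff_self[OF \<Omega>2 \<Gamma>]]) (use that S(2) in auto)
    then have "bounded_set_seminorm {\<phi>} (\<lambda>\<phi>. pullback_limit \<Omega>1 f g \<phi> - pullback_limit \<Omega>1 f h \<phi>) \<le> ennreal (C * P)"
     by (intro est[OF g h P(1)] ballI)
    then show ?thesis unfolding bounded_set_seminorm_le_iff[OF mult_nonneg_nonneg[OF S(3) less_imp_le[OF P(1)]]] using P(2) by simp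
   qed
   then have "norm (pullback_limit \<Omega>1 f g \<phi> - pullback_limit \<Omega>1 f h \<phi>) \<le> 0" by (rule field_le_epsilon)
   then show ?thesis by simp
  qed
 qed (simp add: pullback_limit_def distribution_of_def)
qed

text \<open>Linearity passes to pointwise limits. All normal seminorms of the limit are finite, by
  comparison with one approximant; finiteness on bounded sets gives continuity, and finiteness of
  the Fourier seminorms gives the wave front set.\<close>

lemma pullback_limit_in_distributions_WF:
 assumes g: "approximates \<Omega>2 \<Gamma> g u"
 shows "pullback_limit \<Omega>1 f g \<in> distributions_WF \<Omega>1 (pull_cone \<Omega>1 f \<Gamma>)"
proof -
 let ?F = "pullback_limit \<Omega>1 f g" and ?d = "\<lambda>n. distribution_of \<Omega>1 (g n \<circ> f)"
 have sm: "smooth_on \<Omega>2 (g n)" for n using g by (simp add: approximates_def)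
 have d: "?d n \<in> distributions \<Omega>1" for n by (rule distribution_of_in_distributions[OF continuous_comp[OF \<Omega>1 \<Omega>2 \<Gamma> f im sm]])
 note lim = pullback_limit_tendsto[OF g]
 have add: "?F (\<lambda>x. \<phi> x + \<psi> x) = ?F \<phi> + ?F \<psi>" if "\<phi> \<in> test_functions \<Omega>1" "\<psi> \<in> test_functions \<Omega>1" for \<phi> \<psi>
  using lim[of "\<lambda>x. \<phi> x + \<psi> x"] tendsto_add[OF lim[of \<phi>] lim[of \<psi>]] unfolding distribution_add[OF d that] by (rule LIMSEQ_unique)
 have cm: "?F (\<lambda>x. c * \<phi> x) = c * ?F \<phi>" if "\<phi> \<in> test_functions \<Omega>1" for \<phi> c
  using lim[of "\<lambda>x. c * \<phi> x"] tendsto_mult[OF tendsto_const lim[of \<phi>]] unfolding distribution_cmult[OF d that] by (rule LIMSEQ_unique)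
 have off: "?F \<phi> = 0" if "\<phi> \<notin> test_functions \<Omega>1" for \<phi> using that by (simp add: pullback_limit_def distribution_of_def)
 have fin: "q ?F < \<infinity>" if q: "q \<in> normal_seminorms \<Omega>1 (pull_cone \<Omega>1 f \<Gamma>)" for q
 proof (rule normal_seminorm_pullback[OF q], goal_cases)
  case (1 S C)
  note S = 1(1-3) and est = 1(4)
  obtain n where n: "q (\<lambda>\<phi>. ?F \<phi> - ?d n \<phi>) \<le> ennreal 1" using pullback_limit_approx[OF q g zero_less_one] by (elim exE)
  \<comment> \<open>A common bound for finitely many finite seminorms; the conversion to reals is
    faithful by \<open>normal_seminorm_finite\<close>.\<close>
  define P where "P = (\<Sum>p\<in>S. enn2real (p (distribution_of \<Omega>2 (g n))))"
  have P: "0 \<le> P" unfolding P_def by (intro sum_nonneg) simp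
  have "p (distribution_of \<Omega>2 (g n)) \<le> ennreal P" if p: "p \<in> S" for p
  proof -
   have "p (distribution_of \<Omega>2 (g n)) < \<infinity>"
    by (rule normal_seminorm_finite[OF distribution_of_smooth_WF[OF \<Omega>2 sm] \<Omega>2]) (use p S(2) in blast)
   then have "p (distribution_of \<Omega>2 (g n)) = ennreal (enn2real (p (distribution_of \<Omega>2 (g n))))" by simp
   also have "\<dots> \<le> ennreal P" unfolding P_def by (intro ennreal_leI member_le_sum p S(1)) simp
   finally show ?thesis .
  qed
  then have "q (?d n) \<le> ennreal (C * P)" using est sm P by blast
  \<comment> \<open>Subtracting the zero functional brings the bound into the form of the triangle
    inequality for differences.\<close>
  then have "q (\<lambda>\<phi>. ?d n \<phi> - 0) \<le> ennreal (C * P)" by simp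
  from normal_seminorm_diff_trans[OF \<Omega>1 closed_pull_cone q n this] have "q (\<lambda>\<phi>. ?F \<phi> - 0) \<le> ennreal (1 + C * P)" using S(3) P by simp
  then have "q ?F \<le> ennreal (1 + C * P)" by simp
  then have "q ?F < top" by (rule le_less_trans) (rule ennreal_less_top)
  then show ?thesis by simp
 qed
 have "continuous_on_compact_supports \<Omega>1 (\<lambda>\<phi>. norm (?F \<phi>))"
 proof (rule bounded_imp_continuous_on_compact_supports)
  show "bounded_set_seminorm B ?F < \<infinity>" if "bounded_test_set \<Omega>1 B" for B
   by (rule fin) (use that in \<open>auto simp: normal_seminorms_def\<close>)
 qed (rule cm)
 then have "?F \<in> distributions \<Omega>1" unfolding distributions_def using add cm off by simp
 then show ?thesis unfolding distributions_WF_def using wave_front_set_subset[OF \<Omega>1 closed_pull_cone fin] by simp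
qed

lemma approximates_const:
 assumes "smooth_on \<Omega>2 g"
 shows "approximates \<Omega>2 \<Gamma> (\<lambda>_. g) (distribution_of \<Omega>2 g)"
 unfolding approximates_def
proof (intro conjI allI impI ballI assms always_eventually)
 fix p and \<epsilon> :: real assume "p \<in> normal_seminorms \<Omega>2 \<Gamma>" "0 < \<epsilon>"
 then show "p (\<lambda>\<phi>. distribution_of \<Omega>2 g \<phi> - distribution_of \<Omega>2 g \<phi>) \<le> ennreal \<epsilon>"
  using normal_seminorm_diff_self[OF \<Omega>2 \<Gamma>, of p "distribution_of \<Omega>2 g"] ennreal_leI[of 0 \<epsilon>] order_trans by fastforce
qed

text \<open>The extension built from approximating sequences is continuous by the difference
  estimate, hence sequentially continuous. Smooth functions are sequentially dense, so no other map
  satisfies the description, and the definite description denotes this extension.\<close>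

lemma continuous_pullback:
 "continuous_map (normal_topology \<Omega>2 \<Gamma>) (normal_topology \<Omega>1 (pull_cone \<Omega>1 f \<Gamma>)) (pullback \<Omega>1 \<Omega>2 \<Gamma> f)"
proof -
 let ?D = "distributions_WF \<Omega>2 \<Gamma>" and ?D' = "distributions_WF \<Omega>1 (pull_cone \<Omega>1 f \<Gamma>)"
 let ?X = "normal_topology \<Omega>2 \<Gamma>" and ?Y = "normal_topology \<Omega>1 (pull_cone \<Omega>1 f \<Gamma>)"
 \<comment> \<open>One approximating sequence is chosen for each distribution; by uniqueness of the
   limit the choice does not influence the values.\<close>
 define a where "a u = (SOME g. approximates \<Omega>2 \<Gamma> g u)" for u
 have a: "approximates \<Omega>2 \<Gamma> (a u) u" if "u \<in> ?D" for u
  unfolding a_def by (rule someI_ex[OF approximates_exists[OF that \<Omega>2 \<Gamma>]])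
 define F where "F = restrict (\<lambda>u. pullback_limit \<Omega>1 f (a u)) ?D"
 have F: "F u = pullback_limit \<Omega>1 f (a u)" if "u \<in> ?D" for u using that by (simp add: F_def)
 have FD: "F u \<in> ?D'" if "u \<in> ?D" for u unfolding F[OF that] by (rule pullback_limit_in_distributions_WF[OF a[OF that]])
 have dD: "distribution_of \<Omega>2 g \<in> ?D" if "smooth_on \<Omega>2 g" for g by (rule distribution_of_smooth_WF[OF \<Omega>2 that])
 have Fd: "F (distribution_of \<Omega>2 g) = distribution_of \<Omega>1 (g \<circ> f)" if g: "smooth_on \<Omega>2 g" for g
  unfolding F[OF dD[OF g]] pullback_limit_unique[OF a[OF dD[OF g]] approximates_const[OF g]] by (simp add: pullback_limit_def)
 have cont: "continuous_map ?X ?Y F"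
 proof (rule continuous_map_normalI[OF \<Omega>2 \<Gamma> \<Omega>1 closed_pull_cone FD])
  fix q assume q: "q \<in> normal_seminorms \<Omega>1 (pull_cone \<Omega>1 f \<Gamma>)"
  show "\<exists>S C. finite S \<and> S \<subseteq> normal_seminorms \<Omega>2 \<Gamma> \<and> 0 \<le> C \<and> (\<forall>u\<in>?D. \<forall>v\<in>?D. \<forall>P>0. (\<forall>p\<in>S. p (\<lambda>\<phi>. u \<phi> - v \<phi>) \<le> ennreal P) -->
    q (\<lambda>\<phi>. F u \<phi> - F v \<phi>) \<le> ennreal (C * P))"
  proof (rule pullback_limit_estimate[OF q], goal_cases)
   case (1 S C)
   note S = 1(1-3) and est = 1(4)
   show ?thesis
   proof (intro exI[of _ S] exI[of _ C] conjI S ballI allI impI)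
    fix u v and P :: real assume "u \<in> ?D" "v \<in> ?D" "0 < P" "\<forall>p\<in>S. p (\<lambda>\<phi>. u \<phi> - v \<phi>) \<le> ennreal P"
    then show "q (\<lambda>\<phi>. F u \<phi> - F v \<phi>) \<le> ennreal (C * P)" unfolding F[OF \<open>u \<in> ?D\<close>] F[OF \<open>v \<in> ?D\<close>] by (intro est[OF a a])
   qed
  qed
 qed
 have seq: "sequentially_continuous_map ?X ?Y F"
  unfolding sequentially_continuous_map_def
 proof (intro conjI allI impI)
  show "F ` topspace ?X \<subseteq> topspace ?Y" using FD by auto
  show "limitin ?Y (F \<circ> \<sigma>) (F l) sequentially" if "range \<sigma> \<subseteq> topspace ?X \<and> limitin ?X \<sigma> l sequentially" for \<sigma> l
   using that by (intro continuous_map_limit[OF cont]) simp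
 qed
 \<comment> \<open>Sequential continuity along the chosen sequence fixes the value on test
   functions. Elsewhere both distributions vanish by convention, and outside the domain both maps
   are extensional.\<close>
 have uniq: "G = F" if G: "G \<in> extensional ?D" and sG: "sequentially_continuous_map ?X ?Y G"
  and Gd: "\<And>g. smooth_on \<Omega>2 g ==> G (distribution_of \<Omega>2 g) = distribution_of \<Omega>1 (g \<circ> f)" for G
 proof (rule extensionalityI[OF G])
  show "F \<in> extensional ?D" by (simp add: F_def)
  fix u assume u: "u \<in> ?D"
  have sm: "smooth_on \<Omega>2 (a u n)" for n using a[OF u] by (simp add: approximates_def)
  let ?\<sigma> = "\<lambda>n. distribution_of \<Omega>2 (a u n)"
  have "range ?\<sigma> \<subseteq> topspace ?X" using dD[OF sm] by auto
  then have "limitin ?Y (G \<circ> ?\<sigma>) (G u) sequentially"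
   using sG approximates_limitin[OF \<Omega>2 \<Gamma> a[OF u] u] unfolding sequentially_continuous_map_def by blast
  then have lim: "limitin ?Y (\<lambda>n. distribution_of \<Omega>1 (a u n \<circ> f)) (G u) sequentially" by (simp add: o_def Gd[OF sm, unfolded o_def])
  have GD: "G u \<in> ?D'" using lim by (simp add: limitin_def)
  show "G u = F u"
  proof
   fix \<phi>
   show "G u \<phi> = F u \<phi>"
   proof (cases "\<phi> \<in> test_functions \<Omega>1")
    case True
    show ?thesis unfolding F[OF u]
     by (rule LIMSEQ_unique[OF limitin_normal_pointwise[OF \<Omega>1 closed_pull_cone lim True] pullback_limit_tendsto[OF a[OF u]]])
   next
    case False
    then show ?thesis using GD FD[OF u] by (simp add: distributions_WF_def distributions_def)
   qed
  qed
 qed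
 have "pullback \<Omega>1 \<Omega>2 \<Gamma> f = F"
  unfolding pullback_def
 proof (rule the_equality)
  show "F \<in> extensional ?D \<and> sequentially_continuous_map ?X ?Y F \<and> (\<forall>g. smooth_on \<Omega>2 g --> F (distribution_of \<Omega>2 g) = distribution_of \<Omega>1 (g \<circ> f))"
   using seq Fd by (simp add: F_def)
 qed (use uniq in simp)
 then show ?thesis using cont by simp
qed

end

theorem proposition5p1:
  fixes \<Omega>\<^sub>1 :: "(real ^ 'd1) set" and \<Omega>\<^sub>2 :: "(real ^ 'd2) set"
    and \<Gamma> :: "((real ^ 'd2) \<times> (real ^ 'd2)) set" and f :: "real ^ 'd1 \<Rightarrow> real ^ 'd2"
  assumes "open \<Omega>\<^sub>1" and "open \<Omega>\<^sub>2"
    and "closed_cone_over \<Omega>\<^sub>2 \<Gamma>"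
    and "smooth_on \<Omega>\<^sub>1 f" and "f ` \<Omega>\<^sub>1 \<subseteq> \<Omega>\<^sub>2"
    and "conormal_set \<Omega>\<^sub>1 f \<inter> \<Gamma> = {}"
  shows "continuous_map (normal_topology \<Omega>\<^sub>2 \<Gamma>)
           (normal_topology \<Omega>\<^sub>1 (pull_cone \<Omega>\<^sub>1 f \<Gamma>)) (pullback \<Omega>\<^sub>1 \<Omega>\<^sub>2 \<Gamma> f)"
  by (rule continuous_pullback[OF assms])

end
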